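(* Let $K$ be a field and let $S=K[x_1,\ldots,x_n]$ be a polynomial ring. Let $I\subseteq S$ be an equidimensional ideal and $<$ a monomial order such that the initial ideal $\operatorname{in}_<(I)$ is square-free. Then, for every integer $t$ with $0\le t\le\dim(S/I)$, $$\#\Gamma_t(S/I)=\#\Gamma_t\big((S/I)\otimes_K L\big)$$ for every field extension $K\subseteq L$.
   Context: All rings are commutative, Noetherian, with one. An ideal $I\subseteq S$ is equidimensional if all quotients of $S/I$ by its minimal primes have the same dimension $\dim S/I$. $\operatorname{in}_<(I)$ is the ideal generated by the leading monomials, with respect to $<$, of the nonzero elements of $I$; it is square-free if it is generated by square-free monomials. The rings $S/I$ and $(S/I)\otimes_K L$ have the same dimension. For a ring $R$ of dimension $d$ and an integer $t$ with $0\le t\le d$, $\Gamma_t(R)$ is the simple graph whose vertices are the minimal primes of $R$, with an edge between distinct minimal primes $\mathfrak p$ and $\mathfrak q$ if and only if $\operatorname{ht}(\mathfrak p+\mathfrak q)\le t$. $\#G$ denotes the number of connected components of a graph $G$. *)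

theory Defs
  imports
    "HOL-Algebra.Algebra"
    "HOL-Algebra.Algebraic_Closure_Type"
    "HOL-Library.Poly_Mapping"
    "HOL-Library.Extended_Nat"
begin

section \<open>Krull dimension, height, minimal primes\<close>

text \<open>A strict chain of primes \<open>f 0 \<subset> \<dots> \<subset> f k\<close> has length \<open>k\<close>.\<close>

definition prime_chain :: "('a, 'm) ring_scheme \<Rightarrow> nat \<Rightarrow> (nat \<Rightarrow> 'a set) \<Rightarrow> bool" where
  "prime_chain R k f \<longleftrightarrow> (\<forall>i\<le>k. primeideal (f i) R) \<and> (\<forall>i<k. f i \<subset> f (Suc i))"

text \<open>The zero ring gets dimension \<open>Sup {} = 0\<close> here. This is harmless: it has no primes
  at all, so its graphs below are empty.\<close>

definition krull_dim :: "('a, 'm) ring_scheme \<Rightarrow> enat" where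
  "krull_dim R = Sup {enat k | k f. prime_chain R k f}"

definition prime_height :: "('a, 'm) ring_scheme \<Rightarrow> 'a set \<Rightarrow> enat" where
  "prime_height R P = Sup {enat k | k f. prime_chain R k f \<and> f k = P}"

text \<open>The unit ideal has height \<open>Inf {} = \<infinity>\<close>, so primes with \<open>P + Q = R\<close> are never adjacent below.\<close>

definition height :: "('a, 'm) ring_scheme \<Rightarrow> 'a set \<Rightarrow> enat" where
  "height R J = Inf {prime_height R P | P. primeideal P R \<and> J \<subseteq> P}"

definition minimal_primes :: "('a, 'm) ring_scheme \<Rightarrow> 'a set set" where
  "minimal_primes R = {P. primeideal P R \<and> (\<forall>Q. primeideal Q R \<longrightarrow> Q \<subseteq> P \<longrightarrow> Q = P)}"

definition equidimensional :: "('a, 'm) ring_scheme \<Rightarrow> 'a set \<Rightarrow> bool" where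
  "equidimensional S I \<longleftrightarrow>
     (\<forall>P \<in> minimal_primes (S Quot I). krull_dim ((S Quot I) Quot P) = krull_dim (S Quot I))"


section \<open>The graphs \<open>\<Gamma>\<^sub>t(R)\<close>\<close>

text \<open>A simple graph is a pair of its vertex set and its set of two-element edges.\<close>

definition Gamma :: "nat \<Rightarrow> ('a, 'm) ring_scheme \<Rightarrow> 'a set set \<times> 'a set set set" where
  "Gamma t R =
     (minimal_primes R,
      {{P, Q} | P Q. P \<in> minimal_primes R \<and> Q \<in> minimal_primes R \<and> P \<noteq> Q \<and>
                     height R (P <+>\<^bsub>R\<^esub> Q) \<le> enat t})"

definition connected_components :: "'v set \<times> 'v set set \<Rightarrow> 'v set set" where
  "connected_components G =
     fst G // {(u, v). u \<in> fst G \<and> v \<in> fst G \<and> (u, v) \<in> {(x, y). {x, y} \<in> snd G}\<^sup>*}"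

text \<open>\<^const>\<open>card\<close> does not lose information for the graphs considered here: Noetherian rings have
  only finitely many minimal primes.\<close>

definition num_components :: "'v set \<times> 'v set set \<Rightarrow> nat" where
  "num_components G = card (connected_components G)"


section \<open>Polynomial rings and initial ideals\<close>

text \<open>A monomial is identified with its exponent vector; the variables are indexed by \<open>{..<n}\<close>.\<close>

definition monomials :: "nat \<Rightarrow> (nat \<Rightarrow>\<^sub>0 nat) set" where
  "monomials n = {m. Poly_Mapping.keys m \<subseteq> {..<n}}"

definition mpoly_ring :: "nat \<Rightarrow> ((nat \<Rightarrow>\<^sub>0 nat) \<Rightarrow>\<^sub>0 'k::field) ring" where
  "mpoly_ring n = ring_of_type_algebra \<lparr>carrier := {p. Poly_Mapping.keys p \<subseteq> monomials n}\<rparr>"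

text \<open>The predicate \<open>lt\<close> is the strict part of the order; its values outside \<open>monomials n\<close> are irrelevant.\<close>

definition monomial_order :: "nat \<Rightarrow> ((nat \<Rightarrow>\<^sub>0 nat) \<Rightarrow> (nat \<Rightarrow>\<^sub>0 nat) \<Rightarrow> bool) \<Rightarrow> bool" where
  "monomial_order n lt \<longleftrightarrow>
     irreflp_on (monomials n) lt \<and> transp_on (monomials n) lt \<and> totalp_on (monomials n) lt \<and>
     (\<forall>u \<in> monomials n. u \<noteq> 0 \<longrightarrow> lt 0 u) \<and>
     (\<forall>u \<in> monomials n. \<forall>v \<in> monomials n. \<forall>w \<in> monomials n. lt u v \<longrightarrow> lt (u + w) (v + w))"

definition leading_monomial ::
    "((nat \<Rightarrow>\<^sub>0 nat) \<Rightarrow> (nat \<Rightarrow>\<^sub>0 nat) \<Rightarrow> bool) \<Rightarrow> ((nat \<Rightarrow>\<^sub>0 nat) \<Rightarrow>\<^sub>0 'k::field) \<Rightarrow> (nat \<Rightarrow>\<^sub>0 nat)" where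
  "leading_monomial lt p =
     (THE m. m \<in> Poly_Mapping.keys p \<and> (\<forall>u \<in> Poly_Mapping.keys p. u \<noteq> m \<longrightarrow> lt u m))"

definition monomial_ideal :: "nat \<Rightarrow> (nat \<Rightarrow>\<^sub>0 nat) set \<Rightarrow> ((nat \<Rightarrow>\<^sub>0 nat) \<Rightarrow>\<^sub>0 'k::field) set" where
  "monomial_ideal n M = Idl\<^bsub>mpoly_ring n\<^esub> ((\<lambda>m. Poly_Mapping.single m 1) ` M)"

definition initial_ideal ::
    "nat \<Rightarrow> ((nat \<Rightarrow>\<^sub>0 nat) \<Rightarrow> (nat \<Rightarrow>\<^sub>0 nat) \<Rightarrow> bool) \<Rightarrow> ((nat \<Rightarrow>\<^sub>0 nat) \<Rightarrow>\<^sub>0 'k::field) set \<Rightarrow>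
     ((nat \<Rightarrow>\<^sub>0 nat) \<Rightarrow>\<^sub>0 'k) set" where
  "initial_ideal n lt I = monomial_ideal n (leading_monomial lt ` (I - {0}))"

definition squarefree_monomial_ideal :: "nat \<Rightarrow> ((nat \<Rightarrow>\<^sub>0 nat) \<Rightarrow>\<^sub>0 'k::field) set \<Rightarrow> bool" where
  "squarefree_monomial_ideal n J \<longleftrightarrow>
     (\<exists>M \<subseteq> monomials n. (\<forall>m \<in> M. \<forall>i. Poly_Mapping.lookup m i \<le> 1) \<and> J = monomial_ideal n M)"


section \<open>Tensor products of commutative algebras\<close>

text \<open>The free abelian group on \<open>carrier A \<times> carrier B\<close>, with the biadditive multiplication
  determined by \<open>(a, b) \<cdot> (a', b') = (a a', b b')\<close>.\<close>

definition free_pair_ring ::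
    "('a, 'm) ring_scheme \<Rightarrow> ('b, 'p) ring_scheme \<Rightarrow> (('a \<times> 'b) \<Rightarrow>\<^sub>0 int) ring" where
  "free_pair_ring A B =
     \<lparr>carrier = {c. Poly_Mapping.keys c \<subseteq> carrier A \<times> carrier B},
      monoid.mult = (\<lambda>x y. frag_extend (\<lambda>(a, b). frag_extend
                (\<lambda>(a', b'). frag_of (a \<otimes>\<^bsub>A\<^esub> a', b \<otimes>\<^bsub>B\<^esub> b')) y) x),
      one = frag_of (\<one>\<^bsub>A\<^esub>, \<one>\<^bsub>B\<^esub>),
      ring.zero = 0,
      add = (+)\<rparr>"

text \<open>\<open>A\<close> and \<open>B\<close> are \<open>K\<close>-algebras through the structure maps \<open>\<alpha>\<close> and \<open>\<beta>\<close>.\<close>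

definition tensor_relations ::
    "('k, 'q) ring_scheme \<Rightarrow> ('a, 'm) ring_scheme \<Rightarrow> ('k \<Rightarrow> 'a) \<Rightarrow>
     ('b, 'p) ring_scheme \<Rightarrow> ('k \<Rightarrow> 'b) \<Rightarrow> (('a \<times> 'b) \<Rightarrow>\<^sub>0 int) set" where
  "tensor_relations K A \<alpha> B \<beta> =
     {frag_of (a \<oplus>\<^bsub>A\<^esub> a', b) - frag_of (a, b) - frag_of (a', b) | a a' b.
        a \<in> carrier A \<and> a' \<in> carrier A \<and> b \<in> carrier B} \<union>
     {frag_of (a, b \<oplus>\<^bsub>B\<^esub> b') - frag_of (a, b) - frag_of (a, b') | a b b'.
        a \<in> carrier A \<and> b \<in> carrier B \<and> b' \<in> carrier B} \<union>
     {frag_of (\<alpha> k \<otimes>\<^bsub>A\<^esub> a, b) - frag_of (a, \<beta> k \<otimes>\<^bsub>B\<^esub> b) | k a b.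
        k \<in> carrier K \<and> a \<in> carrier A \<and> b \<in> carrier B}"

text \<open>The set of relations is stable under multiplication by the basis elements, so the ideal
  it generates is the same as the subgroup it generates; the quotient is therefore the usual
  tensor product of modules with its usual multiplication.\<close>

definition tensor_algebra ::
    "('k, 'q) ring_scheme \<Rightarrow> ('a, 'm) ring_scheme \<Rightarrow> ('k \<Rightarrow> 'a) \<Rightarrow>
     ('b, 'p) ring_scheme \<Rightarrow> ('k \<Rightarrow> 'b) \<Rightarrow> (('a \<times> 'b) \<Rightarrow>\<^sub>0 int) set ring" where
  "tensor_algebra K A \<alpha> B \<beta> =
     free_pair_ring A B Quot (Idl\<^bsub>free_pair_ring A B\<^esub> (tensor_relations K A \<alpha> B \<beta>))"

definition quotient_structure_map ::
    "nat \<Rightarrow> ((nat \<Rightarrow>\<^sub>0 nat) \<Rightarrow>\<^sub>0 'k::field) set \<Rightarrow> 'k \<Rightarrow> ((nat \<Rightarrow>\<^sub>0 nat) \<Rightarrow>\<^sub>0 'k) set" where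
  "quotient_structure_map n I c = I +>\<^bsub>mpoly_ring n\<^esub> Poly_Mapping.single 0 c"


section \<open>Well-formedness\<close>

lemma mpoly_ring_simps:
  "carrier (mpoly_ring n) = {p. Poly_Mapping.keys p \<subseteq> monomials n}"
  "x \<otimes>\<^bsub>mpoly_ring n\<^esub> y = x * y" "x \<oplus>\<^bsub>mpoly_ring n\<^esub> y = x + y"
  "\<zero>\<^bsub>mpoly_ring n\<^esub> = 0" "\<one>\<^bsub>mpoly_ring n\<^esub> = 1"
  by (simp_all add: mpoly_ring_def ring_of_type_algebra_def)

lemma monomials_add: "u \<in> monomials n \<Longrightarrow> v \<in> monomials n \<Longrightarrow> u + v \<in> monomials n"
  using Poly_Mapping.keys_add[of u v] by (auto simp: monomials_def)

lemma mpoly_ring_cring: "cring (mpoly_ring n :: ((nat \<Rightarrow>\<^sub>0 nat) \<Rightarrow>\<^sub>0 'k::field) ring)"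
proof (rule cringI)
  show "abelian_group (mpoly_ring n :: ((nat \<Rightarrow>\<^sub>0 nat) \<Rightarrow>\<^sub>0 'k) ring)"
  proof (rule abelian_groupI; (unfold mpoly_ring_simps mem_Collect_eq)?)
    fix x y :: "(nat \<Rightarrow>\<^sub>0 nat) \<Rightarrow>\<^sub>0 'k"
    assume "Poly_Mapping.keys x \<subseteq> monomials n" "Poly_Mapping.keys y \<subseteq> monomials n"
    then show "Poly_Mapping.keys (x + y) \<subseteq> monomials n"
      using Poly_Mapping.keys_add[of x y] by blast
  next
    fix x :: "(nat \<Rightarrow>\<^sub>0 nat) \<Rightarrow>\<^sub>0 'k"
    assume "Poly_Mapping.keys x \<subseteq> monomials n"
    then show "\<exists>y\<in>{p. Poly_Mapping.keys p \<subseteq> monomials n}. y + x = 0"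
      by (intro bexI[of _ "-x"]) auto
  qed (auto simp: algebra_simps)
  show "Group.comm_monoid (mpoly_ring n :: ((nat \<Rightarrow>\<^sub>0 nat) \<Rightarrow>\<^sub>0 'k) ring)"
  proof (rule comm_monoidI; (unfold mpoly_ring_simps mem_Collect_eq)?)
    fix x y :: "(nat \<Rightarrow>\<^sub>0 nat) \<Rightarrow>\<^sub>0 'k"
    assume "Poly_Mapping.keys x \<subseteq> monomials n" "Poly_Mapping.keys y \<subseteq> monomials n"
    then show "Poly_Mapping.keys (x * y) \<subseteq> monomials n"
      using Poly_Mapping.keys_mult[of x y] monomials_add[of _ n] by blast
  next
    show "Poly_Mapping.keys (1 :: (nat \<Rightarrow>\<^sub>0 nat) \<Rightarrow>\<^sub>0 'k) \<subseteq> monomials n"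
      by (simp add: monomials_def)
  qed (auto simp: algebra_simps)
qed (simp_all add: mpoly_ring_simps algebra_simps)

lemma free_pair_ring_simps:
  "carrier (free_pair_ring A B) = {c. Poly_Mapping.keys c \<subseteq> carrier A \<times> carrier B}"
  "x \<oplus>\<^bsub>free_pair_ring A B\<^esub> y = x + y"
  "\<zero>\<^bsub>free_pair_ring A B\<^esub> = 0" "\<one>\<^bsub>free_pair_ring A B\<^esub> = frag_of (\<one>\<^bsub>A\<^esub>, \<one>\<^bsub>B\<^esub>)"
  by (simp_all add: free_pair_ring_def)

lemma frag_extend_fun_add:
  "frag_extend (\<lambda>i. f i + g i) x = frag_extend f x + frag_extend g x"
  by (simp add: frag_extend_def frag_cmul_distrib2 sum.distrib)

lemma frag_extend_fun_diff:
  fixes f g :: "'b \<Rightarrow> 'a \<Rightarrow>\<^sub>0 int"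
  shows "frag_extend (\<lambda>i. f i - g i) x = frag_extend f x - frag_extend g x"
proof -
  have "frag_cmul c (a - b) = frag_cmul c a - frag_cmul c b" for c and a b :: "'a \<Rightarrow>\<^sub>0 int"
    by (rule poly_mapping_eqI) (simp add: lookup_minus right_diff_distrib)
  then show ?thesis
    by (simp add: frag_extend_def sum_subtractf)
qed

lemma frag_extend_fun_zero: "frag_extend (\<lambda>i. 0) x = 0"
  by (simp add: frag_extend_def)

lemma free_pair_mult_of:
  "frag_of (a, b) \<otimes>\<^bsub>free_pair_ring A B\<^esub> frag_of (a', b') = frag_of (a \<otimes>\<^bsub>A\<^esub> a', b \<otimes>\<^bsub>B\<^esub> b')"
  by (simp add: free_pair_ring_def)

lemma free_pair_mult_lin:
  "(x + y) \<otimes>\<^bsub>free_pair_ring A B\<^esub> z = x \<otimes>\<^bsub>free_pair_ring A B\<^esub> z + y \<otimes>\<^bsub>free_pair_ring A B\<^esub> z"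
  "(x - y) \<otimes>\<^bsub>free_pair_ring A B\<^esub> z = x \<otimes>\<^bsub>free_pair_ring A B\<^esub> z - y \<otimes>\<^bsub>free_pair_ring A B\<^esub> z"
  "z \<otimes>\<^bsub>free_pair_ring A B\<^esub> (x + y) = z \<otimes>\<^bsub>free_pair_ring A B\<^esub> x + z \<otimes>\<^bsub>free_pair_ring A B\<^esub> y"
  "z \<otimes>\<^bsub>free_pair_ring A B\<^esub> (x - y) = z \<otimes>\<^bsub>free_pair_ring A B\<^esub> x - z \<otimes>\<^bsub>free_pair_ring A B\<^esub> y"
  "0 \<otimes>\<^bsub>free_pair_ring A B\<^esub> z = 0" "z \<otimes>\<^bsub>free_pair_ring A B\<^esub> 0 = 0"
  by (simp_all add: free_pair_ring_def frag_extend_add frag_extend_diff frag_extend_fun_add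
      frag_extend_fun_diff frag_extend_fun_zero case_prod_unfold)

lemma free_pair_ring_cring:
  assumes "cring A" "cring B"
  shows "cring (free_pair_ring A B)"
proof -
  interpret A: cring A by fact
  interpret B: cring B by fact
  let ?F = "free_pair_ring A B"
  let ?S = "carrier A \<times> carrier B"
  have closed: "Poly_Mapping.keys (x \<otimes>\<^bsub>?F\<^esub> y) \<subseteq> ?S"
    if "Poly_Mapping.keys x \<subseteq> ?S" "Poly_Mapping.keys y \<subseteq> ?S" for x y
    using that(1)
  proof (induction rule: frag_induction)
    case (one p)
    show ?case using that(2)
    proof (induction rule: frag_induction)
      case (one q)
      then show ?case using \<open>p \<in> ?S\<close>
        by (cases p; cases q) (auto simp: free_pair_mult_of)
    next
      case (diff u v)
      then show ?case
        unfolding free_pair_mult_lin by (intro order_trans[OF keys_diff] Un_least)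
    qed (simp add: free_pair_mult_lin)
  next
    case (diff u v)
    then show ?case
      unfolding free_pair_mult_lin by (intro order_trans[OF keys_diff] Un_least)
  qed (simp add: free_pair_mult_lin)
  have comm: "x \<otimes>\<^bsub>?F\<^esub> y = y \<otimes>\<^bsub>?F\<^esub> x"
    if "Poly_Mapping.keys x \<subseteq> ?S" "Poly_Mapping.keys y \<subseteq> ?S" for x y
    using that(1)
  proof (induction rule: frag_induction)
    case (one p)
    show ?case using that(2)
    proof (induction rule: frag_induction)
      case (one q)
      then show ?case using \<open>p \<in> ?S\<close>
        by (cases p; cases q) (auto simp: free_pair_mult_of A.m_comm B.m_comm)
    qed (simp_all add: free_pair_mult_lin)
  qed (simp_all add: free_pair_mult_lin)
  have assoc: "x \<otimes>\<^bsub>?F\<^esub> y \<otimes>\<^bsub>?F\<^esub> z = x \<otimes>\<^bsub>?F\<^esub> (y \<otimes>\<^bsub>?F\<^esub> z)"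
    if "Poly_Mapping.keys x \<subseteq> ?S" "Poly_Mapping.keys y \<subseteq> ?S" "Poly_Mapping.keys z \<subseteq> ?S" for x y z
    using that(1)
  proof (induction rule: frag_induction)
    case (one p)
    show ?case using that(2)
    proof (induction rule: frag_induction)
      case (one q)
      show ?case using that(3)
      proof (induction rule: frag_induction)
        case (one r)
        then show ?case using \<open>p \<in> ?S\<close> \<open>q \<in> ?S\<close>
          by (cases p; cases q; cases r) (auto simp: free_pair_mult_of A.m_assoc B.m_assoc)
      qed (simp_all add: free_pair_mult_lin)
    qed (simp_all add: free_pair_mult_lin)
  qed (simp_all add: free_pair_mult_lin)
  have one: "\<one>\<^bsub>?F\<^esub> \<otimes>\<^bsub>?F\<^esub> x = x" if "Poly_Mapping.keys x \<subseteq> ?S" for x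
    using that
  proof (induction rule: frag_induction)
    case (one p)
    then show ?case by (cases p) (auto simp: free_pair_ring_simps free_pair_mult_of)
  qed (simp_all add: free_pair_mult_lin)
  show ?thesis
  proof (rule cringI)
    show "abelian_group ?F"
    proof (rule abelian_groupI; (unfold free_pair_ring_simps mem_Collect_eq)?)
      fix x y :: "('a \<times> 'c) \<Rightarrow>\<^sub>0 int"
      assume "Poly_Mapping.keys x \<subseteq> ?S" "Poly_Mapping.keys y \<subseteq> ?S"
      then show "Poly_Mapping.keys (x + y) \<subseteq> ?S"
        using Poly_Mapping.keys_add[of x y] by blast
    next
      fix x :: "('a \<times> 'c) \<Rightarrow>\<^sub>0 int"
      assume "Poly_Mapping.keys x \<subseteq> ?S"
      then show "\<exists>y\<in>{p. Poly_Mapping.keys p \<subseteq> ?S}. y + x = 0"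
        by (intro bexI[of _ "-x"]) auto
    qed (auto simp: algebra_simps)
    show "Group.comm_monoid ?F"
      by (rule comm_monoidI) (use closed comm assoc one in \<open>auto simp: free_pair_ring_simps\<close>)
  qed (simp_all add: free_pair_ring_simps free_pair_mult_lin)
qed

lemma tensor_relations_carrier:
  assumes "cring A" "cring B" "\<alpha> \<in> ring_hom K A" "\<beta> \<in> ring_hom K B"
  shows "tensor_relations K A \<alpha> B \<beta> \<subseteq> carrier (free_pair_ring A B)"
proof -
  interpret A: cring A by fact
  interpret B: cring B by fact
  interpret F: cring "free_pair_ring A B" by (rule free_pair_ring_cring) fact+
  have diff: "x - y \<in> carrier (free_pair_ring A B)"
    if "x \<in> carrier (free_pair_ring A B)" "y \<in> carrier (free_pair_ring A B)" for x y
    using that keys_diff[of x y] unfolding free_pair_ring_simps by blast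
  have of: "frag_of (a, b) \<in> carrier (free_pair_ring A B)"
    if "a \<in> carrier A" "b \<in> carrier B" for a b
    using that by (simp add: free_pair_ring_simps)
  have map: "\<alpha> k \<in> carrier A" "\<beta> k \<in> carrier B" if "k \<in> carrier K" for k
    using that assms(3,4) ring_hom_closed by fastforce+
  show ?thesis
    unfolding tensor_relations_def
    by (intro Un_least subsetI; elim CollectE exE conjE; hypsubst)
      (intro diff of map A.a_closed A.m_closed B.a_closed B.m_closed; assumption)+
qed

lemma tensor_algebra_cring:
  assumes "cring A" "cring B" "\<alpha> \<in> ring_hom K A" "\<beta> \<in> ring_hom K B"
  shows "cring (tensor_algebra K A \<alpha> B \<beta>)"
proof -
  interpret F: cring "free_pair_ring A B" by (rule free_pair_ring_cring) fact+
  show ?thesis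
    unfolding tensor_algebra_def
    using F.genideal_ideal[OF tensor_relations_carrier[OF assms]] F.cring_axioms
    by (rule ideal.quotient_is_cring)
qed

end

theory Submission
  imports Defs
begin

text \<open>
  Write \<open>S\<^sub>K\<close> and \<open>S\<^sub>L\<close> for the polynomial rings over the two fields.  The graph \<open>\<Gamma>\<^sub>t(R)\<close> depends only
  on the set of primes of \<open>R\<close>, ordered by inclusion: its vertices are the minimal primes, and two of them
  are adjacent if and only if some prime of height at most \<open>t\<close> contains both.  Since \<open>(S\<^sub>K / I) \<otimes> L\<close> is
  \<open>S\<^sub>L / I S\<^sub>L\<close>, the theorem compares the primes of \<open>S\<^sub>K\<close> above \<open>I\<close> with the primes of \<open>S\<^sub>L\<close> above
  \<open>I S\<^sub>L\<close>.  They are related by contraction, and the claim is that contraction is a bijection between the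
  minimal primes that respects adjacency.  In particular the graphs themselves are isomorphic.

  Adjacency is respected for general reasons.  As \<open>S\<^sub>L\<close> is free over \<open>S\<^sub>K\<close>, going down holds, and
  contraction does not increase heights (\<open>joined_descends\<close>).  Conversely, a prime \<open>p\<close> of height \<open>h\<close> in
  \<open>S\<^sub>K / I\<close> is minimal over \<open>h\<close> elements; a minimal prime over \<open>p S\<^sub>L\<close> is minimal over the same elements,
  and its height is at most \<open>h\<close> by Krull's height theorem (\<open>joined_lifts\<close>).

  Contraction is also surjective on minimal primes by going down and lying over.  What remains is that
  only one minimal prime \<open>Q\<close> lies over a minimal prime \<open>P\<close> of \<open>I\<close> (\<open>contraction_injective\<close>); here the
  hypothesis on the initial ideal is used.  The squarefree generators \<open>u\<close> of the initial ideal are leading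
  monomials of finitely many elements \<open>g \<in> I\<close>.  By Gordan's theorem there are positive integral weights for
  which \<open>u\<close> has larger weight than every other monomial of \<open>g\<close> (\<open>weight_exists\<close>), and from now on monomials are
  compared by weight first.  Let \<open>d\<close> be the dimension of \<open>S\<^sub>K / P\<close>.  Counting standard monomials shows
  that there is a set \<open>A\<close> of \<open>d\<close> variables such that no leading monomial of an element of \<open>P\<close> is a
  monomial in \<open>x\<^sub>A\<close> (\<open>LM_free_of_affine_dim\<close>).  Two observations about \<open>A\<close> lead to the result.

  First, \<open>A\<close> has the same property with respect to every \<open>Q\<close> over \<open>P\<close> (\<open>LM_free_lifts\<close>): a polynomial
  over \<open>L\<close> whose leading monomial is a monomial in \<open>x\<^sub>A\<close> acts injectively on \<open>S\<^sub>L / P S\<^sub>L\<close>, because a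
  suitable matrix describing its action has dominating diagonal.

  Second, for a variable \<open>x\<^sub>b\<close> outside \<open>A\<close> the \<open>d + 1\<close> variables \<open>x\<^sub>b\<close>, \<open>x\<^sub>A\<close> are dependent modulo \<open>I\<close>,
  as \<open>I\<close> is equidimensional.  So the leading monomials of \<open>I\<close> include a squarefree monomial in these variables
  that involves \<open>x\<^sub>b\<close>.  In other words, modulo \<open>I\<close> the product of \<open>x\<^sub>b\<close> and the variables in \<open>A\<close>
  can be replaced by terms of smaller weight.  If \<open>Q1\<close> and \<open>Q2\<close> both lie over \<open>P\<close> and \<open>f \<in> Q1 - Q2\<close>,
  then a multiple of \<open>f\<close> is congruent modulo \<open>Q2\<close> to a nonzero polynomial \<open>p0\<close> in \<open>L[x\<^sub>A]\<close>.  On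
  multiplying with a high power of the product of the variables in \<open>A\<close> and replacing again and again, this
  multiple of \<open>f\<close> becomes small in comparison with the factor, since the terms in \<open>L[x\<^sub>A]\<close>, for which no replacement is
  available, never lead an element of \<open>Q1\<close>.  Modulo \<open>Q2\<close> the same would be true of \<open>p0\<close>, but no
  element of \<open>Q2\<close> has its leading monomial in \<open>L[x\<^sub>A]\<close> (\<open>prime_determined_by_facet\<close>).

  Equidimensionality refers to Krull dimensions, whereas the argument uses numbers of independent
  variables; \<open>Sup_chain_lengths\<close> identifies the two.
\<close>


section \<open>Krull's height theorem in a Noetherian subring\<close>

text \<open>Ideals are treated as subsets of a subring \<open>C\<close> of a commutative ring type, so that all computations
  take place in the type.  In the application the type provides infinitely many variables and \<open>C\<close> is
  the polynomial ring in the first \<open>n\<close> of them.\<close>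

locale subring_in =
  fixes C :: "'a::comm_ring_1 set"
  assumes zero_C [simp, intro]: "0 \<in> C" and one_C [simp, intro]: "1 \<in> C"
    and add_C [simp, intro]: "a \<in> C \<Longrightarrow> b \<in> C \<Longrightarrow> a + b \<in> C"
    and uminus_C [simp, intro]: "a \<in> C \<Longrightarrow> - a \<in> C"
    and mult_C [simp, intro]: "a \<in> C \<Longrightarrow> b \<in> C \<Longrightarrow> a * b \<in> C"

definition ideal_in :: "'a::comm_ring_1 set \<Rightarrow> 'a set \<Rightarrow> bool" where
  "ideal_in C J \<longleftrightarrow> J \<subseteq> C \<and> 0 \<in> J \<and> (\<forall>x\<in>J. \<forall>y\<in>J. x + y \<in> J) \<and> (\<forall>r\<in>C. \<forall>x\<in>J. r * x \<in> J)"

definition prime_in :: "'a::comm_ring_1 set \<Rightarrow> 'a set \<Rightarrow> bool" where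
  "prime_in C P \<longleftrightarrow> ideal_in C P \<and> 1 \<notin> P \<and> (\<forall>a\<in>C. \<forall>b\<in>C. a * b \<in> P \<longrightarrow> a \<in> P \<or> b \<in> P)"

definition minimal_prime_over :: "'a::comm_ring_1 set \<Rightarrow> 'a set \<Rightarrow> 'a set \<Rightarrow> bool" where
  "minimal_prime_over C E P \<longleftrightarrow>
     prime_in C P \<and> E \<subseteq> P \<and> (\<forall>Q. prime_in C Q \<longrightarrow> E \<subseteq> Q \<longrightarrow> Q \<subseteq> P \<longrightarrow> Q = P)"

definition chain_in :: "'a::comm_ring_1 set \<Rightarrow> nat \<Rightarrow> (nat \<Rightarrow> 'a set) \<Rightarrow> bool" where
  "chain_in C k f \<longleftrightarrow> (\<forall>i\<le>k. prime_in C (f i)) \<and> (\<forall>i<k. f i \<subset> f (Suc i))"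

text \<open>The preimage of the extension of \<open>N\<close> to the localisation at \<open>p\<close>.  Saturated ideals stand for the
  ideals of this localisation.\<close>

definition saturation :: "'a::comm_ring_1 set \<Rightarrow> 'a set \<Rightarrow> 'a set \<Rightarrow> 'a set" where
  "saturation C p N = {y \<in> C. \<exists>r\<in>C - p. r * y \<in> N}"

definition saturated :: "'a::comm_ring_1 set \<Rightarrow> 'a set \<Rightarrow> 'a set \<Rightarrow> bool" where
  "saturated C p N \<longleftrightarrow> ideal_in C N \<and> (\<forall>r\<in>C - p. \<forall>y\<in>C. r * y \<in> N \<longrightarrow> y \<in> N)"

definition adjoin :: "'a::comm_ring_1 set \<Rightarrow> 'a set \<Rightarrow> 'a \<Rightarrow> 'a set" where
  "adjoin C N a = {x + r * a | x r. x \<in> N \<and> r \<in> C}"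

definition generated_ideal :: "'a::comm_ring_1 set \<Rightarrow> 'a set \<Rightarrow> 'a set" where
  "generated_ideal C E = {x \<in> C. \<forall>J. ideal_in C J \<longrightarrow> E \<subseteq> J \<longrightarrow> x \<in> J}"

lemma ideal_inD:
  assumes "ideal_in C J"
  shows "J \<subseteq> C" "0 \<in> J" "x \<in> J \<Longrightarrow> y \<in> J \<Longrightarrow> x + y \<in> J" "r \<in> C \<Longrightarrow> x \<in> J \<Longrightarrow> r * x \<in> J"
    "r \<in> C \<Longrightarrow> x \<in> J \<Longrightarrow> x * r \<in> J"
  using assms by (auto simp: ideal_in_def mult.commute)

lemma prime_inD:
  assumes "prime_in C P"
  shows "ideal_in C P" "1 \<notin> P" "a * b \<in> P \<Longrightarrow> a \<in> C \<Longrightarrow> b \<in> C \<Longrightarrow> a \<in> P \<or> b \<in> P"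
  using assms by (auto simp: prime_in_def)

lemma minimal_prime_overD:
  assumes "minimal_prime_over C E P"
  shows "prime_in C P" "E \<subseteq> P" "prime_in C Q \<Longrightarrow> E \<subseteq> Q \<Longrightarrow> Q \<subseteq> P \<Longrightarrow> Q = P"
  using assms by (auto simp: minimal_prime_over_def)

lemma saturatedD:
  assumes "saturated C p N"
  shows "ideal_in C N" "r \<in> C \<Longrightarrow> r \<notin> p \<Longrightarrow> y \<in> C \<Longrightarrow> r * y \<in> N \<Longrightarrow> y \<in> N"
  using assms by (auto simp: saturated_def)

lemma chain_in_mono: "chain_in C k f \<Longrightarrow> i \<le> j \<Longrightarrow> j \<le> k \<Longrightarrow> f i \<subseteq> f j"
proof (induction j)
  case (Suc j)
  then have "f j \<subset> f (Suc j)" unfolding chain_in_def by (meson Suc_le_lessD)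
  then show ?case using Suc by (cases "i = Suc j") auto
qed simp

context subring_in
begin

lemma minus_C [simp, intro]: "a \<in> C \<Longrightarrow> b \<in> C \<Longrightarrow> a - b \<in> C"
  using add_C[of a "- b"] by simp

lemma power_C [simp, intro]: "a \<in> C \<Longrightarrow> a ^ k \<in> C"
  by (induction k) auto

lemma sum_C: "(\<And>i. i \<in> A \<Longrightarrow> f i \<in> C) \<Longrightarrow> sum f A \<in> C"
  by (induction A rule: infinite_finite_induct) auto

lemma ideal_uminus: "ideal_in C J \<Longrightarrow> x \<in> J \<Longrightarrow> - x \<in> J"
  using ideal_inD(4)[of C J "- 1" x] by simp

lemma ideal_minus: "ideal_in C J \<Longrightarrow> x \<in> J \<Longrightarrow> y \<in> J \<Longrightarrow> x - y \<in> J"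
  using ideal_inD(3)[of C J x "- y"] ideal_uminus[of J y] by simp

lemma ideal_sum: "ideal_in C J \<Longrightarrow> (\<And>i. i \<in> A \<Longrightarrow> f i \<in> J) \<Longrightarrow> sum f A \<in> J"
  by (induction A rule: infinite_finite_induct) (auto dest: ideal_inD)

lemma prime_power: "prime_in C P \<Longrightarrow> x \<in> C \<Longrightarrow> x ^ k \<in> P \<Longrightarrow> x \<in> P"
proof (induction k)
  case (Suc k)
  then show ?case using prime_inD(3)[OF Suc.prems(1), of x "x ^ k"] by auto
qed (auto dest: prime_inD)

lemma ideal_Int: "ideal_in C I \<Longrightarrow> ideal_in C J \<Longrightarrow> ideal_in C (I \<inter> J)"
  by (auto simp: ideal_in_def)

lemma adjoinI: "x \<in> N \<Longrightarrow> r \<in> C \<Longrightarrow> z = x + r * a \<Longrightarrow> z \<in> adjoin C N a"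
  by (auto simp: adjoin_def)

lemma ideal_adjoin:
  assumes "ideal_in C N" "a \<in> C" shows "ideal_in C (adjoin C N a)"
  unfolding ideal_in_def
proof (intro conjI ballI)
  show "adjoin C N a \<subseteq> C" using assms ideal_inD(1)[OF assms(1)] by (auto simp: adjoin_def)
  have "0 + 0 * a \<in> adjoin C N a"
    unfolding adjoin_def using ideal_inD(2)[OF assms(1)] by blast
  then show "0 \<in> adjoin C N a" by simp
next
  fix x y assume "x \<in> adjoin C N a" "y \<in> adjoin C N a"
  then obtain x1 r y1 s where xy: "x = x1 + r * a" "y = y1 + s * a" "x1 \<in> N" "y1 \<in> N" "r \<in> C" "s \<in> C"
    by (auto simp: adjoin_def)
  then have "x + y = (x1 + y1) + (r + s) * a" by (simp add: algebra_simps)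
  with xy show "x + y \<in> adjoin C N a"
    using ideal_inD(3)[OF assms(1)] by (intro adjoinI[of "x1 + y1" N "r + s"]) auto
next
  fix c x assume "c \<in> C" "x \<in> adjoin C N a"
  then obtain x1 r where x: "x = x1 + r * a" "x1 \<in> N" "r \<in> C" by (auto simp: adjoin_def)
  then have "c * x = c * x1 + (c * r) * a" by (simp add: algebra_simps)
  with x \<open>c \<in> C\<close> show "c * x \<in> adjoin C N a"
    using ideal_inD(4)[OF assms(1)] by (intro adjoinI[of "c * x1" N "c * r"]) auto
qed

lemma adjoin_superset: "N \<subseteq> adjoin C N a"
  unfolding adjoin_def by (force intro: exI[of _ "0::'a"])

lemma adjoin_self: "ideal_in C N \<Longrightarrow> a \<in> adjoin C N a"
  unfolding adjoin_def using ideal_inD(2) by (force intro: exI[of _ "0::'a"] exI[of _ "1::'a"])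

lemma adjoin_least: "ideal_in C J \<Longrightarrow> N \<subseteq> J \<Longrightarrow> a \<in> J \<Longrightarrow> adjoin C N a \<subseteq> J"
  unfolding adjoin_def using ideal_inD(3,4)[of C J] by blast

lemma adjoin_mono: "N \<subseteq> N' \<Longrightarrow> adjoin C N a \<subseteq> adjoin C N' a"
  by (auto simp: adjoin_def)

lemma generated_ideal_ideal: "E \<subseteq> C \<Longrightarrow> ideal_in C (generated_ideal C E)"
  unfolding ideal_in_def[of C "generated_ideal C E"]
proof (intro conjI ballI)
  fix r x assume "r \<in> C" "x \<in> generated_ideal C E"
  then show "r * x \<in> generated_ideal C E"
    using ideal_inD(4)[of C _ r x] by (auto simp: generated_ideal_def)
next
  fix x y assume "x \<in> generated_ideal C E" "y \<in> generated_ideal C E"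
  then show "x + y \<in> generated_ideal C E"
    using ideal_inD(3)[of C _ x y] by (auto simp: generated_ideal_def)
qed (auto simp: generated_ideal_def dest: ideal_inD)

lemma generated_ideal_superset: "E \<subseteq> C \<Longrightarrow> E \<subseteq> generated_ideal C E"
  by (auto simp: generated_ideal_def)

lemma generated_ideal_least: "ideal_in C J \<Longrightarrow> E \<subseteq> J \<Longrightarrow> generated_ideal C E \<subseteq> J"
  by (auto simp: generated_ideal_def)

lemma not_in_prime_mult:
  "prime_in C p \<Longrightarrow> r \<in> C - p \<Longrightarrow> s \<in> C - p \<Longrightarrow> r * s \<in> C - p"
  by (auto dest: prime_inD)

lemma saturation_superset:
  assumes "prime_in C p" "N \<subseteq> C" shows "N \<subseteq> saturation C p N"
  unfolding saturation_def using assms prime_inD(2)[OF assms(1)]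
  by (auto intro!: bexI[of _ 1])

lemma saturated_saturation:
  assumes p: "prime_in C p" and N: "ideal_in C N"
  shows "saturated C p (saturation C p N)"
  unfolding saturated_def ideal_in_def
proof (intro conjI ballI impI)
  show "saturation C p N \<subseteq> C" by (auto simp: saturation_def)
  show "0 \<in> saturation C p N"
    using saturation_superset[OF p] N ideal_inD(1,2)[OF N] by blast
next
  fix x y assume "x \<in> saturation C p N" "y \<in> saturation C p N"
  then obtain r s where *: "r \<in> C - p" "s \<in> C - p" "r * x \<in> N" "s * y \<in> N" "x \<in> C" "y \<in> C"
    by (auto simp: saturation_def)
  have "(r * s) * (x + y) = s * (r * x) + r * (s * y)" by (simp add: algebra_simps)
  also have "\<dots> \<in> N" using * ideal_inD[OF N] by auto
  finally show "x + y \<in> saturation C p N"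
    using * not_in_prime_mult[OF p, of r s] by (auto simp: saturation_def)
next
  fix c x assume "c \<in> C" "x \<in> saturation C p N"
  then obtain r where *: "r \<in> C - p" "r * x \<in> N" "x \<in> C" by (auto simp: saturation_def)
  have "r * (c * x) = c * (r * x)" by (simp add: algebra_simps)
  also have "\<dots> \<in> N" using * \<open>c \<in> C\<close> ideal_inD[OF N] by auto
  finally show "c * x \<in> saturation C p N" using * \<open>c \<in> C\<close> by (auto simp: saturation_def)
next
  fix r y assume "r \<in> C - p" "y \<in> C" "r * y \<in> saturation C p N"
  then obtain s where "s \<in> C - p" "s * (r * y) \<in> N" by (auto simp: saturation_def)
  then have "(s * r) * y \<in> N" by (simp add: mult.assoc)
  then show "y \<in> saturation C p N"
    using not_in_prime_mult[OF p \<open>s \<in> C - p\<close> \<open>r \<in> C - p\<close>] \<open>y \<in> C\<close> by (auto simp: saturation_def)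
qed

lemma saturation_least: "saturated C p N' \<Longrightarrow> N \<subseteq> N' \<Longrightarrow> saturation C p N \<subseteq> N'"
  by (auto simp: saturation_def saturated_def)

lemma saturation_mono: "N \<subseteq> N' \<Longrightarrow> saturation C p N \<subseteq> saturation C p N'"
  by (auto simp: saturation_def)

lemma saturated_anti: "saturated C p N \<Longrightarrow> p \<subseteq> p' \<Longrightarrow> saturated C p' N"
  by (auto simp: saturated_def)

end

locale noetherian_in = subring_in C for C :: "'a::comm_ring_1 set" +
  assumes acc: "\<And>J :: nat \<Rightarrow> 'a set. (\<And>i. ideal_in C (J i)) \<Longrightarrow> (\<And>i. J i \<subset> J (Suc i)) \<Longrightarrow> False"
begin

lemma maximal_ideal_in_family:
  assumes "\<F> \<noteq> {}" "\<And>J. J \<in> \<F> \<Longrightarrow> ideal_in C J"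
  obtains J where "J \<in> \<F>" "\<And>J'. J' \<in> \<F> \<Longrightarrow> J \<subseteq> J' \<Longrightarrow> J' = J"
proof (rule ccontr)
  assume "\<not> thesis"
  with that have ex: "\<exists>J'\<in>\<F>. J \<subset> J'" if "J \<in> \<F>" for J using that by blast
  define g where "g J = (SOME J'. J' \<in> \<F> \<and> J \<subset> J')" for J
  have g: "g J \<in> \<F> \<and> J \<subset> g J" if "J \<in> \<F>" for J
    unfolding g_def by (rule someI_ex) (use ex[OF that] in blast)
  obtain J0 where "J0 \<in> \<F>" using assms(1) by blast
  define f where "f i = (g ^^ i) J0" for i
  have f: "f i \<in> \<F>" for i
    by (induction i) (auto simp: f_def \<open>J0 \<in> \<F>\<close> g)
  show False
  proof (rule acc[of f])
    show "ideal_in C (f i)" for i using assms(2) f by blast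
    show "f i \<subset> f (Suc i)" for i using g[OF f[of i]] by (simp add: f_def)
  qed
qed

lemma prime_avoiding_multiplicative_set:
  assumes J: "ideal_in C J" and T: "T \<subseteq> C" "1 \<in> T" "\<And>a b. a \<in> T \<Longrightarrow> b \<in> T \<Longrightarrow> a * b \<in> T"
    and disj: "J \<inter> T = {}"
  obtains P where "prime_in C P" "J \<subseteq> P" "P \<inter> T = {}"
proof -
  let ?F = "{H. ideal_in C H \<and> J \<subseteq> H \<and> H \<inter> T = {}}"
  have "?F \<noteq> {}" using J disj by blast
  then obtain P where P: "P \<in> ?F" and max: "\<And>H. H \<in> ?F \<Longrightarrow> P \<subseteq> H \<Longrightarrow> H = P"
    by (rule maximal_ideal_in_family) auto
  have idP: "ideal_in C P" using P by blast
  have ex: "\<exists>x\<in>P. \<exists>r\<in>C. x + r * a \<in> T" if "a \<in> C" "a \<notin> P" for a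
  proof (rule ccontr)
    assume "\<not> ?thesis"
    then have "adjoin C P a \<inter> T = {}" by (auto simp: adjoin_def)
    moreover have "J \<subseteq> adjoin C P a" using P adjoin_superset[of P a] by blast
    ultimately have "adjoin C P a = P"
      using ideal_adjoin[OF idP \<open>a \<in> C\<close>] adjoin_superset max by blast
    then show False using adjoin_self[OF idP, of a] that by blast
  qed
  have "prime_in C P"
    unfolding prime_in_def
  proof (intro conjI ballI impI)
    show "ideal_in C P" "1 \<notin> P" using P T by auto
    fix a b assume ab: "a \<in> C" "b \<in> C" "a * b \<in> P"
    show "a \<in> P \<or> b \<in> P"
    proof (rule ccontr)
      assume "\<not> ?thesis"
      then obtain x r y s where *: "x \<in> P" "r \<in> C" "x + r * a \<in> T" "y \<in> P" "s \<in> C" "y + s * b \<in> T"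
        using ex ab by meson
      have xy: "x \<in> C" "y \<in> C" using * ideal_inD(1)[OF idP] by auto
      have "(x + r * a) * (y + s * b) = (y + s * b) * x + (r * a) * y + (r * s) * (a * b)"
        by (simp add: algebra_simps)
      also have "\<dots> \<in> P" using * ab xy ideal_inD[OF idP] by auto
      finally show False using T(3)[OF *(3,6)] P by blast
    qed
  qed
  with P that show thesis by blast
qed

text \<open>Noetherian induction: an ideal that is not prime is contained in two larger ideals whose product
  lies in it, so a prime above it lies above one of the two.\<close>

lemma finitely_many_primes_suffice:
  assumes "ideal_in C J"
  obtains F where "finite F" "\<And>q. q \<in> F \<Longrightarrow> prime_in C q \<and> J \<subseteq> q"
    "\<And>Q. prime_in C Q \<Longrightarrow> J \<subseteq> Q \<Longrightarrow> \<exists>q\<in>F. q \<subseteq> Q"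
proof -
  let ?good = "\<lambda>J. \<exists>F. finite F \<and> (\<forall>q\<in>F. prime_in C q \<and> J \<subseteq> q) \<and>
      (\<forall>Q. prime_in C Q \<and> J \<subseteq> Q \<longrightarrow> (\<exists>q\<in>F. q \<subseteq> Q))"
  have "?good J"
  proof (rule ccontr)
    assume "\<not> ?good J"
    then have "{J. ideal_in C J \<and> \<not> ?good J} \<noteq> {}" using assms by blast
    then obtain J where J: "J \<in> {J. ideal_in C J \<and> \<not> ?good J}"
      and max: "\<And>J'. J' \<in> {J. ideal_in C J \<and> \<not> ?good J} \<Longrightarrow> J \<subseteq> J' \<Longrightarrow> J' = J"
      by (rule maximal_ideal_in_family) auto
    have idJ: "ideal_in C J" and bad: "\<not> ?good J" using J by auto
    have "1 \<notin> J"
    proof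
      assume "1 \<in> J"
      then have "?good J" by (intro exI[of _ "{}"]) (auto dest: prime_inD)
      with bad show False by contradiction
    qed
    moreover have "\<not> prime_in C J"
    proof
      assume "prime_in C J"
      then have "?good J" by (intro exI[of _ "{J}"]) auto
      with bad show False by contradiction
    qed
    ultimately obtain a b where ab: "a \<in> C" "b \<in> C" "a * b \<in> J" "a \<notin> J" "b \<notin> J"
      using idJ by (auto simp: prime_in_def)
    have good: "?good (adjoin C J c)" if "c \<in> C" "c \<notin> J" for c
      using max[of "adjoin C J c"] ideal_adjoin[OF idJ \<open>c \<in> C\<close>] adjoin_superset[of J c]
        adjoin_self[OF idJ, of c] that by blast
    obtain Fa where Fa: "finite Fa" "\<forall>q\<in>Fa. prime_in C q \<and> adjoin C J a \<subseteq> q"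
        "\<forall>Q. prime_in C Q \<and> adjoin C J a \<subseteq> Q \<longrightarrow> (\<exists>q\<in>Fa. q \<subseteq> Q)"
      using good[OF ab(1,4)] by (elim exE conjE)
    obtain Fb where Fb: "finite Fb" "\<forall>q\<in>Fb. prime_in C q \<and> adjoin C J b \<subseteq> q"
        "\<forall>Q. prime_in C Q \<and> adjoin C J b \<subseteq> Q \<longrightarrow> (\<exists>q\<in>Fb. q \<subseteq> Q)"
      using good[OF ab(2,5)] by (elim exE conjE)
    note F = Fa Fb
    have "?good J"
    proof (intro exI[of _ "Fa \<union> Fb"] conjI allI impI ballI)
      show "finite (Fa \<union> Fb)" using F by simp
      fix q assume "q \<in> Fa \<union> Fb"
      then have "prime_in C q \<and> (adjoin C J a \<subseteq> q \<or> adjoin C J b \<subseteq> q)" using Fa(2) Fb(2) by blast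
      then show "prime_in C q" "J \<subseteq> q"
        using subset_trans[OF adjoin_superset[of J a]] subset_trans[OF adjoin_superset[of J b]] by auto
    next
      fix Q assume Q: "prime_in C Q \<and> J \<subseteq> Q"
      then have "a \<in> Q \<or> b \<in> Q" using ab prime_inD(3) by blast
      then have "adjoin C J a \<subseteq> Q \<or> adjoin C J b \<subseteq> Q"
        using adjoin_least[OF prime_inD(1), of Q J] Q by auto
      then have "(\<exists>q\<in>Fa. q \<subseteq> Q) \<or> (\<exists>q\<in>Fb. q \<subseteq> Q)" using Fa(3) Fb(3) Q by auto
      then show "\<exists>q\<in>Fa \<union> Fb. q \<subseteq> Q" by auto
    qed
    with bad show False by contradiction
  qed
  then obtain F where "finite F" "\<forall>q\<in>F. prime_in C q \<and> J \<subseteq> q"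
      "\<forall>Q. prime_in C Q \<and> J \<subseteq> Q \<longrightarrow> (\<exists>q\<in>F. q \<subseteq> Q)"
    by (elim exE conjE)
  then show thesis by (intro that[of F]) auto
qed

lemma minimal_prime_below:
  assumes J: "ideal_in C J" and Q: "prime_in C Q" "J \<subseteq> Q"
  obtains P where "minimal_prime_over C J P" "P \<subseteq> Q"
proof -
  obtain F where F: "finite F" "\<And>q. q \<in> F \<Longrightarrow> prime_in C q \<and> J \<subseteq> q"
    "\<And>Q. prime_in C Q \<Longrightarrow> J \<subseteq> Q \<Longrightarrow> \<exists>q\<in>F. q \<subseteq> Q"
    using finitely_many_primes_suffice[OF J] by metis
  define G where "G = {q \<in> F. q \<subseteq> Q}"
  have "finite G" unfolding G_def using F(1) by simp
  moreover have "G \<noteq> {}" unfolding G_def using F(3)[OF Q] by blast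
  ultimately obtain P where P: "P \<in> G" and min: "\<And>q. q \<in> G \<Longrightarrow> q \<subseteq> P \<Longrightarrow> P = q"
    using finite_has_minimal[of G] by metis
  have "minimal_prime_over C J P"
    unfolding minimal_prime_over_def
  proof (intro conjI allI impI)
    show "prime_in C P" "J \<subseteq> P" using P F(2)[of P] by (auto simp: G_def)
    fix R assume R: "prime_in C R" "J \<subseteq> R" "R \<subseteq> P"
    then obtain q where q: "q \<in> F" "q \<subseteq> R" using F(3)[OF R(1,2)] by blast
    then have "P = q" using min[of q] P R by (auto simp: G_def)
    then show "R = P" using q R by blast
  qed
  moreover have "P \<subseteq> Q" using P by (auto simp: G_def)
  ultimately show thesis by (rule that)
qed

text \<open>If a member of \<open>G\<close> contains another one, the smaller one may be dropped.  Otherwise an element of \<open>p\<close>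
  that avoids all primes but \<open>q\<close> is corrected by an element of \<open>p\<close> outside \<open>q\<close> that lies in all the
  other primes.\<close>

lemma prime_avoidance:
  assumes "finite G" and p: "ideal_in C p" and "\<And>q. q \<in> G \<Longrightarrow> prime_in C q \<and> \<not> p \<subseteq> q"
  shows "\<exists>a\<in>p. \<forall>q\<in>G. a \<notin> q"
  using assms(1,3)
proof (induction G rule: finite_psubset_induct)
  case (psubset G)
  show ?case
  proof (cases "\<exists>q\<in>G. \<exists>g\<in>G. g \<noteq> q \<and> g \<subseteq> q")
    case True
    then obtain q g where *: "q \<in> G" "g \<in> G" "g \<noteq> q" "g \<subseteq> q" by blast
    then have "\<exists>a\<in>p. \<forall>q\<in>G - {g}. a \<notin> q" using psubset by (metis Diff_iff psubsetI Diff_subset insertI1)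
    then show ?thesis using * by blast
  next
    case incomparable: False
    show ?thesis
    proof (cases "G = {}")
      case True then show ?thesis using ideal_inD(2)[OF p] by auto
    next
      case False
      then obtain q where q: "q \<in> G" by blast
      have "G - {q} \<subset> G" using q by blast
      then obtain a where a: "a \<in> p" "\<forall>g\<in>G - {q}. a \<notin> g" using psubset by (metis Diff_iff)
      show ?thesis
      proof (cases "a \<in> q")
        case False then show ?thesis using a by blast
      next
        case True
        have q': "prime_in C q" "\<not> p \<subseteq> q" using psubset.prems q by blast+
        then obtain b where b: "b \<in> p" "b \<notin> q" by blast
        have "\<exists>e\<in>C. e \<notin> q \<and> (\<forall>g\<in>H. e \<in> g)" if "H \<subseteq> G - {q}" for H
          using that
        proof (induction H rule: infinite_finite_induct)
          case (insert g H)
          then obtain e where e: "e \<in> C" "e \<notin> q" "\<forall>g\<in>H. e \<in> g" by auto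
          have g: "g \<in> G" "g \<noteq> q" using insert.prems by auto
          then obtain c where c: "c \<in> g" "c \<notin> q" using incomparable q by blast
          have id: "ideal_in C h" if "h \<in> insert g H" for h
            using psubset.prems[of h] insert.prems that prime_inD(1)[of C h] by auto
          have "c \<in> C" using c(1) id[of g] ideal_inD(1) by blast
          then have "e * c \<notin> q" using e c q' by (auto dest: prime_inD)
          moreover have "e * c \<in> h" if "h \<in> insert g H" for h
            using that id[OF that] e c \<open>c \<in> C\<close> ideal_inD(4,5)[of C h] by auto
          ultimately show ?case using e \<open>c \<in> C\<close> by (intro bexI[of _ "e * c"]) auto
        next
          case empty
          show ?case using prime_inD(2)[OF q'(1)] by (intro bexI[of _ 1]) auto
        next
          case (infinite H)
          then have "finite H" using psubset.hyps by (meson finite_Diff finite_subset)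
          then show ?case using infinite by simp
        qed
        then obtain e where e: "e \<in> C" "e \<notin> q" "\<forall>g\<in>G - {q}. e \<in> g" by blast
        have C: "a \<in> C" "b \<in> C" using a b ideal_inD(1)[OF p] by auto
        have "a + b * e \<in> p" using a b e ideal_inD[OF p] by auto
        moreover have "a + b * e \<notin> g" if "g \<in> G" for g
        proof
          assume in_g: "a + b * e \<in> g"
          have g: "prime_in C g" "ideal_in C g" using psubset.prems[OF that] prime_inD(1) by blast+
          show False
          proof (cases "g = q")
            case True
            then have "b * e \<in> q" using ideal_minus[OF g(2) in_g, of a] \<open>a \<in> q\<close> by simp
            then show False using b e C q' by (auto dest: prime_inD)
          next
            case False
            then have "b * e \<in> g" using e that C ideal_inD(4)[OF g(2)] by auto
            then have "a \<in> g" using ideal_minus[OF g(2) in_g, of "b * e"] by simp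
            then show False using a that False by blast
          qed
        qed
        ultimately show ?thesis by blast
      qed
    qed
  qed
qed

text \<open>In the localisation at \<open>Q\<close> modulo \<open>J\<close> the ideal \<open>Q\<close> is the only prime.\<close>

lemma minimal_prime_locally_nilpotent:
  assumes J: "ideal_in C J" and Q: "minimal_prime_over C J Q" and g: "g \<in> Q"
  obtains k h where "h \<in> C" "h \<notin> Q" "g ^ k * h \<in> J"
proof (rule ccontr)
  assume "\<not> thesis"
  note Q' = minimal_prime_overD[OF Q]
  have gC: "g \<in> C" using g ideal_inD(1) prime_inD(1) Q'(1) by blast
  let ?T = "{g ^ k * h | k h. h \<in> C - Q}"
  have "J \<inter> ?T = {}" using \<open>\<not> thesis\<close> that by auto
  moreover have "1 \<in> ?T"
    using prime_inD(2)[OF Q'(1)] by (intro CollectI exI[of _ 0] exI[of _ 1]) auto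
  moreover have "a * b \<in> ?T" if "a \<in> ?T" "b \<in> ?T" for a b
  proof -
    obtain k h where a: "a = g ^ k * h" "h \<in> C - Q" using \<open>a \<in> ?T\<close> by auto
    obtain l i where b: "b = g ^ l * i" "i \<in> C - Q" using \<open>b \<in> ?T\<close> by auto
    from a b have "a * b = g ^ (k + l) * (h * i)" "h * i \<in> C - Q"
      using not_in_prime_mult[OF Q'(1)] by (auto simp: power_add algebra_simps)
    then show ?thesis by blast
  qed
  moreover have "?T \<subseteq> C" using gC by auto
  ultimately obtain P where P: "prime_in C P" "J \<subseteq> P" "P \<inter> ?T = {}"
    using prime_avoiding_multiplicative_set[OF J, of ?T] by blast
  have PC: "P \<subseteq> C" using P ideal_inD(1) prime_inD(1) by blast
  have "P \<subseteq> Q"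
  proof
    fix x assume "x \<in> P"
    show "x \<in> Q"
    proof (rule ccontr)
      assume "x \<notin> Q"
      then have "g ^ 0 * x \<in> ?T" using PC \<open>x \<in> P\<close> by blast
      then show False using P \<open>x \<in> P\<close> by auto
    qed
  qed
  moreover have "g ^ 1 * 1 \<in> ?T" using prime_inD(2)[OF Q'(1)] by blast
  then have "g \<notin> P" using P by auto
  ultimately show False using Q'(3)[of P] P g by blast
qed

subsection \<open>Krull's principal ideal theorem\<close>

text \<open>The localisation at \<open>p\<close> modulo \<open>J\<close> is Artinian.  Let \<open>H\<close> be maximal among the saturated ideals such
  that the condition holds for chains between \<open>J\<close> and \<open>H\<close>.  If \<open>H\<close> were proper, an element \<open>y\<close> outside
  \<open>H\<close> with the largest annihilator modulo \<open>H\<close> would be annihilated exactly by \<open>p\<close>.  Then no saturated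
  ideal lies strictly between \<open>H\<close> and the saturation \<open>H'\<close> of \<open>H + (y)\<close>, and by the modular law the
  condition extends to chains below \<open>H'\<close>.\<close>

lemma descending_chain_condition:
  assumes J: "ideal_in C J" and pJ: "minimal_prime_over C J p"
    and I: "\<And>i. saturated C p (I i)" "\<And>i. J \<subseteq> I i" "\<And>i. I (Suc i) \<subseteq> I i"
  shows "\<exists>m. \<forall>i\<ge>m. I i = I m"
proof -
  note p = minimal_prime_overD[OF pJ]
  define D where "D H \<longleftrightarrow> (\<forall>I. (\<forall>i. saturated C p (I i) \<and> J \<subseteq> I i \<and> I i \<subseteq> H \<and> I (Suc i) \<subseteq> I i) \<longrightarrow>
    (\<exists>m. \<forall>i\<ge>m. I i = I m))" for H :: "'a set"
  let ?F = "{H. saturated C p H \<and> J \<subseteq> H \<and> D H}"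
  have "saturation C p J \<in> ?F"
  proof -
    have "D (saturation C p J)"
      unfolding D_def
    proof (intro allI impI)
      fix I assume I: "\<forall>i. saturated C p (I i) \<and> J \<subseteq> I i \<and> I i \<subseteq> saturation C p J \<and> I (Suc i) \<subseteq> I i"
      then have "I i = saturation C p J" for i using saturation_least[of p "I i" J] by blast
      then show "\<exists>m. \<forall>i\<ge>m. I i = I m" by simp
    qed
    then show ?thesis
      using saturated_saturation[OF p(1) J] saturation_superset[OF p(1)] ideal_inD(1)[OF J] by blast
  qed
  then have "?F \<noteq> {}" by blast
  then obtain H where H: "H \<in> ?F" and max: "\<And>H'. H' \<in> ?F \<Longrightarrow> H \<subseteq> H' \<Longrightarrow> H' = H"
    by (rule maximal_ideal_in_family) (auto dest: saturatedD)
  have satH: "saturated C p H" and idH: "ideal_in C H" and JH: "J \<subseteq> H" and DH: "D H"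
    using H saturatedD(1) by auto
  have "H = C"
  proof (rule ccontr)
    assume "H \<noteq> C"
    define colon where "colon y = {r \<in> C. r * y \<in> H}" for y
    have id_colon: "ideal_in C (colon y)" if "y \<in> C" for y
      using ideal_inD[OF idH] that by (auto simp: ideal_in_def colon_def ring_distribs mult.assoc)
    let ?K = "colon ` (C - H)"
    have "?K \<noteq> {}" using \<open>H \<noteq> C\<close> ideal_inD(1)[OF idH] by blast
    then obtain c where "c \<in> ?K" and maxc: "\<And>c'. c' \<in> ?K \<Longrightarrow> c \<subseteq> c' \<Longrightarrow> c' = c"
      by (rule maximal_ideal_in_family) (use id_colon in auto)
    then obtain y where y: "y \<in> C" "y \<notin> H" "c = colon y" by blast
    have colon_p: "colon y \<subseteq> p"
      using saturatedD(2)[OF satH] y by (auto simp: colon_def)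
    have "prime_in C (colon y)"
      unfolding prime_in_def
    proof (intro conjI ballI impI)
      show "ideal_in C (colon y)" by (rule id_colon[OF y(1)])
      show "1 \<notin> colon y" using y by (simp add: colon_def)
      fix a b assume ab: "a \<in> C" "b \<in> C" "a * b \<in> colon y"
      show "a \<in> colon y \<or> b \<in> colon y"
      proof (rule disjCI)
        assume "b \<notin> colon y"
        then have "b * y \<in> C - H" using ab y by (auto simp: colon_def)
        moreover have "colon y \<subseteq> colon (b * y)"
        proof
          fix r assume "r \<in> colon y"
          then have "b * (r * y) \<in> H" using ideal_inD(4)[OF idH] ab by (auto simp: colon_def)
          then show "r \<in> colon (b * y)" using \<open>r \<in> colon y\<close> by (auto simp: colon_def algebra_simps)
        qed
        ultimately have "colon (b * y) = colon y" using maxc[of "colon (b * y)"] y by blast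
        moreover have "a \<in> colon (b * y)" using ab by (auto simp: colon_def algebra_simps)
        ultimately show "a \<in> colon y" by simp
      qed
    qed
    moreover have "J \<subseteq> colon y"
      using JH y ideal_inD(1)[OF J] ideal_inD(5)[OF idH] by (auto simp: colon_def)
    ultimately have colon_eq: "colon y = p" using p(3) colon_p by blast
    define H' where "H' = saturation C p (adjoin C H y)"
    have H': "saturated C p H'" "H \<subseteq> H'" "y \<in> H'"
      unfolding H'_def
      using saturated_saturation[OF p(1) ideal_adjoin[OF idH y(1)]]
        saturation_superset[OF p(1)] ideal_inD(1)[OF ideal_adjoin[OF idH y(1)]]
        adjoin_superset[of H y] adjoin_self[OF idH, of y] by blast+
    have elem: "\<exists>r\<in>C - p. \<exists>b\<in>C. r * t - b * y \<in> H" if t: "t \<in> H'" for t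
    proof -
      obtain r x b where *: "r \<in> C - p" "r * t = x + b * y" "x \<in> H" "b \<in> C"
        using t by (auto simp: H'_def saturation_def adjoin_def)
      then have "r * t - b * y = x" by simp
      then have "r * t - b * y \<in> H" using * by simp
      then show ?thesis using * by blast
    qed
    have "D H'"
      unfolding D_def
    proof (intro allI impI)
      fix I assume I: "\<forall>i. saturated C p (I i) \<and> J \<subseteq> I i \<and> I i \<subseteq> H' \<and> I (Suc i) \<subseteq> I i"
      have anti: "I j \<subseteq> I i" if "i \<le> j" for i j
        using lift_Suc_antimono_le[of I i j] that I by blast
      have idI: "ideal_in C (I i)" for i using I saturatedD(1) by blast
      have "\<forall>i. saturated C p (I i \<inter> H) \<and> J \<subseteq> I i \<inter> H \<and> I i \<inter> H \<subseteq> H \<and> I (Suc i) \<inter> H \<subseteq> I i \<inter> H"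
        using I satH JH ideal_Int[OF idI idH] by (auto simp: saturated_def)
      then obtain m where m: "\<And>i. i \<ge> m \<Longrightarrow> I i \<inter> H = I m \<inter> H"
        using DH[unfolded D_def, rule_format, of "\<lambda>i. I i \<inter> H"] by blast
      show "\<exists>m. \<forall>i\<ge>m. I i = I m"
      proof (cases "\<exists>i0. I i0 \<subseteq> H")
        case True
        then obtain i0 where "I i0 \<subseteq> H" by blast
        then have "I i = I (max i0 m)" if "i \<ge> max i0 m" for i
          using m[of i] m[of "max i0 m"] anti[of i0 i] anti[of i0 "max i0 m"] that
          by (metis dual_order.trans inf.absorb1 max.boundedE max.cobounded1 max.cobounded2)
        then show ?thesis by blast
      next
        case False
        have "z \<in> I i" if "i \<ge> m" "z \<in> I m" for i z
        proof -
          obtain t where t: "t \<in> I i" "t \<notin> H" using False by blast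
          have tz: "t \<in> H'" "z \<in> H'" using t that I by blast+
          have C: "t \<in> C" "z \<in> C" using t that ideal_inD(1)[OF idI] by auto
          obtain r b where rb: "r \<in> C - p" "b \<in> C" "r * t - b * y \<in> H" using elem[OF tz(1)] by blast
          obtain r' b' where rb': "r' \<in> C - p" "b' \<in> C" "r' * z - b' * y \<in> H" using elem[OF tz(2)] by blast
          have "b \<notin> p"
          proof
            assume "b \<in> p"
            then have "b * y \<in> H" using colon_eq by (auto simp: colon_def)
            then have "r * t \<in> H" using ideal_inD(3)[OF idH rb(3), of "b * y"] by simp
            then show False using saturatedD(2)[OF satH] rb C t by blast
          qed
          have "b * (r' * z - b' * y) - b' * (r * t - b * y) \<in> H"
            using ideal_minus[OF idH ideal_inD(4)[OF idH rb(2) rb'(3)] ideal_inD(4)[OF idH rb'(2) rb(3)]] .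
          then have "b * r' * z - b' * r * t \<in> H" by (simp add: algebra_simps)
          moreover have "b * r' * z - b' * r * t \<in> I m"
            using rb rb' idI that anti[OF that(1)] t by (intro ideal_minus[OF idI] ideal_inD(4)[OF idI]) auto
          ultimately have "b * r' * z - b' * r * t \<in> I i" using m[OF that(1)] by blast
          moreover have "b' * r * t \<in> I i" using rb rb' t by (intro ideal_inD(4)[OF idI]) auto
          ultimately have "b * r' * z \<in> I i"
            using ideal_inD(3)[OF idI, of "b * r' * z - b' * r * t" i "b' * r * t"] by simp
          moreover have "b * r' \<in> C - p" using not_in_prime_mult[OF p(1)] rb rb' \<open>b \<notin> p\<close> by blast
          ultimately show "z \<in> I i" using I C saturatedD(2)[of C p "I i" "b * r'" z] by blast
        qed
        then show ?thesis using anti by blast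
      qed
    qed
    then have "H' = H" using max[of H'] H' JH by blast
    then show False using H' y by simp
  qed
  moreover have "\<forall>i. saturated C p (I i) \<and> J \<subseteq> I i \<and> I i \<subseteq> C \<and> I (Suc i) \<subseteq> I i"
    using I saturatedD(1) ideal_inD(1) by metis
  ultimately show ?thesis using DH unfolding D_def by blast
qed

text \<open>Among the saturated ideals above \<open>N\<close> that do not contain \<open>M\<close> choose a maximal one.  Modulo this ideal
  and up to factors outside \<open>p\<close>, every element of \<open>M\<close> is a multiple of any given \<open>y \<in> M\<close> outside it, and
  the hypothesis makes \<open>y\<close> a multiple of itself by an element of \<open>p\<close>.\<close>

lemma nakayama:
  assumes p: "prime_in C p" and N: "saturated C p N" and a: "a \<in> p"
    and M: "M \<subseteq> C" "\<And>m. m \<in> M \<Longrightarrow> \<exists>r\<in>C - p. \<exists>n\<in>N. \<exists>m'\<in>M. r * m = n + a * m'"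
  shows "M \<subseteq> N"
proof (rule ccontr)
  assume "\<not> M \<subseteq> N"
  let ?F = "{N'. saturated C p N' \<and> N \<subseteq> N' \<and> \<not> M \<subseteq> N'}"
  have "?F \<noteq> {}" using N \<open>\<not> M \<subseteq> N\<close> by blast
  then obtain H where H: "H \<in> ?F" and max: "\<And>H'. H' \<in> ?F \<Longrightarrow> H \<subseteq> H' \<Longrightarrow> H' = H"
    by (rule maximal_ideal_in_family) (auto dest: saturatedD)
  have satH: "saturated C p H" and idH: "ideal_in C H" using H saturatedD(1) by auto
  obtain y where y: "y \<in> M" "y \<notin> H" using H by blast
  have yC: "y \<in> C" using y M(1) by blast
  have aC: "a \<in> C" using a p ideal_inD(1) prime_inD(1) by blast
  let ?H' = "saturation C p (adjoin C H y)"
  have "saturated C p ?H'" "H \<subseteq> ?H'" "y \<in> ?H'"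
    using saturated_saturation[OF p ideal_adjoin[OF idH yC]]
      saturation_superset[OF p] ideal_inD(1)[OF ideal_adjoin[OF idH yC]]
      adjoin_superset[of H y] adjoin_self[OF idH, of y] by blast+
  then have M_sub: "M \<subseteq> ?H'" using max[of ?H'] H y by blast
  obtain r n m' where r: "r \<in> C - p" "n \<in> N" "m' \<in> M" "r * y = n + a * m'" using M(2)[OF y(1)] by blast
  then have "m' \<in> ?H'" using M_sub by blast
  then obtain r' n' b where r': "r' \<in> C - p" "n' \<in> H" "b \<in> C" "r' * m' = n' + b * y"
    by (auto simp: saturation_def adjoin_def)
  have "r' * (r * y) = r' * n + a * (r' * m')" by (subst r(4)) (simp add: algebra_simps)
  also have "\<dots> = r' * n + a * (n' + b * y)" by (simp only: r'(4))
  finally have eq: "(r' * r - a * b) * y = r' * n + a * n'" by (simp add: algebra_simps)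
  have "\<dots> \<in> H" using r r' H aC ideal_inD(3,4)[OF idH] by auto
  then have "(r' * r - a * b) * y \<in> H" using eq by simp
  moreover have "r' * r - a * b \<in> C - p"
  proof -
    have "r' * r \<notin> p" using not_in_prime_mult[OF p] r r' by blast
    moreover have "a * b \<in> p" using ideal_inD(5)[OF prime_inD(1)[OF p]] a r' by blast
    ultimately have "r' * r - a * b \<notin> p"
      using ideal_inD(3)[OF prime_inD(1)[OF p], of "r' * r - a * b" "a * b"] by auto
    then show ?thesis using r r' aC by auto
  qed
  ultimately have "y \<in> H" using saturatedD(2)[OF satH] yC by blast
  with y show False by blast
qed

text \<open>Krull's argument with the powers of one element \<open>y \<in> p1 - q\<close> in place of the symbolic powers of \<open>p1\<close>.
  Let \<open>Y m\<close> be the ideal generated by \<open>q\<close> and \<open>y ^ m\<close>, saturated with respect to \<open>p1\<close>.  The descending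
  chain condition makes \<open>Y m + (a)\<close> stationary; since \<open>a\<close> is not in \<open>p1\<close>, Nakayama's lemma then makes
  \<open>Y m\<close> itself stationary, and \<open>y ^ m\<close> would be a multiple of \<open>y ^ (m + 1)\<close> modulo \<open>q\<close>.\<close>

lemma krull_principal_ideal_theorem:
  assumes q: "prime_in C q" and p1: "prime_in C p1" and a: "a \<in> C"
    and strict: "q \<subset> p1" "p1 \<subset> p" and pa: "minimal_prime_over C (insert a q) p"
  shows False
proof -
  note p = minimal_prime_overD[OF pa]
  have idq: "ideal_in C q" and idp1: "ideal_in C p1" using q p1 prime_inD(1) by blast+
  have pa': "minimal_prime_over C (adjoin C q a) p"
    using p adjoin_least[of _ q a] prime_inD(1) adjoin_superset[of q a] adjoin_self[OF idq, of a]
    unfolding minimal_prime_over_def by (meson insert_subset subset_trans subsetD)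
  have "a \<notin> p1" using p(3)[OF p1] strict by blast
  obtain y where y: "y \<in> p1" "y \<notin> q" using strict by blast
  have yC: "y \<in> C" using y ideal_inD(1)[OF idp1] by blast
  define Y where "Y m = saturation C p1 (adjoin C q (y ^ m))" for m
  have satY1: "saturated C p1 (Y m)" for m
    unfolding Y_def using saturated_saturation[OF p1 ideal_adjoin[OF idq]] yC by blast
  then have satY: "saturated C p (Y m)" for m using saturated_anti strict by blast
  have idY: "ideal_in C (Y m)" for m using satY saturatedD(1) by blast
  have sup: "adjoin C q (y ^ m) \<subseteq> Y m" for m
    unfolding Y_def
    using saturation_superset[OF p1] ideal_inD(1)[OF ideal_adjoin[OF idq]] yC by blast
  have powY: "y ^ m \<in> Y m" for m using sup adjoin_self[OF idq] by blast
  have qY: "q \<subseteq> Y m" for m using sup adjoin_superset by blast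
  have decY: "Y (Suc m) \<subseteq> Y m" for m
  proof -
    have "adjoin C q (y ^ Suc m) \<subseteq> Y m"
      using ideal_inD(4)[OF idY yC powY] by (intro adjoin_least idY qY) simp
    then show ?thesis unfolding Y_def[of "Suc m"] by (rule saturation_least[OF satY1])
  qed
  define I where "I m = saturation C p (adjoin C (Y m) a)" for m
  have "\<exists>m. \<forall>i\<ge>m. I i = I m"
  proof (rule descending_chain_condition[OF ideal_adjoin[OF idq a] pa'])
    fix i
    show "saturated C p (I i)" unfolding I_def by (rule saturated_saturation[OF p(1) ideal_adjoin[OF idY a]])
    have "adjoin C (Y i) a \<subseteq> I i"
      unfolding I_def using saturation_superset[OF p(1)] ideal_inD(1)[OF ideal_adjoin[OF idY a]] by blast
    then show "adjoin C q a \<subseteq> I i" using adjoin_mono[OF qY] by blast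
    show "I (Suc i) \<subseteq> I i" unfolding I_def by (intro saturation_mono adjoin_mono decY)
  qed
  then obtain m where m: "I (Suc m) = I m" by (metis le_SucI order_refl)
  have "Y m \<subseteq> Y (Suc m)"
  proof (rule nakayama[OF p(1) satY])
    show "a \<in> p" using p(2) by blast
    show "Y m \<subseteq> C" using ideal_inD(1)[OF idY] .
    fix z assume z: "z \<in> Y m"
    have "z \<in> adjoin C (Y m) a" using z adjoin_superset[of "Y m" a] by blast
    then have "z \<in> I m"
      unfolding I_def
      using saturation_superset[OF p(1) ideal_inD(1)[OF ideal_adjoin[OF idY a]]] by blast
    then have "z \<in> I (Suc m)" using m by simp
    then obtain r n c where *: "r \<in> C - p" "n \<in> Y (Suc m)" "c \<in> C" "r * z = n + c * a"
      by (auto simp: I_def saturation_def adjoin_def)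
    have "a * c = r * z - n" using *(4) by (simp add: algebra_simps)
    also have "\<dots> \<in> Y m" using * z decY by (intro ideal_minus[OF idY] ideal_inD(4)[OF idY]) auto
    finally have "c \<in> Y m" using saturatedD(2)[OF satY1 a \<open>a \<notin> p1\<close> *(3)] by blast
    then show "\<exists>r\<in>C - p. \<exists>n\<in>Y (Suc m). \<exists>m'\<in>Y m. r * z = n + a * m'"
      using * by (metis mult.commute)
  qed
  then have "y ^ m \<in> Y (Suc m)" using powY by blast
  then obtain s x b where s: "s \<in> C - p1" "x \<in> q" "b \<in> C" "s * y ^ m = x + b * y ^ Suc m"
    by (auto simp: Y_def saturation_def adjoin_def)
  then have "(s - b * y) * y ^ m = x" by (simp add: algebra_simps)
  then have "(s - b * y) * y ^ m \<in> q" using s by simp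
  then have "s - b * y \<in> q \<or> y ^ m \<in> q" using s yC by (intro prime_inD(3)[OF q]) auto
  then have "s - b * y \<in> p1" using prime_power[OF q yC] y strict by blast
  then have "s \<in> p1"
    using ideal_inD(3)[OF idp1, of "s - b * y" "b * y"] ideal_inD(4)[OF idp1, of b y] y s by auto
  with s show False by blast
qed

text \<open>Replace the last step of the chain by a prime \<open>p1\<close> immediately below \<open>p\<close> and choose a generator \<open>a\<close>
  outside \<open>p1\<close>.  Then \<open>p\<close> is minimal over \<open>p1 + (a)\<close>, so suitable multiples of powers of the other
  generators are congruent modulo \<open>a\<close> to elements of \<open>p1\<close>.  By the principal ideal theorem \<open>p1\<close> is
  minimal over these elements, which are one fewer than the original generators.\<close>

theorem krull_height_theorem:
  assumes "finite E" "E \<subseteq> C" "J \<subseteq> C" "minimal_prime_over C (J \<union> E) p"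
    and "chain_in C k f" "f k = p" "J \<subseteq> f 0"
  shows "k \<le> card E"
proof -
  have "k \<le> h" if "finite E" "E \<subseteq> C" "card E \<le> h" "minimal_prime_over C (J \<union> E) p"
    "chain_in C k f" "f k = p" "J \<subseteq> f 0" for h E p k f
    using that
  proof (induction h arbitrary: E p k f)
    case 0
    show ?case
    proof (rule ccontr)
      assume "\<not> k \<le> 0"
      note mono = chain_in_mono[OF 0(5)]
      have "f 0 = p"
        using 0 mono[of 0 k] by (intro minimal_prime_overD(3)[OF 0(4)]) (auto simp: chain_in_def)
      moreover have "f 0 \<subset> f 1" "f 1 \<subseteq> p"
        using 0 mono[of 1 k] \<open>\<not> k \<le> 0\<close> by (auto simp: chain_in_def)
      ultimately show False by blast
    qed
  next
    case (Suc h)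
    note p = minimal_prime_overD[OF Suc.prems(4)]
    show ?case
    proof (cases k)
      case (Suc k')
      note mono = chain_in_mono[OF Suc.prems(5)]
      let ?F = "{q. prime_in C q \<and> f k' \<subseteq> q \<and> q \<subset> p}"
      have "f k' \<in> ?F" using Suc.prems(5,6) Suc by (auto simp: chain_in_def)
      then have "?F \<noteq> {}" by blast
      then obtain p1 where p1: "p1 \<in> ?F" and max: "\<And>q. q \<in> ?F \<Longrightarrow> p1 \<subseteq> q \<Longrightarrow> q = p1"
        by (rule maximal_ideal_in_family) (auto dest: prime_inD)
      have pr1: "prime_in C p1" and id1: "ideal_in C p1" using p1 prime_inD(1) by auto
      have Jp1: "J \<subseteq> p1" using Suc.prems(7) mono[of 0 k'] p1 Suc by auto
      have "\<not> J \<union> E \<subseteq> p1" using p(3)[OF pr1] p1 by blast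
      then obtain a where a: "a \<in> E" "a \<notin> p1" using Jp1 by blast
      have aC: "a \<in> C" using a Suc.prems by blast
      have pa: "minimal_prime_over C (adjoin C p1 a) p"
        unfolding minimal_prime_over_def
      proof (intro conjI allI impI)
        show "prime_in C p" by fact
        show "adjoin C p1 a \<subseteq> p"
          using p p1 a by (intro adjoin_least prime_inD(1)) auto
        fix Q assume Q: "prime_in C Q" "adjoin C p1 a \<subseteq> Q" "Q \<subseteq> p"
        have "p1 \<subseteq> Q" "a \<in> Q" using Q adjoin_superset[of p1 a] adjoin_self[OF id1, of a] by blast+
        then show "Q = p" using max[of Q] Q p1 a by blast
      qed
      have "\<forall>x\<in>E - {a}. \<exists>c\<in>p1. \<exists>s u r. x ^ s * u = c + r * a \<and> u \<in> C \<and> u \<notin> p \<and> r \<in> C"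
      proof
        fix x assume "x \<in> E - {a}"
        then have "x \<in> p" using p by blast
        then obtain s u where "u \<in> C" "u \<notin> p" "x ^ s * u \<in> adjoin C p1 a"
          using minimal_prime_locally_nilpotent[OF ideal_adjoin[OF id1 aC] pa] by blast
        then show "\<exists>c\<in>p1. \<exists>s u r. x ^ s * u = c + r * a \<and> u \<in> C \<and> u \<notin> p \<and> r \<in> C"
          unfolding adjoin_def by blast
      qed
      then obtain c where c: "\<And>x. x \<in> E - {a} \<Longrightarrow> c x \<in> p1 \<and>
          (\<exists>s u r. x ^ s * u = c x + r * a \<and> u \<in> C \<and> u \<notin> p \<and> r \<in> C)" by metis
      let ?E = "c ` (E - {a})"
      have "k' \<le> h"
      proof (rule Suc.IH)
        show "finite ?E" using Suc.prems by simp
        show "?E \<subseteq> C" using c ideal_inD(1)[OF id1] by blast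
        have "card ?E \<le> card (E - {a})" using Suc.prems by (intro card_image_le) simp
        also have "\<dots> \<le> h" using Suc.prems a by (simp add: card_Diff_singleton)
        finally show "card ?E \<le> h" .
        show "chain_in C k' (f(k' := p1))"
          unfolding chain_in_def
        proof (intro conjI allI impI)
          fix i assume "i \<le> k'"
          then show "prime_in C ((f(k' := p1)) i)"
            using Suc.prems(5) pr1 Suc by (auto simp: chain_in_def)
        next
          fix i assume i: "i < k'"
          then have "f i \<subset> f (Suc i)" using Suc.prems(5) Suc by (auto simp: chain_in_def)
          moreover have "Suc i = k' \<Longrightarrow> f (Suc i) \<subseteq> p1" using p1 by auto
          ultimately show "(f(k' := p1)) i \<subset> (f(k' := p1)) (Suc i)" using i by auto
        qed
        show "(f(k' := p1)) k' = p1" by simp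
        show "J \<subseteq> (f(k' := p1)) 0" using Jp1 Suc.prems by simp
        show "minimal_prime_over C (J \<union> ?E) p1"
          unfolding minimal_prime_over_def
        proof (intro conjI allI impI)
          show "prime_in C p1" by fact
          show "J \<union> ?E \<subseteq> p1" using Jp1 c by blast
          fix Q assume Q: "prime_in C Q" "J \<union> ?E \<subseteq> Q" "Q \<subseteq> p1"
          show "Q = p1"
          proof (rule ccontr)
            assume "Q \<noteq> p1"
            have "minimal_prime_over C (insert a Q) p"
              unfolding minimal_prime_over_def
            proof (intro conjI allI impI)
              show "prime_in C p" by fact
              show "insert a Q \<subseteq> p" using Q p1 a p by blast
              fix R assume R: "prime_in C R" "insert a Q \<subseteq> R" "R \<subseteq> p"
              have "x \<in> R" if x: "x \<in> E" for x
              proof (cases "x = a")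
                case False
                then obtain s u r where su: "x ^ s * u = c x + r * a" "u \<in> C" "u \<notin> p" "r \<in> C"
                  using c x by blast
                have "c x \<in> R" "a \<in> R" using R(2) Q(2) x False by auto
                then have "c x + r * a \<in> R"
                  using su ideal_inD(3,4)[OF prime_inD(1)[OF R(1)]] by auto
                then have "x ^ s * u \<in> R" using su by simp
                moreover have "x \<in> C" using x Suc.prems by blast
                ultimately have "x ^ s \<in> R" using prime_inD(3)[OF R(1)] su R by blast
                then show ?thesis using prime_power[OF R(1) \<open>x \<in> C\<close>] by blast
              qed (use R in blast)
              then show "R = p" using p(3)[OF R(1)] R Q by blast
            qed
            then show False
              using krull_principal_ideal_theorem[OF Q(1) pr1 aC] \<open>Q \<noteq> p1\<close> Q p1 by blast
          qed
        qed
      qed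
      then show ?thesis using Suc by simp
    qed simp
  qed
  then show ?thesis using assms by blast
qed

text \<open>The converse of the height theorem: an element of \<open>p\<close> that avoids the finitely many relevant primes
  over \<open>J\<close> cuts the length of all chains below \<open>p\<close> by one.\<close>

lemma minimal_over_height_many_elements:
  assumes "J \<subseteq> C" "prime_in C p" "J \<subseteq> p"
    and "\<And>k f. chain_in C k f \<Longrightarrow> f k = p \<Longrightarrow> J \<subseteq> f 0 \<Longrightarrow> k \<le> h"
  shows "\<exists>E. finite E \<and> E \<subseteq> p \<and> card E \<le> h \<and> minimal_prime_over C (J \<union> E) p"
  using assms
proof (induction h arbitrary: J)
  case 0
  have "Q = p" if Q: "prime_in C Q" "J \<subseteq> Q" "Q \<subseteq> p" for Q
  proof (rule ccontr)
    assume "Q \<noteq> p"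
    then have "chain_in C 1 (\<lambda>i. if i = 0 then Q else p)"
      using Q 0 by (auto simp: chain_in_def)
    from 0(4)[OF this] Q show False by simp
  qed
  then have "minimal_prime_over C J p" using 0 by (auto simp: minimal_prime_over_def)
  then show ?case by (intro exI[of _ "{}"]) auto
next
  case (Suc h)
  obtain F where F: "finite F" "\<And>q. q \<in> F \<Longrightarrow> prime_in C q \<and> generated_ideal C J \<subseteq> q"
    "\<And>Q. prime_in C Q \<Longrightarrow> generated_ideal C J \<subseteq> Q \<Longrightarrow> \<exists>q\<in>F. q \<subseteq> Q"
    using finitely_many_primes_suffice[OF generated_ideal_ideal[OF Suc.prems(1)]] by metis
  have "\<exists>a\<in>p. \<forall>q\<in>{q \<in> F. \<not> p \<subseteq> q}. a \<notin> q"
    using F Suc.prems(2) by (intro prime_avoidance) (auto dest: prime_inD)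
  then obtain a where a: "a \<in> p" "\<And>q. q \<in> F \<Longrightarrow> \<not> p \<subseteq> q \<Longrightarrow> a \<notin> q" by blast
  have pC: "p \<subseteq> C" using Suc.prems(2) ideal_inD(1) prime_inD(1) by blast
  have "\<exists>E. finite E \<and> E \<subseteq> p \<and> card E \<le> h \<and> minimal_prime_over C (insert a J \<union> E) p"
  proof (rule Suc.IH)
    show "insert a J \<subseteq> C" "prime_in C p" "insert a J \<subseteq> p" using a pC Suc.prems by auto
    fix k f assume f: "chain_in C k f" "f k = p" "insert a J \<subseteq> f 0"
    have mono: "f 0 \<subseteq> f j" if "j \<le> k" for j
      using chain_in_mono[OF f(1) _ that] by simp
    have f0: "prime_in C (f 0)" using f by (auto simp: chain_in_def)
    then have "generated_ideal C J \<subseteq> f 0" using f by (intro generated_ideal_least prime_inD(1)) auto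
    then obtain q where q: "q \<in> F" "q \<subseteq> f 0" using F f0 by blast
    show "k \<le> h"
    proof (cases "p \<subseteq> q")
      case True
      then have "f 0 = f k" using q f mono[of k] by blast
      have "k = 0"
      proof (rule ccontr)
        assume "k \<noteq> 0"
        then obtain k' where k': "k = Suc k'" by (cases k) auto
        then have "f k' \<subset> f k" "f 0 \<subseteq> f k'" using f(1) mono[of k'] by (auto simp: chain_in_def)
        then show False using \<open>f 0 = f k\<close> by blast
      qed
      then show ?thesis by simp
    next
      case False
      then have strict: "q \<subset> f 0" using a(2)[OF q(1)] q f by blast
      have "chain_in C (Suc k) (\<lambda>i. case i of 0 \<Rightarrow> q | Suc j \<Rightarrow> f j)"
        using f(1) strict F(2)[OF q(1)] by (auto simp: chain_in_def split: nat.splits)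
      moreover have "J \<subseteq> q"
        using F(2)[OF q(1)] generated_ideal_superset[OF Suc.prems(1)] by blast
      ultimately have "Suc k \<le> Suc h" using Suc.prems(4)[of "Suc k"] f by auto
      then show ?thesis by simp
    qed
  qed
  then obtain E where "finite E" "E \<subseteq> p" "card E \<le> h" "minimal_prime_over C (J \<union> insert a E) p"
    by auto
  then show ?case
    using a by (intro exI[of _ "insert a E"]) (auto simp: card_insert_if)
qed

end


section \<open>The graphs as invariants of the poset of primes\<close>

definition strict_chain :: "'a set set \<Rightarrow> nat \<Rightarrow> (nat \<Rightarrow> 'a set) \<Rightarrow> bool" where
  "strict_chain Z k f \<longleftrightarrow> (\<forall>i\<le>k. f i \<in> Z) \<and> (\<forall>i<k. f i \<subset> f (Suc i))"

definition minimal_members :: "'a set set \<Rightarrow> 'a set set" where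
  "minimal_members Z = {P \<in> Z. \<forall>Q\<in>Z. Q \<subseteq> P \<longrightarrow> Q = P}"

text \<open>The condition that the height of \<open>P + Q\<close> is at most \<open>t\<close>: a prime contains \<open>P + Q\<close> if and only if it
  contains \<open>P\<close> and \<open>Q\<close>, and heights are lengths of chains.  Thus the graphs can be read off from the
  inclusion order of the primes alone.\<close>

definition joined :: "nat \<Rightarrow> 'a set set \<Rightarrow> 'a set \<Rightarrow> 'a set \<Rightarrow> bool" where
  "joined t Z P Q \<longleftrightarrow> (\<exists>p\<in>Z. P \<subseteq> p \<and> Q \<subseteq> p \<and> (\<forall>k f. strict_chain Z k f \<longrightarrow> f k = p \<longrightarrow> k \<le> t))"

definition poset_graph :: "nat \<Rightarrow> 'a set set \<Rightarrow> 'a set set \<times> 'a set set set" where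
  "poset_graph t Z = (minimal_members Z,
     {{P, Q} | P Q. P \<in> minimal_members Z \<and> Q \<in> minimal_members Z \<and> P \<noteq> Q \<and> joined t Z P Q})"

definition primes_over :: "'a::comm_ring_1 set \<Rightarrow> 'a set \<Rightarrow> 'a set set" where
  "primes_over C J = {P. prime_in C P \<and> J \<subseteq> P}"

lemma joined_sym: "joined t Z P Q \<Longrightarrow> joined t Z Q P"
  by (auto simp: joined_def)

lemma prime_height_le_iff:
  "prime_height R p \<le> enat t \<longleftrightarrow> (\<forall>k f. prime_chain R k f \<longrightarrow> f k = p \<longrightarrow> k \<le> t)"
  unfolding prime_height_def Sup_le_iff by (auto simp: Ball_def) (metis enat_ord_simps(1))

lemma Inf_enat_le_iff: "Inf A \<le> enat t \<longleftrightarrow> (\<exists>x\<in>A. x \<le> enat t)" for A :: "enat set"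
proof
  assume *: "Inf A \<le> enat t"
  show "\<exists>x\<in>A. x \<le> enat t"
  proof (cases "A = {}")
    case True
    then show ?thesis using * by (simp add: top_enat_def)
  next
    case False
    then have "Inf A \<in> A" unfolding Inf_enat_def by (auto intro: LeastI)
    then show ?thesis using * by blast
  qed
next
  assume "\<exists>x\<in>A. x \<le> enat t"
  then show "Inf A \<le> enat t" by (meson Inf_lower order_trans)
qed

lemma set_add_subset_iff:
  assumes "cring R" "ideal P R" "ideal Q R" "ideal p R"
  shows "P <+>\<^bsub>R\<^esub> Q \<subseteq> p \<longleftrightarrow> P \<subseteq> p \<and> Q \<subseteq> p"
proof -
  interpret cring R by fact
  interpret P: ideal P R by fact
  interpret Q: ideal Q R by fact
  interpret p: ideal p R by fact
  show ?thesis
  proof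
    assume *: "P <+>\<^bsub>R\<^esub> Q \<subseteq> p"
    have "x \<in> p" if "x \<in> P" for x
    proof -
      have "x \<oplus>\<^bsub>R\<^esub> \<zero>\<^bsub>R\<^esub> \<in> P <+>\<^bsub>R\<^esub> Q" unfolding set_add_def' using that Q.zero_closed by blast
      moreover have "x \<in> carrier R" using that P.Icarr by blast
      ultimately show ?thesis using * by auto
    qed
    moreover have "x \<in> p" if "x \<in> Q" for x
    proof -
      have "\<zero>\<^bsub>R\<^esub> \<oplus>\<^bsub>R\<^esub> x \<in> P <+>\<^bsub>R\<^esub> Q" unfolding set_add_def' using that P.zero_closed by blast
      moreover have "x \<in> carrier R" using that Q.Icarr by blast
      ultimately show ?thesis using * by auto
    qed
    ultimately show "P \<subseteq> p \<and> Q \<subseteq> p" by blast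
  next
    assume "P \<subseteq> p \<and> Q \<subseteq> p"
    then show "P <+>\<^bsub>R\<^esub> Q \<subseteq> p" unfolding set_add_def' by (auto intro!: p.a_closed)
  qed
qed

lemma Gamma_eq_poset_graph:
  assumes "cring R"
  shows "Gamma t R = poset_graph t {P. primeideal P R}"
proof -
  let ?Z = "{P. primeideal P R}"
  have chain: "prime_chain R k f \<longleftrightarrow> strict_chain ?Z k f" for k f
    by (simp add: prime_chain_def strict_chain_def)
  have min: "minimal_primes R = minimal_members ?Z"
    by (auto simp: minimal_primes_def minimal_members_def)
  have "height R (P <+>\<^bsub>R\<^esub> Q) \<le> enat t \<longleftrightarrow> joined t ?Z P Q" if "P \<in> ?Z" "Q \<in> ?Z" for P Q
  proof -
    have id: "ideal P R" "ideal Q R" using that by (auto intro: primeideal.axioms)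
    have "height R (P <+>\<^bsub>R\<^esub> Q) \<le> enat t \<longleftrightarrow>
        (\<exists>p. primeideal p R \<and> P <+>\<^bsub>R\<^esub> Q \<subseteq> p \<and> prime_height R p \<le> enat t)"
      unfolding height_def Inf_enat_le_iff by blast
    also have "\<dots> \<longleftrightarrow> joined t ?Z P Q"
      unfolding joined_def prime_height_le_iff chain
      using set_add_subset_iff[OF assms id] primeideal.axioms(1) by (metis mem_Collect_eq)
    finally show ?thesis .
  qed
  then have "P \<in> minimal_members ?Z \<and> Q \<in> minimal_members ?Z \<and> P \<noteq> Q \<and> height R (P <+>\<^bsub>R\<^esub> Q) \<le> enat t
    \<longleftrightarrow> P \<in> minimal_members ?Z \<and> Q \<in> minimal_members ?Z \<and> P \<noteq> Q \<and> joined t ?Z P Q" for P Q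
    unfolding minimal_members_def by blast
  then show ?thesis unfolding Gamma_def poset_graph_def min by simp
qed

lemma num_components_isomorphic:
  assumes bij: "bij_betw \<sigma> (fst G) (fst H)"
    and G: "\<And>u v. {u, v} \<in> snd G \<Longrightarrow> u \<in> fst G" and H: "\<And>u v. {u, v} \<in> snd H \<Longrightarrow> u \<in> fst H"
    and edges: "\<And>u v. u \<in> fst G \<Longrightarrow> v \<in> fst G \<Longrightarrow> {u, v} \<in> snd G \<longleftrightarrow> {\<sigma> u, \<sigma> v} \<in> snd H"
  shows "num_components G = num_components H"
proof -
  let ?rG = "{(u, v). u \<in> fst G \<and> v \<in> fst G \<and> (u, v) \<in> {(x, y). {x, y} \<in> snd G}\<^sup>*}"
  let ?rH = "{(u, v). u \<in> fst H \<and> v \<in> fst H \<and> (u, v) \<in> {(x, y). {x, y} \<in> snd H}\<^sup>*}"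
  define \<rho> where "\<rho> = inv_into (fst G) \<sigma>"
  have \<sigma>: "\<sigma> u \<in> fst H" if "u \<in> fst G" for u using bij that by (auto simp: bij_betw_def)
  have \<rho>: "\<rho> w \<in> fst G" "\<sigma> (\<rho> w) = w" if "w \<in> fst H" for w
    using bij_betw_inv_into_right[OF bij that] bij_betwE[OF bij_betw_inv_into[OF bij]] that
    by (auto simp: \<rho>_def)
  have \<rho>\<sigma>: "\<rho> (\<sigma> u) = u" if "u \<in> fst G" for u
    using bij_betw_inv_into_left[OF bij that] by (simp add: \<rho>_def)
  have to: "(\<sigma> u, \<sigma> v) \<in> {(x, y). {x, y} \<in> snd H}\<^sup>*" if "(u, v) \<in> {(x, y). {x, y} \<in> snd G}\<^sup>*" for u v
    using that
  proof induction
    case (step y z)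
    then have "{y, z} \<in> snd G" by simp
    then have "{\<sigma> y, \<sigma> z} \<in> snd H" using edges G[of y z] G[of z y] by (simp add: insert_commute)
    then show ?case using step by (simp add: rtrancl_into_rtrancl)
  qed simp
  have from_: "(\<rho> u, \<rho> v) \<in> {(x, y). {x, y} \<in> snd G}\<^sup>*" if "(u, v) \<in> {(x, y). {x, y} \<in> snd H}\<^sup>*" for u v
    using that
  proof induction
    case (step y z)
    then have "{y, z} \<in> snd H" by simp
    then have "{\<rho> y, \<rho> z} \<in> snd G" using edges[of "\<rho> y" "\<rho> z"] \<rho> H[of y z] H[of z y] by (simp add: insert_commute)
    then show ?case using step by (simp add: rtrancl_into_rtrancl)
  qed simp
  have cls: "\<sigma> ` (?rG `` {u}) = ?rH `` {\<sigma> u}" if u: "u \<in> fst G" for u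
  proof
    show "\<sigma> ` (?rG `` {u}) \<subseteq> ?rH `` {\<sigma> u}" using to \<sigma> u by auto
    show "?rH `` {\<sigma> u} \<subseteq> \<sigma> ` (?rG `` {u})"
    proof
      fix w assume "w \<in> ?rH `` {\<sigma> u}"
      then have w: "w \<in> fst H" "(\<sigma> u, w) \<in> {(x, y). {x, y} \<in> snd H}\<^sup>*" by auto
      then have "(u, \<rho> w) \<in> {(x, y). {x, y} \<in> snd G}\<^sup>*" using from_[OF w(2)] \<rho>\<sigma>[OF u] by simp
      then have "\<rho> w \<in> ?rG `` {u}" using u \<rho> w by auto
      then have "\<sigma> (\<rho> w) \<in> \<sigma> ` (?rG `` {u})" by (rule imageI)
      then show "w \<in> \<sigma> ` (?rG `` {u})" unfolding \<rho>(2)[OF w(1)] .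
    qed
  qed
  have "connected_components H = (`) \<sigma> ` connected_components G"
  proof -
    have "connected_components H = (\<lambda>u. ?rH `` {u}) ` (\<sigma> ` fst G)"
      using bij by (auto simp: connected_components_def quotient_def bij_betw_def)
    also have "\<dots> = (\<lambda>u. \<sigma> ` (?rG `` {u})) ` fst G" unfolding image_image using cls by auto
    also have "\<dots> = (`) \<sigma> ` connected_components G"
      by (auto simp: connected_components_def quotient_def)
    finally show ?thesis .
  qed
  moreover have "inj_on ((`) \<sigma>) (connected_components G)"
  proof (rule inj_on_subset[OF inj_on_image_Pow])
    show "inj_on \<sigma> (fst G)" using bij by (simp add: bij_betw_def)
    show "connected_components G \<subseteq> Pow (fst G)"
      by (auto simp: connected_components_def quotient_def)
  qed
  ultimately show ?thesis unfolding num_components_def by (simp add: card_image)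
qed

lemma poset_graph_edge_iff:
  "{P, Q} \<in> snd (poset_graph t Z) \<longleftrightarrow>
    P \<in> minimal_members Z \<and> Q \<in> minimal_members Z \<and> P \<noteq> Q \<and> joined t Z P Q"
  unfolding poset_graph_def by (auto simp: doubleton_eq_iff intro: joined_sym)

lemma num_components_poset_graph:
  assumes bij: "bij_betw \<sigma> (minimal_members Z) (minimal_members W)"
    and joined: "\<And>P Q. P \<in> minimal_members Z \<Longrightarrow> Q \<in> minimal_members Z \<Longrightarrow>
      joined t Z P Q \<longleftrightarrow> joined t W (\<sigma> P) (\<sigma> Q)"
  shows "num_components (poset_graph t Z) = num_components (poset_graph t W)"
proof (rule num_components_isomorphic)
  show "bij_betw \<sigma> (fst (poset_graph t Z)) (fst (poset_graph t W))"
    using bij by (simp add: poset_graph_def)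
  have inj: "\<sigma> P = \<sigma> Q \<longleftrightarrow> P = Q" if "P \<in> minimal_members Z" "Q \<in> minimal_members Z" for P Q
    using bij that by (auto simp: bij_betw_def inj_on_def)
  fix P Q assume *: "P \<in> fst (poset_graph t Z)" "Q \<in> fst (poset_graph t Z)"
  then have "P \<in> minimal_members Z" "Q \<in> minimal_members Z" by (auto simp: poset_graph_def)
  moreover from this have "\<sigma> P \<in> minimal_members W" "\<sigma> Q \<in> minimal_members W"
    using bij by (auto simp: bij_betw_def)
  ultimately show "{P, Q} \<in> snd (poset_graph t Z) \<longleftrightarrow> {\<sigma> P, \<sigma> Q} \<in> snd (poset_graph t W)"
    unfolding poset_graph_edge_iff using joined inj by simp
qed (simp_all only: poset_graph_edge_iff, simp_all add: poset_graph_def)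

lemma strict_chain_image:
  assumes "strict_chain Z k f" "\<And>P. P \<in> Z \<Longrightarrow> \<sigma> P \<in> W" "\<And>P Q. P \<in> Z \<Longrightarrow> Q \<in> Z \<Longrightarrow> P \<subset> Q \<Longrightarrow> \<sigma> P \<subset> \<sigma> Q"
  shows "strict_chain W k (\<lambda>i. \<sigma> (f i))"
  unfolding strict_chain_def
proof (intro conjI allI impI)
  fix i assume "i < k"
  then have "f i \<in> Z" "f (Suc i) \<in> Z" "f i \<subset> f (Suc i)" using assms(1) by (auto simp: strict_chain_def)
  then show "\<sigma> (f i) \<subset> \<sigma> (f (Suc i))" by (rule assms(3))
qed (use assms in \<open>auto simp: strict_chain_def\<close>)

lemma num_components_poset_isomorphic:
  assumes bij: "bij_betw \<sigma> Z W" and mono: "\<And>P Q. P \<in> Z \<Longrightarrow> Q \<in> Z \<Longrightarrow> P \<subseteq> Q \<longleftrightarrow> \<sigma> P \<subseteq> \<sigma> Q"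
  shows "num_components (poset_graph t Z) = num_components (poset_graph t W)"
proof (rule num_components_poset_graph)
  define \<rho> where "\<rho> = inv_into Z \<sigma>"
  have \<sigma>: "\<sigma> P \<in> W" if "P \<in> Z" for P using bij that by (auto simp: bij_betw_def)
  have \<rho>: "\<rho> w \<in> Z" "\<sigma> (\<rho> w) = w" if "w \<in> W" for w
    using bij_betw_inv_into_right[OF bij that] bij_betwE[OF bij_betw_inv_into[OF bij]] that
    by (auto simp: \<rho>_def)
  have \<rho>\<sigma>: "\<rho> (\<sigma> u) = u" if "u \<in> Z" for u
    using bij_betw_inv_into_left[OF bij that] by (simp add: \<rho>_def)
  have mono': "P \<subseteq> Q \<longleftrightarrow> \<rho> P \<subseteq> \<rho> Q" if "P \<in> W" "Q \<in> W" for P Q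
    using mono[of "\<rho> P" "\<rho> Q"] \<rho> that by simp
  have s\<sigma>: "\<sigma> P \<subset> \<sigma> Q" if "P \<in> Z" "Q \<in> Z" "P \<subset> Q" for P Q
    using mono[of P Q] mono[of Q P] that by auto
  have s\<rho>: "\<rho> P \<subset> \<rho> Q" if "P \<in> W" "Q \<in> W" "P \<subset> Q" for P Q
    using mono'[of P Q] mono'[of Q P] that by auto
  have min: "\<sigma> P \<in> minimal_members W" if "P \<in> minimal_members Z" for P
    unfolding minimal_members_def
  proof (intro CollectI conjI ballI impI)
    have P: "P \<in> Z" "\<And>Q. Q \<in> Z \<Longrightarrow> Q \<subseteq> P \<Longrightarrow> Q = P" using that by (auto simp: minimal_members_def)
    show "\<sigma> P \<in> W" using \<sigma>[OF P(1)] .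
    fix Q assume "Q \<in> W" "Q \<subseteq> \<sigma> P"
    then have "\<rho> Q \<subseteq> P" using mono[OF \<rho>(1) P(1), of Q] \<rho>(2)[of Q] by simp
    then show "Q = \<sigma> P" using P(2)[OF \<rho>(1)] \<rho>(2) \<open>Q \<in> W\<close> by metis
  qed
  have min': "\<rho> P \<in> minimal_members Z" if "P \<in> minimal_members W" for P
    unfolding minimal_members_def
  proof (intro CollectI conjI ballI impI)
    have P: "P \<in> W" "\<And>Q. Q \<in> W \<Longrightarrow> Q \<subseteq> P \<Longrightarrow> Q = P" using that by (auto simp: minimal_members_def)
    show "\<rho> P \<in> Z" using \<rho>(1)[OF P(1)] .
    fix Q assume "Q \<in> Z" "Q \<subseteq> \<rho> P"
    then have "\<sigma> Q \<subseteq> P" using mono[OF _ \<rho>(1)[OF P(1)], of Q] \<rho>(2)[OF P(1)] by simp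
    then show "Q = \<rho> P" using P(2)[OF \<sigma>] \<rho>\<sigma> \<open>Q \<in> Z\<close> by metis
  qed
  show "bij_betw \<sigma> (minimal_members Z) (minimal_members W)"
  proof (rule bij_betw_byWitness[of _ \<rho>])
    have sub: "minimal_members Z \<subseteq> Z" "minimal_members W \<subseteq> W" by (auto simp: minimal_members_def)
    show "\<forall>P\<in>minimal_members Z. \<rho> (\<sigma> P) = P" using \<rho>\<sigma> sub by blast
    show "\<forall>P\<in>minimal_members W. \<sigma> (\<rho> P) = P" using \<rho>(2) sub by blast
    show "\<sigma> ` minimal_members Z \<subseteq> minimal_members W" using min by blast
    show "\<rho> ` minimal_members W \<subseteq> minimal_members Z" using min' by blast
  qed
  fix P Q assume PQ: "P \<in> minimal_members Z" "Q \<in> minimal_members Z"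
  then have Z: "P \<in> Z" "Q \<in> Z" by (auto simp: minimal_members_def)
  show "joined t Z P Q \<longleftrightarrow> joined t W (\<sigma> P) (\<sigma> Q)"
  proof
    assume "joined t Z P Q"
    then obtain p where p: "p \<in> Z" "P \<subseteq> p" "Q \<subseteq> p" "\<And>k f. strict_chain Z k f \<Longrightarrow> f k = p \<Longrightarrow> k \<le> t"
      by (auto simp: joined_def)
    show "joined t W (\<sigma> P) (\<sigma> Q)"
      unfolding joined_def
    proof (intro bexI[of _ "\<sigma> p"] conjI allI impI)
      show "\<sigma> P \<subseteq> \<sigma> p" "\<sigma> Q \<subseteq> \<sigma> p" "\<sigma> p \<in> W" using mono Z p \<sigma> by auto
      fix k f assume "strict_chain W k f" "f k = \<sigma> p"
      then show "k \<le> t"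
        using p(4)[of k "\<lambda>i. \<rho> (f i)"] strict_chain_image[of W k f \<rho> Z] \<rho> s\<rho> \<rho>\<sigma>[OF p(1)] by simp
    qed
  next
    assume "joined t W (\<sigma> P) (\<sigma> Q)"
    then obtain p where p: "p \<in> W" "\<sigma> P \<subseteq> p" "\<sigma> Q \<subseteq> p" "\<And>k f. strict_chain W k f \<Longrightarrow> f k = p \<Longrightarrow> k \<le> t"
      by (auto simp: joined_def)
    show "joined t Z P Q"
      unfolding joined_def
    proof (intro bexI[of _ "\<rho> p"] conjI allI impI)
      show "P \<subseteq> \<rho> p" "Q \<subseteq> \<rho> p" "\<rho> p \<in> Z" using mono[of _ "\<rho> p"] Z p \<rho> by auto
      fix k f assume "strict_chain Z k f" "f k = \<rho> p"
      then show "k \<le> t"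
        using p(4)[of k "\<lambda>i. \<sigma> (f i)"] strict_chain_image[of Z k f \<sigma> W] \<sigma> s\<sigma> \<rho>[OF p(1)] by simp
    qed
  qed
qed

subsection \<open>Primes of a homomorphic image\<close>

text \<open>The two rings of the theorem, and their quotients by primes, are all handled as homomorphic images of
  a polynomial ring \<open>C\<close>; their primes are then the primes of \<open>C\<close> above the kernel.\<close>

locale surjection_onto = subring_in C + cring R
  for C :: "'a::comm_ring_1 set" and R :: "('b, 'm) ring_scheme" (structure) +
  fixes h :: "'a \<Rightarrow> 'b"
  assumes surj: "h ` C = carrier R"
    and h_add: "a \<in> C \<Longrightarrow> b \<in> C \<Longrightarrow> h (a + b) = h a \<oplus>\<^bsub>R\<^esub> h b"
    and h_mult: "a \<in> C \<Longrightarrow> b \<in> C \<Longrightarrow> h (a * b) = h a \<otimes>\<^bsub>R\<^esub> h b"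
    and h_one: "h 1 = \<one>\<^bsub>R\<^esub>"
begin

definition ker :: "'a set" where "ker = {a \<in> C. h a = \<zero>\<^bsub>R\<^esub>}"

lemma h_closed: "a \<in> C \<Longrightarrow> h a \<in> carrier R"
  using surj by blast

lemma h_zero: "h 0 = \<zero>\<^bsub>R\<^esub>"
  using h_add[of 0 0] h_closed[of 0] by (simp add: add.r_cancel_one')

lemma h_uminus: "a \<in> C \<Longrightarrow> h (- a) = \<ominus>\<^bsub>R\<^esub> h a"
  using h_add[of a "- a"] h_closed h_zero by (intro minus_equality[symmetric]) (auto simp: a_comm)

lemma h_minus: "a \<in> C \<Longrightarrow> b \<in> C \<Longrightarrow> h (a - b) = h a \<ominus>\<^bsub>R\<^esub> h b"
  using h_add[of a "- b"] h_uminus[of b] by (simp add: a_minus_def)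

lemma h_eq: "a \<in> C \<Longrightarrow> b \<in> C \<Longrightarrow> h a = h b \<Longrightarrow> a - b \<in> ker"
  using h_minus[of a b] h_closed by (simp add: ker_def r_neg a_minus_def)

lemma image_mem_iff:
  assumes "ideal_in C P" "ker \<subseteq> P" "a \<in> C"
  shows "h a \<in> h ` P \<longleftrightarrow> a \<in> P"
proof
  assume "h a \<in> h ` P"
  then obtain b where b: "b \<in> P" "h a = h b" by blast
  then have "a - b \<in> P" using h_eq[of a b] assms ideal_inD(1) by blast
  then show "a \<in> P" using ideal_inD(3)[OF assms(1), of "a - b" b] b by simp
qed blast

lemma prime_image:
  assumes P: "prime_in C P" "ker \<subseteq> P"
  shows "primeideal (h ` P) R"
proof -
  note id = prime_inD(1)[OF P(1)]
  have sub: "P \<subseteq> C" using ideal_inD(1)[OF id] .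
  have ideal: "ideal (h ` P) R"
  proof (rule idealI)
    show "ring R" by (rule ring_axioms)
    show "subgroup (h ` P) (add_monoid R)"
    proof (rule add.subgroupI)
      show "h ` P \<subseteq> carrier R" using sub h_closed by blast
      show "h ` P \<noteq> {}" using ideal_inD(2)[OF id] by blast
      fix a assume "a \<in> h ` P"
      then obtain x where "x \<in> P" "a = h x" by blast
      then show "\<ominus>\<^bsub>R\<^esub> a \<in> h ` P" using h_uminus[of x] ideal_uminus[OF id] sub by (metis imageI subsetD)
    next
      fix a b assume "a \<in> h ` P" "b \<in> h ` P"
      then obtain x y where "x \<in> P" "a = h x" "y \<in> P" "b = h y" by blast
      then show "a \<oplus>\<^bsub>R\<^esub> b \<in> h ` P" using h_add[of x y] ideal_inD(3)[OF id] sub by (metis imageI subsetD)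
    qed
    fix a b assume "a \<in> h ` P" "b \<in> carrier R"
    then obtain x y where *: "x \<in> P" "a = h x" "y \<in> C" "b = h y" using surj by blast
    then show "b \<otimes>\<^bsub>R\<^esub> a \<in> h ` P" "a \<otimes>\<^bsub>R\<^esub> b \<in> h ` P"
      using h_mult[of y x] h_mult[of x y] ideal_inD(4,5)[OF id, of y x] sub by (metis imageI subsetD)+
  qed
  show ?thesis
  proof (rule primeidealI[OF ideal cring_axioms])
    show "carrier R \<noteq> h ` P"
      using image_mem_iff[OF id P(2) one_C] prime_inD(2)[OF P(1)] h_closed[OF one_C] by blast
    fix a b assume "a \<in> carrier R" "b \<in> carrier R" and ab: "a \<otimes>\<^bsub>R\<^esub> b \<in> h ` P"
    then obtain x y where *: "x \<in> C" "a = h x" "y \<in> C" "b = h y" using surj by blast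
    then have "x * y \<in> P" using ab h_mult[of x y] image_mem_iff[OF id P(2), of "x * y"] by simp
    then show "a \<in> h ` P \<or> b \<in> h ` P" using prime_inD(3)[OF P(1)] * by blast
  qed
qed

lemma prime_preimage:
  assumes "primeideal p R"
  shows "prime_in C {a \<in> C. h a \<in> p}" "ker \<subseteq> {a \<in> C. h a \<in> p}" "h ` {a \<in> C. h a \<in> p} = p"
proof -
  interpret p: primeideal p R by fact
  show "prime_in C {a \<in> C. h a \<in> p}"
    unfolding prime_in_def ideal_in_def
  proof (intro conjI ballI impI)
    show "1 \<notin> {a \<in> C. h a \<in> p}" using h_one p.one_imp_carrier p.I_notcarr by auto
    fix a b assume "a \<in> C" "b \<in> C" "a * b \<in> {a \<in> C. h a \<in> p}"
    then show "a \<in> {a \<in> C. h a \<in> p} \<or> b \<in> {a \<in> C. h a \<in> p}"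
      using h_mult p.I_prime h_closed by auto
  qed (auto simp: h_add h_mult h_zero h_closed p.I_l_closed intro: p.a_closed)
  show "ker \<subseteq> {a \<in> C. h a \<in> p}" by (auto simp: ker_def)
  show "h ` {a \<in> C. h a \<in> p} = p"
  proof
    show "p \<subseteq> h ` {a \<in> C. h a \<in> p}"
    proof
      fix x assume "x \<in> p"
      then have "x \<in> carrier R" using p.Icarr by blast
      then obtain a where "a \<in> C" "x = h a" unfolding surj[symmetric] by (rule imageE)
      then show "x \<in> h ` {a \<in> C. h a \<in> p}" using \<open>x \<in> p\<close> by simp
    qed
  qed auto
qed

lemma primes_bij: "bij_betw ((`) h) (primes_over C ker) {p. primeideal p R}"
proof (rule bij_betw_byWitness[of _ "\<lambda>p. {a \<in> C. h a \<in> p}"])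
  show "\<forall>P\<in>primes_over C ker. {a \<in> C. h a \<in> h ` P} = P"
  proof
    fix P assume "P \<in> primes_over C ker"
    then have P: "ideal_in C P" "ker \<subseteq> P" by (auto simp: primes_over_def prime_in_def)
    show "{a \<in> C. h a \<in> h ` P} = P" using image_mem_iff[OF P] ideal_inD(1)[OF P(1)] by blast
  qed
next
  show "\<forall>p\<in>{p. primeideal p R}. h ` {a \<in> C. h a \<in> p} = p" using prime_preimage(3) by simp
  show "(`) h ` primes_over C ker \<subseteq> {p. primeideal p R}"
    using prime_image by (auto simp: primes_over_def)
  show "(\<lambda>p. {a \<in> C. h a \<in> p}) ` {p. primeideal p R} \<subseteq> primes_over C ker"
    unfolding primes_over_def using prime_preimage(1,2) by blast
qed

lemma primes_mono:
  assumes "P \<in> primes_over C ker" "Q \<in> primes_over C ker"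
  shows "P \<subseteq> Q \<longleftrightarrow> h ` P \<subseteq> h ` Q"
proof
  assume *: "h ` P \<subseteq> h ` Q"
  have P: "ideal_in C P" and Q: "ideal_in C Q" "ker \<subseteq> Q"
    using assms by (auto simp: primes_over_def prime_in_def)
  show "P \<subseteq> Q" using * image_mem_iff[OF Q] ideal_inD(1)[OF P] by blast
qed blast

lemma num_components_Gamma:
  "num_components (Gamma t R) = num_components (poset_graph t (primes_over C ker))"
  unfolding Gamma_eq_poset_graph[OF cring_axioms]
  by (rule sym, rule num_components_poset_isomorphic[OF primes_bij primes_mono])

lemma prime_chain_iff_strict_chain:
  "(\<exists>f. prime_chain R k f) \<longleftrightarrow> (\<exists>f. strict_chain (primes_over C ker) k f)"
proof
  assume "\<exists>f. prime_chain R k f"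
  then obtain f where "strict_chain {p. primeideal p R} k f"
    by (auto simp: prime_chain_def strict_chain_def)
  then have "strict_chain (primes_over C ker) k (\<lambda>i. {a \<in> C. h a \<in> f i})"
  proof (rule strict_chain_image)
    show "{a \<in> C. h a \<in> P} \<subset> {a \<in> C. h a \<in> Q}"
      if *: "P \<in> {p. primeideal p R}" "Q \<in> {p. primeideal p R}" "P \<subset> Q" for P Q
    proof (rule psubsetI)
      show "{a \<in> C. h a \<in> P} \<subseteq> {a \<in> C. h a \<in> Q}" using *(3) by auto
      show "{a \<in> C. h a \<in> P} \<noteq> {a \<in> C. h a \<in> Q}"
        using *(3) prime_preimage(3)[of P] prime_preimage(3)[of Q] *(1,2) by (metis mem_Collect_eq psubset_eq)
    qed
    show "{a \<in> C. h a \<in> P} \<in> primes_over C ker" if "P \<in> {p. primeideal p R}" for P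
      unfolding primes_over_def using prime_preimage(1,2)[of P] that by simp
  qed
  then show "\<exists>f. strict_chain (primes_over C ker) k f" by blast
next
  assume "\<exists>f. strict_chain (primes_over C ker) k f"
  then obtain f where "strict_chain (primes_over C ker) k f" by blast
  then have "strict_chain {p. primeideal p R} k (\<lambda>i. h ` f i)"
  proof (rule strict_chain_image)
    show "h ` P \<in> {p. primeideal p R}" if "P \<in> primes_over C ker" for P
      using that prime_image by (auto simp: primes_over_def)
    show "h ` P \<subset> h ` Q" if "P \<in> primes_over C ker" "Q \<in> primes_over C ker" "P \<subset> Q" for P Q
      using primes_mono[OF that(1,2)] primes_mono[OF that(2,1)] that(3) by (metis psubset_eq subset_antisym subset_refl)
  qed
  then have "prime_chain R k (\<lambda>i. h ` f i)" by (auto simp: prime_chain_def strict_chain_def)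
  then show "\<exists>f. prime_chain R k f" by blast
qed

lemma krull_dim_eq: "krull_dim R = Sup {enat k | k f. strict_chain (primes_over C ker) k f}"
proof -
  have "{enat k | k f. prime_chain R k f} = {enat k | k f. strict_chain (primes_over C ker) k f}"
    using prime_chain_iff_strict_chain by auto
  then show ?thesis by (simp add: krull_dim_def)
qed

end


section \<open>Polynomials, leading monomials and the Noetherian property\<close>

abbreviation "supp \<equiv> Poly_Mapping.keys"
abbreviation "cf \<equiv> Poly_Mapping.lookup"
abbreviation "term_of \<equiv> Poly_Mapping.single"

definition mons :: "nat set \<Rightarrow> (nat \<Rightarrow>\<^sub>0 nat) set" where
  "mons A = {m. supp m \<subseteq> A}"

definition polys :: "nat set \<Rightarrow> ((nat \<Rightarrow>\<^sub>0 nat) \<Rightarrow>\<^sub>0 'k::field) set" where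
  "polys A = {p. supp p \<subseteq> mons A}"

lemma monomials_eq: "monomials n = mons {..<n}"
  by (simp add: monomials_def mons_def)

lemma keys_add_nat: "supp (u + v) = supp u \<union> supp (v :: nat \<Rightarrow>\<^sub>0 nat)"
  by (auto simp: in_keys_iff lookup_add)

lemma mons_add_iff: "u + v \<in> mons A \<longleftrightarrow> u \<in> mons A \<and> v \<in> mons A"
  by (auto simp: mons_def keys_add_nat)

lemma mons_add: "u \<in> mons A \<Longrightarrow> v \<in> mons A \<Longrightarrow> u + v \<in> mons A"
  by (simp add: mons_add_iff)

lemma zero_mons [simp, intro]: "0 \<in> mons A"
  by (simp add: mons_def)

lemma mons_mono: "A \<subseteq> B \<Longrightarrow> mons A \<subseteq> mons B"
  by (auto simp: mons_def)

lemma polys_mono: "A \<subseteq> B \<Longrightarrow> polys A \<subseteq> polys B"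
  unfolding polys_def using mons_mono by blast

lemma polysD: "p \<in> polys A \<Longrightarrow> m \<in> supp p \<Longrightarrow> m \<in> mons A"
  by (auto simp: polys_def)

lemma keys_mult_split: "m \<in> supp (p * q) \<Longrightarrow> \<exists>a\<in>supp p. \<exists>b\<in>supp q. m = a + b"
  using keys_mult[of p q] by blast

lemma subring_polys: "subring_in (polys A)"
proof
  show "0 \<in> polys A" "1 \<in> polys A" by (auto simp: polys_def)
  fix p q :: "(nat \<Rightarrow>\<^sub>0 nat) \<Rightarrow>\<^sub>0 'a" assume "p \<in> polys A" "q \<in> polys A"
  then show "p + q \<in> polys A" unfolding polys_def using Poly_Mapping.keys_add[of p q] by blast
  show "p * q \<in> polys A"
    using \<open>p \<in> polys A\<close> \<open>q \<in> polys A\<close> keys_mult_split[of _ p q] mons_add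
    unfolding polys_def by blast
next
  fix p :: "(nat \<Rightarrow>\<^sub>0 nat) \<Rightarrow>\<^sub>0 'a" assume "p \<in> polys A"
  then show "- p \<in> polys A" by (auto simp: polys_def in_keys_iff)
qed

interpretation polys: subring_in "polys A :: ((nat \<Rightarrow>\<^sub>0 nat) \<Rightarrow>\<^sub>0 'k::field) set" for A
  by (rule subring_polys)

lemma term_polys: "m \<in> mons A \<Longrightarrow> term_of m c \<in> polys A"
  by (auto simp: polys_def)

lemma poly_expand: "p = (\<Sum>m\<in>supp p. term_of m (cf p m))"
  by (rule poly_mapping_eqI) (simp add: lookup_sum lookup_single when_def in_keys_iff)

lemma cf_mult:
  fixes p q :: "(nat \<Rightarrow>\<^sub>0 nat) \<Rightarrow>\<^sub>0 'k::field"
  shows "cf (p * q) m = (\<Sum>a\<in>supp p. \<Sum>b\<in>supp q. if a + b = m then cf p a * cf q b else 0)"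
proof -
  have "p * q = (\<Sum>a\<in>supp p. \<Sum>b\<in>supp q. term_of (a + b) (cf p a * cf q b))"
    by (subst (1) poly_expand[of p], subst (1) poly_expand[of q]) (simp add: sum_product mult_single)
  then show ?thesis by (simp add: lookup_sum lookup_single when_def)
qed

lemma cf_term_mult: "cf (term_of m c * p) (m + u) = c * cf p u"
  for p :: "(nat \<Rightarrow>\<^sub>0 nat) \<Rightarrow>\<^sub>0 'k::field"
proof (cases "c = 0")
  case False
  then have "cf (term_of m c * p) (m + u) = (\<Sum>b\<in>supp p. if b = u then c * cf p b else 0)"
    unfolding cf_mult by simp
  also have "\<dots> = c * cf p u" by (simp add: in_keys_iff)
  finally show ?thesis .
qed simp

lemma supp_term_mult: "supp (term_of m c * p) \<subseteq> (+) m ` supp p"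
  for p :: "(nat \<Rightarrow>\<^sub>0 nat) \<Rightarrow>\<^sub>0 'k::field"
  using keys_mult_split[of _ "term_of m c" p] by (cases "c = 0") auto

lemma card_mons_box:
  assumes "finite B" and "\<And>i. i \<in> B \<Longrightarrow> finite (D i)"
  shows "finite {m \<in> mons B. \<forall>i\<in>B. cf m i \<in> D i} \<and> card {m \<in> mons B. \<forall>i\<in>B. cf m i \<in> D i} = (\<Prod>i\<in>B. card (D i))"
proof -
  let ?E = "{m \<in> mons B. \<forall>i\<in>B. cf m i \<in> D i}"
  have "bij_betw (\<lambda>m. restrict (cf m) B) ?E (PiE B D)"
  proof (rule bij_betwI[where g = "\<lambda>f. Abs_poly_mapping (\<lambda>i. if i \<in> B then f i else 0)"])
    have cfA: "cf (Abs_poly_mapping (\<lambda>i. if i \<in> B then f i else 0)) = (\<lambda>i. if i \<in> B then f i else 0)"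
      for f :: "nat \<Rightarrow> nat"
      by (rule lookup_Abs_poly_mapping, rule finite_subset[OF _ assms(1)]) auto
    show "(\<lambda>m. restrict (cf m) B) \<in> ?E \<rightarrow> PiE B D" by auto
    show "(\<lambda>f. Abs_poly_mapping (\<lambda>i. if i \<in> B then f i else 0)) \<in> PiE B D \<rightarrow> ?E"
      by (auto simp: cfA mons_def in_keys_iff split: if_splits)
    show "Abs_poly_mapping (\<lambda>i. if i \<in> B then restrict (cf m) B i else 0) = m" if "m \<in> ?E" for m
    proof (rule poly_mapping_eqI)
      fix i
      have "i \<notin> B \<Longrightarrow> cf m i = 0" using that by (auto simp: mons_def in_keys_iff)
      then show "cf (Abs_poly_mapping (\<lambda>i. if i \<in> B then restrict (cf m) B i else 0)) i = cf m i"
        unfolding cfA by auto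
    qed
    show "restrict (cf (Abs_poly_mapping (\<lambda>i. if i \<in> B then f i else 0))) B = f" if "f \<in> PiE B D" for f
      unfolding cfA using that by (auto simp: restrict_def PiE_def extensional_def fun_eq_iff)
  qed
  note bij = this
  have "finite (PiE B D)" by (rule finite_PiE[OF assms])
  then show ?thesis
    using card_PiE[OF assms(1), of D] bij_betw_same_card[OF bij] bij_betw_finite[OF bij] by simp
qed

lemma dickson_monotone_subsequence:
  fixes f :: "nat \<Rightarrow> nat \<Rightarrow> nat"
  shows "\<exists>r :: nat \<Rightarrow> nat. strict_mono r \<and> (\<forall>k<n. \<forall>i j. i \<le> j \<longrightarrow> f (r i) k \<le> f (r j) k)"
proof (induction n)
  case 0
  show ?case by (intro exI[of _ "\<lambda>i. i"]) (simp add: strict_mono_def)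
next
  case (Suc n)
  then obtain r :: "nat \<Rightarrow> nat" where r: "strict_mono r" "\<forall>k<n. \<forall>i j. i \<le> j \<longrightarrow> f (r i) k \<le> f (r j) k" by blast
  obtain s where s: "strict_mono s" "monoseq (\<lambda>i. f (r (s i)) n)"
    using seq_monosub[of "\<lambda>i. f (r i) n"] by blast
  obtain N where N: "\<forall>i j. N \<le> i \<longrightarrow> i \<le> j \<longrightarrow> f (r (s i)) n \<le> f (r (s j)) n"
  proof (cases "incseq (\<lambda>i. f (r (s i)) n)")
    case True
    then show ?thesis using that[of 0] by (simp add: incseq_def)
  next
    case False
    then have dec: "decseq (\<lambda>i. f (r (s i)) n)" using s(2) by (simp add: monoseq_iff)
    define v where "v = (LEAST v. v \<in> range (\<lambda>i. f (r (s i)) n))"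
    have "v \<in> range (\<lambda>i. f (r (s i)) n)" unfolding v_def by (rule LeastI_ex) blast
    then obtain N where N: "v = f (r (s N)) n" by blast
    have "v \<le> f (r (s i)) n" for i unfolding v_def by (rule Least_le) blast
    moreover have "f (r (s i)) n \<le> v" if "N \<le> i" for i using dec that N by (simp add: decseq_def)
    ultimately show ?thesis using that[of N] by (metis order_trans)
  qed
  have "strict_mono (\<lambda>i. r (s (N + i)))"
    using r(1) s(1) by (auto simp: strict_mono_def)
  moreover have "f (r (s (N + i))) k \<le> f (r (s (N + j))) k" if "k < Suc n" "i \<le> j" for k i j
  proof (cases "k = n")
    case False
    have "s (N + i) \<le> s (N + j)" using s(1) that by (simp add: strict_mono_less_eq)
    then show ?thesis using r(2) that False by auto
  qed (use N that in auto)
  ultimately show ?case by (intro exI[of _ "\<lambda>i. r (s (N + i))"]) auto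
qed

lemma dickson:
  fixes f :: "nat \<Rightarrow> (nat \<Rightarrow>\<^sub>0 nat)"
  assumes "\<And>i. f i \<in> mons {..<n}"
  obtains i j v where "i < j" "v \<in> mons {..<n}" "f j = f i + v"
proof -
  obtain r :: "nat \<Rightarrow> nat" where r: "strict_mono r" "\<forall>k<n. \<forall>i j. i \<le> j \<longrightarrow> cf (f (r i)) k \<le> cf (f (r j)) k"
    using dickson_monotone_subsequence[of n "\<lambda>i. cf (f i)"] by blast
  have le: "cf (f (r 0)) k \<le> cf (f (r 1)) k" for k
  proof (cases "k < n")
    case False
    then have "k \<notin> supp (f (r 0))" using assms[of "r 0"] by (auto simp: mons_def)
    then show ?thesis by (simp add: in_keys_iff)
  qed (use r in auto)
  have eq: "f (r 1) = f (r 0) + (f (r 1) - f (r 0))"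
    by (rule poly_mapping_eqI) (simp add: lookup_add lookup_minus le del: One_nat_def)
  then have "f (r 1) - f (r 0) \<in> mons {..<n}" using assms[of "r 1"] mons_add_iff by metis
  moreover have "r 0 < r 1" using r(1) by (simp add: strict_mono_def)
  ultimately show thesis using that eq by blast
qed

definition wdeg :: "nat \<Rightarrow> (nat \<Rightarrow> nat) \<Rightarrow> (nat \<Rightarrow>\<^sub>0 nat) \<Rightarrow> nat" where
  "wdeg n w m = (\<Sum>i<n. w i * cf m i)"

lemma wdeg_add: "wdeg n w (u + v) = wdeg n w u + wdeg n w v"
  by (simp add: wdeg_def lookup_add algebra_simps sum.distrib)

lemma wdeg_zero [simp]: "wdeg n w 0 = 0"
  by (simp add: wdeg_def)

locale monomial_ordering =
  fixes n :: nat and lt :: "(nat \<Rightarrow>\<^sub>0 nat) \<Rightarrow> (nat \<Rightarrow>\<^sub>0 nat) \<Rightarrow> bool"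
  assumes monomial_order: "monomial_order n lt"
begin

abbreviation "M \<equiv> mons {..<n}"

lemma lt_irrefl: "u \<in> M \<Longrightarrow> \<not> lt u u"
  using monomial_order by (auto simp: monomial_order_def monomials_eq irreflp_on_def)

lemma lt_trans: "u \<in> M \<Longrightarrow> v \<in> M \<Longrightarrow> x \<in> M \<Longrightarrow> lt u v \<Longrightarrow> lt v x \<Longrightarrow> lt u x"
  using monomial_order unfolding monomial_order_def monomials_eq transp_on_def by blast

lemma lt_total: "u \<in> M \<Longrightarrow> v \<in> M \<Longrightarrow> u = v \<or> lt u v \<or> lt v u"
  using monomial_order unfolding monomial_order_def monomials_eq totalp_on_def by blast

lemma lt_add: "u \<in> M \<Longrightarrow> v \<in> M \<Longrightarrow> x \<in> M \<Longrightarrow> lt u v \<Longrightarrow> lt (u + x) (v + x)"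
  using monomial_order unfolding monomial_order_def monomials_eq by blast

lemma lt_zero: "u \<in> M \<Longrightarrow> u \<noteq> 0 \<Longrightarrow> lt 0 u"
  using monomial_order unfolding monomial_order_def monomials_eq by blast

definition le where "le u v \<longleftrightarrow> u = v \<or> lt u v"

lemma le_add: 
  assumes "a \<in> M" "b \<in> M" "u \<in> M" "v \<in> M" "le u a" "le v b"
  shows "le (u + v) (a + b)" and "u + v = a + b \<Longrightarrow> u = a \<and> v = b"
proof -
  have *: "lt (u + v) (a + b)" if "u \<noteq> a \<or> v \<noteq> b"
  proof (cases "u = a")
    case True
    then have "lt (v + u) (b + u)" using that assms lt_add by (auto simp: le_def)
    then show ?thesis using True by (simp add: add.commute)
  next
    case False
    then have 1: "lt (u + v) (a + v)" using assms lt_add by (auto simp: le_def)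
    show ?thesis
    proof (cases "v = b")
      case False
      then have "lt (v + a) (b + a)" using assms lt_add by (auto simp: le_def)
      then have "lt (a + v) (a + b)" by (simp add: add.commute)
      then show ?thesis using 1 lt_trans[of "u + v" "a + v" "a + b"] assms mons_add by blast
    qed (use 1 in simp)
  qed
  then show "le (u + v) (a + b)" unfolding le_def by blast
  show "u = a \<and> v = b" if "u + v = a + b"
  proof (rule ccontr)
    assume "\<not> (u = a \<and> v = b)"
    then have "lt (u + v) (a + b)" using * by blast
    then show False using that lt_irrefl[of "a + b"] assms mons_add by simp
  qed
qed

lemma lt_le_add:
  assumes "a \<in> M" "b \<in> M" "u \<in> M" "v \<in> M" "lt u a" "le v b"
  shows "lt (u + v) (a + b)"
proof -
  have "le u a" using assms(5) by (simp add: le_def)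
  then have "le (u + v) (a + b)" using le_add(1) assms by blast
  moreover have "u + v \<noteq> a + b"
  proof
    assume "u + v = a + b"
    then have "u = a" using le_add(2)[OF assms(1-4) \<open>le u a\<close> assms(6)] by simp
    then show False using lt_irrefl assms by simp
  qed
  ultimately show ?thesis by (simp add: le_def)
qed

text \<open>The reason why leading monomials are multiplicative, in a form that also covers polynomials
  whose support is merely bounded by a given monomial.\<close>

lemma mult_bounded:
  fixes p q :: "(nat \<Rightarrow>\<^sub>0 nat) \<Rightarrow>\<^sub>0 'k::field"
  assumes "a \<in> M" "b \<in> M" "p \<in> polys {..<n}" "q \<in> polys {..<n}"
    and "\<forall>u\<in>supp p. le u a" "\<forall>v\<in>supp q. le v b"
  shows "\<forall>m\<in>supp (p * q). le m (a + b)" and "cf (p * q) (a + b) = cf p a * cf q b"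
proof -
  show "\<forall>m\<in>supp (p * q). le m (a + b)"
  proof
    fix m assume "m \<in> supp (p * q)"
    then obtain u v where uv: "u \<in> supp p" "v \<in> supp q" "m = u + v"
      using keys_mult_split[of m p q] by blast
    then show "le m (a + b)"
      using le_add(1)[OF assms(1,2)] polysD[OF assms(3)] polysD[OF assms(4)] assms(5,6) by simp
  qed
  have "u + v = a + b \<longleftrightarrow> u = a \<and> v = b" if "u \<in> supp p" "v \<in> supp q" for u v
    using le_add(2)[of a b u v] that assms polysD by blast
  then have "cf (p * q) (a + b) = (\<Sum>u\<in>supp p. \<Sum>v\<in>supp q. if u = a \<and> v = b then cf p u * cf q v else 0)"
    unfolding cf_mult by (intro sum.cong refl) auto
  also have "\<dots> = (\<Sum>u\<in>supp p. if u = a then \<Sum>v\<in>supp q. if v = b then cf p a * cf q b else 0 else 0)"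
    by (intro sum.cong refl) auto
  also have "\<dots> = cf p a * cf q b" by (simp add: in_keys_iff)
  finally show "cf (p * q) (a + b) = cf p a * cf q b" .
qed

lemma mult_strictly_bounded:
  fixes p q :: "(nat \<Rightarrow>\<^sub>0 nat) \<Rightarrow>\<^sub>0 'k::field"
  assumes "a \<in> M" "b \<in> M" "p \<in> polys {..<n}" "q \<in> polys {..<n}"
    and "\<forall>u\<in>supp p. lt u a" "\<forall>v\<in>supp q. le v b"
  shows "\<forall>m\<in>supp (p * q). lt m (a + b)"
proof
  fix m assume "m \<in> supp (p * q)"
  then obtain u v where uv: "u \<in> supp p" "v \<in> supp q" "m = u + v"
    using keys_mult_split[of m p q] by blast
  then show "lt m (a + b)"
    using lt_le_add[OF assms(1,2)] polysD[OF assms(3)] polysD[OF assms(4)] assms(5,6) by simp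
qed

abbreviation lead where "lead \<equiv> leading_monomial lt"

lemma lead_eqI:
  assumes "p \<in> polys {..<n}" "m \<in> supp p" "\<forall>u\<in>supp p. le u m"
  shows "lead p = m"
  unfolding leading_monomial_def
proof (rule the_equality)
  show "m \<in> supp p \<and> (\<forall>u\<in>supp p. u \<noteq> m \<longrightarrow> lt u m)" using assms by (auto simp: le_def)
  fix x assume x: "x \<in> supp p \<and> (\<forall>u\<in>supp p. u \<noteq> x \<longrightarrow> lt u x)"
  have M: "x \<in> M" "m \<in> M" using x assms polysD by auto
  show "x = m"
  proof (rule ccontr)
    assume "x \<noteq> m"
    then have "lt m x" "lt x m" using x assms by (auto simp: le_def)
    then show False using lt_trans[of x m x] lt_irrefl M by blast
  qed
qed

lemma lead:
  assumes "p \<in> polys {..<n}" "p \<noteq> 0"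
  shows "lead p \<in> supp p" "\<And>u. u \<in> supp p \<Longrightarrow> le u (lead p)" "lead p \<in> M"
proof -
  have "supp p \<subseteq> M" using assms(1) by (simp add: polys_def)
  moreover have "transp_on M lt" "totalp_on M lt"
    using monomial_order by (auto simp: monomial_order_def monomials_eq)
  ultimately have "transp_on (supp p) lt" "totalp_on (supp p) lt"
    using transp_on_subset totalp_on_subset by blast+
  moreover have "supp p \<noteq> {}" using assms(2) by (metis poly_expand sum.empty)
  ultimately obtain m where m: "m \<in> supp p" "\<forall>u\<in>supp p. u \<noteq> m \<longrightarrow> lt u m"
    using Finite_Set.bex_greatest_element[of "supp p" lt] by auto
  then have "lead p = m" using lead_eqI[OF assms(1), of m] by (auto simp: le_def)
  then show "lead p \<in> supp p" "\<And>u. u \<in> supp p \<Longrightarrow> le u (lead p)" "lead p \<in> M"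
    using m assms polysD by (auto simp: le_def)
qed

lemma lead_mult:
  fixes p q :: "(nat \<Rightarrow>\<^sub>0 nat) \<Rightarrow>\<^sub>0 'k::field"
  assumes "p \<in> polys {..<n}" "q \<in> polys {..<n}" "p \<noteq> 0" "q \<noteq> 0"
  shows "lead (p * q) = lead p + lead q"
proof (rule lead_eqI)
  note p = lead[OF assms(1,3)] and q = lead[OF assms(2,4)]
  show "p * q \<in> polys {..<n}" using assms polys.mult_C by blast
  note * = mult_bounded[OF p(3) q(3) assms(1,2)] 
  show "\<forall>u\<in>supp (p * q). le u (lead p + lead q)" using *(1) p(2) q(2) by blast
  have "cf (p * q) (lead p + lead q) = cf p (lead p) * cf q (lead q)" using *(2) p(2) q(2) by blast
  then show "lead p + lead q \<in> supp (p * q)" using p(1) q(1) by (simp add: in_keys_iff)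
qed

lemma lead_term: "m \<in> M \<Longrightarrow> c \<noteq> 0 \<Longrightarrow> lead (term_of m c :: (nat \<Rightarrow>\<^sub>0 nat) \<Rightarrow>\<^sub>0 'k::field) = m"
  by (rule lead_eqI) (auto simp: term_polys le_def)

definition LM :: "((nat \<Rightarrow>\<^sub>0 nat) \<Rightarrow>\<^sub>0 'k::field) set \<Rightarrow> (nat \<Rightarrow>\<^sub>0 nat) set" where
  "LM J = lead ` (J - {0})"

lemma LM_I: "p \<in> J \<Longrightarrow> p \<noteq> 0 \<Longrightarrow> lead p \<in> LM J"
  by (auto simp: LM_def)

lemma LM_mono: "J \<subseteq> J' \<Longrightarrow> LM J \<subseteq> LM J'"
  by (auto simp: LM_def)

lemma LM_add:
  fixes J :: "((nat \<Rightarrow>\<^sub>0 nat) \<Rightarrow>\<^sub>0 'k::field) set"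
  assumes J: "ideal_in (polys {..<n}) J" and u: "u \<in> LM J" and v: "v \<in> M"
  shows "u + v \<in> LM J"
proof -
  obtain p where p: "p \<in> J" "p \<noteq> 0" "u = lead p" using u by (auto simp: LM_def)
  have pS: "p \<in> polys {..<n}" using p J ideal_inD(1) by blast
  have v0: "term_of v (1::'k) \<noteq> 0" by (metis lookup_single_eq lookup_zero zero_neq_one)
  have vS: "term_of v 1 \<in> (polys {..<n} :: ((nat \<Rightarrow>\<^sub>0 nat) \<Rightarrow>\<^sub>0 'k) set)" using v by (rule term_polys)
  have "p * term_of v 1 \<in> J" using ideal_inD(5)[OF J vS p(1)] .
  moreover have "lead (p * term_of v 1) = u + v"
    using lead_mult[OF pS vS p(2) v0] lead_term[OF v, of "1::'k"] p by simp
  moreover have "p * term_of v 1 \<noteq> 0" using p v0 by simp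
  ultimately show ?thesis using LM_I by metis
qed

lemma LM_mons: "ideal_in (polys {..<n}) J \<Longrightarrow> LM J \<subseteq> M"
  unfolding LM_def using lead(3) ideal_inD(1) by blast

lemma LM_free_imp_independent:
  assumes "A \<subseteq> {..<n}" "mons A \<inter> LM J = {}" "p \<in> polys A" "p \<in> J"
  shows "p = 0"
proof (rule ccontr)
  assume "p \<noteq> 0"
  have "p \<in> polys {..<n}" using assms polys_mono by blast
  then have "lead p \<in> supp p" using lead \<open>p \<noteq> 0\<close> by blast
  then have "lead p \<in> mons A" using assms polysD by blast
  then show False using assms LM_I \<open>p \<noteq> 0\<close> by blast
qed

end

text \<open>Comparing weights first and breaking ties by the given order.\<close>

lemma monomial_order_wdeg:
  assumes "monomial_order n lt"
  shows "monomial_order n (\<lambda>u v. wdeg n w u < wdeg n w v \<or> (wdeg n w u = wdeg n w v \<and> lt u v))"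
proof -
  interpret monomial_ordering n lt using assms by unfold_locales
  show ?thesis
    unfolding monomial_order_def monomials_eq irreflp_on_def transp_on_def totalp_on_def
  proof (intro conjI ballI impI)
    show "wdeg n w 0 < wdeg n w u \<or> wdeg n w 0 = wdeg n w u \<and> lt 0 u" if "u \<in> M" "u \<noteq> 0" for u
      using lt_zero[OF that] by auto
    show "(wdeg n w u < wdeg n w v \<or> wdeg n w u = wdeg n w v \<and> lt u v) \<or>
        (wdeg n w v < wdeg n w u \<or> wdeg n w v = wdeg n w u \<and> lt v u)"
      if "u \<in> M" "v \<in> M" "u \<noteq> v" for u v
      using lt_total[OF that(1,2)] that(3) by auto
  qed (use lt_irrefl lt_add in \<open>auto simp: wdeg_add intro: lt_trans\<close>)
qed

locale graded_ordering = monomial_ordering +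
  fixes w :: "nat \<Rightarrow> nat"
  assumes w_pos: "\<And>i. i < n \<Longrightarrow> 0 < w i"
    and graded: "\<And>u v. u \<in> M \<Longrightarrow> v \<in> M \<Longrightarrow> wdeg n w u < wdeg n w v \<Longrightarrow> lt u v"
begin

abbreviation "degw \<equiv> wdeg n w"

lemma lt_deg: "u \<in> M \<Longrightarrow> v \<in> M \<Longrightarrow> lt u v \<Longrightarrow> degw u \<le> degw v"
  using graded[of v u] lt_trans[of u v u] lt_irrefl[of u] by (meson not_less)

lemma exponent_le_deg:
  assumes "i < n" shows "cf m i \<le> degw m"
proof -
  have "cf m i \<le> w i * cf m i" using w_pos[OF assms] by simp
  also have "\<dots> \<le> degw m" unfolding wdeg_def using assms by (intro member_le_sum) auto
  finally show ?thesis .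
qed

lemma finite_deg_le: "finite {m \<in> M. degw m \<le> N}"
proof (rule finite_subset)
  show "{m \<in> M. degw m \<le> N} \<subseteq> {m \<in> M. \<forall>i\<in>{..<n}. cf m i \<in> {..N}}"
    using exponent_le_deg by (auto intro: order_trans)
  show "finite {m \<in> M. \<forall>i\<in>{..<n}. cf m i \<in> {..N}}"
    using card_mons_box[of "{..<n}" "\<lambda>i. {..N}"] by simp
qed

text \<open>Only finitely many monomials are smaller than a given one, because smaller monomials have at most the
  same weight.  Their number serves as the measure for all inductions along the order.\<close>

definition rank :: "(nat \<Rightarrow>\<^sub>0 nat) \<Rightarrow> nat" where "rank m = card {u \<in> M. lt u m}"

lemma rank_less:
  assumes "u \<in> M" "v \<in> M" "lt u v" shows "rank u < rank v"
  unfolding rank_def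
proof (rule psubset_card_mono)
  show "finite {x \<in> M. lt x v}"
    by (rule finite_subset[OF _ finite_deg_le[of "degw v"]]) (use lt_deg assms in blast)
  show "{x \<in> M. lt x u} \<subset> {x \<in> M. lt x v}"
  proof
    show "{x \<in> M. lt x u} \<subseteq> {x \<in> M. lt x v}" using lt_trans assms by blast
    show "{x \<in> M. lt x u} \<noteq> {x \<in> M. lt x v}" using assms lt_irrefl by blast
  qed
qed

text \<open>Division with remainder.  The bound on the weights of the remainder is what makes it possible to count
  dimensions by counting standard monomials.\<close>

lemma normal_form:
  fixes J :: "((nat \<Rightarrow>\<^sub>0 nat) \<Rightarrow>\<^sub>0 'k::field) set"
  assumes J: "ideal_in (polys {..<n}) J" and "p \<in> polys {..<n}" "\<forall>m\<in>supp p. degw m \<le> N"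
  shows "\<exists>r. p - r \<in> J \<and> supp r \<subseteq> {m \<in> M - LM J. degw m \<le> N}"
  using assms(2,3)
proof (induction "rank (lead p)" arbitrary: p rule: less_induct)
  case less
  show ?case
  proof (cases "p = 0")
    case True
    then show ?thesis using ideal_inD(2)[OF J] by (intro exI[of _ 0]) auto
  next
    case False
    note p = lead[OF less.prems(1) False]
    define m c where "m = lead p" and "c = cf p m"
    have m: "m \<in> M" "m \<in> supp p" "c \<noteq> 0" "degw m \<le> N"
      using p less.prems by (auto simp: m_def c_def in_keys_iff)
    define q where "q = (if m \<in> LM J then (SOME g. g \<in> J \<and> g \<noteq> 0 \<and> lead g = m) else term_of m 1)"
    have q: "q \<in> polys {..<n}" "q \<noteq> 0" "lead q = m" "m \<in> LM J \<Longrightarrow> q \<in> J"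
    proof -
      have "q \<in> J \<and> q \<noteq> 0 \<and> lead q = m" if "m \<in> LM J"
        unfolding q_def using that someI_ex[of "\<lambda>g. g \<in> J \<and> g \<noteq> 0 \<and> lead g = m"]
        by (auto simp: LM_def)
      moreover have "q \<in> polys {..<n} \<and> q \<noteq> 0 \<and> lead q = m" if "m \<notin> LM J"
      proof -
        have "term_of m (1::'k) \<noteq> 0" by (metis lookup_single_eq lookup_zero zero_neq_one)
        then show ?thesis using that m lead_term[of m "1::'k"] by (simp add: q_def term_polys)
      qed
      ultimately show "q \<in> polys {..<n}" "q \<noteq> 0" "lead q = m" "m \<in> LM J \<Longrightarrow> q \<in> J"
        using ideal_inD(1)[OF J] by blast+
    qed
    note lq = lead[OF q(1,2), unfolded q(3)]
    define a where "a = c / cf q m"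
    define p' where "p' = p - term_of 0 a * q"
    have sub: "cf p' u = cf p u - a * cf q u" for u
      using cf_term_mult[of 0 a q u] by (simp add: p'_def lookup_minus)
    have p'S: "p' \<in> polys {..<n}"
      unfolding p'_def using less.prems q by (intro polys.minus_C polys.mult_C term_polys) auto
    have "cf q m \<noteq> 0" using lq(1) by (simp add: in_keys_iff)
    then have "cf p' m = 0" using sub[of m] by (simp add: a_def c_def)
    have supp': "le u m" "u \<noteq> m" "u \<in> M" if "u \<in> supp p'" for u
    proof -
      have "u \<in> supp p \<or> u \<in> supp q" using that sub[of u] by (auto simp: in_keys_iff)
      then show "le u m" using p(2) lq(2) by (auto simp: m_def)
      show "u \<noteq> m" using that \<open>cf p' m = 0\<close> by (auto simp: in_keys_iff)
      show "u \<in> M" using that p'S polysD by blast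
    qed
    have degw': "degw u \<le> N" if "u \<in> supp p'" for u
      using supp'[OF that] lt_deg[of u m] m by (auto simp: le_def)
    have "\<exists>r. p' - r \<in> J \<and> supp r \<subseteq> {m \<in> M - LM J. degw m \<le> N}"
    proof (cases "p' = 0")
      case True
      then show ?thesis using ideal_inD(2)[OF J] by (intro exI[of _ 0]) auto
    next
      case False
      have "lead p' \<in> supp p'" using lead p'S False by blast
      then have "rank (lead p') < rank m"
        using supp' m by (intro rank_less) (auto simp: le_def)
      then show ?thesis using less.hyps[of p'] p'S degw' by (simp add: m_def)
    qed
    then obtain r where r: "p' - r \<in> J" "supp r \<subseteq> {m \<in> M - LM J. degw m \<le> N}" by blast
    show ?thesis
    proof (cases "m \<in> LM J")
      case True
      have "term_of 0 a * q \<in> J" using q(4)[OF True] by (intro ideal_inD(4)[OF J] term_polys) auto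
      then have "(p' - r) + term_of 0 a * q \<in> J" using ideal_inD(3)[OF J] r by blast
      then show ?thesis using r by (intro exI[of _ r]) (auto simp: p'_def algebra_simps)
    next
      case False
      then have "q = term_of m 1" by (simp add: q_def)
      then have "p - (r + term_of m a) = p' - r" by (simp add: p'_def mult_single algebra_simps)
      moreover have "supp (r + term_of m a) \<subseteq> {m \<in> M - LM J. degw m \<le> N}"
        using Poly_Mapping.keys_add[of r "term_of m a"] r m False by (auto split: if_splits)
      ultimately show ?thesis using r(1) by (intro exI[of _ "r + term_of m a"]) metis
    qed
  qed
qed

lemma deg_bound_exists: "\<exists>N. \<forall>m\<in>supp p. degw m \<le> N"
  by (meson finite_imageI finite_keys finite_nat_set_iff_bounded_le imageI)

lemma LM_determines_ideal:
  fixes J J' :: "((nat \<Rightarrow>\<^sub>0 nat) \<Rightarrow>\<^sub>0 'k::field) set"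
  assumes J: "ideal_in (polys {..<n}) J" and J': "ideal_in (polys {..<n}) J'"
    and sub: "J \<subseteq> J'" and LM: "LM J' \<subseteq> LM J"
  shows "J' = J"
proof
  show "J' \<subseteq> J"
  proof
    fix p assume p: "p \<in> J'"
    then have pS: "p \<in> polys {..<n}" using ideal_inD(1)[OF J'] by blast
    obtain N where "\<forall>m\<in>supp p. degw m \<le> N" using deg_bound_exists by blast
    then obtain r where r: "p - r \<in> J" "supp r \<subseteq> {m \<in> M - LM J. degw m \<le> N}"
      using normal_form[OF J pS] by blast
    have "r \<in> J'" using polys.ideal_minus[OF J' p, of "p - r"] r sub by auto
    have rS: "r \<in> polys {..<n}" using r by (auto simp: polys_def)
    have "r = 0"
    proof (rule ccontr)
      assume "r \<noteq> 0"
      then have "lead r \<in> LM J'" "lead r \<in> supp r" using LM_I \<open>r \<in> J'\<close> lead rS by blast+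
      then show False using r LM by blast
    qed
    then show "p \<in> J" using r by simp
  qed
qed (fact sub)

text \<open>Strictly increasing ideals have strictly increasing sets of leading monomials, and these are closed
  under multiples, so Dickson's lemma applies to a choice of new leading monomials.\<close>

lemma polys_noetherian: "noetherian_in (polys {..<n} :: ((nat \<Rightarrow>\<^sub>0 nat) \<Rightarrow>\<^sub>0 'k::field) set)"
proof
  fix J :: "nat \<Rightarrow> ((nat \<Rightarrow>\<^sub>0 nat) \<Rightarrow>\<^sub>0 'k::field) set"
  assume id: "\<And>i. ideal_in (polys {..<n}) (J i)" and inc: "\<And>i. J i \<subset> J (Suc i)"
  have "\<exists>m. m \<in> LM (J (Suc i)) \<and> m \<notin> LM (J i)" for i
    using LM_determines_ideal[OF id[of i] id[of "Suc i"]] inc[of i] by blast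
  then obtain f where f: "\<And>i. f i \<in> LM (J (Suc i))" "\<And>i. f i \<notin> LM (J i)" by metis
  have "f i \<in> M" for i using f(1) LM_mons[OF id] by blast
  then obtain i j v where *: "i < j" "v \<in> M" "f j = f i + v" using dickson[of f n] by blast
  have "J (Suc i) \<subseteq> J j" using lift_Suc_mono_le[of J "Suc i" j] inc * by (simp add: psubset_imp_subset)
  then have "f i \<in> LM (J j)" using f(1) LM_mono by blast
  then have "f i + v \<in> LM (J j)" using LM_add[OF id] *(2) by blast
  then show False using *(3) f(2)[of j] by simp
qed

subsection \<open>Counting standard monomials\<close>

text \<open>There are at most \<open>2 ^ n\<close> choices for the positions of the large exponents.  For each choice there are
  at most \<open>N + 1\<close> values at these positions, of which there are at most \<open>k\<close>, and \<open>b\<close> values at the others.\<close>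

lemma count_few_large_exponents:
  assumes "1 \<le> b"
  shows "finite {m \<in> M. degw m \<le> N \<and> card {i \<in> {..<n}. b \<le> cf m i} < Suc k} \<and>
    card {m \<in> M. degw m \<le> N \<and> card {i \<in> {..<n}. b \<le> cf m i} < Suc k} \<le> 2 ^ n * (b ^ n * (N + 1) ^ k)"
proof -
  let ?E = "{m \<in> M. degw m \<le> N \<and> card {i \<in> {..<n}. b \<le> cf m i} < Suc k}"
  let ?D = "\<lambda>B i. if i \<in> B then {..N} else {..<b}"
  let ?F = "\<lambda>B. {m \<in> M. \<forall>i\<in>{..<n}. cf m i \<in> ?D B i}"
  let ?BB = "{B. B \<subseteq> {..<n} \<and> card B \<le> k}"
  have finBB: "finite ?BB" by (rule finite_subset[of _ "Pow {..<n}"]) auto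
  have F: "finite (?F B)" "card (?F B) = (\<Prod>i<n. card (?D B i))" for B
    using card_mons_box[of "{..<n}" "?D B"] by auto
  have sub: "?E \<subseteq> (\<Union>B\<in>?BB. ?F B)"
  proof
    fix m assume m: "m \<in> ?E"
    have "m \<in> ?F {i \<in> {..<n}. b \<le> cf m i}" using m exponent_le_deg[of _ m] by (auto intro: order_trans)
    moreover have "{i \<in> {..<n}. b \<le> cf m i} \<in> ?BB" using m by auto
    ultimately show "m \<in> (\<Union>B\<in>?BB. ?F B)" by (rule UN_I[rotated])
  qed
  have fin: "finite (\<Union>B\<in>?BB. ?F B)" using finBB F(1) by auto
  have "card ?E \<le> card (\<Union>B\<in>?BB. ?F B)" by (rule card_mono[OF fin sub])
  also have "\<dots> \<le> (\<Sum>B\<in>?BB. card (?F B))" by (rule card_UN_le[OF finBB])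
  also have "\<dots> \<le> (\<Sum>B\<in>?BB. b ^ n * (N + 1) ^ k)"
  proof (rule sum_mono)
    fix B assume B: "B \<in> ?BB"
    have "(\<Prod>i<n. card (?D B i)) = (\<Prod>i\<in>{..<n}. if i \<in> B then N + 1 else b)"
      by (intro prod.cong) auto
    also have "\<dots> = (N + 1) ^ card ({..<n} \<inter> B) * b ^ card ({..<n} - B)"
      by (subst prod.If_cases) (auto simp: Diff_eq)
    also have "\<dots> \<le> (N + 1) ^ k * b ^ n"
    proof (intro mult_mono power_increasing)
      show "card ({..<n} \<inter> B) \<le> k" using B by (simp add: inf.absorb2)
      show "card ({..<n} - B) \<le> n" using card_mono[of "{..<n}" "{..<n} - B"] by auto
    qed (use assms in auto)
    finally show "card (?F B) \<le> b ^ n * (N + 1) ^ k" by (simp add: F(2) mult.commute)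
  qed
  also have "\<dots> = card ?BB * (b ^ n * (N + 1) ^ k)" by simp
  also have "\<dots> \<le> 2 ^ n * (b ^ n * (N + 1) ^ k)"
  proof (rule mult_right_mono)
    have "card ?BB \<le> card (Pow {..<n})" by (intro card_mono) auto
    then show "card ?BB \<le> 2 ^ n" by (simp add: card_Pow)
  qed simp
  finally show ?thesis using finite_subset[OF sub fin] by simp
qed

lemma linear_dependence_bound:
  fixes r :: "'i \<Rightarrow> ((nat \<Rightarrow>\<^sub>0 nat) \<Rightarrow>\<^sub>0 'k::field)"
  assumes "finite \<Omega>" "finite E" "\<And>i. i \<in> \<Omega> \<Longrightarrow> supp (r i) \<subseteq> E"
    and indep: "\<And>a. (\<Sum>i\<in>\<Omega>. term_of 0 (a i) * r i) = 0 \<Longrightarrow> \<forall>i\<in>\<Omega>. a i = 0"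
  shows "card \<Omega> \<le> card E"
proof -
  interpret V: vector_space "\<lambda>c (p :: (nat \<Rightarrow>\<^sub>0 nat) \<Rightarrow>\<^sub>0 'k). term_of 0 c * p"
    by unfold_locales (simp_all add: algebra_simps single_add mult_single)
  have inj: "inj_on r \<Omega>"
  proof (rule inj_onI, rule ccontr)
    fix i j assume ij: "i \<in> \<Omega>" "j \<in> \<Omega>" "r i = r j" "i \<noteq> j"
    let ?a = "\<lambda>x. if x = i then 1 else if x = j then - 1 else (0::'k)"
    have "(\<Sum>x\<in>\<Omega>. term_of 0 (?a x) * r x) = (\<Sum>x\<in>{i, j}. term_of 0 (?a x) * r x)"
      using assms(1) ij by (intro sum.mono_neutral_right) auto
    also have "\<dots> = 0" using ij by (simp add: single_uminus)
    finally have "?a i = 0" using indep[of ?a] ij by blast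
    then show False by simp
  qed
  have "V.independent (r ` \<Omega>)"
    unfolding V.independent_explicit_finite_subsets
  proof (intro allI impI ballI)
    fix T u v assume T: "T \<subseteq> r ` \<Omega>" "finite T" "(\<Sum>v\<in>T. term_of 0 (u v) * v) = 0" "v \<in> T"
    let ?a = "\<lambda>i. if r i \<in> T then u (r i) else 0"
    have "(\<Sum>i\<in>\<Omega>. term_of 0 (?a i) * r i) = (\<Sum>v\<in>r ` \<Omega>. term_of 0 (if v \<in> T then u v else 0) * v)"
      by (subst sum.reindex[OF inj]) simp
    also have "\<dots> = (\<Sum>v\<in>T. term_of 0 (if v \<in> T then u v else 0) * v)"
      using T assms(1) by (intro sum.mono_neutral_right) auto
    also have "\<dots> = 0" using T(3) by simp
    finally have "\<forall>i\<in>\<Omega>. ?a i = 0" by (rule indep)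
    moreover obtain i where "i \<in> \<Omega>" "v = r i" using T(1,4) by blast
    ultimately show "u v = 0" using T(4) by auto
  qed
  moreover have "r ` \<Omega> \<subseteq> V.span ((\<lambda>m. term_of m 1) ` E)"
  proof
    fix p assume "p \<in> r ` \<Omega>"
    then have p: "supp p \<subseteq> E" using assms(3) by auto
    have "(\<Sum>m\<in>supp p. term_of 0 (cf p m) * term_of m 1) \<in> V.span ((\<lambda>m. term_of m 1) ` E)"
      using p by (intro V.span_sum V.span_scale V.span_base) auto
    then show "p \<in> V.span ((\<lambda>m. term_of m 1) ` E)"
      using poly_expand[of p] by (simp add: mult_single)
  qed
  ultimately have "card (r ` \<Omega>) \<le> card ((\<lambda>m. term_of m (1::'k)) ` E)"
    using V.independent_span_bound[of "(\<lambda>m. term_of m (1::'k)) ` E" "r ` \<Omega>"] assms(2) by simp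
  also have "\<dots> \<le> card E" by (rule card_image_le[OF assms(2)])
  finally show ?thesis by (simp add: card_image[OF inj])
qed

text \<open>A comparison of growth rates.  The remainders of the given elements are linearly independent
  combinations of standard monomials of weight at most \<open>c * N\<close>, so there are at least \<open>(N + 1) ^ k\<close> of
  these.  If every set of \<open>k\<close> variables supported a leading monomial, a standard monomial would have
  fewer than \<open>k\<close> large exponents, and the number of standard monomials would be of order \<open>N ^ (k - 1)\<close>
  only.\<close>

theorem many_independent_elements:
  fixes J :: "((nat \<Rightarrow>\<^sub>0 nat) \<Rightarrow>\<^sub>0 'k::field) set" and v :: "nat \<Rightarrow> 'i \<Rightarrow> ((nat \<Rightarrow>\<^sub>0 nat) \<Rightarrow>\<^sub>0 'k)"
  assumes J: "ideal_in (polys {..<n}) J"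
    and fin: "\<And>N. finite (\<Omega> N)" and big: "\<And>N. (N + 1) ^ k \<le> card (\<Omega> N)"
    and v: "\<And>N i. i \<in> \<Omega> N \<Longrightarrow> v N i \<in> polys {..<n}"
    and deg_v: "\<And>N i m. i \<in> \<Omega> N \<Longrightarrow> m \<in> supp (v N i) \<Longrightarrow> degw m \<le> c * N"
    and indep: "\<And>N a. (\<Sum>i\<in>\<Omega> N. term_of 0 (a i) * v N i) \<in> J \<Longrightarrow> \<forall>i\<in>\<Omega> N. a i = 0"
  shows "\<exists>A\<subseteq>{..<n}. card A = k \<and> mons A \<inter> LM J = {}"
proof (rule ccontr)
  assume no: "\<not> ?thesis"
  let ?A = "{A. A \<subseteq> {..<n} \<and> card A = k}"
  have "\<forall>A\<in>?A. \<exists>m. m \<in> mons A \<and> m \<in> LM J" using no by blast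
  then obtain g where g: "\<And>A. A \<in> ?A \<Longrightarrow> g A \<in> mons A \<and> g A \<in> LM J" by metis
  have finA: "finite ?A" by (rule finite_subset[of _ "Pow {..<n}"]) auto
  define b where "b = Suc (\<Sum>A\<in>?A. degw (g A))"
  have b: "cf (g A) i \<le> b" if "A \<in> ?A" "i < n" for A i
  proof -
    have "cf (g A) i \<le> degw (g A)" by (rule exponent_le_deg[OF that(2)])
    also have "\<dots> \<le> (\<Sum>A\<in>?A. degw (g A))" using that(1) finA by (intro member_le_sum) auto
    finally show ?thesis by (simp add: b_def)
  qed
  have few: "card {i \<in> {..<n}. b \<le> cf m i} < k" if m: "m \<in> M" "m \<notin> LM J" for m
  proof (rule ccontr)
    assume "\<not> ?thesis"
    then obtain A where A: "A \<subseteq> {i \<in> {..<n}. b \<le> cf m i}" "card A = k"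
      using obtain_subset_with_card_n[of k "{i \<in> {..<n}. b \<le> cf m i}"] by auto
    then have AA: "A \<in> ?A" by auto
    have le: "cf (g A) i \<le> cf m i" for i
    proof (cases "i \<in> A")
      case True
      then have "i < n" "b \<le> cf m i" using A by auto
      then show ?thesis using b[OF AA, of i] by linarith
    next
      case False
      then have "cf (g A) i = 0" using g[OF AA] by (auto simp: mons_def in_keys_iff)
      then show ?thesis by simp
    qed
    have eq: "m = g A + (m - g A)" by (rule poly_mapping_eqI) (simp add: lookup_add lookup_minus le)
    then have "m - g A \<in> M" using m(1) mons_add_iff by metis
    then show False using LM_add[OF J, of "g A" "m - g A"] g[OF AA] eq m(2) by auto
  qed
  have count: "card (\<Omega> N) \<le> card {m \<in> M - LM J. degw m \<le> c * N}" for N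
  proof -
    have "\<forall>i\<in>\<Omega> N. \<exists>r. v N i - r \<in> J \<and> supp r \<subseteq> {m \<in> M - LM J. degw m \<le> c * N}"
      by (intro ballI normal_form[OF J v]) (use deg_v in auto)
    then obtain r where "\<forall>i\<in>\<Omega> N. v N i - r i \<in> J \<and> supp (r i) \<subseteq> {m \<in> M - LM J. degw m \<le> c * N}"
      by (rule bchoice[THEN exE])
    then have r: "\<And>i. i \<in> \<Omega> N \<Longrightarrow> v N i - r i \<in> J"
      "\<And>i. i \<in> \<Omega> N \<Longrightarrow> supp (r i) \<subseteq> {m \<in> M - LM J. degw m \<le> c * N}" by simp_all
    show ?thesis
    proof (rule linear_dependence_bound[OF fin _ r(2)])
      show "finite {m \<in> M - LM J. degw m \<le> c * N}"
        by (rule finite_subset[OF _ finite_deg_le[of "c * N"]]) auto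
      fix a assume a: "(\<Sum>i\<in>\<Omega> N. term_of 0 (a i) * r i) = 0"
      have "(\<Sum>i\<in>\<Omega> N. term_of 0 (a i) * (v N i - r i)) \<in> J"
        using r(1) by (intro polys.ideal_sum[OF J] ideal_inD(4)[OF J] term_polys) auto
      then have "(\<Sum>i\<in>\<Omega> N. term_of 0 (a i) * v N i) \<in> J"
        using a by (simp add: right_diff_distrib sum_subtractf)
      then show "\<forall>i\<in>\<Omega> N. a i = 0" by (rule indep)
    qed
  qed
  show False
  proof (cases k)
    case 0
    then have "{m \<in> M - LM J. degw m \<le> c * 0} = {}" using few by auto
    then have "card (\<Omega> 0) = 0" using count[of 0] by (metis card.empty le_zero_eq)
    then show False using big[of 0] by simp
  next
    case (Suc k')
    have bound: "(N + 1) ^ k \<le> 2 ^ n * (b ^ n * (c * N + 1) ^ k')" for N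
    proof -
      have *: "finite {m \<in> M. degw m \<le> c * N \<and> card {i \<in> {..<n}. b \<le> cf m i} < Suc k'} \<and>
        card {m \<in> M. degw m \<le> c * N \<and> card {i \<in> {..<n}. b \<le> cf m i} < Suc k'} \<le> 2 ^ n * (b ^ n * (c * N + 1) ^ k')"
        by (rule count_few_large_exponents) (simp add: b_def)
      have "(N + 1) ^ k \<le> card (\<Omega> N)" by (rule big)
      also have "\<dots> \<le> card {m \<in> M - LM J. degw m \<le> c * N}" by (rule count)
      also have "\<dots> \<le> card {m \<in> M. degw m \<le> c * N \<and> card {i \<in> {..<n}. b \<le> cf m i} < Suc k'}"
        using * few Suc by (intro card_mono) auto
      finally show ?thesis using * by linarith
    qed
    define K where "K = 2 ^ n * (b ^ n * (c + 1) ^ k')"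
    have "(K + 1) ^ k \<le> 2 ^ n * (b ^ n * (c * K + 1) ^ k')" by (rule bound)
    also have "\<dots> \<le> 2 ^ n * (b ^ n * ((c + 1) * (K + 1)) ^ k')"
      by (intro mult_left_mono power_mono) (auto simp: algebra_simps)
    also have "\<dots> = K * (K + 1) ^ k'" by (simp only: K_def power_mult_distrib mult.assoc)
    also have "\<dots> < (K + 1) * (K + 1) ^ k'" by simp
    also have "\<dots> = (K + 1) ^ k" by (simp add: Suc)
    finally show False by simp
  qed
qed

end


section \<open>Dimension of affine domains\<close>

text \<open>Gaussian elimination for square matrices with dominating diagonal: if such a matrix maps the vector \<open>h\<close>
  into \<open>J\<close>, then \<open>h\<close> itself is in \<open>J\<close>.  After \<open>k\<close> eliminations the diagonal entries belong to \<open>U k\<close> and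
  the other entries to \<open>Z k\<close>.  The lemma replaces determinants in two places: for the finiteness over
  \<open>K[x\<^sub>A]\<close> behind the dimension theory, with \<open>Z\<close> consisting of the multiples of an element, and for the
  action of polynomials on \<open>S\<^sub>L\<close>, with \<open>Z\<close> consisting of polynomials with smaller leading monomials.\<close>

lemma (in subring_in) elimination:
  fixes U Z :: "nat \<Rightarrow> 'a set" and h :: "'i \<Rightarrow> 'a"
  assumes J: "ideal_in C J" and "finite E"
    and UZ: "\<And>k. U k \<subseteq> C" "\<And>k. Z k \<subseteq> C"
    and nzd: "\<And>k u y. u \<in> U k \<Longrightarrow> y \<in> C \<Longrightarrow> u * y \<in> J \<Longrightarrow> y \<in> J"
    and step_U: "\<And>k u u' z z'. u \<in> U k \<Longrightarrow> u' \<in> U k \<Longrightarrow> z \<in> Z k \<Longrightarrow> z' \<in> Z k \<Longrightarrow> u * u' - z * z' \<in> U (Suc k)"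
    and step_Z: "\<And>k u z z' z''. u \<in> U k \<Longrightarrow> z \<in> Z k \<Longrightarrow> z' \<in> Z k \<Longrightarrow> z'' \<in> Z k \<Longrightarrow> u * z - z' * z'' \<in> Z (Suc k)"
    and h: "\<And>b. b \<in> E \<Longrightarrow> h b \<in> C"
    and mat: "\<And>c b. c \<in> E \<Longrightarrow> b \<in> E \<Longrightarrow> mat c b \<in> (if c = b then U k else Z k)"
    and rows: "\<And>c. c \<in> E \<Longrightarrow> (\<Sum>b\<in>E. mat c b * h b) \<in> J"
  shows "\<forall>b\<in>E. h b \<in> J"
  using assms(2) h mat rows
proof (induction E arbitrary: mat k rule: finite_induct)
  case (insert x F)
  note matD = insert.prems(2) and row = insert.prems(3)
  have inC: "mat c b \<in> C" if "c \<in> insert x F" "b \<in> insert x F" for c b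
    using matD[OF that] UZ[of k] by (auto split: if_splits)
  have sumC: "(\<Sum>b\<in>F. mat x b * h b) \<in> C"
    using inC insert.prems(1) by (intro sum_C mult_C) auto
  have "\<forall>b\<in>F. h b \<in> J"
  proof (rule insert.IH[of "\<lambda>c b. mat x x * mat c b - mat c x * mat x b" "Suc k"])
    show "h b \<in> C" if "b \<in> F" for b using insert.prems(1) that by simp
    show "mat x x * mat c b - mat c x * mat x b \<in> (if c = b then U (Suc k) else Z (Suc k))"
      if cb: "c \<in> F" "b \<in> F" for c b
    proof -
      have "c \<noteq> x" "b \<noteq> x" using insert.hyps cb by auto
      then have "mat x x \<in> U k" "mat c x \<in> Z k" "mat x b \<in> Z k" "mat c b \<in> (if c = b then U k else Z k)"
        using matD[of x x] matD[of c x] matD[of x b] matD[of c b] cb by auto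
      then show ?thesis using step_U step_Z by (auto split: if_splits)
    qed
    show "(\<Sum>b\<in>F. (mat x x * mat c b - mat c x * mat x b) * h b) \<in> J" if c: "c \<in> F" for c
    proof -
      have "mat x x * (\<Sum>b\<in>insert x F. mat c b * h b) - mat c x * (\<Sum>b\<in>insert x F. mat x b * h b) \<in> J"
        using c by (intro ideal_minus[OF J] ideal_inD(4)[OF J] row inC) auto
      moreover have "(\<Sum>b\<in>F. (mat x x * mat c b - mat c x * mat x b) * h b) =
          mat x x * (\<Sum>b\<in>F. mat c b * h b) - mat c x * (\<Sum>b\<in>F. mat x b * h b)"
        by (simp add: sum_distrib_left sum_subtractf left_diff_distrib mult.assoc)
      moreover have "(\<Sum>b\<in>insert x F. mat c b * h b) = mat c x * h x + (\<Sum>b\<in>F. mat c b * h b)"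
        "(\<Sum>b\<in>insert x F. mat x b * h b) = mat x x * h x + (\<Sum>b\<in>F. mat x b * h b)"
        using insert.hyps by simp_all
      moreover have "u * (z * y + s) - z * (u * y + s') = u * s - z * s'" for u z y s s' :: 'a
        by (simp add: algebra_simps)
      ultimately show ?thesis by simp
    qed
  qed
  moreover have "h x \<in> J"
  proof -
    have "(\<Sum>b\<in>F. mat x b * h b) \<in> J"
      using calculation inC by (intro ideal_sum[OF J] ideal_inD(4)[OF J]) auto
    moreover have "mat x x * h x + (\<Sum>b\<in>F. mat x b * h b) \<in> J"
      using row[of x] insert.hyps by simp
    ultimately have "mat x x * h x \<in> J"
      using ideal_minus[OF J, of "mat x x * h x + (\<Sum>b\<in>F. mat x b * h b)" "\<Sum>b\<in>F. mat x b * h b"] by simp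
    then show ?thesis using nzd[of "mat x x" k "h x"] matD[of x x] insert.prems(1)[of x] by simp
  qed
  ultimately show ?case by simp
qed simp

definition alg_independent :: "nat set \<Rightarrow> ((nat \<Rightarrow>\<^sub>0 nat) \<Rightarrow>\<^sub>0 'k::field) set \<Rightarrow> bool" where
  "alg_independent A J \<longleftrightarrow> polys A \<inter> J \<subseteq> {0}"

lemma alg_independentD: "alg_independent A J \<Longrightarrow> p \<in> polys A \<Longrightarrow> p \<in> J \<Longrightarrow> p = 0"
  by (auto simp: alg_independent_def)

lemma term_nonzero: "term_of v (1::'k::field) \<noteq> 0"
  by (metis lookup_single_eq lookup_zero zero_neq_one)

context graded_ordering
begin

abbreviation "weight_sum \<equiv> (\<Sum>i<n. w i)"

lemma box_degree: "m \<in> mons B \<Longrightarrow> \<forall>i\<in>B. cf m i \<in> {..N} \<Longrightarrow> degw m \<le> weight_sum * N"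
proof -
  assume m: "m \<in> mons B" "\<forall>i\<in>B. cf m i \<in> {..N}"
  have "cf m i \<le> N" for i
  proof (cases "i \<in> B")
    case False
    then have "i \<notin> supp m" using m(1) by (auto simp: mons_def)
    then show ?thesis by (simp add: in_keys_iff)
  qed (use m in auto)
  then show ?thesis unfolding wdeg_def sum_distrib_right by (intro sum_mono mult_left_mono) auto
qed

lemma degree_mult:
  fixes p q :: "(nat \<Rightarrow>\<^sub>0 nat) \<Rightarrow>\<^sub>0 'k::field"
  assumes "\<forall>m\<in>supp p. degw m \<le> a" "\<forall>m\<in>supp q. degw m \<le> b"
  shows "\<forall>m\<in>supp (p * q). degw m \<le> a + b"
proof
  fix m assume "m \<in> supp (p * q)"
  then obtain u v where "u \<in> supp p" "v \<in> supp q" "m = u + v" using keys_mult_split[of m p q] by blast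
  then show "degw m \<le> a + b" using assms by (auto simp: wdeg_add intro!: add_mono)
qed

lemma degree_power:
  fixes p :: "(nat \<Rightarrow>\<^sub>0 nat) \<Rightarrow>\<^sub>0 'k::field"
  assumes "\<forall>m\<in>supp p. degw m \<le> a"
  shows "\<forall>m\<in>supp (p ^ j). degw m \<le> a * j"
proof (induction j)
  case (Suc j)
  show ?case using degree_mult[OF assms Suc] by simp
qed simp

lemma sum_terms_coeff: "finite E \<Longrightarrow> m \<in> E \<Longrightarrow> cf (\<Sum>m\<in>E. term_of m (a m)) m = a m"
  by (simp add: lookup_sum lookup_single when_def)

lemma LM_free_of_independent:
  fixes J :: "((nat \<Rightarrow>\<^sub>0 nat) \<Rightarrow>\<^sub>0 'k::field) set"
  assumes J: "ideal_in (polys {..<n}) J" and B: "B \<subseteq> {..<n}" "alg_independent B J"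
  shows "\<exists>A\<subseteq>{..<n}. card A = card B \<and> mons A \<inter> LM J = {}"
proof (rule many_independent_elements[OF J])
  let ?\<Omega> = "\<lambda>N. {m \<in> mons B. \<forall>i\<in>B. cf m i \<in> {..N}}"
  have finB: "finite B" using B finite_subset by blast
  note box = card_mons_box[OF finB, of "\<lambda>i. {..N}" for N]
  show fin: "finite (?\<Omega> N)" "(N + 1) ^ card B \<le> card (?\<Omega> N)" for N
    using box[of N] by auto
  fix N
  show "term_of m (1::'k) \<in> polys {..<n}" if "m \<in> ?\<Omega> N" for m
    using that mons_mono[OF B(1)] by (intro term_polys) auto
  show "degw u \<le> weight_sum * N" if "m \<in> ?\<Omega> N" "u \<in> supp (term_of m (1::'k))" for m u
    using that box_degree[of m B N] by auto
  fix a assume "(\<Sum>m\<in>?\<Omega> N. term_of 0 (a m) * term_of m 1) \<in> J"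
  then have "(\<Sum>m\<in>?\<Omega> N. term_of m (a m)) \<in> J" by (simp add: mult_single)
  moreover have "(\<Sum>m\<in>?\<Omega> N. term_of m (a m)) \<in> polys B"
    by (intro polys.sum_C term_polys) auto
  ultimately have "(\<Sum>m\<in>?\<Omega> N. term_of m (a m)) = 0" using alg_independentD[OF B(2)] by blast
  then have "cf (\<Sum>m\<in>?\<Omega> N. term_of m (a m)) u = 0" for u by simp
  then show "\<forall>m\<in>?\<Omega> N. a m = 0" using sum_terms_coeff[OF fin(1), of _ N a] by (intro ballI) simp
qed

text \<open>The products of monomials in \<open>x\<^sub>A\<close> and powers of \<open>f\<close> behave like monomials in one more variable.\<close>

lemma LM_free_of_transcendental_element:
  fixes J :: "((nat \<Rightarrow>\<^sub>0 nat) \<Rightarrow>\<^sub>0 'k::field) set"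
  assumes J: "ideal_in (polys {..<n}) J" and A: "A \<subseteq> {..<n}" and f: "f \<in> polys {..<n}"
    and norel: "\<And>D p. \<forall>j\<le>D. p j \<in> polys A \<Longrightarrow> (\<Sum>j\<le>D. p j * f ^ j) \<in> J \<Longrightarrow> \<forall>j\<le>D. p j = 0"
  shows "\<exists>B\<subseteq>{..<n}. card B = Suc (card A) \<and> mons B \<inter> LM J = {}"
proof -
  obtain d where d: "\<forall>m\<in>supp f. degw m \<le> d" using deg_bound_exists by blast
  let ?E = "\<lambda>N. {m \<in> mons A. \<forall>i\<in>A. cf m i \<in> {..N}}"
  let ?\<Omega> = "\<lambda>N. ?E N \<times> {..N}"
  show ?thesis
  proof (rule many_independent_elements[OF J, of ?\<Omega> _ "\<lambda>N mj. case mj of (m, j) \<Rightarrow> term_of m 1 * f ^ j" "weight_sum + d"])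
  have finA: "finite A" using A finite_subset by blast
  note box = card_mons_box[OF finA, of "\<lambda>i. {..N}" for N]
  have finE: "finite (?E N)" for N using box[of N] by auto
  show fin: "finite (?\<Omega> N)" "(N + 1) ^ Suc (card A) \<le> card (?\<Omega> N)" for N
    using box[of N] by (auto simp: card_cartesian_product)
  fix N
  show "(case mj of (m, j) \<Rightarrow> term_of m (1::'k) * f ^ j) \<in> polys {..<n}" if "mj \<in> ?\<Omega> N" for mj
    using that mons_mono[OF A] f
    by (auto intro!: polys.mult_C polys.power_C term_polys split: prod.splits)
  show "degw u \<le> (weight_sum + d) * N"
    if mj: "mj \<in> ?\<Omega> N" "u \<in> supp (case mj of (m, j) \<Rightarrow> term_of m (1::'k) * f ^ j)" for mj u
  proof -
    obtain m j where [simp]: "mj = (m, j)" by (cases mj)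
    have *: "m \<in> mons A" "\<forall>i\<in>A. cf m i \<in> {..N}" "j \<le> N" using mj by auto
    have "\<forall>u\<in>supp (term_of m (1::'k) * f ^ j). degw u \<le> weight_sum * N + d * j"
      by (intro degree_mult degree_power[OF d]) (use box_degree[OF *(1,2)] in auto)
    then have "degw u \<le> weight_sum * N + d * j" using mj by simp
    also have "\<dots> \<le> (weight_sum + d) * N" using * by (simp add: algebra_simps)
    finally show ?thesis .
  qed
  fix a assume "(\<Sum>mj\<in>?\<Omega> N. term_of 0 (a mj) * (case mj of (m, j) \<Rightarrow> term_of m 1 * f ^ j)) \<in> J"
  also have "(\<Sum>mj\<in>?\<Omega> N. term_of 0 (a mj) * (case mj of (m, j) \<Rightarrow> term_of m 1 * f ^ j)) =
      (\<Sum>m\<in>?E N. \<Sum>j\<le>N. term_of m (a (m, j)) * f ^ j)"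
    by (subst sum.cartesian_product, intro sum.cong refl)
       (auto simp: mult.assoc[symmetric] mult_single)
  also have "\<dots> = (\<Sum>j\<le>N. (\<Sum>m\<in>?E N. term_of m (a (m, j))) * f ^ j)"
    by (subst sum.swap) (simp add: sum_distrib_right)
  finally have "(\<Sum>j\<le>N. (\<Sum>m\<in>?E N. term_of m (a (m, j))) * f ^ j) \<in> J" .
  moreover have "\<forall>j\<le>N. (\<Sum>m\<in>?E N. term_of m (a (m, j))) \<in> polys A"
    by (intro allI impI polys.sum_C term_polys) auto
  ultimately have zero: "\<forall>j\<le>N. (\<Sum>m\<in>?E N. term_of m (a (m, j))) = 0" by (rule norel[rotated])
  show "\<forall>mj\<in>?\<Omega> N. a mj = 0"
  proof
    fix mj assume "mj \<in> ?\<Omega> N"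
    then obtain m j where mj: "mj = (m, j)" "m \<in> ?E N" "j \<le> N" by auto
    then show "a mj = 0" using sum_terms_coeff[OF finE mj(2), of "\<lambda>m. a (m, j)"] zero by simp
  qed
  qed
qed

lemma algebraic_relation:
  fixes J :: "((nat \<Rightarrow>\<^sub>0 nat) \<Rightarrow>\<^sub>0 'k::field) set"
  assumes J: "ideal_in (polys {..<n}) J" and A: "A \<subseteq> {..<n}" and f: "f \<in> polys {..<n}"
    and max: "\<not> (\<exists>B\<subseteq>{..<n}. card B = Suc (card A) \<and> mons B \<inter> LM J = {})"
  obtains D p where "\<forall>j\<le>D. p j \<in> polys A" "(\<Sum>j\<le>D. p j * f ^ j) \<in> J" "\<exists>j\<le>D. p j \<noteq> 0"
  using LM_free_of_transcendental_element[OF J A f] max by blast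

text \<open>In an algebraic equation for \<open>f\<close> over \<open>K[x\<^sub>A]\<close> a power of \<open>f\<close> can be cancelled, since \<open>P\<close> is prime;
  \<open>p0\<close> is the constant coefficient that remains.\<close>

lemma algebraic_multiple:
  fixes P :: "((nat \<Rightarrow>\<^sub>0 nat) \<Rightarrow>\<^sub>0 'k::field) set"
  assumes P: "prime_in (polys {..<n}) P" and A: "A \<subseteq> {..<n}" and f: "f \<in> polys {..<n}" "f \<notin> P"
    and max: "\<not> (\<exists>B\<subseteq>{..<n}. card B = Suc (card A) \<and> mons B \<inter> LM P = {})"
  obtains p0 e where "p0 \<in> polys A" "p0 \<noteq> 0" "e \<in> polys {..<n}" "p0 + f * e \<in> P"
proof -
  obtain D p where p: "\<forall>j\<le>D. p j \<in> polys A" "(\<Sum>j\<le>D. p j * f ^ j) \<in> P" "\<exists>j\<le>D. p j \<noteq> 0"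
    using algebraic_relation[OF prime_inD(1)[OF P] A f(1) max] by blast
  define i where "i = (LEAST j. j \<le> D \<and> p j \<noteq> 0)"
  have i: "i \<le> D" "p i \<noteq> 0" using LeastI_ex[OF p(3)] by (auto simp: i_def)
  have least: "p j = 0" if "j < i" for j
  proof (rule ccontr)
    assume "p j \<noteq> 0"
    then have "i \<le> j" unfolding i_def using that i by (intro Least_le) auto
    then show False using that by simp
  qed
  define e where "e = (\<Sum>j\<in>{Suc i..D}. p j * f ^ (j - Suc i))"
  have AS: "polys A \<subseteq> polys {..<n}" by (rule polys_mono[OF A])
  have e: "e \<in> polys {..<n}"
    unfolding e_def using p(1) AS f by (intro polys.sum_C polys.mult_C polys.power_C) auto
  have "(\<Sum>j\<le>D. p j * f ^ j) = (\<Sum>j\<in>{i..D}. p j * f ^ j)"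
    using least by (intro sum.mono_neutral_right) (auto simp: not_le)
  also have "\<dots> = p i * f ^ i + (\<Sum>j\<in>{Suc i..D}. p j * f ^ j)"
    by (rule sum.atLeast_Suc_atMost[OF i(1)])
  also have "(\<Sum>j\<in>{Suc i..D}. p j * f ^ j) = f ^ i * (f * e)"
    unfolding e_def sum_distrib_left
  proof (intro sum.cong refl)
    fix j assume "j \<in> {Suc i..D}"
    then have "f ^ j = f ^ (i + (1 + (j - Suc i)))" by simp
    then have "f ^ j = f ^ i * (f * f ^ (j - Suc i))" by (simp only: power_add power_one_right)
    then show "p j * f ^ j = f ^ i * (f * (p j * f ^ (j - Suc i)))" by (simp add: algebra_simps)
  qed
  finally have "f ^ i * (p i + f * e) \<in> P" using p(2) by (simp add: algebra_simps)
  moreover have "p i + f * e \<in> polys {..<n}" using p(1) i AS f e by (intro polys.add_C polys.mult_C) auto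
  ultimately have "f ^ i \<in> P \<or> p i + f * e \<in> P"
    by (intro prime_inD(3)[OF P]) (use f polys.power_C in auto)
  then have "p i + f * e \<in> P" using polys.prime_power[OF P f(1)] f(2) by blast
  then show thesis using that[of "p i" e] p(1) i e by blast
qed

text \<open>An element of \<open>Q - P\<close> is transcendental over \<open>K[x\<^sub>A]\<close> modulo \<open>P\<close>: the constant coefficient of an
  algebraic equation would lie in \<open>Q\<close>.\<close>

lemma independent_set_grows:
  fixes P Q :: "((nat \<Rightarrow>\<^sub>0 nat) \<Rightarrow>\<^sub>0 'k::field) set"
  assumes P: "prime_in (polys {..<n}) P" and Q: "prime_in (polys {..<n}) Q" and PQ: "P \<subset> Q"
    and A: "A \<subseteq> {..<n}" "alg_independent A Q"
  shows "\<exists>B\<subseteq>{..<n}. card B = Suc (card A) \<and> alg_independent B P"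
proof -
  have "\<exists>B\<subseteq>{..<n}. card B = Suc (card A) \<and> mons B \<inter> LM P = {}"
  proof (rule ccontr)
    assume max: "\<not> ?thesis"
    obtain f where f: "f \<in> Q" "f \<notin> P" using PQ by blast
    note idQ = prime_inD(1)[OF Q]
    have fS: "f \<in> polys {..<n}" using f ideal_inD(1)[OF idQ] by blast
    obtain p0 e where *: "p0 \<in> polys A" "p0 \<noteq> 0" "e \<in> polys {..<n}" "p0 + f * e \<in> P"
      using algebraic_multiple[OF P A(1) fS f(2) max] by blast
    have "p0 + f * e \<in> Q" using *(4) PQ by blast
    moreover have "f * e \<in> Q" using ideal_inD(5)[OF idQ *(3) f(1)] .
    ultimately have "p0 \<in> Q" using polys.ideal_minus[OF idQ, of "p0 + f * e" "f * e"] by simp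
    then show False using alg_independentD[OF A(2) *(1)] *(2) by blast
  qed
  then obtain B where B: "B \<subseteq> {..<n}" "card B = Suc (card A)" "mons B \<inter> LM P = {}" by blast
  then have "alg_independent B P"
    using LM_free_imp_independent[OF B(1,3)] by (auto simp: alg_independent_def)
  with B show ?thesis by blast
qed

lemma monomial_induct [consumes 1, case_names zero step]:
  assumes "m \<in> M" and "Pr 0" and "\<And>m j. m \<in> M \<Longrightarrow> j < n \<Longrightarrow> Pr m \<Longrightarrow> Pr (term_of j (1::nat) + m)"
  shows "Pr m"
  using assms(1)
proof (induction "\<Sum>i<n. cf m i" arbitrary: m)
  case 0
  then have "cf m i = 0" for i by (cases "i < n") (auto simp: mons_def in_keys_iff)
  then have "m = 0" by (intro poly_mapping_eqI) simp
  then show ?case using assms(2) by simp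
next
  case (Suc x)
  then obtain j where j: "j < n" "cf m j \<noteq> 0" by (metis lessThan_iff nat.distinct(1) sum.neutral)
  define m' where "m' = m - term_of j 1"
  have eq: "m = term_of j 1 + m'"
    by (rule poly_mapping_eqI) (use j in \<open>auto simp: m'_def lookup_add lookup_minus lookup_single when_def\<close>)
  then have "m' \<in> M" using Suc.prems mons_add_iff by metis
  moreover have "x = (\<Sum>i<n. cf m' i)"
  proof -
    have "Suc x = (\<Sum>i<n. (if j = i then Suc 0 else 0) + cf m' i)"
      using Suc.hyps(2) by (subst (asm) eq) (simp add: lookup_add lookup_single when_def)
    also have "\<dots> = 1 + (\<Sum>i<n. cf m' i)" using j by (simp add: sum.distrib)
    finally show ?thesis by simp
  qed
  ultimately show ?case using Suc.hyps(1)[of m'] assms(3)[OF _ j(1)] eq by metis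
qed

text \<open>The core of Zariski's lemma.  Let \<open>c\<close> be the product of the leading coefficients of equations for all
  variables over \<open>K[x\<^sub>A]\<close>.  After inverting \<open>c\<close>, the ring modulo \<open>P\<close> is generated as a module over
  \<open>K[x\<^sub>A]\<close> by a finite set \<open>E\<close> of monomials.  Add \<open>f = 1 + c x\<^sub>a\<close> to \<open>P\<close>.  If a nonzero polynomial
  \<open>s\<close> that does not involve \<open>x\<^sub>a\<close> were equal to \<open>g f\<close> modulo \<open>P\<close>, then elimination for the matrix of
  \<open>s - g f\<close> on \<open>E\<close> would show that \<open>f\<close> divides a power of \<open>s c\<^sup>t\<close> in \<open>K[x\<^sub>A]\<close>.  But \<open>c\<close> is
  invertible modulo \<open>f\<close>, so \<open>f\<close> would divide a power of \<open>s\<close>, and \<open>f\<close> has positive degree in \<open>x\<^sub>a\<close>.\<close>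

lemma larger_prime_with_independent_set:
  fixes P :: "((nat \<Rightarrow>\<^sub>0 nat) \<Rightarrow>\<^sub>0 'k::field) set"
  assumes P: "prime_in (polys {..<n}) P" and A: "A \<subseteq> {..<n}" "alg_independent A P" and a: "a \<in> A"
    and max: "\<not> (\<exists>B\<subseteq>{..<n}. card B = Suc (card A) \<and> mons B \<inter> LM P = {})"
  shows "\<exists>Q. prime_in (polys {..<n}) Q \<and> P \<subset> Q \<and> alg_independent (A - {a}) Q"
proof -
  interpret N: noetherian_in "polys {..<n} :: ((nat \<Rightarrow>\<^sub>0 nat) \<Rightarrow>\<^sub>0 'k) set" by (rule polys_noetherian)
  let ?S = "polys {..<n} :: ((nat \<Rightarrow>\<^sub>0 nat) \<Rightarrow>\<^sub>0 'k) set"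
  note idP = prime_inD(1)[OF P]
  have AS: "polys A \<subseteq> ?S" by (rule polys_mono[OF A(1)])
  define x where "x j = term_of (term_of j (1::nat)) (1::'k)" for j :: nat
  have xS: "x j \<in> ?S" if "j < n" for j
    unfolding x_def using that by (intro term_polys) (auto simp: mons_def)
  define Rel where "Rel j D p \<longleftrightarrow> 0 < D \<and> (\<forall>i\<le>D. p i \<in> polys A) \<and> (\<Sum>i\<le>D. p i * x j ^ i) \<in> P \<and> p D \<noteq> 0"
    for j D p
  have rel: "\<exists>D p. Rel j D p" if jn: "j < n" for j
  proof -
    obtain D p where p: "\<forall>i\<le>D. p i \<in> polys A" "(\<Sum>i\<le>D. p i * x j ^ i) \<in> P" "\<exists>i\<le>D. p i \<noteq> 0"
      using algebraic_relation[OF idP A(1) xS[OF jn] max] by blast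
    define d where "d = Max {i. i \<le> D \<and> p i \<noteq> 0}"
    have fin: "finite {i. i \<le> D \<and> p i \<noteq> 0}" by simp
    have d: "d \<le> D" "p d \<noteq> 0" using Max_in[OF fin] p(3) by (auto simp: d_def)
    have top: "p i = 0" if "i \<le> D" "d < i" for i
    proof (rule ccontr)
      assume "p i \<noteq> 0"
      then have "i \<le> d" unfolding d_def using that by (intro Max_ge fin) simp
      then show False using that by simp
    qed
    have "(\<Sum>i\<le>D. p i * x j ^ i) = (\<Sum>i\<le>d. p i * x j ^ i)"
      using top d by (intro sum.mono_neutral_right) auto
    then have in_P: "(\<Sum>i\<le>d. p i * x j ^ i) \<in> P" using p(2) by simp
    moreover have "0 < d"
    proof (rule ccontr)
      assume "\<not> 0 < d"
      then have "p d \<in> P" using in_P by simp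
      then show False using alg_independentD[OF A(2)] p(1) d by blast
    qed
    ultimately show ?thesis using p(1) d unfolding Rel_def by (intro exI[of _ d] exI[of _ p]) auto
  qed
  then obtain D p where Rel: "\<And>j. j < n \<Longrightarrow> Rel j (D j) (p j)" by metis
  have p: "\<And>j. j < n \<Longrightarrow> 0 < D j"
    "\<And>j i. j < n \<Longrightarrow> i \<le> D j \<Longrightarrow> p j i \<in> polys A"
    "\<And>j. j < n \<Longrightarrow> (\<Sum>i\<le>D j. p j i * x j ^ i) \<in> P" "\<And>j. j < n \<Longrightarrow> p j (D j) \<noteq> 0"
    using Rel by (auto simp: Rel_def)
  define c where "c = (\<Prod>j<n. p j (D j))"
  have cA: "c \<in> polys A"
  proof -
    have "(\<Prod>j\<in>T. p j (D j)) \<in> polys A" if "T \<subseteq> {..<n}" for T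
      using finite_subset[OF that finite_lessThan] that
      by (induction T rule: finite_induct) (auto intro!: polys.mult_C p(2))
    then show ?thesis by (auto simp: c_def)
  qed
  have c0: "c \<noteq> 0" using p(4) by (simp add: c_def)
  have cS: "c \<in> ?S" using cA AS by blast
  define E where "E = {m \<in> M. \<forall>j\<in>{..<n}. cf m j \<in> {..<D j}}"
  have finE: "finite E" unfolding E_def using card_mons_box[of "{..<n}" "\<lambda>j. {..<D j}"] by simp
  have zeroE: "0 \<in> E" using p(1) by (auto simp: E_def)
  \<comment> \<open>the \<open>K[x\<^sub>A]\<close>-module generated by \<open>E\<close> and \<open>P\<close>; every element gets into it after
    multiplication by a power of \<open>c\<close>\<close>
  define Sp where "Sp = {y \<in> ?S. \<exists>q. (\<forall>e\<in>E. q e \<in> polys A) \<and> y - (\<Sum>e\<in>E. q e * term_of e 1) \<in> P}"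
  have Sp_add: "y + z \<in> Sp" if yz: "y \<in> Sp" "z \<in> Sp" for y z
  proof -
    obtain q r where *: "\<forall>e\<in>E. q e \<in> polys A" "y - (\<Sum>e\<in>E. q e * term_of e 1) \<in> P"
      "\<forall>e\<in>E. r e \<in> polys A" "z - (\<Sum>e\<in>E. r e * term_of e 1) \<in> P"
      using yz by (auto simp: Sp_def)
    have "y + z - (\<Sum>e\<in>E. (q e + r e) * term_of e 1) =
      (y - (\<Sum>e\<in>E. q e * term_of e 1)) + (z - (\<Sum>e\<in>E. r e * term_of e 1))"
      by (simp add: algebra_simps sum.distrib)
    also have "\<dots> \<in> P" using * ideal_inD(3)[OF idP] by blast
    finally show ?thesis
      using yz * polys.add_C unfolding Sp_def by (intro CollectI conjI exI[of _ "\<lambda>e. q e + r e"]) auto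
  qed
  have Sp_mult: "b * y \<in> Sp" if b: "b \<in> polys A" and y: "y \<in> Sp" for b y
  proof -
    obtain q where *: "\<forall>e\<in>E. q e \<in> polys A" "y - (\<Sum>e\<in>E. q e * term_of e 1) \<in> P"
      using y by (auto simp: Sp_def)
    have "b * y - (\<Sum>e\<in>E. (b * q e) * term_of e 1) = b * (y - (\<Sum>e\<in>E. q e * term_of e 1))"
      by (simp add: algebra_simps sum_distrib_left)
    also have "\<dots> \<in> P" using * b AS ideal_inD(4)[OF idP] by blast
    finally show ?thesis
      using y b AS * polys.mult_C unfolding Sp_def
      by (intro CollectI conjI exI[of _ "\<lambda>e. b * q e"]) auto
  qed
  have Sp_P: "y \<in> Sp" if "y \<in> P" for y
    unfolding Sp_def using that ideal_inD(1)[OF idP] by (auto intro!: exI[of _ "\<lambda>e. 0"])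
  have Sp_E: "term_of e 1 \<in> Sp" if "e \<in> E" for e
  proof -
    have "(\<Sum>e'\<in>E. (if e' = e then 1 else 0) * term_of e' (1::'k)) = (\<Sum>e'\<in>E. if e' = e then term_of e' 1 else 0)"
      by (intro sum.cong) auto
    also have "\<dots> = term_of e 1" using that finE by simp
    finally have "term_of e 1 - (\<Sum>e'\<in>E. (if e' = e then 1 else 0) * term_of e' (1::'k)) \<in> P"
      using ideal_inD(2)[OF idP] by simp
    moreover have "term_of e 1 \<in> ?S" using that by (intro term_polys) (auto simp: E_def)
    ultimately show ?thesis unfolding Sp_def by (intro CollectI conjI exI[of _ "\<lambda>e'. if e' = e then 1 else 0"]) auto
  qed
  have Sp_zero: "0 \<in> Sp" using Sp_P ideal_inD(2)[OF idP] by blast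
  have Sp_sum: "sum g T \<in> Sp" if "\<And>i. i \<in> T \<Longrightarrow> g i \<in> Sp" for g and T :: "'i set"
    using that by (induction T rule: infinite_finite_induct) (auto simp: Sp_zero Sp_add)
  have Sp_sub: "Sp \<subseteq> ?S" by (auto simp: Sp_def)
  have Sp_xE: "c * (x j * term_of e 1) \<in> Sp" if j: "j < n" and e: "e \<in> E" for j e
  proof -
    have x_e: "x j * term_of e 1 = term_of (term_of j 1 + e) 1" by (simp add: x_def mult_single)
    show ?thesis
    proof (cases "cf e j + 1 < D j")
      case True
      moreover have "term_of j 1 + e \<in> M"
        using e j by (intro mons_add) (auto simp: mons_def E_def)
      ultimately have "term_of j 1 + e \<in> E"
        using e unfolding E_def by (auto simp: lookup_add lookup_single when_def)
      then show ?thesis using Sp_mult[OF cA Sp_E] x_e by simp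
    next
      case False
      moreover have "cf e j < D j" using e j by (auto simp: E_def)
      ultimately have ej: "cf e j = D j - 1" by simp
      define e' where "e' = e - term_of j (D j - 1)"
      have e_eq: "e = term_of j (D j - 1) + e'"
        by (rule poly_mapping_eqI) (use ej in \<open>auto simp: e'_def lookup_add lookup_minus lookup_single when_def\<close>)
      have xpow: "x j ^ i = term_of (term_of j i) 1" for i
        by (induction i) (simp_all add: x_def mult_single single_add[symmetric])
      have cfe': "cf e' j = 0" using ej by (simp add: e'_def lookup_minus)
      have e'M: "e' \<in> M" using e e_eq mons_add_iff by (metis (no_types, lifting) E_def mem_Collect_eq)
      have inE: "term_of j i + e' \<in> E" if "i < D j" for i
      proof -
        have "cf (term_of j i + e') k \<in> {..<D k}" if "k \<in> {..<n}" for k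
          using \<open>i < D j\<close> e cfe' that
          by (cases "k = j") (auto simp: E_def lookup_add lookup_single when_def e'_def lookup_minus intro: le_less_trans)
        moreover have "term_of j i + e' \<in> M" using e'M j by (intro mons_add) (auto simp: mons_def)
        ultimately show ?thesis by (auto simp: E_def)
      qed
      have x_e': "x j * term_of e 1 = x j ^ D j * term_of e' 1"
      proof -
        have "x j * term_of e 1 = x j * (x j ^ (D j - 1) * term_of e' 1)"
          unfolding xpow mult_single e_eq[symmetric] by simp
        also have "\<dots> = x j ^ Suc (D j - 1) * term_of e' 1" by (simp add: mult.assoc)
        finally show ?thesis using p(1)[OF j] by simp
      qed
      have "(\<Sum>i\<le>D j. p j i * x j ^ i) * term_of e' 1 \<in> Sp"
        using e'M by (intro Sp_P ideal_inD(5)[OF idP] p(3) j term_polys)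
      moreover have "(\<Sum>i<D j. (- 1 * p j i) * (x j ^ i * term_of e' 1)) \<in> Sp"
      proof (rule Sp_sum)
        fix i assume "i \<in> {..<D j}"
        then have "x j ^ i * term_of e' 1 \<in> Sp" using Sp_E[OF inE[of i]] by (simp add: xpow mult_single)
        then show "(- 1 * p j i) * (x j ^ i * term_of e' 1) \<in> Sp"
            using p(2)[OF j, of i] \<open>i \<in> {..<D j}\<close> by - (rule Sp_mult[rotated], auto)
      qed
      ultimately have "(\<Sum>i\<le>D j. p j i * x j ^ i) * term_of e' 1 +
          (\<Sum>i<D j. (- 1 * p j i) * (x j ^ i * term_of e' 1)) \<in> Sp" by (rule Sp_add)
      moreover have "(\<Sum>i\<le>D j. p j i * x j ^ i) * term_of e' 1 +
          (\<Sum>i<D j. (- 1 * p j i) * (x j ^ i * term_of e' 1)) = p j (D j) * (x j ^ D j * term_of e' 1)"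
        by (simp add: lessThan_Suc_atMost[symmetric] algebra_simps sum_distrib_left sum_negf)
      ultimately have "p j (D j) * (x j * term_of e 1) \<in> Sp" by (simp add: x_e')
      moreover have "(\<Prod>k\<in>{..<n} - {j}. p k (D k)) \<in> polys A"
      proof -
        have "(\<Prod>k\<in>T. p k (D k)) \<in> polys A" if "T \<subseteq> {..<n}" for T
          using finite_subset[OF that finite_lessThan] that
          by (induction T rule: finite_induct) (auto intro!: polys.mult_C p(2))
        then show ?thesis by auto
      qed
      ultimately have "(\<Prod>k\<in>{..<n} - {j}. p k (D k)) * (p j (D j) * (x j * term_of e 1)) \<in> Sp"
        by (rule Sp_mult[rotated])
      moreover have "c = p j (D j) * (\<Prod>k\<in>{..<n} - {j}. p k (D k))"
        unfolding c_def using j by (intro prod.remove) auto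
      ultimately show ?thesis by (simp add: algebra_simps)
    qed
  qed
  have Sp_x: "c * (x j * y) \<in> Sp" if j: "j < n" and y: "y \<in> Sp" for j y
  proof -
    obtain q where q: "\<forall>e\<in>E. q e \<in> polys A" "y - (\<Sum>e\<in>E. q e * term_of e 1) \<in> P"
      using y by (auto simp: Sp_def)
    have "(c * x j) * (y - (\<Sum>e\<in>E. q e * term_of e 1)) \<in> Sp"
      using q cS xS[OF j] by (intro Sp_P ideal_inD(4)[OF idP] polys.mult_C) auto
    moreover have "(\<Sum>e\<in>E. q e * (c * (x j * term_of e 1))) \<in> Sp"
      using q Sp_xE[OF j] by - (rule Sp_sum, rule Sp_mult, auto)
    ultimately have "(c * x j) * (y - (\<Sum>e\<in>E. q e * term_of e 1)) + (\<Sum>e\<in>E. q e * (c * (x j * term_of e 1))) \<in> Sp"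
      by (rule Sp_add)
    moreover have "(\<Sum>e\<in>E. q e * (c * (x j * term_of e 1))) = (c * x j) * (\<Sum>e\<in>E. q e * term_of e 1)"
      by (simp add: sum_distrib_left algebra_simps)
    ultimately show ?thesis by (simp add: algebra_simps)
  qed
  have up: "c ^ (k + i) * y \<in> Sp" if "c ^ k * y \<in> Sp" for k i y
    using that
  proof (induction i)
    case (Suc i)
    then show ?case using Sp_mult[OF cA, of "c ^ (k + i) * y"] by (simp add: algebra_simps)
  qed simp
  have mono_Sp: "\<exists>k. c ^ k * term_of m 1 \<in> Sp" if "m \<in> M" for m
    using that
  proof (induction m rule: monomial_induct)
    case zero
    show ?case using Sp_E[OF zeroE] by (intro exI[of _ 0]) simp
  next
    case (step m j)
    then obtain k where "c ^ k * term_of m 1 \<in> Sp" by blast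
    then have "c * (x j * (c ^ k * term_of m 1)) \<in> Sp" using Sp_x step by blast
    moreover have "c * (x j * (c ^ k * term_of m 1)) = c ^ Suc k * term_of (term_of j 1 + m) 1"
      using mult_single[of "term_of j 1" "1::'k" m 1] by (simp add: x_def algebra_simps)
    ultimately show ?case by (intro exI[of _ "Suc k"]) simp
  qed
  have all_Sp: "\<exists>k. c ^ k * y \<in> Sp" if y: "y \<in> ?S" for y
  proof -
    have "\<exists>k. c ^ k * (\<Sum>m\<in>T. term_of m (cf y m)) \<in> Sp" if "T \<subseteq> supp y" for T
      using finite_subset[OF that finite_keys] that
    proof (induction T rule: finite_induct)
      case empty
      then show ?case using Sp_zero by simp
    next
      case (insert m T)
      obtain k where k: "c ^ k * (\<Sum>m\<in>T. term_of m (cf y m)) \<in> Sp" using insert by auto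
      have "m \<in> M" using insert y polysD by blast
      then obtain l where l: "c ^ l * term_of m 1 \<in> Sp" using mono_Sp by blast
      have "term_of 0 (cf y m) * (c ^ (l + k) * term_of m 1) \<in> Sp"
        by (rule Sp_mult[OF term_polys up[OF l]]) simp
      moreover have "term_of 0 (cf y m) * (c ^ (l + k) * term_of m 1) = c ^ (l + k) * term_of m (cf y m)"
      proof -
        have "term_of 0 (cf y m) * term_of m 1 = term_of m (cf y m)" by (simp add: mult_single)
        then show ?thesis by (metis mult.left_commute)
      qed
      ultimately have "c ^ (l + k) * term_of m (cf y m) + c ^ (k + l) * (\<Sum>m\<in>T. term_of m (cf y m)) \<in> Sp"
        using Sp_add up[OF k, of l] by simp
      then show ?case using insert by (intro exI[of _ "k + l"]) (simp add: algebra_simps)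
    qed
    then show ?thesis using poly_expand[of y] by (metis order_refl)
  qed
  define f where "f = 1 + x a * c"
  have an: "a < n" using a A by auto
  have xaA: "x a \<in> polys A" unfolding x_def using a by (intro term_polys) (auto simp: mons_def)
  have fA: "f \<in> polys A" unfolding f_def using xaA cA by (intro polys.add_C polys.mult_C polys.one_C)
  have fS: "f \<in> ?S" using fA AS by blast
  \<comment> \<open>ordering monomials by their degree in \<open>x\<^sub>a\<close> first makes this degree additive\<close>
  let ?lt = "\<lambda>u v. wdeg n (\<lambda>i. if i = a then 1 else 0) u < wdeg n (\<lambda>i. if i = a then 1 else 0) v \<or>
      (wdeg n (\<lambda>i. if i = a then 1 else 0) u = wdeg n (\<lambda>i. if i = a then 1 else 0) v \<and> lt u v)"
  interpret X: monomial_ordering n ?lt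
    by unfold_locales (rule monomial_order_wdeg[OF monomial_order])
  have wd: "wdeg n (\<lambda>i. if i = a then 1 else 0) m = cf m a" for m
  proof -
    have "wdeg n (\<lambda>i. if i = a then 1 else 0) m = (\<Sum>i<n. if i = a then cf m i else 0)"
      unfolding wdeg_def by (intro sum.cong) auto
    then show ?thesis using an by simp
  qed
  have x0: "x a \<noteq> 0" unfolding x_def by (rule term_nonzero)
  have f_top: "\<exists>m\<in>supp f. 1 \<le> cf m a"
  proof -
    have "x a * c \<noteq> 0" using x0 c0 by simp
    then obtain m where m: "m \<in> supp (x a * c)" by (metis poly_expand sum.empty ex_in_conv)
    then obtain u where "m = term_of a 1 + u" using supp_term_mult[of "term_of a 1" 1 c] by (auto simp: x_def)
    then have "1 \<le> cf m a" by (simp add: lookup_add)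
    moreover from this have "m \<noteq> 0" by auto
    then have "cf f m = cf (x a * c) m" by (simp add: f_def lookup_add lookup_one)
    then have "m \<in> supp f" using m by (simp add: in_keys_iff)
    ultimately show ?thesis by blast
  qed
  then have f0: "f \<noteq> 0" by auto
  have not_dvd: False if s: "s \<in> polys (A - {a})" "s \<noteq> 0" and z: "z \<in> polys A" and eq: "s = f * z" for s z
  proof -
    have sub: "polys (A - {a}) \<subseteq> ?S" using A(1) by (intro polys_mono) auto
    have zS: "z \<in> ?S" "s \<in> ?S" using z AS s sub by blast+
    have z0: "z \<noteq> 0" using s eq by auto
    obtain m where m: "m \<in> supp f" "1 \<le> cf m a" using f_top by blast
    define l where "l = X.lead f"
    have "m = l \<or> ?lt m l" using X.lead(2)[OF fS f0 m(1)] by (simp only: X.le_def l_def)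
    then have "1 \<le> cf l a" using m(2) unfolding wd by auto
    then have "1 \<le> cf (X.lead f) a" by (simp only: l_def)
    moreover have "X.lead s = X.lead f + X.lead z" unfolding eq by (rule X.lead_mult[OF fS zS(1) f0 z0])
    ultimately have "1 \<le> cf (X.lead s) a" by (simp add: lookup_add)
    moreover have "X.lead s \<in> mons (A - {a})" using X.lead(1)[OF zS(2) s(2)] s(1) polysD by blast
    then have "cf (X.lead s) a = 0" by (auto simp: mons_def in_keys_iff)
    ultimately show False by simp
  qed
  have not_dvd_c: False if s: "s \<in> polys (A - {a})" "s \<noteq> 0" and z: "z \<in> polys A" and eq: "(s * c ^ t) ^ r = f * z"
    for s z t r
  proof -
    have s_r: "s ^ r \<in> polys (A - {a})" "s ^ r \<noteq> 0" using s polys.power_C by auto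
    define k where "k = t * r"
    have eq': "s ^ r * c ^ k = f * z" using eq by (simp add: k_def power_mult_distrib power_mult)
    \<comment> \<open>\<open>x a * c\<close> is congruent to \<open>- 1\<close> modulo \<open>f\<close>\<close>
    have dv: "\<exists>y\<in>polys A. (x a * c) ^ i - (- 1) ^ i = f * y" for i
    proof (induction i)
      case 0
      show ?case by (intro bexI[of _ 0]) auto
    next
      case (Suc i)
      then obtain y where y: "y \<in> polys A" "(x a * c) ^ i - (- 1) ^ i = f * y" by blast
      have "(x a * c) ^ Suc i - (- 1) ^ Suc i = (x a * c) * ((x a * c) ^ i - (- 1) ^ i) + (- 1) ^ i * f"
        by (simp add: f_def algebra_simps)
      also have "\<dots> = f * ((x a * c) * y + (- 1) ^ i)" unfolding y(2) by (simp add: algebra_simps)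
      finally show ?case
        using y xaA cA by (intro bexI[of _ "(x a * c) * y + (- 1) ^ i"]) (auto intro!: polys.add_C polys.mult_C polys.power_C polys.uminus_C)
    qed
    then obtain y where y: "y \<in> polys A" "(x a * c) ^ k - (- 1) ^ k = f * y" by blast
    have "(- 1) ^ k * s ^ r = (x a * c) ^ k * s ^ r - ((x a * c) ^ k - (- 1) ^ k) * s ^ r"
      by (simp add: algebra_simps)
    also have "(x a * c) ^ k * s ^ r = x a ^ k * (s ^ r * c ^ k)" by (simp add: power_mult_distrib algebra_simps)
    also have "\<dots> = f * (x a ^ k * z)" unfolding eq' by (simp add: algebra_simps)
    also have "f * (x a ^ k * z) - ((x a * c) ^ k - (- 1) ^ k) * s ^ r = f * (x a ^ k * z - y * s ^ r)"
      unfolding y(2) by (simp add: algebra_simps)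
    finally have e1: "(- 1) ^ k * s ^ r = f * (x a ^ k * z - y * s ^ r)" .
    have sA: "s \<in> polys A" using s polys_mono[of "A - {a}" A] by blast
    show False
    proof (rule not_dvd[OF _ _ _ e1])
      show "(- 1) ^ k * s ^ r \<in> polys (A - {a})"
        using s_r by (intro polys.mult_C polys.power_C[of "- 1"] polys.uminus_C polys.one_C)
      show "(- 1) ^ k * s ^ r \<noteq> 0" using s_r by simp
      show "x a ^ k * z - y * s ^ r \<in> polys A"
        using xaA z y sA by (intro polys.minus_C polys.mult_C polys.power_C)
    qed
  qed
  have idf: "ideal_in ?S (adjoin ?S P f)" by (rule polys.ideal_adjoin[OF idP fS])
  have indep: "s = 0" if s: "s \<in> polys (A - {a})" "s \<in> adjoin ?S P f" for s
  proof (rule ccontr)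
    assume s0: "s \<noteq> 0"
    have sA: "s \<in> polys A" using s polys_mono[of "A - {a}" A] by blast
    obtain y g where yg: "y \<in> P" "g \<in> ?S" "s = y + g * f" using s(2) by (auto simp: adjoin_def)
    have "\<exists>k. c ^ k * (g * term_of e 1) \<in> Sp" if "e \<in> E" for e
      using that yg by (intro all_Sp polys.mult_C term_polys) (auto simp: E_def)
    then obtain k where k: "\<And>e. e \<in> E \<Longrightarrow> c ^ k e * (g * term_of e 1) \<in> Sp" by metis
    define t where "t = (\<Sum>e\<in>E. k e)"
    have "c ^ t * (g * term_of e 1) \<in> Sp" if "e \<in> E" for e
    proof -
      have "k e \<le> t" unfolding t_def using finE that by (intro member_le_sum) auto
      then show ?thesis using up[OF k[OF that], of "t - k e"] by simp
    qed
    moreover define Rq where "Rq e q \<longleftrightarrow> (\<forall>e'\<in>E. q e' \<in> polys A) \<and>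
      c ^ t * (g * term_of e 1) - (\<Sum>e'\<in>E. q e' * term_of e' 1) \<in> P" for e q
    ultimately have "\<exists>q. Rq e q" if "e \<in> E" for e using that by (simp add: Sp_def)
    then obtain q where "\<And>e. e \<in> E \<Longrightarrow> Rq e (q e)" by metis
    then have q: "\<And>e e'. e \<in> E \<Longrightarrow> e' \<in> E \<Longrightarrow> q e e' \<in> polys A"
      "\<And>e. e \<in> E \<Longrightarrow> c ^ t * (g * term_of e 1) - (\<Sum>e'\<in>E. q e e' * term_of e' 1) \<in> P"
      by (auto simp: Rq_def)
    define \<sigma> where "\<sigma> = s * c ^ t"
    have \<sigma>A: "\<sigma> \<in> polys A" unfolding \<sigma>_def using sA cA by (intro polys.mult_C polys.power_C)
    define U where "U k = {\<sigma> ^ (2 ^ k) + f * z | z. z \<in> polys A}" for k :: nat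
    define Z where "Z k = {f * z | z. z \<in> polys A}" for k :: nat
    have UA: "U k \<subseteq> polys A" "Z k \<subseteq> polys A" for k
      unfolding U_def Z_def using \<sigma>A fA by (auto intro!: polys.add_C polys.mult_C polys.power_C)
    have "\<forall>e\<in>E. term_of e 1 \<in> P"
    proof (rule polys.elimination[OF idP finE, of U Z _ "\<lambda>e e'. (if e = e' then \<sigma> else 0) - f * q e e'" 0])
      show "U k \<subseteq> ?S" "Z k \<subseteq> ?S" for k using UA AS by blast+
      show "y \<in> P" if u: "u \<in> U k" "y \<in> ?S" "u * y \<in> P" for k u y
      proof (rule ccontr)
        assume "y \<notin> P"
        then have "u \<in> P" using prime_inD(3)[OF P u(3)] u UA(1)[of k] AS by blast
        then have "u = 0" using alg_independentD[OF A(2)] u UA by blast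
        then obtain z where z: "z \<in> polys A" "\<sigma> ^ (2 ^ k) + f * z = 0" using u by (auto simp: U_def)
        then have "(s * c ^ t) ^ (2 ^ k) = f * (- z)" by (simp add: \<sigma>_def eq_neg_iff_add_eq_0)
        then show False using not_dvd_c[OF s(1) s0 polys.uminus_C[OF z(1)]] by blast
      qed
      show "u * u' - z * z' \<in> U (Suc k)" if uz: "u \<in> U k" "u' \<in> U k" "z \<in> Z k" "z' \<in> Z k" for k u u' z z'
      proof -
        obtain b b' d d' where *: "u = \<sigma> ^ (2 ^ k) + f * b" "u' = \<sigma> ^ (2 ^ k) + f * b'" "z = f * d" "z' = f * d'"
          "b \<in> polys A" "b' \<in> polys A" "d \<in> polys A" "d' \<in> polys A" using uz by (auto simp: U_def Z_def)
        have "u * u' - z * z' = \<sigma> ^ (2 ^ Suc k) + f * (\<sigma> ^ (2 ^ k) * b' + \<sigma> ^ (2 ^ k) * b + f * b * b' - f * d * d')"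
          unfolding * by (simp add: algebra_simps mult_2 power_add)
        moreover have "\<sigma> ^ (2 ^ k) * b' + \<sigma> ^ (2 ^ k) * b + f * b * b' - f * d * d' \<in> polys A"
          using * \<sigma>A fA by (intro polys.add_C polys.minus_C polys.mult_C polys.power_C)
        ultimately show ?thesis unfolding U_def by blast
      qed
      show "u * z - z' * z'' \<in> Z (Suc k)" if uz: "u \<in> U k" "z \<in> Z k" "z' \<in> Z k" "z'' \<in> Z k" for k u z z' z''
      proof -
        obtain d where d: "z = f * d" "d \<in> polys A" using uz(2) unfolding Z_def by blast
        obtain d' where d': "z' = f * d'" "d' \<in> polys A" using uz(3) unfolding Z_def by blast
        obtain d'' where d'': "z'' = f * d''" "d'' \<in> polys A" using uz(4) unfolding Z_def by blast
        have "u \<in> polys A" using uz(1) UA(1)[of k] by blast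
        note * = d(1) d'(1) d''(1) this d(2) d'(2) d''(2)
        have "u * z - z' * z'' = f * (u * d - f * d' * d'')" unfolding * by (simp add: algebra_simps)
        moreover have "u * d - f * d' * d'' \<in> polys A" using * fA by (intro polys.minus_C polys.mult_C)
        ultimately show ?thesis unfolding Z_def by blast
      qed
      show "term_of e 1 \<in> ?S" if "e \<in> E" for e using that by (intro term_polys) (auto simp: E_def)
      show "(if e = e' then \<sigma> else 0) - f * q e e' \<in> (if e = e' then U 0 else Z 0)"
        if "e \<in> E" "e' \<in> E" for e e'
      proof -
        have "- q e e' \<in> polys A" using q(1)[OF that] by (rule polys.uminus_C)
        moreover have "\<sigma> - f * q e e' = \<sigma> ^ 2 ^ 0 + f * (- q e e')" "0 - f * q e e' = f * (- q e e')" by simp_all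
        ultimately have "\<sigma> - f * q e e' \<in> U 0" "0 - f * q e e' \<in> Z 0" unfolding U_def Z_def by blast+
        then show ?thesis by (cases "e = e'") simp_all
      qed
      show "(\<Sum>e'\<in>E. ((if e = e' then \<sigma> else 0) - f * q e e') * term_of e' 1) \<in> P" if e: "e \<in> E" for e
      proof -
        have "(\<Sum>e'\<in>E. ((if e = e' then \<sigma> else 0) - f * q e e') * term_of e' 1) =
          (\<Sum>e'\<in>E. (if e = e' then \<sigma> * term_of e' 1 else 0)) - f * (\<Sum>e'\<in>E. q e e' * term_of e' 1)"
          unfolding sum_distrib_left sum_subtractf[symmetric]
          by (intro sum.cong refl) (auto simp: algebra_simps)
        also have "\<dots> = \<sigma> * term_of e 1 - f * (\<Sum>e'\<in>E. q e e' * term_of e' 1)" using e finE by simp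
        also have "\<dots> = (c ^ t * term_of e 1) * y +
            f * (c ^ t * (g * term_of e 1) - (\<Sum>e'\<in>E. q e e' * term_of e' 1))"
          unfolding \<sigma>_def yg(3) by (simp add: algebra_simps)
        also have "\<dots> \<in> P"
          using e yg q(2)[OF e] cS fS
          by (intro ideal_inD(3,4)[OF idP] polys.mult_C polys.power_C term_polys) (auto simp: E_def)
        finally show ?thesis .
      qed
    qed
    then have "1 \<in> P" using zeroE by force
    then show False using prime_inD(2)[OF P] by blast
  qed
  define T where "T = polys (A - {a}) - {0 :: (nat \<Rightarrow>\<^sub>0 nat) \<Rightarrow>\<^sub>0 'k}"
  have T: "T \<subseteq> ?S" "1 \<in> T" "\<And>u v. u \<in> T \<Longrightarrow> v \<in> T \<Longrightarrow> u * v \<in> T" "adjoin ?S P f \<inter> T = {}"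
    using polys_mono[of "A - {a}" "{..<n}"] A(1) indep by (auto simp: T_def)
  obtain Q where Q: "prime_in ?S Q" "adjoin ?S P f \<subseteq> Q" "Q \<inter> T = {}"
    by (rule N.prime_avoiding_multiplicative_set[OF idf T])
  have "f \<in> Q" "P \<subseteq> Q" using Q(2) polys.adjoin_self[OF idP] polys.adjoin_superset by blast+
  moreover have "f \<notin> P" using alg_independentD[OF A(2) fA] f0 by blast
  ultimately show ?thesis using Q by (intro exI[of _ Q]) (auto simp: alg_independent_def T_def)
qed

text \<open>For a prime \<open>P\<close> this is the transcendence degree of the fraction field of \<open>S / P\<close>.  It also is the
  dimension of the initial ideal of \<open>P\<close>, by \<open>LM_free_le_affine_dim\<close> and \<open>LM_free_of_affine_dim\<close>.\<close>

definition affine_dim :: "((nat \<Rightarrow>\<^sub>0 nat) \<Rightarrow>\<^sub>0 'k::field) set \<Rightarrow> nat" where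
  "affine_dim P = Max {card A | A. A \<subseteq> {..<n} \<and> alg_independent A P}"

lemma finite_independent_cards: "finite {card A | A. A \<subseteq> {..<n} \<and> alg_independent A P}"
proof -
  have "finite (card ` Pow {..<n})" by simp
  then show ?thesis by (rule rev_finite_subset) auto
qed

lemma independent_le_affine_dim: "A \<subseteq> {..<n} \<Longrightarrow> alg_independent A P \<Longrightarrow> card A \<le> affine_dim P"
  unfolding affine_dim_def by (intro Max_ge finite_independent_cards) blast

lemma empty_independent:
  fixes P :: "((nat \<Rightarrow>\<^sub>0 nat) \<Rightarrow>\<^sub>0 'k::field) set"
  assumes P: "prime_in (polys {..<n}) P"
  shows "alg_independent {} P"
proof -
  have "p = 0" if p: "p \<in> polys {}" "p \<in> P" for p
  proof (rule ccontr)
    assume "p \<noteq> 0"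
    have "supp p \<subseteq> {0}" using p(1) by (auto simp: polys_def mons_def)
    then have eq: "p = term_of 0 (cf p 0)"
      by (intro poly_mapping_eqI) (auto simp: lookup_single when_def in_keys_iff)
    then have "cf p 0 \<noteq> 0" using \<open>p \<noteq> 0\<close> by (metis single_zero)
    then have "term_of 0 (inverse (cf p 0)) * p = 1" by (subst eq) (simp add: mult_single)
    moreover have "term_of 0 (inverse (cf p 0)) * p \<in> P"
      using p by (intro ideal_inD(4)[OF prime_inD(1)[OF P]] term_polys) auto
    ultimately show False using prime_inD(2)[OF P] by simp
  qed
  then show ?thesis by (auto simp: alg_independent_def)
qed

lemma affine_dim_attained:
  fixes P :: "((nat \<Rightarrow>\<^sub>0 nat) \<Rightarrow>\<^sub>0 'k::field) set"
  assumes P: "prime_in (polys {..<n}) P"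
  obtains A where "A \<subseteq> {..<n}" "alg_independent A P" "card A = affine_dim P"
proof -
  have "{card A | A. A \<subseteq> {..<n} \<and> alg_independent A P} \<noteq> {}" using empty_independent[OF P] by blast
  from Max_in[OF finite_independent_cards this]
  have "affine_dim P \<in> {card A | A. A \<subseteq> {..<n} \<and> alg_independent A P}" by (simp only: affine_dim_def)
  then obtain A where "A \<subseteq> {..<n}" "alg_independent A P" "affine_dim P = card A" by blast
  then show thesis using that[of A] by simp
qed

lemma LM_free_le_affine_dim:
  assumes "B \<subseteq> {..<n}" "mons B \<inter> LM P = {}" shows "card B \<le> affine_dim P"
  using independent_le_affine_dim[OF assms(1)] LM_free_imp_independent[OF assms]
  by (auto simp: alg_independent_def)

lemma LM_free_of_affine_dim:
  fixes P :: "((nat \<Rightarrow>\<^sub>0 nat) \<Rightarrow>\<^sub>0 'k::field) set"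
  assumes P: "prime_in (polys {..<n}) P"
  obtains A where "A \<subseteq> {..<n}" "mons A \<inter> LM P = {}" "card A = affine_dim P"
proof -
  obtain B where B: "B \<subseteq> {..<n}" "alg_independent B P" "card B = affine_dim P"
    by (rule affine_dim_attained[OF P])
  obtain A where "A \<subseteq> {..<n}" "card A = card B" "mons A \<inter> LM P = {}"
    using LM_free_of_independent[OF prime_inD(1)[OF P] B(1,2)] by blast
  then show thesis using that[of A] B(3) by simp
qed

lemma affine_dim_strict_mono:
  fixes P Q :: "((nat \<Rightarrow>\<^sub>0 nat) \<Rightarrow>\<^sub>0 'k::field) set"
  assumes P: "prime_in (polys {..<n}) P" and Q: "prime_in (polys {..<n}) Q" and PQ: "P \<subset> Q"
  shows "affine_dim Q < affine_dim P"
proof -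
  obtain A where A: "A \<subseteq> {..<n}" "alg_independent A Q" "card A = affine_dim Q"
    using affine_dim_attained[OF Q] .
  then obtain B where B: "B \<subseteq> {..<n}" "card B = Suc (card A)" "alg_independent B P"
    using independent_set_grows[OF P Q PQ A(1,2)] by blast
  then show ?thesis using independent_le_affine_dim[OF B(1,3)] A(3) by simp
qed

lemma chain_of_affine_dim:
  fixes P :: "((nat \<Rightarrow>\<^sub>0 nat) \<Rightarrow>\<^sub>0 'k::field) set"
  assumes "prime_in (polys {..<n}) P"
  shows "\<exists>f. strict_chain (primes_over (polys {..<n}) P) (affine_dim P) f"
proof -
  have "\<exists>f. strict_chain (primes_over (polys {..<n}) P) d f"
    if "prime_in (polys {..<n}) P" "affine_dim P = d" for d and P :: "((nat \<Rightarrow>\<^sub>0 nat) \<Rightarrow>\<^sub>0 'k::field) set"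
    using that
  proof (induction d arbitrary: P)
    case 0
    then show ?case by (intro exI[of _ "\<lambda>i. P"]) (auto simp: strict_chain_def primes_over_def)
  next
    case (Suc d)
    obtain A where A: "A \<subseteq> {..<n}" "alg_independent A P" "card A = affine_dim P"
      using affine_dim_attained[OF Suc.prems(1)] .
    then obtain a where a: "a \<in> A" using Suc.prems by fastforce
    have finA: "finite A" using A finite_subset by blast
    have max: "\<not> (\<exists>B\<subseteq>{..<n}. card B = Suc (card A) \<and> mons B \<inter> LM P = {})"
    proof
      assume "\<exists>B\<subseteq>{..<n}. card B = Suc (card A) \<and> mons B \<inter> LM P = {}"
      then obtain B where B: "B \<subseteq> {..<n}" "card B = Suc (card A)" "mons B \<inter> LM P = {}" by blast
      then show False using LM_free_le_affine_dim[OF B(1,3)] A(3) by simp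
    qed
    obtain Q where Q: "prime_in (polys {..<n}) Q" "P \<subset> Q" "alg_independent (A - {a}) Q"
      using larger_prime_with_independent_set[OF Suc.prems(1) A(1,2) a max] by blast
    have "affine_dim Q = d"
    proof -
      have "card (A - {a}) \<le> affine_dim Q" using A Q by (intro independent_le_affine_dim) auto
      then have "d \<le> affine_dim Q" using A a Suc.prems finA by simp
      moreover have "affine_dim Q < Suc d" using affine_dim_strict_mono[OF Suc.prems(1) Q(1,2)] Suc.prems by simp
      ultimately show ?thesis by simp
    qed
    then obtain f where f: "strict_chain (primes_over (polys {..<n}) Q) d f" using Suc.IH Q by blast
    have "strict_chain (primes_over (polys {..<n}) P) (Suc d) (\<lambda>i. case i of 0 \<Rightarrow> P | Suc j \<Rightarrow> f j)"
      unfolding strict_chain_def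
    proof (intro conjI allI impI)
      fix i
      show "(case i of 0 \<Rightarrow> P | Suc j \<Rightarrow> f j) \<in> primes_over (polys {..<n}) P" if "i \<le> Suc d"
        using that f Suc.prems(1) Q(2) by (cases i) (auto simp: strict_chain_def primes_over_def)
      show "(case i of 0 \<Rightarrow> P | Suc j \<Rightarrow> f j) \<subset> (case Suc i of 0 \<Rightarrow> P | Suc j \<Rightarrow> f j)" if "i < Suc d"
      proof (cases i)
        case 0
        have "Q \<subseteq> f 0" using f by (auto simp: strict_chain_def primes_over_def)
        then show ?thesis using 0 Q(2) by auto
      qed (use that f in \<open>auto simp: strict_chain_def\<close>)
    qed
    then show ?case by blast
  qed
  then show ?thesis using assms by blast
qed

lemma chain_length_le_affine_dim:
  fixes P :: "((nat \<Rightarrow>\<^sub>0 nat) \<Rightarrow>\<^sub>0 'k::field) set"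
  assumes P: "prime_in (polys {..<n}) P" and f: "strict_chain (primes_over (polys {..<n}) P) k f"
  shows "k \<le> affine_dim P"
proof -
  have pr: "prime_in (polys {..<n}) (f i)" "P \<subseteq> f i" if "i \<le> k" for i
    using f that by (auto simp: strict_chain_def primes_over_def)
  have "i \<le> k \<Longrightarrow> i \<le> affine_dim (f (k - i))" for i
  proof (induction i)
    case (Suc i)
    then have "f (k - Suc i) \<subset> f (Suc (k - Suc i))" using f by (simp add: strict_chain_def)
    moreover have "Suc (k - Suc i) = k - i" using Suc.prems by simp
    ultimately have "affine_dim (f (k - i)) < affine_dim (f (k - Suc i))"
      using pr by (intro affine_dim_strict_mono) auto
    then show ?case using Suc by simp
  qed simp
  from this[of k] have "k \<le> affine_dim (f 0)" by simp
  moreover have "affine_dim (f 0) \<le> affine_dim P"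
    using affine_dim_strict_mono[OF P pr(1)[of 0]] pr(2)[of 0] by (cases "P = f 0") (simp_all add: psubset_eq)
  ultimately show ?thesis by simp
qed

text \<open>The Krull dimension of \<open>S / P\<close> is its transcendence degree: chains are not longer because
  \<open>affine_dim\<close> drops at each step, and a chain in which it drops by one at each step exists by
  \<open>larger_prime_with_independent_set\<close>.\<close>

lemma Sup_chain_lengths:
  fixes P :: "((nat \<Rightarrow>\<^sub>0 nat) \<Rightarrow>\<^sub>0 'k::field) set"
  assumes P: "prime_in (polys {..<n}) P"
  shows "Sup {enat k | k f. strict_chain (primes_over (polys {..<n}) P) k f} = enat (affine_dim P)"
proof (rule Sup_eqI)
  show "y \<le> enat (affine_dim P)" if "y \<in> {enat k | k f. strict_chain (primes_over (polys {..<n}) P) k f}" for y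
    using that chain_length_le_affine_dim[OF P] by auto
  show "enat (affine_dim P) \<le> y"
    if "\<And>z. z \<in> {enat k | k f. strict_chain (primes_over (polys {..<n}) P) k f} \<Longrightarrow> z \<le> y" for y
    using that chain_of_affine_dim[OF P] by blast
qed

end


section \<open>Extension of the ground field\<close>

lemma cf_mult_superset:
  fixes p q :: "(nat \<Rightarrow>\<^sub>0 nat) \<Rightarrow>\<^sub>0 'k::field"
  assumes "finite A" "finite B" "supp p \<subseteq> A" "supp q \<subseteq> B"
  shows "cf (p * q) m = (\<Sum>a\<in>A. \<Sum>b\<in>B. if a + b = m then cf p a * cf q b else 0)"
proof -
  have "cf (p * q) m = (\<Sum>a\<in>supp p. \<Sum>b\<in>B. if a + b = m then cf p a * cf q b else 0)"
    unfolding cf_mult using assms by (intro sum.cong refl sum.mono_neutral_left) (auto simp: in_keys_iff)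
  also have "\<dots> = (\<Sum>a\<in>A. \<Sum>b\<in>B. if a + b = m then cf p a * cf q b else 0)"
    using assms by (intro sum.mono_neutral_left) (auto simp: in_keys_iff intro!: sum.neutral)
  finally show ?thesis .
qed

lemma strict_chain_primes_over_iff:
  "strict_chain (primes_over C J) k f \<longleftrightarrow> chain_in C k f \<and> J \<subseteq> f 0"
proof
  assume "chain_in C k f \<and> J \<subseteq> f 0"
  moreover from this have "J \<subseteq> f i" if "i \<le> k" for i using chain_in_mono[of C k f 0 i] that by auto
  ultimately show "strict_chain (primes_over C J) k f"
    by (auto simp: strict_chain_def chain_in_def primes_over_def)
qed (auto simp: strict_chain_def chain_in_def primes_over_def)

locale field_embedding =
  fixes \<phi> :: "'k::field \<Rightarrow> 'l::field"
  assumes \<phi>_add: "\<phi> (a + b) = \<phi> a + \<phi> b" and \<phi>_mult: "\<phi> (a * b) = \<phi> a * \<phi> b" and \<phi>_one: "\<phi> 1 = 1"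
begin

lemma \<phi>_zero [simp]: "\<phi> 0 = 0"
proof -
  have "\<phi> 0 = \<phi> 0 + \<phi> 0" using \<phi>_add[of 0 0] by (simp only: add_0_left)
  then show ?thesis by (simp only: add_cancel_right_right)
qed

lemma \<phi>_eq_zero_iff [simp]: "\<phi> a = 0 \<longleftrightarrow> a = 0"
proof
  assume *: "\<phi> a = 0"
  show "a = 0"
  proof (rule ccontr)
    assume "a \<noteq> 0"
    then have "\<phi> (a * inverse a) = 1" by (simp add: \<phi>_one)
    then show False using * by (simp add: \<phi>_mult)
  qed
qed simp

sublocale V: vector_space "\<lambda>a c. \<phi> a * c"
  by unfold_locales (simp_all add: \<phi>_add \<phi>_mult \<phi>_one algebra_simps)

definition basis :: "'l set" where "basis = V.extend_basis {}"

definition coord :: "'l \<Rightarrow> 'l \<Rightarrow> 'k" where "coord b c = V.representation basis c b"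

lemma basis: "V.independent basis" "V.span basis = UNIV"
  unfolding basis_def using V.independent_extend_basis[of "{}"] V.span_extend_basis[of "{}"] V.independent_empty
  by auto

lemma coord_add: "coord b (c + d) = coord b c + coord b d"
  using V.representation_add[OF basis(1), of d c] by (simp add: coord_def basis(2) add.commute)

lemma coord_scale: "coord b (\<phi> a * c) = a * coord b c"
  using V.representation_scale[OF basis(1), of c a] by (simp add: coord_def basis(2))

lemma coord_zero [simp]: "coord b 0 = 0"
  using coord_scale[of b 0 0] by simp

lemma coord_basis: "b \<in> basis \<Longrightarrow> coord c b = (if b = c then 1 else 0)"
  using V.representation_basis[OF basis(1), of b] by (simp add: coord_def)

lemma finite_coord: "finite {b. coord b c \<noteq> 0}"
  unfolding coord_def by (rule V.finite_representation)

lemma coord_in_basis: "coord b c \<noteq> 0 \<Longrightarrow> b \<in> basis"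
  unfolding coord_def by (rule V.representation_ne_zero)

lemma coord_expand:
  assumes "finite T" "{b. coord b c \<noteq> 0} \<subseteq> T"
  shows "(\<Sum>b\<in>T. \<phi> (coord b c) * b) = c"
proof -
  have "(\<Sum>b\<in>T. \<phi> (coord b c) * b) = (\<Sum>b | coord b c \<noteq> 0. \<phi> (coord b c) * b)"
    using assms by (intro sum.mono_neutral_right) auto
  also have "\<dots> = c"
    using V.sum_nonzero_representation_eq[OF basis(1), of c] by (simp add: coord_def basis(2))
  finally show ?thesis .
qed

definition extend :: "((nat \<Rightarrow>\<^sub>0 nat) \<Rightarrow>\<^sub>0 'k) \<Rightarrow> ((nat \<Rightarrow>\<^sub>0 nat) \<Rightarrow>\<^sub>0 'l)" where
  "extend p = Poly_Mapping.map \<phi> p"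

text \<open>The coefficient of the basis element \<open>b\<close> when \<open>S\<^sub>L\<close> is regarded as a free module over \<open>S\<^sub>K\<close>.\<close>

definition component :: "'l \<Rightarrow> ((nat \<Rightarrow>\<^sub>0 nat) \<Rightarrow>\<^sub>0 'l) \<Rightarrow> ((nat \<Rightarrow>\<^sub>0 nat) \<Rightarrow>\<^sub>0 'k)" where
  "component b g = Poly_Mapping.map (coord b) g"

lemma cf_extend [simp]: "cf (extend p) m = \<phi> (cf p m)"
  by (simp add: extend_def map.rep_eq when_def)

lemma cf_component [simp]: "cf (component b g) m = coord b (cf g m)"
  by (simp add: component_def map.rep_eq when_def)

lemma supp_extend [simp]: "supp (extend p) = supp p"
  by (auto simp: in_keys_iff)

lemma supp_component: "supp (component b g) \<subseteq> supp g"
  by (auto simp: in_keys_iff)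

lemma extend_polys [simp]: "extend p \<in> polys A \<longleftrightarrow> p \<in> polys A"
  by (simp add: polys_def)

lemma component_polys: "g \<in> polys A \<Longrightarrow> component b g \<in> polys A"
  using supp_component[of b g] by (auto simp: polys_def)

lemma extend_add: "extend (p + q) = extend p + extend q"
  by (rule poly_mapping_eqI) (simp add: lookup_add \<phi>_add)

lemma \<phi>_sum: "\<phi> (sum f T) = (\<Sum>i\<in>T. \<phi> (f i))"
  by (induction T rule: infinite_finite_induct) (simp_all add: \<phi>_add)

lemma coord_sum: "coord b (sum f T) = (\<Sum>i\<in>T. coord b (f i))"
  by (induction T rule: infinite_finite_induct) (simp_all add: coord_add)

lemma extend_mult: "extend (p * q) = extend p * extend q"
proof (rule poly_mapping_eqI)
  fix m
  show "cf (extend (p * q)) m = cf (extend p * extend q) m"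
    unfolding cf_extend cf_mult \<phi>_sum supp_extend by (intro sum.cong refl) (simp add: \<phi>_mult)
qed

lemma extend_zero [simp]: "extend 0 = 0"
  by (rule poly_mapping_eqI) simp

lemma extend_term: "extend (term_of m c) = term_of m (\<phi> c)"
  by (rule poly_mapping_eqI) (simp add: lookup_single when_def)

lemma extend_one [simp]: "extend 1 = 1"
  using extend_term[of 0 1] by (simp add: \<phi>_one)

lemma extend_sum: "extend (sum f T) = (\<Sum>i\<in>T. extend (f i))"
  by (induction T rule: infinite_finite_induct) (simp_all add: extend_add)

lemma extend_eq_iff [simp]: "extend p = extend q \<longleftrightarrow> p = q"
proof
  assume *: "extend p = extend q"
  show "p = q"
  proof (rule poly_mapping_eqI)
    fix m
    have "\<phi> (cf p m - cf q m) + \<phi> (cf q m) = \<phi> (cf p m)" using \<phi>_add[of "cf p m - cf q m" "cf q m"] by simp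
    moreover have "\<phi> (cf p m) = \<phi> (cf q m)" using * by (metis cf_extend)
    ultimately have "\<phi> (cf p m - cf q m) = 0" by simp
    then show "cf p m = cf q m" by simp
  qed
qed simp

lemma component_add: "component b (g + h) = component b g + component b h"
  by (rule poly_mapping_eqI) (simp add: lookup_add coord_add)

lemma component_zero [simp]: "component b 0 = 0"
  by (rule poly_mapping_eqI) simp

lemma component_sum: "component b (sum f T) = (\<Sum>i\<in>T. component b (f i))"
  by (induction T rule: infinite_finite_induct) (simp_all add: component_add)

lemma component_extend_mult: "component b (extend p * g) = p * component b g"
proof (rule poly_mapping_eqI)
  fix m
  have "cf (component b (extend p * g)) m =
      (\<Sum>a\<in>supp p. \<Sum>c\<in>supp g. coord b (if a + c = m then \<phi> (cf p a) * cf g c else 0))"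
    by (simp add: cf_mult coord_sum cong: if_cong)
  also have "\<dots> = (\<Sum>a\<in>supp p. \<Sum>c\<in>supp g. if a + c = m then cf p a * cf (component b g) c else 0)"
    by (intro sum.cong refl) (simp add: coord_scale)
  also have "\<dots> = cf (p * component b g) m"
    using cf_mult_superset[of "supp p" "supp g" p "component b g" m] supp_component by simp
  finally show "cf (component b (extend p * g)) m = cf (p * component b g) m" .
qed

lemma component_extend: "component b (extend p) = term_of 0 (coord b 1) * p"
proof -
  have "component b 1 = term_of 0 (coord b 1)"
    by (rule poly_mapping_eqI) (simp add: lookup_one lookup_single when_def)
  then show ?thesis using component_extend_mult[of b p 1] by (simp add: mult.commute)
qed

lemma component_support: "finite {b. component b g \<noteq> 0}" "{b. component b g \<noteq> 0} \<subseteq> basis"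
proof -
  have sub: "{b. component b g \<noteq> 0} \<subseteq> (\<Union>m\<in>supp g. {b. coord b (cf g m) \<noteq> 0})"
  proof
    fix b assume "b \<in> {b. component b g \<noteq> 0}"
    then obtain m where "cf (component b g) m \<noteq> 0" by (metis (full_types) lookup_zero mem_Collect_eq poly_mapping_eqI)
    then have m: "coord b (cf g m) \<noteq> 0" by simp
    then have "m \<in> supp g" by (metis coord_zero in_keys_iff)
    then show "b \<in> (\<Union>m\<in>supp g. {b. coord b (cf g m) \<noteq> 0})" using m by auto
  qed
  show "finite {b. component b g \<noteq> 0}" by (rule finite_subset[OF sub]) (simp add: finite_coord)
  show "{b. component b g \<noteq> 0} \<subseteq> basis" using sub coord_in_basis by fastforce
qed

lemma component_expand:
  assumes "finite T" "{b. component b g \<noteq> 0} \<subseteq> T"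
  shows "g = (\<Sum>b\<in>T. term_of 0 b * extend (component b g))"
proof (rule poly_mapping_eqI)
  fix m
  have "{b. coord b (cf g m) \<noteq> 0} \<subseteq> T"
  proof
    fix b assume "b \<in> {b. coord b (cf g m) \<noteq> 0}"
    then have "cf (component b g) m \<noteq> 0" by simp
    then have "component b g \<noteq> 0" by (metis lookup_zero)
    then show "b \<in> T" using assms by auto
  qed
  then have "cf g m = (\<Sum>b\<in>T. \<phi> (coord b (cf g m)) * b)" using coord_expand[OF assms(1)] by simp
  also have "\<dots> = cf (\<Sum>b\<in>T. term_of 0 b * extend (component b g)) m"
  proof -
    have "cf (term_of 0 b * extend (component b g)) m = b * \<phi> (coord b (cf g m))" for b
      using cf_term_mult[of 0 b "extend (component b g)" m] by simp
    then show ?thesis by (simp add: lookup_sum mult.commute)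
  qed
  finally show "cf g m = cf (\<Sum>b\<in>T. term_of 0 b * extend (component b g)) m" .
qed

end

locale extended_polys = graded_ordering n lt w + field_embedding \<phi>
  for n lt w and \<phi> :: "'k::field \<Rightarrow> 'l::field"
begin

abbreviation "SK \<equiv> polys {..<n} :: ((nat \<Rightarrow>\<^sub>0 nat) \<Rightarrow>\<^sub>0 'k) set"
abbreviation "SL \<equiv> polys {..<n} :: ((nat \<Rightarrow>\<^sub>0 nat) \<Rightarrow>\<^sub>0 'l) set"

sublocale NK: noetherian_in SK by (rule polys_noetherian)
sublocale NL: noetherian_in SL by (rule polys_noetherian)

text \<open>The ideal generated by \<open>J\<close> in \<open>S\<^sub>L\<close>, described by coordinates; that it is generated by \<open>J\<close> is
  \<open>extended_ideal_least\<close>.\<close>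

definition extended_ideal :: "((nat \<Rightarrow>\<^sub>0 nat) \<Rightarrow>\<^sub>0 'k) set \<Rightarrow> ((nat \<Rightarrow>\<^sub>0 nat) \<Rightarrow>\<^sub>0 'l) set" where
  "extended_ideal J = {g \<in> SL. \<forall>b. component b g \<in> J}"

definition contraction :: "((nat \<Rightarrow>\<^sub>0 nat) \<Rightarrow>\<^sub>0 'l) set \<Rightarrow> ((nat \<Rightarrow>\<^sub>0 nat) \<Rightarrow>\<^sub>0 'k) set" where
  "contraction Q = {f \<in> SK. extend f \<in> Q}"

lemma extended_ideal_ideal:
  assumes J: "ideal_in SK J" shows "ideal_in SL (extended_ideal J)"
  unfolding ideal_in_def
proof (intro conjI ballI)
  show "extended_ideal J \<subseteq> SL" by (auto simp: extended_ideal_def)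
  show "0 \<in> extended_ideal J" using ideal_inD(2)[OF J] by (simp add: extended_ideal_def polys.zero_C)
  fix g h assume "g \<in> extended_ideal J" "h \<in> extended_ideal J"
  then show "g + h \<in> extended_ideal J"
    using ideal_inD(3)[OF J] by (auto simp: extended_ideal_def component_add)
next
  fix r g assume r: "r \<in> SL" and g: "g \<in> extended_ideal J"
  let ?T = "{b. component b g \<noteq> 0}"
  have "component c (r * g) \<in> J" for c
  proof -
    have "r * g = (\<Sum>b\<in>?T. extend (component b g) * (r * term_of 0 b))"
      by (subst component_expand[OF component_support(1) order_refl, of g])
         (simp add: sum_distrib_left algebra_simps)
    then have "component c (r * g) = (\<Sum>b\<in>?T. component b g * component c (r * term_of 0 b))"
      by (simp add: component_sum component_extend_mult)
    also have "\<dots> \<in> J"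
      using g r by (intro polys.ideal_sum[OF J] ideal_inD(5)[OF J] component_polys polys.mult_C term_polys)
        (auto simp: extended_ideal_def)
    finally show ?thesis .
  qed
  then show "r * g \<in> extended_ideal J" using r g by (auto simp: extended_ideal_def)
qed

lemma extend_mem_extended_ideal:
  assumes J: "ideal_in SK J" and f: "f \<in> SK"
  shows "extend f \<in> extended_ideal J \<longleftrightarrow> f \<in> J"
proof
  assume "extend f \<in> extended_ideal J"
  then have *: "term_of 0 (coord b 1) * f \<in> J" for b
    by (auto simp: extended_ideal_def component_extend)
  obtain b where b: "coord b 1 \<noteq> 0"
  proof (rule ccontr)
    assume "\<not> thesis"
    then have "{b. coord b 1 \<noteq> 0} \<subseteq> {}" using that by auto
    then show False using coord_expand[of "{}" 1] by simp
  qed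
  have "term_of 0 (inverse (coord b 1)) * (term_of 0 (coord b 1) * f) \<in> J"
    by (intro ideal_inD(4)[OF J] * term_polys) simp
  then show "f \<in> J" using b by (simp add: mult.assoc[symmetric] mult_single)
next
  assume "f \<in> J"
  then show "extend f \<in> extended_ideal J"
    using f by (auto simp: extended_ideal_def component_extend intro!: ideal_inD(4)[OF J] term_polys)
qed

lemma extended_ideal_least:
  assumes H: "ideal_in SL H" and J: "extend ` J \<subseteq> H"
  shows "extended_ideal J \<subseteq> H"
proof
  fix g assume g: "g \<in> extended_ideal J"
  have "(\<Sum>b | component b g \<noteq> 0. term_of 0 b * extend (component b g)) \<in> H"
    using g J by (intro polys.ideal_sum[OF H] ideal_inD(4)[OF H] term_polys) (auto simp: extended_ideal_def)
  then show "g \<in> H" using component_expand[OF component_support(1) order_refl, of g] by simp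
qed

lemma extended_ideal_mono: "J \<subseteq> J' \<Longrightarrow> extended_ideal J \<subseteq> extended_ideal J'"
  by (auto simp: extended_ideal_def)

lemma extended_ideal_subset_iff:
  assumes J: "ideal_in SK J" and Q: "ideal_in SL Q"
  shows "extended_ideal J \<subseteq> Q \<longleftrightarrow> J \<subseteq> contraction Q"
proof
  assume *: "extended_ideal J \<subseteq> Q"
  show "J \<subseteq> contraction Q"
  proof
    fix f assume "f \<in> J"
    moreover from this have "f \<in> SK" using ideal_inD(1)[OF J] by blast
    ultimately show "f \<in> contraction Q"
      using * extend_mem_extended_ideal[OF J] by (auto simp: contraction_def)
  qed
next
  assume "J \<subseteq> contraction Q"
  then show "extended_ideal J \<subseteq> Q" by (intro extended_ideal_least[OF Q]) (auto simp: contraction_def)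
qed

lemma contraction_mono: "P \<subseteq> Q \<Longrightarrow> contraction P \<subseteq> contraction Q"
  by (auto simp: contraction_def)

lemma contraction_prime:
  assumes Q: "prime_in SL Q" shows "prime_in SK (contraction Q)"
proof -
  note idQ = prime_inD(1)[OF Q]
  show ?thesis
    unfolding prime_in_def ideal_in_def
  proof (intro conjI ballI impI)
    show "1 \<notin> contraction Q" using prime_inD(2)[OF Q] by (simp add: contraction_def)
    fix a b assume "a \<in> SK" "b \<in> SK" "a * b \<in> contraction Q"
    then show "a \<in> contraction Q \<or> b \<in> contraction Q"
      using prime_inD(3)[OF Q, of "extend a" "extend b"] by (auto simp: contraction_def extend_mult)
  qed (use ideal_inD(2-4)[OF idQ] in \<open>auto simp: contraction_def extend_add extend_mult\<close>)
qed

text \<open>Since \<open>S\<^sub>L\<close> is free over \<open>S\<^sub>K\<close>, an element outside a prime \<open>p\<close> acts injectively on \<open>S\<^sub>L / p S\<^sub>L\<close>.\<close>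

lemma extend_nonzerodivisor:
  assumes p: "prime_in SK p" and a: "a \<in> SK" "a \<notin> p" and h: "h \<in> SL" "extend a * h \<in> extended_ideal p"
  shows "h \<in> extended_ideal p"
proof -
  have "component b h \<in> p" for b
    using h prime_inD(3)[OF p, of a "component b h"] a component_polys[OF h(1), of b]
    by (auto simp: extended_ideal_def component_extend_mult)
  then show ?thesis using h by (simp add: extended_ideal_def)
qed

text \<open>The products of elements of \<open>S\<^sub>K - p\<close> and of \<open>S\<^sub>L - q'\<close> form a multiplicative set that does not meet
  \<open>p S\<^sub>L\<close>, because elements of the first kind can be cancelled modulo \<open>p S\<^sub>L\<close>.  A prime above \<open>p S\<^sub>L\<close>
  that avoids this set is contained in \<open>q'\<close> and lies over \<open>p\<close>.\<close>

lemma going_down: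
  assumes p: "prime_in SK p" and q': "prime_in SL q'" and sub: "p \<subseteq> contraction q'"
  obtains p' where "prime_in SL p'" "p' \<subseteq> q'" "contraction p' = p"
proof -
  note idp = prime_inD(1)[OF p]
  let ?T = "{extend a * h | a h. a \<in> SK - p \<and> h \<in> SL - q'}"
  have "extended_ideal p \<inter> ?T = {}"
  proof -
    have False if "a \<in> SK - p" "h \<in> SL - q'" "extend a * h \<in> extended_ideal p" for a h
      using extend_nonzerodivisor[OF p, of a h] that extended_ideal_subset_iff[OF idp prime_inD(1)[OF q']] sub
      by blast
    then show ?thesis by blast
  qed
  moreover have "1 \<in> ?T"
    using prime_inD(2)[OF p] prime_inD(2)[OF q']
    by (intro CollectI exI[of _ 1]) (simp add: polys.one_C)
  moreover have "u * v \<in> ?T" if "u \<in> ?T" "v \<in> ?T" for u v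
  proof -
    obtain a h where u: "u = extend a * h" "a \<in> SK - p" "h \<in> SL - q'" using \<open>u \<in> ?T\<close> by auto
    obtain b i where v: "v = extend b * i" "b \<in> SK - p" "i \<in> SL - q'" using \<open>v \<in> ?T\<close> by auto
    have "u * v = extend (a * b) * (h * i)" using u v by (simp add: extend_mult algebra_simps)
    then show ?thesis
      using polys.not_in_prime_mult[OF p u(2) v(2)] polys.not_in_prime_mult[OF q' u(3) v(3)] by blast
  qed
  moreover have "?T \<subseteq> SL" by auto
  ultimately obtain p' where p': "prime_in SL p'" "extended_ideal p \<subseteq> p'" "p' \<inter> ?T = {}"
    using NL.prime_avoiding_multiplicative_set[OF extended_ideal_ideal[OF idp], of ?T] by blast
  have p'S: "p' \<subseteq> SL" using ideal_inD(1) prime_inD(1)[OF p'(1)] by blast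
  have "p' \<subseteq> q'"
  proof
    fix x assume x: "x \<in> p'"
    show "x \<in> q'"
    proof (rule ccontr)
      assume "x \<notin> q'"
      then have "extend 1 * x \<in> ?T" using x p'S prime_inD(2)[OF p] polys.one_C by blast
      then show False using x p'(3) by auto
    qed
  qed
  moreover have "contraction p' = p"
  proof
    show "p \<subseteq> contraction p'" using p' extended_ideal_subset_iff[OF idp prime_inD(1)[OF p'(1)]] by blast
    show "contraction p' \<subseteq> p"
    proof
      fix x assume x: "x \<in> contraction p'"
      show "x \<in> p"
      proof (rule ccontr)
        assume "x \<notin> p"
        then have "extend x * 1 \<in> ?T"
          using x prime_inD(2)[OF q'] polys.one_C unfolding contraction_def by blast
        then show False using x p'(3) by (auto simp: contraction_def)
      qed
    qed
  qed
  ultimately show thesis using that p' by blast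
qed

lemma lying_over:
  assumes p: "prime_in SK p"
  obtains q where "prime_in SL q" "contraction q = p"
proof -
  note idp = prime_inD(1)[OF p]
  let ?T = "extend ` (SK - p)"
  have "extended_ideal p \<inter> ?T = {}" using extend_mem_extended_ideal[OF idp] by auto
  moreover have "1 \<in> ?T" using prime_inD(2)[OF p] by (intro image_eqI[of _ _ 1]) (auto simp: polys.one_C)
  moreover have "u * v \<in> ?T" if uv: "u \<in> ?T" "v \<in> ?T" for u v
  proof -
    obtain a b where ab: "u = extend a" "a \<in> SK - p" "v = extend b" "b \<in> SK - p" using uv by blast
    then have "u * v = extend (a * b)" by (simp add: extend_mult)
    then show ?thesis using polys.not_in_prime_mult[OF p ab(2,4)] by blast
  qed
  moreover have "?T \<subseteq> SL" by auto
  ultimately obtain q where q: "prime_in SL q" "extended_ideal p \<subseteq> q" "q \<inter> ?T = {}"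
    using NL.prime_avoiding_multiplicative_set[OF extended_ideal_ideal[OF idp], of ?T] by blast
  have "p \<subseteq> contraction q" using q extended_ideal_subset_iff[OF idp prime_inD(1)[OF q(1)]] by blast
  moreover have "contraction q \<subseteq> p" using q(3) by (auto simp: contraction_def)
  ultimately show thesis using that q by blast
qed

lemma contraction_minimal:
  assumes p: "prime_in SK p" and Q: "minimal_prime_over SL (extended_ideal p) Q"
  shows "contraction Q = p"
proof -
  note Q' = minimal_prime_overD[OF Q]
  have "p \<subseteq> contraction Q"
    using extended_ideal_subset_iff[OF prime_inD(1)[OF p] prime_inD(1)[OF Q'(1)]] Q'(2) by blast
  then obtain q where q: "prime_in SL q" "q \<subseteq> Q" "contraction q = p"
    using going_down[OF p Q'(1)] by blast
  have "extended_ideal p \<subseteq> q"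
    using extended_ideal_subset_iff[OF prime_inD(1)[OF p] prime_inD(1)[OF q(1)]] q by blast
  then show ?thesis using Q'(3) q by blast
qed

lemma mem_primes_over_extended:
  assumes J: "ideal_in SK J"
  shows "Q \<in> primes_over SL (extended_ideal J) \<longleftrightarrow> prime_in SL Q \<and> contraction Q \<in> primes_over SK J"
  using extended_ideal_subset_iff[OF J] contraction_prime prime_inD(1) by (auto simp: primes_over_def)

lemma lift_chain:
  assumes J: "ideal_in SK J"
  shows "strict_chain (primes_over SK J) k f \<Longrightarrow> prime_in SL p' \<Longrightarrow> contraction p' = f k \<Longrightarrow>
    \<exists>f'. strict_chain (primes_over SL (extended_ideal J)) k f' \<and> f' k = p'"
proof (induction k arbitrary: p')
  case 0
  then have "p' \<in> primes_over SL (extended_ideal J)"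
    unfolding mem_primes_over_extended[OF J] by (auto simp: strict_chain_def)
  then show ?case by (intro exI[of _ "\<lambda>i. p'"]) (auto simp: strict_chain_def)
next
  case (Suc k)
  have f: "f k \<in> primes_over SK J" "f (Suc k) \<in> primes_over SK J" "f k \<subset> f (Suc k)"
    using Suc.prems(1) by (auto simp: strict_chain_def)
  then have fk: "prime_in SK (f k)" "f k \<subseteq> contraction p'" using Suc.prems(3) by (auto simp: primes_over_def)
  obtain q where q: "prime_in SL q" "q \<subseteq> p'" "contraction q = f k"
    using going_down[OF fk(1) Suc.prems(2) fk(2)] by blast
  have "strict_chain (primes_over SK J) k f" using Suc.prems(1) by (auto simp: strict_chain_def)
  then obtain f' where f': "strict_chain (primes_over SL (extended_ideal J)) k f'" "f' k = q"
    using Suc.IH q by blast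
  have "q \<subset> p'" using q f(3) Suc.prems(3) by blast
  moreover have "p' \<in> primes_over SL (extended_ideal J)"
    unfolding mem_primes_over_extended[OF J] using Suc.prems f(2) by auto
  ultimately have "strict_chain (primes_over SL (extended_ideal J)) (Suc k) (f'(Suc k := p'))"
    using f' by (auto simp: strict_chain_def less_Suc_eq le_Suc_eq)
  then show ?case by (metis fun_upd_same)
qed

lemma minimal_contraction:
  assumes J: "ideal_in SK J" and Q: "Q \<in> minimal_members (primes_over SL (extended_ideal J))"
  shows "contraction Q \<in> minimal_members (primes_over SK J)"
proof -
  have Q': "prime_in SL Q" "contraction Q \<in> primes_over SK J"
    using Q mem_primes_over_extended[OF J] by (auto simp: minimal_members_def)
  have "p = contraction Q" if p: "p \<in> primes_over SK J" "p \<subseteq> contraction Q" for p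
  proof -
    have "prime_in SK p" using p by (auto simp: primes_over_def)
    then obtain q where q: "prime_in SL q" "q \<subseteq> Q" "contraction q = p" using going_down Q' p by blast
    then have "q \<in> primes_over SL (extended_ideal J)" using mem_primes_over_extended[OF J] p by auto
    then have "q = Q" using Q q by (auto simp: minimal_members_def)
    then show ?thesis using q by simp
  qed
  then show ?thesis using Q' by (auto simp: minimal_members_def)
qed

lemma minimal_over_minimal:
  assumes J: "ideal_in SK J" and P: "P \<in> minimal_members (primes_over SK J)"
    and Q: "minimal_prime_over SL (extended_ideal P) Q"
  shows "Q \<in> minimal_members (primes_over SL (extended_ideal J))"
proof -
  have P': "prime_in SK P" "J \<subseteq> P" using P by (auto simp: minimal_members_def primes_over_def)
  note Q' = minimal_prime_overD[OF Q]
  have con: "contraction Q = P" by (rule contraction_minimal[OF P'(1) Q])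
  have "R = Q" if R: "R \<in> primes_over SL (extended_ideal J)" "R \<subseteq> Q" for R
  proof -
    have R': "prime_in SL R" "contraction R \<in> primes_over SK J" using R mem_primes_over_extended[OF J] by auto
    moreover have "contraction R \<subseteq> P" using contraction_mono[OF R(2)] con by simp
    ultimately have "contraction R = P" using P by (auto simp: minimal_members_def)
    then have "extended_ideal P \<subseteq> R"
      using extended_ideal_subset_iff[OF prime_inD(1)[OF P'(1)] prime_inD(1)[OF R'(1)]] by simp
    then show ?thesis using Q'(3) R' R by blast
  qed
  moreover have "Q \<in> primes_over SL (extended_ideal J)"
    unfolding mem_primes_over_extended[OF J] using Q'(1) con P' by (auto simp: primes_over_def)
  ultimately show ?thesis by (auto simp: minimal_members_def)
qed

lemma minimal_prime_over_exists:
  assumes p: "prime_in SK p"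
  obtains Q where "minimal_prime_over SL (extended_ideal p) Q"
proof -
  note idp = prime_inD(1)[OF p]
  obtain q where q: "prime_in SL q" "contraction q = p" using lying_over[OF p] .
  then have "extended_ideal p \<subseteq> q" using extended_ideal_subset_iff[OF idp prime_inD(1)[OF q(1)]] by simp
  then show thesis using NL.minimal_prime_below[OF extended_ideal_ideal[OF idp] q(1)] that by blast
qed

lemma contraction_surj_minimal:
  assumes J: "ideal_in SK J"
  shows "contraction ` minimal_members (primes_over SL (extended_ideal J)) = minimal_members (primes_over SK J)"
proof
  show "contraction ` minimal_members (primes_over SL (extended_ideal J)) \<subseteq> minimal_members (primes_over SK J)"
    using minimal_contraction[OF J] by blast
  show "minimal_members (primes_over SK J) \<subseteq> contraction ` minimal_members (primes_over SL (extended_ideal J))"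
  proof
    fix P assume P: "P \<in> minimal_members (primes_over SK J)"
    then have P': "prime_in SK P" by (auto simp: minimal_members_def primes_over_def)
    obtain Q where Q: "minimal_prime_over SL (extended_ideal P) Q" using minimal_prime_over_exists[OF P'] .
    then show "P \<in> contraction ` minimal_members (primes_over SL (extended_ideal J))"
      using minimal_over_minimal[OF J P Q] contraction_minimal[OF P' Q] by blast
  qed
qed

text \<open>By going down, contraction does not increase heights.\<close>

lemma joined_descends:
  assumes J: "ideal_in SK J" and "joined t (primes_over SL (extended_ideal J)) P Q"
  shows "joined t (primes_over SK J) (contraction P) (contraction Q)"
proof -
  obtain p where p: "p \<in> primes_over SL (extended_ideal J)" "P \<subseteq> p" "Q \<subseteq> p"
    "\<And>k f. strict_chain (primes_over SL (extended_ideal J)) k f \<Longrightarrow> f k = p \<Longrightarrow> k \<le> t"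
    using assms(2) by (auto simp: joined_def)
  have p': "prime_in SL p" "contraction p \<in> primes_over SK J" using p mem_primes_over_extended[OF J] by auto
  show ?thesis
    unfolding joined_def
  proof (intro bexI[OF _ p'(2)] conjI allI impI)
    fix k f assume f: "strict_chain (primes_over SK J) k f" "f k = contraction p"
    then obtain f' where "strict_chain (primes_over SL (extended_ideal J)) k f'" "f' k = p"
      using lift_chain[OF J f(1) p'(1)] by auto
    then show "k \<le> t" by (rule p(4))
  qed (use contraction_mono p in auto)
qed

text \<open>Heights do not increase in the other direction either, for a suitable prime over \<open>p\<close>: if \<open>p\<close> is minimal
  over \<open>J\<close> and \<open>h\<close> further elements, then a prime that is minimal over \<open>p S\<^sub>L\<close> is minimal over \<open>J S\<^sub>L\<close>
  and the same elements, and the height theorem applies.  Injectivity of the contraction ensures that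
  the minimal primes found below this prime are the given ones.\<close>

lemma joined_lifts:
  assumes J: "ideal_in SK J"
    and inj: "inj_on contraction (minimal_members (primes_over SL (extended_ideal J)))"
    and P: "P \<in> minimal_members (primes_over SL (extended_ideal J))"
    and Q: "Q \<in> minimal_members (primes_over SL (extended_ideal J))"
    and "joined t (primes_over SK J) (contraction P) (contraction Q)"
  shows "joined t (primes_over SL (extended_ideal J)) P Q"
proof -
  obtain p where p: "p \<in> primes_over SK J" "contraction P \<subseteq> p" "contraction Q \<subseteq> p"
    "\<And>k f. strict_chain (primes_over SK J) k f \<Longrightarrow> f k = p \<Longrightarrow> k \<le> t"
    using assms(5) by (auto simp: joined_def)
  have prp: "prime_in SK p" "J \<subseteq> p" using p by (auto simp: primes_over_def)
  note idp = prime_inD(1)[OF prp(1)]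
  have JS: "J \<subseteq> SK" by (rule ideal_inD(1)[OF J])
  have "\<exists>G. finite G \<and> G \<subseteq> p \<and> card G \<le> t \<and> minimal_prime_over SK (J \<union> G) p"
    by (rule NK.minimal_over_height_many_elements[OF JS prp])
       (use p(4) in \<open>simp add: strict_chain_primes_over_iff\<close>)
  then obtain G where G: "finite G" "G \<subseteq> p" "card G \<le> t" "minimal_prime_over SK (J \<union> G) p"
    by blast
  obtain p' where p': "minimal_prime_over SL (extended_ideal p) p'" using minimal_prime_over_exists[OF prp(1)] .
  note p'D = minimal_prime_overD[OF p']
  have con: "contraction p' = p" by (rule contraction_minimal[OF prp(1) p'])
  have GS: "G \<subseteq> SK" using G(2) ideal_inD(1)[OF idp] by blast
  have min: "minimal_prime_over SL (extended_ideal J \<union> extend ` G) p'"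
    unfolding minimal_prime_over_def
  proof (intro conjI allI impI)
    show "prime_in SL p'" by (rule p'D(1))
    show "extended_ideal J \<union> extend ` G \<subseteq> p'"
    proof -
      have "extended_ideal J \<subseteq> p'" using extended_ideal_mono[OF prp(2)] p'D(2) by blast
      moreover have "extend ` G \<subseteq> p'" using G(2) con unfolding contraction_def by blast
      ultimately show ?thesis by blast
    qed
    fix R assume R: "prime_in SL R" "extended_ideal J \<union> extend ` G \<subseteq> R" "R \<subseteq> p'"
    have "J \<subseteq> contraction R" using R extended_ideal_subset_iff[OF J prime_inD(1)[OF R(1)]] by blast
    moreover have "G \<subseteq> contraction R" using R(2) GS by (auto simp: contraction_def)
    moreover have "contraction R \<subseteq> p" using contraction_mono[OF R(3)] con by simp
    ultimately have "contraction R = p"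
      using minimal_prime_overD(3)[OF G(4) contraction_prime[OF R(1)]] by blast
    then have "extended_ideal p \<subseteq> R" using extended_ideal_subset_iff[OF idp prime_inD(1)[OF R(1)]] by simp
    then show "R = p'" using p'D(3) R by blast
  qed
  have below: "W \<subseteq> p'"
    if W: "W \<in> minimal_members (primes_over SL (extended_ideal J))" "contraction W \<subseteq> p" for W
  proof -
    have cW: "contraction W \<in> minimal_members (primes_over SK J)" by (rule minimal_contraction[OF J W(1)])
    then have prW: "prime_in SK (contraction W)" by (auto simp: minimal_members_def primes_over_def)
    note idW = prime_inD(1)[OF prW]
    have "extended_ideal (contraction W) \<subseteq> p'"
      using extended_ideal_subset_iff[OF idW prime_inD(1)[OF p'D(1)]] W(2) con by simp
    then obtain R where R: "minimal_prime_over SL (extended_ideal (contraction W)) R" "R \<subseteq> p'"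
      using NL.minimal_prime_below[OF extended_ideal_ideal[OF idW] p'D(1)] by blast
    have "R \<in> minimal_members (primes_over SL (extended_ideal J))"
      by (rule minimal_over_minimal[OF J cW R(1)])
    moreover have "contraction R = contraction W" by (rule contraction_minimal[OF prW R(1)])
    ultimately have "R = W" using inj W(1) by (auto simp: inj_on_def)
    then show ?thesis using R by simp
  qed
  show ?thesis
    unfolding joined_def
  proof (intro bexI conjI allI impI)
    show "p' \<in> primes_over SL (extended_ideal J)"
      unfolding mem_primes_over_extended[OF J] using p'D(1) con p(1) by simp
    show "P \<subseteq> p'" "Q \<subseteq> p'" using below P Q p by blast+
    fix k f assume f: "strict_chain (primes_over SL (extended_ideal J)) k f" "f k = p'"
    then have f': "chain_in SL k f" "extended_ideal J \<subseteq> f 0" by (auto simp: strict_chain_primes_over_iff)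
    have "k \<le> card (extend ` G)"
      using G(1) GS by (intro NL.krull_height_theorem[OF _ _ _ min f'(1) f(2) f'(2)])
        (auto simp: extended_ideal_def)
    also have "\<dots> \<le> card G" by (rule card_image_le[OF G(1)])
    finally show "k \<le> t" using G(3) by simp
  qed
qed

theorem num_components_extension:
  assumes J: "ideal_in SK J"
    and inj: "inj_on contraction (minimal_members (primes_over SL (extended_ideal J)))"
  shows "num_components (poset_graph t (primes_over SL (extended_ideal J))) =
    num_components (poset_graph t (primes_over SK J))"
proof (rule num_components_poset_graph)
  show "bij_betw contraction (minimal_members (primes_over SL (extended_ideal J))) (minimal_members (primes_over SK J))"
    unfolding bij_betw_def using inj contraction_surj_minimal[OF J] by blast
  show "joined t (primes_over SL (extended_ideal J)) P Q \<longleftrightarrow>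
      joined t (primes_over SK J) (contraction P) (contraction Q)"
    if "P \<in> minimal_members (primes_over SL (extended_ideal J))"
      "Q \<in> minimal_members (primes_over SL (extended_ideal J))" for P Q
    using joined_descends[OF J] joined_lifts[OF J inj that] by blast
qed

end


section \<open>Weights representing a monomial order\<close>

definition dot :: "nat \<Rightarrow> (nat \<Rightarrow> int) \<Rightarrow> (nat \<Rightarrow> int) \<Rightarrow> int" where
  "dot n u v = (\<Sum>i<n. u i * v i)"

lemma dot_add_left: "dot n (\<lambda>i. u i + u' i) v = dot n u v + dot n u' v"
  by (simp add: dot_def algebra_simps sum.distrib)

lemma dot_scale_left: "dot n (\<lambda>i. a * u i) v = a * dot n u v"
  by (simp add: dot_def sum_distrib_left algebra_simps)

lemma dot_add_right: "dot n u (\<lambda>i. v i + v' i) = dot n u v + dot n u v'"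
  by (simp add: dot_def algebra_simps sum.distrib)

lemma dot_scale_right: "dot n u (\<lambda>i. a * v i) = a * dot n u v"
  by (simp add: dot_def sum_distrib_left algebra_simps)

text \<open>Gordan's theorem of the alternative over the integers.  If \<open>u\<close> is positive on the vectors of \<open>F\<close> but
  not on the new vector \<open>v x\<close>, the induction hypothesis is applied once more, to the combinations
  \<open>a d * v x + b * v d\<close>, on which \<open>u\<close> vanishes.\<close>

lemma gordan:
  fixes v :: "'i \<Rightarrow> nat \<Rightarrow> int"
  assumes "finite T"
    and "\<And>c :: 'i \<Rightarrow> nat. (\<And>i. i < n \<Longrightarrow> (\<Sum>d\<in>T. int (c d) * v d i) = 0) \<Longrightarrow> \<forall>d\<in>T. c d = 0"
  shows "\<exists>u. \<forall>d\<in>T. 0 < dot n u (v d)"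
  using assms
proof (induction T arbitrary: v rule: finite_induct)
  case (insert x F)
  note cond = insert.prems
  show ?case
  proof (cases "F = {}")
    case True
    have "\<exists>i<n. v x i \<noteq> 0"
    proof (rule ccontr)
      assume "\<not> ?thesis"
      then have "\<forall>d\<in>insert x F. (\<lambda>_. 1 :: nat) d = 0" using True by (intro cond) auto
      then show False by (metis insertI1 one_neq_zero)
    qed
    then obtain i where i: "i < n" "v x i \<noteq> 0" by blast
    have "0 < v x i * v x i" using i(2) by (simp add: zero_less_mult_iff linorder_neq_iff disj_commute)
    also have "\<dots> \<le> dot n (v x) (v x)" unfolding dot_def using i(1) by (intro member_le_sum) auto
    finally show ?thesis using True by auto
  next
    case False
    have "\<exists>u. \<forall>d\<in>F. 0 < dot n u (v d)"
    proof (rule insert.IH)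
      fix c :: "'i \<Rightarrow> nat" assume c: "\<And>i. i < n \<Longrightarrow> (\<Sum>d\<in>F. int (c d) * v d i) = 0"
      have "\<forall>d\<in>insert x F. (c(x := 0)) d = 0"
      proof (rule cond)
        fix i assume "i < n"
        have "(\<Sum>d\<in>F. int ((c(x := 0)) d) * v d i) = (\<Sum>d\<in>F. int (c d) * v d i)"
          using insert.hyps by (intro sum.cong) auto
        then show "(\<Sum>d\<in>insert x F. int ((c(x := 0)) d) * v d i) = 0"
          using insert.hyps c[OF \<open>i < n\<close>] by simp
      qed
      then show "\<forall>d\<in>F. c d = 0" using insert.hyps by (metis fun_upd_other insertI2)
    qed
    then obtain u where u: "\<And>d. d \<in> F \<Longrightarrow> 0 < dot n u (v d)" by blast
    show ?thesis
    proof (cases "0 < dot n u (v x)")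
      case True
      then show ?thesis using u by auto
    next
      case neg: False
      define a where "a d = dot n u (v d)" for d
      define b where "b = - dot n u (v x)"
      have a: "0 < a d" if "d \<in> F" for d using u that by (simp add: a_def)
      have b: "0 \<le> b" using neg by (simp add: b_def)
      have "\<exists>u. \<forall>d\<in>F. 0 < dot n u (\<lambda>i. a d * v x i + b * v d i)"
      proof (rule insert.IH)
        fix c :: "'i \<Rightarrow> nat"
        assume c: "\<And>i. i < n \<Longrightarrow> (\<Sum>d\<in>F. int (c d) * (a d * v x i + b * v d i)) = 0"
        let ?c = "\<lambda>d. if d = x then nat (\<Sum>d\<in>F. int (c d) * a d) else nat b * c d"
        have nn: "0 \<le> (\<Sum>d\<in>F. int (c d) * a d)" using a by (intro sum_nonneg) (simp add: less_imp_le)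
        have "\<forall>d\<in>insert x F. ?c d = 0"
        proof (rule cond)
          fix i assume i: "i < n"
          have "(\<Sum>d\<in>F. int (?c d) * v d i) = (\<Sum>d\<in>F. b * (int (c d) * v d i))"
            using insert.hyps b by (intro sum.cong) auto
          then have "(\<Sum>d\<in>insert x F. int (?c d) * v d i) =
              (\<Sum>d\<in>F. int (c d) * a d) * v x i + (\<Sum>d\<in>F. b * (int (c d) * v d i))"
            using insert.hyps nn by simp
          also have "\<dots> = (\<Sum>d\<in>F. int (c d) * (a d * v x i + b * v d i))"
            by (simp add: sum_distrib_left sum_distrib_right sum.distrib algebra_simps)
          finally show "(\<Sum>d\<in>insert x F. int (?c d) * v d i) = 0" using c[OF i] by simp
        qed
        then have "(\<Sum>d\<in>F. int (c d) * a d) = 0" using nn by auto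
        then have "\<forall>d\<in>F. int (c d) * a d = 0"
          using sum_nonneg_eq_0_iff[OF insert.hyps(1), of "\<lambda>d. int (c d) * a d"] a by (simp add: less_imp_le)
        then show "\<forall>d\<in>F. c d = 0" using a by fastforce
      qed
      then obtain u' where u': "\<And>d. d \<in> F \<Longrightarrow> 0 < a d * dot n u' (v x) + b * dot n u' (v d)"
        by (auto simp: dot_add_right dot_scale_right)
      define e where "e = dot n u' (v x)"
      \<comment> \<open>\<open>s\<close> is positive on \<open>F\<close> and vanishes on \<open>v x\<close>; \<open>z\<close> perturbs it\<close>
      define s where "s i = b * u' i + e * u i" for i
      have s: "dot n s (v d) = b * dot n u' (v d) + e * dot n u (v d)" for d
        unfolding s_def by (simp add: dot_add_left dot_scale_left)
      have s_F: "1 \<le> dot n s (v d)" if "d \<in> F" for d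
        using u'[OF that] by (simp add: s a_def e_def algebra_simps)
      have s_x: "dot n s (v x) = 0" by (simp add: s b_def e_def)
      define z where "z = (if b = 0 then u' else (\<lambda>i. - 1 * u i))"
      have z: "0 < dot n z (v x)"
      proof (cases "b = 0")
        case True
        obtain d where d: "d \<in> F" using False by blast
        have "0 < a d * dot n u' (v x)" using u'[OF d] True by simp
        then show ?thesis using a[OF d] True by (simp add: z_def zero_less_mult_iff)
      next
        case False
        have "dot n z (v x) = b" using False by (simp add: z_def dot_scale_left[of n "- 1" u, simplified] b_def)
        then show ?thesis using False b by simp
      qed
      define N where "N = 1 + (\<Sum>d\<in>F. \<bar>dot n z (v d)\<bar>)"
      have N0: "0 \<le> N" unfolding N_def by (simp add: sum_nonneg add_nonneg_nonneg)
      have "0 < dot n (\<lambda>i. N * s i + z i) (v d)" if d: "d \<in> insert x F" for d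
      proof (cases "d = x")
        case True
        then show ?thesis using z by (simp add: dot_add_left dot_scale_left s_x)
      next
        case False
        then have dF: "d \<in> F" using d by simp
        have "\<bar>dot n z (v d)\<bar> \<le> (\<Sum>d\<in>F. \<bar>dot n z (v d)\<bar>)" using insert.hyps dF by (intro member_le_sum) auto
        moreover have "N * 1 \<le> N * dot n s (v d)" using N0 s_F[OF dF] by (rule mult_left_mono[rotated])
        ultimately show ?thesis by (simp add: dot_add_left dot_scale_left N_def)
      qed
      then show ?thesis by blast
    qed
  qed
qed simp

context monomial_ordering
begin

lemma lt_sum:
  assumes "finite Y" "Y \<noteq> {}" "\<And>y. y \<in> Y \<Longrightarrow> f y \<in> M \<and> g y \<in> M \<and> lt (g y) (f y)"
  shows "sum f Y \<in> M \<and> sum g Y \<in> M \<and> lt (sum g Y) (sum f Y)"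
  using assms
proof (induction Y rule: finite_ne_induct)
  case (insert y Y)
  then have IH: "sum f Y \<in> M" "sum g Y \<in> M" "lt (sum g Y) (sum f Y)" and y: "f y \<in> M" "g y \<in> M" "lt (g y) (f y)"
    by auto
  then have "lt (g y + sum g Y) (f y + sum f Y)" by (intro lt_le_add) (auto simp: le_def)
  then show ?case using insert.hyps IH y by (simp add: mons_add)
qed auto

text \<open>The unit vectors are included to make the weights positive.  If no weight existed, Gordan's theorem would
  provide products of the larger and of the smaller monomials that are equal, against the compatibility
  of the order with multiplication.\<close>

lemma weight_exists:
  assumes fin: "finite T" and T: "\<And>u v. (u, v) \<in> T \<Longrightarrow> u \<in> M \<and> v \<in> M \<and> lt v u"
  shows "\<exists>w. (\<forall>i<n. 0 < w i) \<and> (\<forall>(u, v)\<in>T. wdeg n w v < wdeg n w u)"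
proof -
  define T' where "T' = T \<union> (\<lambda>i. (term_of i (1::nat), 0)) ` {..<n}"
  have finT': "finite T'" using fin by (simp add: T'_def)
  have T': "fst t \<in> M \<and> snd t \<in> M \<and> lt (snd t) (fst t)" if "t \<in> T'" for t
  proof -
    have "term_of i (1::nat) \<noteq> 0" for i :: nat by (metis lookup_single_eq lookup_zero zero_neq_one)
    moreover have "term_of i (1::nat) \<in> M" if "i < n" for i using that by (simp add: mons_def)
    ultimately show ?thesis using that T[of "fst t" "snd t"] lt_zero by (auto simp: T'_def)
  qed
  define vec where "vec t i = int (cf (fst t) i) - int (cf (snd t) i)" for t :: "(nat \<Rightarrow>\<^sub>0 nat) \<times> (nat \<Rightarrow>\<^sub>0 nat)" and i
  have "\<exists>u. \<forall>t\<in>T'. 0 < dot n u (vec t)"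
  proof (rule gordan[OF finT'])
    fix c :: "(nat \<Rightarrow>\<^sub>0 nat) \<times> (nat \<Rightarrow>\<^sub>0 nat) \<Rightarrow> nat"
    assume c: "\<And>i. i < n \<Longrightarrow> (\<Sum>t\<in>T'. int (c t) * vec t i) = 0"
    show "\<forall>t\<in>T'. c t = 0"
    proof (rule ccontr)
      assume "\<not> ?thesis"
      then obtain t0 where t0: "t0 \<in> T'" "0 < c t0" by auto
      let ?Y = "SIGMA t:T'. {..<c t}"
      have Y: "finite ?Y" "?Y \<noteq> {}" using finT' t0 by auto
      have *: "sum (\<lambda>y. fst (fst y)) ?Y \<in> M \<and> sum (\<lambda>y. snd (fst y)) ?Y \<in> M \<and>
          lt (sum (\<lambda>y. snd (fst y)) ?Y) (sum (\<lambda>y. fst (fst y)) ?Y)"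
        by (rule lt_sum[OF Y]) (use T' in auto)
      have cfY: "cf (sum (\<lambda>y. p (fst y)) ?Y) i = (\<Sum>t\<in>T'. c t * cf (p t) i)"
        for p :: "(nat \<Rightarrow>\<^sub>0 nat) \<times> (nat \<Rightarrow>\<^sub>0 nat) \<Rightarrow> (nat \<Rightarrow>\<^sub>0 nat)" and i
      proof -
        have "cf (sum (\<lambda>y. p (fst y)) ?Y) i = (\<Sum>y\<in>?Y. cf (p (fst y)) i)" by (simp add: lookup_sum)
        also have "\<dots> = (\<Sum>t\<in>T'. \<Sum>k<c t. cf (p t) i)"
          using finT' by (subst sum.Sigma) (auto simp: case_prod_unfold)
        finally show ?thesis by simp
      qed
      have "sum (\<lambda>y. fst (fst y)) ?Y = sum (\<lambda>y. snd (fst y)) ?Y"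
      proof (rule poly_mapping_eqI)
        fix i
        show "cf (sum (\<lambda>y. fst (fst y)) ?Y) i = cf (sum (\<lambda>y. snd (fst y)) ?Y) i"
        proof (cases "i < n")
          case True
          have "int (\<Sum>t\<in>T'. c t * cf (fst t) i) - int (\<Sum>t\<in>T'. c t * cf (snd t) i) = 0"
            using c[OF True] by (simp add: vec_def sum_subtractf right_diff_distrib)
          then show ?thesis unfolding cfY[of fst] cfY[of snd] by linarith
        next
          case False
          then have "i \<notin> supp (sum (\<lambda>y. fst (fst y)) ?Y)" "i \<notin> supp (sum (\<lambda>y. snd (fst y)) ?Y)"
            using * by (auto simp: mons_def)
          then show ?thesis by (simp add: in_keys_iff)
        qed
      qed
      then show False using * lt_irrefl by metis
    qed
  qed
  then obtain u where u: "\<And>t. t \<in> T' \<Longrightarrow> 0 < dot n u (vec t)" by blast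
  have u_pos: "0 < u i" if i: "i < n" for i
  proof -
    have "dot n u (vec (term_of i 1, 0)) = (\<Sum>j<n. if j = i then u j else 0)"
      unfolding dot_def vec_def by (intro sum.cong) (auto simp: lookup_single when_def)
    then show ?thesis using u[of "(term_of i 1, 0)"] i by (simp add: T'_def)
  qed
  define w where "w i = nat (u i)" for i
  have wdeg: "int (wdeg n w m) = (\<Sum>i<n. u i * int (cf m i))" for m
    unfolding wdeg_def of_nat_sum by (intro sum.cong refl) (use u_pos in \<open>simp add: w_def less_imp_le\<close>)
  have "wdeg n w v < wdeg n w x" if "(x, v) \<in> T" for x v
  proof -
    have "0 < dot n u (vec (x, v))" using u[of "(x, v)"] that by (simp add: T'_def)
    also have "dot n u (vec (x, v)) = int (wdeg n w x) - int (wdeg n w v)"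
      by (simp add: wdeg dot_def vec_def right_diff_distrib sum_subtractf)
    finally show ?thesis by simp
  qed
  then show ?thesis using u_pos by (intro exI[of _ w]) (auto simp: w_def)
qed

end

section \<open>Minimal primes remain irreducible\<close>

context graded_ordering
begin

text \<open>One round of trading: multiply \<open>r\<close> by \<open>x\<^sup>\<delta>\<close> and replace all terms of the top weight that involve a
  variable outside \<open>A\<close> by terms of smaller weight.  Top terms in \<open>K[x\<^sub>A]\<close> cannot remain, as one of them
  would be the leading term of an element of \<open>Q\<close>.  So the weight of the result, relative to that of the
  factor \<open>x\<^sup>\<delta>\<close>, has dropped.\<close>

lemma reduction_step:
  fixes J Q :: "((nat \<Rightarrow>\<^sub>0 nat) \<Rightarrow>\<^sub>0 'k::field) set"
  assumes J: "ideal_in (polys {..<n}) J" and Q: "ideal_in (polys {..<n}) Q" and JQ: "J \<subseteq> Q"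
    and A: "A \<subseteq> {..<n}" "mons A \<inter> LM Q = {}" and \<delta>: "\<delta> \<in> mons A"
    and red: "\<And>m. m \<in> M \<Longrightarrow> m \<notin> mons A \<Longrightarrow> \<exists>g\<in>J. \<exists>u m'. \<delta> + m = u + m' \<and> cf g u = 1 \<and>
      (\<forall>v\<in>supp g. v \<noteq> u \<longrightarrow> degw v < degw u)"
    and r: "r \<in> Q" "\<forall>m\<in>supp r. degw m + N \<le> D"
  shows "\<exists>r'\<in>Q. term_of \<delta> 1 * r - r' \<in> J \<and> (\<forall>m\<in>supp r'. degw m + Suc N \<le> D + degw \<delta>)"
proof -
  let ?S = "polys {..<n} :: ((nat \<Rightarrow>\<^sub>0 nat) \<Rightarrow>\<^sub>0 'k) set"
  have \<delta>M: "\<delta> \<in> M" using \<delta> mons_mono[OF A(1)] by blast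
  have rS: "r \<in> ?S" using r ideal_inD(1)[OF Q] by blast
  define Top where "Top = {m \<in> supp r. degw m + N = D \<and> m \<notin> mons A}"
  have Top: "finite Top" "Top \<subseteq> supp r" by (auto simp: Top_def)
  define Red where "Red m g u m' \<longleftrightarrow> g \<in> J \<and> \<delta> + m = u + m' \<and> cf g u = 1 \<and>
      (\<forall>v\<in>supp g. v \<noteq> u \<longrightarrow> degw v < degw u)" for m g u m'
  have "\<exists>g u m'. Red m g u m'" if "m \<in> Top" for m
    using red[of m] that polysD[OF rS] by (auto simp: Top_def Red_def)
  then obtain g u c where gu: "\<And>m. m \<in> Top \<Longrightarrow> Red m (g m) (u m) (c m)" by metis
  have cM: "c m \<in> M" if "m \<in> Top" for m
  proof -
    have "u m + c m \<in> M" using gu[OF that] that \<delta>M polysD[OF rS] mons_add[of \<delta> _ m] Top by (auto simp: Red_def)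
    then show ?thesis by (simp add: mons_add_iff)
  qed
  define corr where "corr = (\<Sum>m\<in>Top. term_of (c m) (cf r m) * g m)"
  have corr: "corr \<in> J"
    unfolding corr_def using gu cM by (intro polys.ideal_sum[OF J] ideal_inD(4)[OF J] term_polys) (auto simp: Red_def)
  define r' where "r' = term_of \<delta> 1 * r - corr"
  have "term_of \<delta> 1 * r \<in> Q" by (intro ideal_inD(4)[OF Q] term_polys \<delta>M r)
  then have r'Q: "r' \<in> Q" unfolding r'_def using corr JQ by (intro polys.ideal_minus[OF Q]) auto
  have r'_eq: "r' = (\<Sum>m\<in>supp r - Top. term_of (\<delta> + m) (cf r m)) +
      (\<Sum>m\<in>Top. term_of (c m) (cf r m) * (term_of (u m) 1 - g m))"
  proof -
    have "term_of \<delta> 1 * r = (\<Sum>m\<in>supp r. term_of (\<delta> + m) (cf r m))"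
      by (subst poly_expand[of r]) (simp add: sum_distrib_left mult_single)
    also have "\<dots> = (\<Sum>m\<in>supp r - Top. term_of (\<delta> + m) (cf r m)) + (\<Sum>m\<in>Top. term_of (\<delta> + m) (cf r m))"
      using Top by (intro sum.subset_diff) auto
    also have "(\<Sum>m\<in>Top. term_of (\<delta> + m) (cf r m)) = (\<Sum>m\<in>Top. term_of (c m) (cf r m) * term_of (u m) 1)"
      using gu by (intro sum.cong refl) (simp add: Red_def mult_single add.commute)
    finally show ?thesis unfolding r'_def corr_def by (simp add: right_diff_distrib sum_subtractf)
  qed
  have supp_r': "degw x + Suc N \<le> D + degw \<delta> \<or> (x \<in> mons A \<and> degw x + N = D + degw \<delta>)" if x: "x \<in> supp r'" for x
  proof -
    have "x \<in> supp (\<Sum>m\<in>supp r - Top. term_of (\<delta> + m) (cf r m)) \<or>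
        x \<in> supp (\<Sum>m\<in>Top. term_of (c m) (cf r m) * (term_of (u m) 1 - g m))"
      using subsetD[OF Poly_Mapping.keys_add x[unfolded r'_eq]] by simp
    then show ?thesis
    proof
      assume s: "x \<in> supp (\<Sum>m\<in>supp r - Top. term_of (\<delta> + m) (cf r m))"
      from subsetD[OF keys_sum s] obtain m where m: "m \<in> supp r - Top" "x \<in> supp (term_of (\<delta> + m) (cf r m))"
        by blast
      then have xm: "x = \<delta> + m" by (simp split: if_splits)
      show ?thesis
      proof (cases "degw m + N = D")
        case True
        then have "m \<in> mons A" using m by (auto simp: Top_def)
        then show ?thesis using True xm \<delta> by (simp add: mons_add wdeg_add)
      next
        case False
        then have "degw m + N < D" using r(2) m by (auto simp: less_le)
        then show ?thesis using xm by (simp add: wdeg_add)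
      qed
    next
      assume s: "x \<in> supp (\<Sum>m\<in>Top. term_of (c m) (cf r m) * (term_of (u m) 1 - g m))"
      from subsetD[OF keys_sum s]
      obtain m where m: "m \<in> Top" "x \<in> supp (term_of (c m) (cf r m) * (term_of (u m) 1 - g m))"
        by blast
      then obtain y where y: "y \<in> supp (term_of (u m) 1 - g m)" "x = c m + y"
        using supp_term_mult by blast
      have "y \<noteq> u m" using y(1) gu[OF m(1)] by (auto simp: in_keys_iff lookup_minus Red_def)
      then have "y \<in> supp (g m)" using y(1) by (auto simp: in_keys_iff lookup_minus lookup_single when_def)
      then have "degw y < degw (u m)" using gu[OF m(1)] \<open>y \<noteq> u m\<close> by (auto simp: Red_def)
      then have "degw x < degw (u m + c m)" using y by (simp add: wdeg_add)
      also have "u m + c m = \<delta> + m" using gu[OF m(1)] by (simp add: Red_def)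
      finally have "degw x < degw \<delta> + degw m" by (simp add: wdeg_add)
      moreover have "degw m + N = D" using m by (auto simp: Top_def)
      ultimately show ?thesis by simp
    qed
  qed
  have "degw x + Suc N \<le> D + degw \<delta>" if x: "x \<in> supp r'" for x
  proof (rule ccontr)
    assume no: "\<not> ?thesis"
    have r'S: "r' \<in> ?S" using r'Q ideal_inD(1)[OF Q] by blast
    have r'0: "r' \<noteq> 0" using x by auto
    note l = lead[OF r'S r'0]
    have "degw x \<le> degw (lead r')"
      using l(2)[OF x] lt_deg[of x "lead r'"] polysD[OF r'S x] l(3) by (auto simp: le_def)
    then have "lead r' \<in> mons A" using supp_r'[OF l(1)] no by auto
    then show False using LM_I[OF r'Q r'0] A(2) by blast
  qed
  then show ?thesis using r'Q corr by (intro bexI[of _ r']) (auto simp: r'_def)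
qed

text \<open>A uniqueness statement in the spirit of Hensel's lemma.  Let \<open>f\<close> be in \<open>Q1\<close> but not in \<open>Q2\<close>.  A multiple
  \<open>f'\<close> of \<open>f\<close> is congruent modulo \<open>Q2\<close> to a nonzero \<open>p0 \<in> K[x\<^sub>A]\<close>.  Repeated reduction inside \<open>Q1\<close>
  shows that \<open>x\<^sup>N\<^sup>\<delta> f'\<close> is congruent modulo \<open>J\<close> to some \<open>r\<close> of weight smaller than that of \<open>x\<^sup>N\<^sup>\<delta>\<close>.
  Hence \<open>x\<^sup>N\<^sup>\<delta> p0 - r\<close> is an element of \<open>Q2\<close> whose leading monomial involves only variables in \<open>A\<close>.\<close>

lemma prime_determined_by_facet:
  fixes J Q1 Q2 :: "((nat \<Rightarrow>\<^sub>0 nat) \<Rightarrow>\<^sub>0 'k::field) set"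
  assumes J: "ideal_in (polys {..<n}) J"
    and Q1: "prime_in (polys {..<n}) Q1" "J \<subseteq> Q1" and Q2: "prime_in (polys {..<n}) Q2" "J \<subseteq> Q2"
    and A: "A \<subseteq> {..<n}" "mons A \<inter> LM Q1 = {}" "mons A \<inter> LM Q2 = {}"
    and max: "affine_dim Q2 \<le> card A"
    and red: "\<And>b. b < n \<Longrightarrow> b \<notin> A \<Longrightarrow> \<exists>g\<in>J. \<exists>v\<in>mons A. (\<forall>i. cf v i \<le> 1) \<and> cf g (term_of b 1 + v) = 1 \<and>
      (\<forall>x\<in>supp g. x \<noteq> term_of b 1 + v \<longrightarrow> degw x < degw (term_of b 1 + v))"
  shows "Q1 \<subseteq> Q2"
proof (rule subsetI, rule ccontr)
  fix f assume f: "f \<in> Q1" "f \<notin> Q2"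
  let ?S = "polys {..<n} :: ((nat \<Rightarrow>\<^sub>0 nat) \<Rightarrow>\<^sub>0 'k) set"
  note id1 = prime_inD(1)[OF Q1(1)] and id2 = prime_inD(1)[OF Q2(1)]
  have fS: "f \<in> ?S" using f ideal_inD(1)[OF id1] by blast
  have finA: "finite A" using A finite_subset by blast
  have AS: "polys A \<subseteq> ?S" by (rule polys_mono[OF A(1)])
  have max': "\<not> (\<exists>B\<subseteq>{..<n}. card B = Suc (card A) \<and> mons B \<inter> LM Q2 = {})"
  proof
    assume "\<exists>B\<subseteq>{..<n}. card B = Suc (card A) \<and> mons B \<inter> LM Q2 = {}"
    then obtain B where B: "B \<subseteq> {..<n}" "card B = Suc (card A)" "mons B \<inter> LM Q2 = {}" by blast
    then show False using LM_free_le_affine_dim[OF B(1,3)] max by simp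
  qed
  obtain p0 e where p0: "p0 \<in> polys A" "p0 \<noteq> 0" "e \<in> ?S" "p0 + f * e \<in> Q2"
    using algebraic_multiple[OF Q2(1) A(1) fS f(2) max'] .
  define f' where "f' = - (f * e)"
  have f': "f' \<in> Q1" unfolding f'_def using p0 f by (intro polys.ideal_uminus[OF id1] ideal_inD(5)[OF id1])
  have diff: "p0 - f' \<in> Q2" using p0 by (simp add: f'_def)
  obtain D0 where D0: "\<forall>m\<in>supp f'. degw m \<le> D0" using deg_bound_exists by blast
  \<comment> \<open>the product of the variables in \<open>A\<close>: a multiple of every squarefree monomial in them, so that one
    factor serves for all reductions of a round\<close>
  define \<delta> where "\<delta> = (\<Sum>a\<in>A. term_of a (1::nat))"
  have cf_\<delta>: "cf \<delta> i = (if i \<in> A then 1 else 0)" for i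
    unfolding \<delta>_def using finA by (simp add: lookup_sum lookup_single when_def)
  have \<delta>A: "\<delta> \<in> mons A" by (auto simp: mons_def in_keys_iff cf_\<delta> split: if_splits)
  then have \<delta>M: "\<delta> \<in> M" using mons_mono[OF A(1)] by blast
  define x\<delta> where "x\<delta> = term_of \<delta> (1::'k)"
  have x\<delta>A: "x\<delta> \<in> polys A" unfolding x\<delta>_def by (rule term_polys[OF \<delta>A])
  have red': "\<exists>g\<in>J. \<exists>u m'. \<delta> + m = u + m' \<and> cf g u = 1 \<and> (\<forall>v\<in>supp g. v \<noteq> u \<longrightarrow> degw v < degw u)"
    if m: "m \<in> M" "m \<notin> mons A" for m
  proof -
    obtain b where b: "b \<in> supp m" "b \<notin> A" using m(2) by (auto simp: mons_def)
    then have bn: "b < n" using m(1) by (auto simp: mons_def)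
    obtain g v where g: "g \<in> J" "v \<in> mons A" "\<forall>i. cf v i \<le> 1" "cf g (term_of b 1 + v) = 1"
      "\<forall>x\<in>supp g. x \<noteq> term_of b 1 + v \<longrightarrow> degw x < degw (term_of b 1 + v)"
      using red[OF bn b(2)] by blast
    have le: "cf (term_of b (1::nat) + v) i \<le> cf (\<delta> + m) i" for i
    proof -
      have "i \<notin> A \<Longrightarrow> cf v i = 0" using g(2) by (auto simp: mons_def in_keys_iff)
      moreover have "cf v i \<le> 1" using g(3) by simp
      moreover have "1 \<le> cf m b" using b(1) by (simp add: in_keys_iff)
      ultimately show ?thesis using b(2) by (auto simp: lookup_add lookup_single when_def cf_\<delta>)
    qed
    have "\<delta> + m = (term_of b 1 + v) + ((\<delta> + m) - (term_of b 1 + v))"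
      by (rule poly_mapping_eqI) (use le in \<open>simp add: lookup_add lookup_minus\<close>)
    then show ?thesis using g by blast
  qed
  have "\<exists>r\<in>Q1. x\<delta> ^ N * f' - r \<in> J \<and> (\<forall>m\<in>supp r. degw m + N \<le> D0 + N * degw \<delta>)" for N
  proof (induction N)
    case 0
    show ?case using f' D0 ideal_inD(2)[OF J] by (intro bexI[of _ f']) auto
  next
    case (Suc N)
    then obtain r where r: "r \<in> Q1" "x\<delta> ^ N * f' - r \<in> J" "\<forall>m\<in>supp r. degw m + N \<le> D0 + N * degw \<delta>" by blast
    obtain r' where r': "r' \<in> Q1" "term_of \<delta> 1 * r - r' \<in> J"
      "\<forall>m\<in>supp r'. degw m + Suc N \<le> D0 + N * degw \<delta> + degw \<delta>"
      using reduction_step[OF J id1 Q1(2) A(1,2) \<delta>A red' r(1,3)] by blast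
    have "x\<delta> * (x\<delta> ^ N * f' - r) + (x\<delta> * r - r') \<in> J"
      using r(2) r'(2) x\<delta>A AS by (intro ideal_inD(3)[OF J] ideal_inD(4)[OF J]) (auto simp: x\<delta>_def)
    then have "x\<delta> ^ Suc N * f' - r' \<in> J" by (simp add: algebra_simps)
    then show ?case using r' by (intro bexI[of _ r']) (auto simp: algebra_simps)
  qed
  then obtain r where r: "r \<in> Q1" "x\<delta> ^ Suc D0 * f' - r \<in> J"
    "\<forall>m\<in>supp r. degw m + Suc D0 \<le> D0 + Suc D0 * degw \<delta>" by blast
  define y where "y = x\<delta> ^ Suc D0 * p0"
  have yA: "y \<in> polys A" unfolding y_def by (intro polys.mult_C polys.power_C x\<delta>A p0)
  have yS: "y \<in> ?S" using yA AS by blast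
  have rS: "r \<in> ?S" using r ideal_inD(1)[OF id1] by blast
  have y0: "y \<noteq> 0" using p0(2) term_nonzero[of \<delta>, where 'k='k] by (simp add: y_def x\<delta>_def)
  have "y - r = x\<delta> ^ Suc D0 * (p0 - f') + (x\<delta> ^ Suc D0 * f' - r)" by (simp add: y_def algebra_simps)
  also have "\<dots> \<in> Q2"
  proof (intro ideal_inD(3)[OF id2] ideal_inD(4)[OF id2 _ diff])
    show "x\<delta> ^ Suc D0 \<in> ?S" using x\<delta>A AS by (intro polys.power_C) blast
    show "x\<delta> ^ Suc D0 * f' - r \<in> Q2" using r Q2(2) by blast
  qed
  finally have yr: "y - r \<in> Q2" .
  have deg_y: "Suc D0 * degw \<delta> \<le> degw m" if m: "m \<in> supp y" for m
  proof -
    have "\<forall>N. \<forall>m\<in>supp (x\<delta> ^ N * p0). N * degw \<delta> \<le> degw m"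
    proof
      fix N
      show "\<forall>m\<in>supp (x\<delta> ^ N * p0). N * degw \<delta> \<le> degw m"
      proof (induction N)
        case (Suc N)
        show ?case
        proof
          fix m assume "m \<in> supp (x\<delta> ^ Suc N * p0)"
          then have "m \<in> supp (x\<delta> * (x\<delta> ^ N * p0))" by (simp add: mult.assoc)
          then obtain m' where "m' \<in> supp (x\<delta> ^ N * p0)" "m = \<delta> + m'"
            unfolding x\<delta>_def using supp_term_mult by blast
          then show "Suc N * degw \<delta> \<le> degw m" using Suc by (simp add: wdeg_add)
        qed
      qed simp
    qed
    then show ?thesis using m unfolding y_def by blast
  qed
  have deg_r: "degw m < Suc D0 * degw \<delta>" if "m \<in> supp r" for m using r(3) that by fastforce
  note ly = lead[OF yS y0]
  have ly_r: "lead y \<notin> supp r" using deg_y[OF ly(1)] deg_r[of "lead y"] by linarith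
  have "lead (y - r) = lead y"
  proof (rule lead_eqI)
    show "y - r \<in> ?S" using yS rS by blast
    show "lead y \<in> supp (y - r)" using ly(1) ly_r by (simp add: in_keys_iff lookup_minus)
    show "\<forall>u\<in>supp (y - r). le u (lead y)"
    proof
      fix u assume "u \<in> supp (y - r)"
      then have "u \<in> supp y \<or> u \<in> supp r" by (auto simp: in_keys_iff lookup_minus)
      then show "le u (lead y)"
      proof
        assume u: "u \<in> supp r"
        have "degw u < degw (lead y)" using deg_r[OF u] deg_y[OF ly(1)] by linarith
        then show ?thesis using graded[of u "lead y"] polysD[OF rS u] ly(3) by (auto simp: le_def)
      qed (rule ly(2))
    qed
  qed
  moreover have "y - r \<noteq> 0"
  proof
    assume "y - r = 0"
    then show False using ly(1) ly_r by simp
  qed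
  moreover have "lead y \<in> mons A" using ly(1) yA polysD by blast
  ultimately show False using LM_I[OF yr] A(3) by auto
qed

end

context extended_polys
begin

text \<open>For infinite or transcendental extensions there is no norm from \<open>S\<^sub>L\<close> to \<open>S\<^sub>K\<close>, but a substitute is
  available: let \<open>V\<close> be the span of the finitely many basis elements that occur in \<open>h\<close>, and follow
  multiplication by \<open>g\<close> on \<open>V \<otimes> S\<^sub>K\<close> by the projection back to \<open>V \<otimes> S\<^sub>K\<close>.  If \<open>g\<close> is normalised, this is
  a square matrix over \<open>S\<^sub>K\<close> with leading monomial \<open>lead g\<close> on the diagonal and smaller monomials
  elsewhere, and it annihilates \<open>h\<close> modulo \<open>J\<close>.\<close>

lemma lead_in_facet_nonzerodivisor:
  assumes J: "ideal_in SK J" and A: "A \<subseteq> {..<n}"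
    and nzd: "\<And>s y. s \<in> SK \<Longrightarrow> s \<noteq> 0 \<Longrightarrow> lead s \<in> mons A \<Longrightarrow> y \<in> SK \<Longrightarrow> s * y \<in> J \<Longrightarrow> y \<in> J"
    and g: "g \<in> SL" "g \<noteq> 0" "lead g \<in> mons A" and h: "h \<in> SL" "g * h \<in> extended_ideal J"
  shows "h \<in> extended_ideal J"
proof -
  define \<beta> where "\<beta> = lead g"
  note lg = lead[OF g(1,2), folded \<beta>_def]
  define g1 where "g1 = term_of 0 (inverse (cf g \<beta>)) * g"
  have cf_g1: "cf g1 m = inverse (cf g \<beta>) * cf g m" for m
    using cf_term_mult[of 0 "inverse (cf g \<beta>)" g m] by (simp add: g1_def)
  have g1_\<beta>: "cf g1 \<beta> = 1" using lg(1) by (simp add: cf_g1 in_keys_iff)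
  have g1S: "g1 \<in> SL" unfolding g1_def using g(1) by (intro polys.mult_C term_polys) auto
  have "term_of 0 (inverse (cf g \<beta>)) * (g * h) \<in> extended_ideal J"
    by (intro ideal_inD(4)[OF extended_ideal_ideal[OF J] _ h(2)] term_polys) simp
  then have g1h: "g1 * h \<in> extended_ideal J" by (simp add: g1_def mult.assoc)
  define T where "T = {b. component b h \<noteq> 0}"
  have T: "finite T" "T \<subseteq> basis" unfolding T_def by (rule component_support)+
  define B where "B k = rec_nat \<beta> (\<lambda>_ m. m + m) k" for k
  have B_simps: "B 0 = \<beta>" "B (Suc k) = B k + B k" for k by (simp_all add: B_def)
  have BA: "B k \<in> mons A" for k
    by (induction k) (use g(3) in \<open>simp_all add: B_simps \<beta>_def mons_add\<close>)
  then have BM: "B k \<in> M" for k using mons_mono[OF A] by blast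
  define U where "U k = {u \<in> SK. cf u (B k) \<noteq> 0 \<and> (\<forall>m\<in>supp u. le m (B k))}" for k
  define Z where "Z k = {z \<in> SK. \<forall>m\<in>supp z. lt m (B k)}" for k
  have Z0: "cf z (B k) = 0" if "z \<in> SK" "\<forall>m\<in>supp z. lt m (B k)" for z k
    using that lt_irrefl[OF BM[of k]] by (auto simp: in_keys_iff)
  have Zle: "\<forall>m\<in>supp z. le m (B k)" if "z \<in> Z k" for z k using that by (auto simp: Z_def le_def)
  have "\<forall>b\<in>T. component b h \<in> J"
  proof (rule polys.elimination[OF J T(1), of U Z "\<lambda>b. component b h" "\<lambda>c b. component c (g1 * term_of 0 b)" 0])
    show "U k \<subseteq> SK" "Z k \<subseteq> SK" for k by (auto simp: U_def Z_def)
    show "y \<in> J" if u: "u \<in> U k" "y \<in> SK" "u * y \<in> J" for k u y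
    proof -
      have "lead u = B k" using u(1) by (intro lead_eqI) (auto simp: U_def in_keys_iff)
      moreover have "u \<noteq> 0" using u(1) by (auto simp: U_def)
      ultimately show ?thesis using nzd[of u y] u BA[of k] by (simp add: U_def)
    qed
    show "u * u' - z * z' \<in> U (Suc k)" if uz: "u \<in> U k" "u' \<in> U k" "z \<in> Z k" "z' \<in> Z k" for k u u' z z'
    proof -
      have S: "u \<in> SK" "u' \<in> SK" "z \<in> SK" "z' \<in> SK" using uz by (auto simp: U_def Z_def)
      have uu: "\<forall>m\<in>supp (u * u'). le m (B (Suc k))" "cf (u * u') (B (Suc k)) \<noteq> 0"
        using mult_bounded[OF BM[of k] BM[of k] S(1,2)] uz by (auto simp: U_def B_simps)
      have zz: "\<forall>m\<in>supp (z * z'). lt m (B (Suc k))"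
        using mult_strictly_bounded[OF BM[of k] BM[of k] S(3,4)] uz Zle[OF uz(4)] by (auto simp: Z_def B_simps)
      have "cf (z * z') (B (Suc k)) = 0" by (rule Z0) (use zz S in auto)
      then have "cf (u * u' - z * z') (B (Suc k)) \<noteq> 0" using uu by (simp add: lookup_minus)
      moreover have "le m (B (Suc k))" if "m \<in> supp (u * u' - z * z')" for m
      proof -
        have "m \<in> supp (u * u') \<or> m \<in> supp (z * z')" using that by (auto simp: in_keys_iff lookup_minus)
        then show ?thesis using uu zz by (auto simp: le_def)
      qed
      ultimately show ?thesis using S by (auto simp: U_def)
    qed
    show "u * z - z' * z'' \<in> Z (Suc k)" if uz: "u \<in> U k" "z \<in> Z k" "z' \<in> Z k" "z'' \<in> Z k" for k u z z' z''
    proof -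
      have S: "u \<in> SK" "z \<in> SK" "z' \<in> SK" "z'' \<in> SK" using uz by (auto simp: U_def Z_def)
      have "\<forall>m\<in>supp (z * u). lt m (B (Suc k))"
        using mult_strictly_bounded[OF BM[of k] BM[of k] S(2,1)] uz by (auto simp: U_def Z_def B_simps)
      moreover have "\<forall>m\<in>supp (z' * z''). lt m (B (Suc k))"
        using mult_strictly_bounded[OF BM[of k] BM[of k] S(3,4)] uz Zle[OF uz(4)] by (auto simp: Z_def B_simps)
      ultimately have "lt m (B (Suc k))" if "m \<in> supp (u * z - z' * z'')" for m
        using that by (auto simp: in_keys_iff lookup_minus mult.commute)
      then show ?thesis using S by (auto simp: Z_def)
    qed
    show "component b h \<in> SK" for b by (rule component_polys[OF h(1)])
    fix c assume c: "c \<in> T"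
    show "component c (g1 * term_of 0 b) \<in> (if c = b then U 0 else Z 0)" if b: "b \<in> T" for b
    proof -
      have cfc: "cf (component c (g1 * term_of 0 b)) m = coord c (b * cf g1 m)" for m
        using cf_term_mult[of 0 b g1 m] by (simp add: mult.commute)
      have S: "component c (g1 * term_of 0 b) \<in> SK"
        by (intro component_polys polys.mult_C g1S term_polys) simp
      have at_\<beta>: "cf (component c (g1 * term_of 0 b)) \<beta> = (if b = c then 1 else 0)"
        unfolding cfc g1_\<beta> using coord_basis[of b c] b T by auto
      have sub: "lt m \<beta> \<or> m = \<beta>" if "m \<in> supp (component c (g1 * term_of 0 b))" for m
      proof -
        have "cf g1 m \<noteq> 0" using that unfolding in_keys_iff cfc by (metis coord_zero mult_zero_right)
        then have "m \<in> supp g" by (auto simp: cf_g1 in_keys_iff)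
        then show ?thesis using lg(2) by (auto simp: le_def)
      qed
      show ?thesis
      proof (cases "c = b")
        case True
        then show ?thesis using S at_\<beta> sub by (auto simp: U_def B_simps le_def)
      next
        case False
        then have "m \<noteq> \<beta>" if "m \<in> supp (component c (g1 * term_of 0 b))" for m
          using that at_\<beta> by (auto simp: in_keys_iff)
        then show ?thesis using False S sub by (auto simp: Z_def B_simps)
      qed
    qed
    show "(\<Sum>b\<in>T. component c (g1 * term_of 0 b) * component b h) \<in> J"
    proof -
      have "g1 * h = (\<Sum>b\<in>T. extend (component b h) * (g1 * term_of 0 b))"
        by (subst component_expand[OF T(1), of h]) (auto simp: T_def sum_distrib_left algebra_simps)
      then have "component c (g1 * h) = (\<Sum>b\<in>T. component b h * component c (g1 * term_of 0 b))"
        by (simp add: component_sum component_extend_mult)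
      moreover have "component c (g1 * h) \<in> J" using g1h by (simp add: extended_ideal_def)
      ultimately show ?thesis by (simp add: mult.commute)
    qed
  qed
  moreover have "component b h \<in> J" if "b \<notin> T" for b using that ideal_inD(2)[OF J] by (simp add: T_def)
  ultimately show ?thesis using h(1) by (auto simp: extended_ideal_def)
qed

text \<open>An element of \<open>Q\<close> is nilpotent modulo \<open>P S\<^sub>L\<close> locally at \<open>Q\<close>, hence not a nonzerodivisor.\<close>

lemma LM_free_lifts:
  assumes P: "prime_in SK P" and Q: "minimal_prime_over SL (extended_ideal P) Q"
    and A: "A \<subseteq> {..<n}" "mons A \<inter> LM P = {}"
  shows "mons A \<inter> LM Q = {}"
proof (rule ccontr)
  note idP = prime_inD(1)[OF P]
  note Q' = minimal_prime_overD[OF Q]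
  assume "mons A \<inter> LM Q \<noteq> {}"
  then obtain g where g: "g \<in> Q" "g \<noteq> 0" "lead g \<in> mons A" by (auto simp: LM_def)
  have gS: "g \<in> SL" using g ideal_inD(1) prime_inD(1)[OF Q'(1)] by blast
  obtain k h where h: "h \<in> SL" "h \<notin> Q" "g ^ k * h \<in> extended_ideal P"
    using NL.minimal_prime_locally_nilpotent[OF extended_ideal_ideal[OF idP] Q g(1)] .
  have nzd: "y \<in> P" if s: "s \<in> SK" "s \<noteq> 0" "lead s \<in> mons A" "y \<in> SK" "s * y \<in> P" for s y
  proof -
    have "s \<notin> P" using LM_I[of s P] s A(2) by blast
    then show ?thesis using prime_inD(3)[OF P s(5) s(1) s(4)] by blast
  qed
  have "g ^ i * h \<in> extended_ideal P \<Longrightarrow> h \<in> extended_ideal P" for i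
  proof (induction i)
    case (Suc i)
    have gh: "g * (g ^ i * h) \<in> extended_ideal P" using Suc.prems by (simp add: mult.assoc)
    have ghS: "g ^ i * h \<in> SL" using gS h(1) by (intro polys.mult_C polys.power_C)
    have "g ^ i * h \<in> extended_ideal P"
      by (rule lead_in_facet_nonzerodivisor[OF idP A(1) _ gS g(2,3) ghS gh]) (rule nzd)
    then show ?case by (rule Suc.IH)
  qed simp
  then have "h \<in> extended_ideal P" using h(3) by blast
  then show False using Q'(2) h(2) by blast
qed

lemma affine_dim_contraction:
  assumes Q: "prime_in SL Q" shows "affine_dim Q \<le> affine_dim (contraction Q)"
proof -
  obtain A where A: "A \<subseteq> {..<n}" "alg_independent A Q" "card A = affine_dim Q"
    using affine_dim_attained[OF Q] .
  have "alg_independent A (contraction Q)"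
    unfolding alg_independent_def
  proof
    fix p assume "p \<in> polys A \<inter> contraction Q"
    then have "extend p = 0" using alg_independentD[OF A(2), of "extend p"] by (auto simp: contraction_def)
    then show "p \<in> {0}" using extend_eq_iff[of p 0] by simp
  qed
  then show ?thesis using independent_le_affine_dim A by metis
qed

text \<open>Let \<open>P\<close> be the common contraction of two minimal primes, and let \<open>A\<close> consist of \<open>d\<close> variables that
  support no leading monomial of \<open>P\<close>.  For \<open>b\<close> outside \<open>A\<close> the \<open>d + 1\<close> variables in \<open>insert b A\<close> are
  dependent modulo \<open>I\<close>, because all minimal primes of \<open>I\<close> have dimension \<open>d\<close>.  So one of the squarefree
  monomials \<open>u \<in> M0\<close> involves only these variables; it involves \<open>b\<close>, by the choice of \<open>A\<close>, and only to
  the first power.  This is the situation of \<open>prime_determined_by_facet\<close>.\<close>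

theorem contraction_injective:
  assumes I: "ideal_in SK I"
    and equidim: "\<And>P. P \<in> minimal_members (primes_over SK I) \<Longrightarrow> affine_dim P = d"
    and gen: "\<And>u. u \<in> M0 \<Longrightarrow> (\<forall>i. cf u i \<le> 1) \<and> (\<exists>g\<in>I. cf g u = 1 \<and> (\<forall>x\<in>supp g. x \<noteq> u \<longrightarrow> degw x < degw u))"
    and div: "\<And>B h. B \<subseteq> {..<n} \<Longrightarrow> h \<in> I \<Longrightarrow> h \<in> polys B \<Longrightarrow> h \<noteq> 0 \<Longrightarrow> \<exists>u\<in>M0. u \<in> mons B"
  shows "inj_on contraction (minimal_members (primes_over SL (extended_ideal I)))"
proof (rule inj_onI)
  fix Q1 Q2
  assume Q: "Q1 \<in> minimal_members (primes_over SL (extended_ideal I))"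
    "Q2 \<in> minimal_members (primes_over SL (extended_ideal I))" and eq: "contraction Q1 = contraction Q2"
  define P where "P = contraction Q1"
  have Pmin: "P \<in> minimal_members (primes_over SK I)" unfolding P_def by (rule minimal_contraction[OF I Q(1)])
  then have P: "prime_in SK P" "I \<subseteq> P" by (auto simp: minimal_members_def primes_over_def)
  have min: "minimal_prime_over SL (extended_ideal P) W"
    if W: "W \<in> minimal_members (primes_over SL (extended_ideal I))" "contraction W = P" for W
    unfolding minimal_prime_over_def
  proof (intro conjI allI impI)
    show prW: "prime_in SL W" using W by (auto simp: minimal_members_def primes_over_def)
    show "extended_ideal P \<subseteq> W"
      using extended_ideal_subset_iff[OF prime_inD(1)[OF P(1)] prime_inD(1)[OF prW]] W by simp
    fix R assume R: "prime_in SL R" "extended_ideal P \<subseteq> R" "R \<subseteq> W"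
    then have "R \<in> primes_over SL (extended_ideal I)"
      using extended_ideal_mono[OF P(2)] by (auto simp: primes_over_def)
    then show "R = W" using W R by (auto simp: minimal_members_def)
  qed
  note min1 = min[OF Q(1) P_def[symmetric]] and min2 = min[OF Q(2)]
  have con2: "contraction Q2 = P" using eq by (simp add: P_def)
  obtain A where A: "A \<subseteq> {..<n}" "mons A \<inter> LM P = {}" "card A = affine_dim P"
    using LM_free_of_affine_dim[OF P(1)] .
  have dimP: "affine_dim P = d" by (rule equidim[OF Pmin])
  have pr: "prime_in SL Q1" "extended_ideal I \<subseteq> Q1" "prime_in SL Q2" "extended_ideal I \<subseteq> Q2"
    using Q by (auto simp: minimal_members_def primes_over_def)
  have "Q1 \<subseteq> Q2"
  proof (rule prime_determined_by_facet[OF extended_ideal_ideal[OF I] pr A(1)])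
    show "mons A \<inter> LM Q1 = {}" by (rule LM_free_lifts[OF P(1) min1 A(1,2)])
    show "mons A \<inter> LM Q2 = {}" by (rule LM_free_lifts[OF P(1) min2[OF con2] A(1,2)])
    show "affine_dim Q2 \<le> card A" using affine_dim_contraction[OF pr(3)] con2 A(3) by simp
    fix b assume b: "b < n" "b \<notin> A"
    have finA: "finite A" using A finite_subset by blast
    have AB: "insert b A \<subseteq> {..<n}" using A b by auto
    have "\<exists>h\<in>I. h \<in> polys (insert b A) \<and> h \<noteq> 0"
    proof (rule ccontr)
      assume no: "\<not> ?thesis"
      define T where "T = polys (insert b A) - {0 :: (nat \<Rightarrow>\<^sub>0 nat) \<Rightarrow>\<^sub>0 'k}"
      have T: "T \<subseteq> SK" "1 \<in> T" "\<And>u v. u \<in> T \<Longrightarrow> v \<in> T \<Longrightarrow> u * v \<in> T" "I \<inter> T = {}"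
        using polys_mono[OF AB] no by (auto simp: T_def)
      obtain R where R: "prime_in SK R" "I \<subseteq> R" "R \<inter> T = {}"
        by (rule NK.prime_avoiding_multiplicative_set[OF I T])
      obtain W where W: "minimal_prime_over SK I W" "W \<subseteq> R" using NK.minimal_prime_below[OF I R(1,2)] .
      have "W \<in> minimal_members (primes_over SK I)"
        using minimal_prime_overD[OF W(1)] by (auto simp: minimal_members_def primes_over_def)
      then have dimW: "affine_dim W = d" by (rule equidim)
      have "alg_independent (insert b A) W" using R(3) W(2) by (auto simp: alg_independent_def T_def)
      then have "card (insert b A) \<le> d" using independent_le_affine_dim[OF AB, of W] dimW by simp
      then show False using b A(3) dimP finA by simp
    qed
    then obtain u where u: "u \<in> M0" "u \<in> mons (insert b A)" using div[OF AB] by blast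
    obtain g where g: "g \<in> I" "cf g u = 1" "\<forall>x\<in>supp g. x \<noteq> u \<longrightarrow> degw x < degw u" using gen[OF u(1)] by blast
    have sq: "\<forall>i. cf u i \<le> 1" using gen[OF u(1)] by blast
    have gS: "g \<in> SK" using g ideal_inD(1)[OF I] by blast
    have ug: "u \<in> supp g" using g(2) by (simp add: in_keys_iff)
    have "lead g = u"
    proof (rule lead_eqI[OF gS ug])
      show "\<forall>x\<in>supp g. le x u" using g(3) graded polysD[OF gS] ug by (auto simp: le_def)
    qed
    moreover have "g \<noteq> 0" using ug by auto
    ultimately have "u \<in> LM P" using LM_I[of g P] g(1) P(2) by auto
    then have "u \<notin> mons A" using A(2) by blast
    then have "b \<in> supp u" using u(2) by (auto simp: mons_def)
    then have ub: "cf u b = 1" using sq by (metis in_keys_iff le_antisym less_one not_less)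
    define v where "v = u - term_of b 1"
    have uv: "u = term_of b 1 + v"
      by (rule poly_mapping_eqI) (use ub in \<open>auto simp: v_def lookup_add lookup_minus lookup_single when_def\<close>)
    have "v \<in> mons A"
    proof -
      have "cf v i = 0" if "i \<notin> A" for i
      proof (cases "i = b")
        case True
        then show ?thesis using ub by (simp add: v_def lookup_minus)
      next
        case False
        then have "i \<notin> supp u" using u(2) that by (auto simp: mons_def)
        then show ?thesis by (simp add: v_def lookup_minus in_keys_iff)
      qed
      then show ?thesis by (auto simp: mons_def in_keys_iff)
    qed
    moreover have "\<forall>i. cf v i \<le> 1" using sq by (auto simp: v_def lookup_minus intro: le_trans[OF diff_le_self])
    moreover have "extend g \<in> extended_ideal I" using extend_mem_extended_ideal[OF I gS] g(1) by simp
    ultimately show "\<exists>g\<in>extended_ideal I. \<exists>v\<in>mons A. (\<forall>i. cf v i \<le> 1) \<and> cf g (term_of b 1 + v) = 1 \<and>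
      (\<forall>x\<in>supp g. x \<noteq> term_of b 1 + v \<longrightarrow> degw x < degw (term_of b 1 + v))"
      using g(2,3) uv by (intro bexI[of _ "extend g"] bexI[of _ v]) (auto simp: \<phi>_one)
  qed
  then show "Q1 = Q2" using Q(2) pr by (auto simp: minimal_members_def primes_over_def)
qed

end


section \<open>The rings of the statement as quotients of polynomial rings\<close>

lemma surjection_onto_quotient:
  assumes h: "surjection_onto C R h" and J: "ideal J R"
  shows "surjection_onto C (R Quot J) (\<lambda>a. J +>\<^bsub>R\<^esub> h a)"
    and "surjection_onto.ker C (R Quot J) (\<lambda>a. J +>\<^bsub>R\<^esub> h a) = {a \<in> C. h a \<in> J}"
proof -
  interpret h: surjection_onto C R h by (rule h)
  interpret J: ideal J R by (rule J)
  note hom = J.rcos_ring_hom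
  show s: "surjection_onto C (R Quot J) (\<lambda>a. J +>\<^bsub>R\<^esub> h a)"
  proof (intro surjection_onto.intro surjection_onto_axioms.intro)
    show "subring_in C" by (rule h.subring_in_axioms)
    show "cring (R Quot J)" by (rule J.quotient_is_cring[OF h.is_cring])
    show "(\<lambda>a. J +>\<^bsub>R\<^esub> h a) ` C = carrier (R Quot J)"
    proof -
      have "(\<lambda>a. J +>\<^bsub>R\<^esub> h a) ` C = (\<lambda>x. J +>\<^bsub>R\<^esub> x) ` (h ` C)" by (simp add: image_image)
      also have "\<dots> = carrier (R Quot J)" unfolding h.surj by (auto simp: FactRing_def A_RCOSETS_def')
      finally show ?thesis .
    qed
    fix a b assume "a \<in> C" "b \<in> C"
    then show "J +>\<^bsub>R\<^esub> h (a + b) = (J +>\<^bsub>R\<^esub> h a) \<oplus>\<^bsub>R Quot J\<^esub> (J +>\<^bsub>R\<^esub> h b)"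
      "J +>\<^bsub>R\<^esub> h (a * b) = (J +>\<^bsub>R\<^esub> h a) \<otimes>\<^bsub>R Quot J\<^esub> (J +>\<^bsub>R\<^esub> h b)"
      using ring_hom_add[OF hom] ring_hom_mult[OF hom] h.h_closed by (simp_all add: h.h_add h.h_mult)
  next
    show "J +>\<^bsub>R\<^esub> h 1 = \<one>\<^bsub>R Quot J\<^esub>" using ring_hom_one[OF hom] by (simp add: h.h_one)
  qed
  interpret s: surjection_onto C "R Quot J" "\<lambda>a. J +>\<^bsub>R\<^esub> h a" by (rule s)
  have zero: "\<zero>\<^bsub>R Quot J\<^esub> = J" by (simp add: FactRing_def)
  show "s.ker = {a \<in> C. h a \<in> J}"
    unfolding s.ker_def zero using J.a_rcos_const J.rcos_const_imp_mem h.h_closed by blast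
qed

lemma surjection_onto_mpoly_ring:
  "surjection_onto (polys {..<n}) (mpoly_ring n :: ((nat \<Rightarrow>\<^sub>0 nat) \<Rightarrow>\<^sub>0 'k::field) ring) (\<lambda>p. p)"
  by (intro surjection_onto.intro surjection_onto_axioms.intro subring_polys mpoly_ring_cring)
     (auto simp: mpoly_ring_simps polys_def monomials_eq)

lemma ideal_mpoly_ring:
  fixes I :: "((nat \<Rightarrow>\<^sub>0 nat) \<Rightarrow>\<^sub>0 'k::field) set"
  assumes "ideal I (mpoly_ring n)"
  shows "ideal_in (polys {..<n}) I"
proof -
  interpret I: ideal I "mpoly_ring n" by fact
  show ?thesis
    unfolding ideal_in_def
  proof (intro conjI ballI)
    show "I \<subseteq> polys {..<n}" using I.a_subset by (simp add: mpoly_ring_simps polys_def monomials_eq)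
    note sub = ideal.axioms(1)[OF assms]
    show "0 \<in> I" using additive_subgroup.zero_closed[OF sub] by (simp add: mpoly_ring_simps)
    show "x + y \<in> I" if "x \<in> I" "y \<in> I" for x y
      using additive_subgroup.a_closed[OF sub that] by (simp add: mpoly_ring_simps)
    show "r * x \<in> I" if "r \<in> polys {..<n}" "x \<in> I" for r x
      using I.I_l_closed[OF that(2), of r] that(1) by (simp add: mpoly_ring_simps polys_def monomials_eq)
  qed
qed

lemma ideal_mpoly_ringI:
  fixes J :: "((nat \<Rightarrow>\<^sub>0 nat) \<Rightarrow>\<^sub>0 'k::field) set"
  assumes J: "ideal_in (polys {..<n}) J"
  shows "ideal J (mpoly_ring n)"
proof (rule idealI)
  interpret R: cring "mpoly_ring n :: ((nat \<Rightarrow>\<^sub>0 nat) \<Rightarrow>\<^sub>0 'k) ring" by (rule mpoly_ring_cring)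
  have car: "carrier (mpoly_ring n :: ((nat \<Rightarrow>\<^sub>0 nat) \<Rightarrow>\<^sub>0 'k) ring) = polys {..<n}"
    by (simp add: mpoly_ring_simps polys_def monomials_eq)
  show "ring (mpoly_ring n :: ((nat \<Rightarrow>\<^sub>0 nat) \<Rightarrow>\<^sub>0 'k) ring)" by (rule R.ring_axioms)
  show "subgroup J (add_monoid (mpoly_ring n))"
  proof (rule R.add.subgroupI)
    show "J \<subseteq> carrier (mpoly_ring n)" unfolding car by (rule ideal_inD(1)[OF J])
    show "J \<noteq> {}" using ideal_inD(2)[OF J] by blast
    show "\<ominus>\<^bsub>mpoly_ring n\<^esub> a \<in> J" if a: "a \<in> J" for a
    proof -
      have aC: "a \<in> polys {..<n}" using a ideal_inD(1)[OF J] by blast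
      have "\<ominus>\<^bsub>mpoly_ring n\<^esub> a = - a"
        by (rule R.minus_equality) (use aC polys.uminus_C[OF aC] in \<open>simp_all add: mpoly_ring_simps(3,4) car\<close>)
      then show ?thesis using polys.ideal_uminus[OF J a] by simp
    qed
    show "a \<oplus>\<^bsub>mpoly_ring n\<^esub> b \<in> J" if "a \<in> J" "b \<in> J" for a b
      using ideal_inD(3)[OF J that] by (simp add: mpoly_ring_simps)
  qed
  show "x \<otimes>\<^bsub>mpoly_ring n\<^esub> a \<in> J" "a \<otimes>\<^bsub>mpoly_ring n\<^esub> x \<in> J"
    if "a \<in> J" "x \<in> carrier (mpoly_ring n)" for a x
    using that ideal_inD(4,5)[OF J, of x a] by (simp_all add: mpoly_ring_simps(2) car)
qed

lemma mem_monomial_ideal: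
  assumes E: "E \<subseteq> mons {..<n}" and m: "term_of m (1::'k::field) \<in> monomial_ideal n E"
  shows "\<exists>u\<in>E. \<exists>v\<in>mons {..<n}. m = u + v"
proof -
  interpret R: cring "mpoly_ring n :: ((nat \<Rightarrow>\<^sub>0 nat) \<Rightarrow>\<^sub>0 'k) ring" by (rule mpoly_ring_cring)
  define H where "H = {p \<in> polys {..<n} :: ((nat \<Rightarrow>\<^sub>0 nat) \<Rightarrow>\<^sub>0 'k) set. \<forall>m\<in>supp p. \<exists>u\<in>E. \<exists>v\<in>mons {..<n}. m = u + v}"
  have "ideal_in (polys {..<n}) H"
    unfolding ideal_in_def
  proof (intro conjI ballI)
    show "0 \<in> H" by (simp add: H_def polys.zero_C)
    fix p q assume pq: "p \<in> H" "q \<in> H"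
    have "m \<in> supp p \<or> m \<in> supp q" if "m \<in> supp (p + q)" for m
      using subsetD[OF Poly_Mapping.keys_add that] by simp
    then show "p + q \<in> H" using pq polys.add_C unfolding H_def by blast
  next
    fix r p :: "(nat \<Rightarrow>\<^sub>0 nat) \<Rightarrow>\<^sub>0 'k" assume rp: "r \<in> polys {..<n}" "p \<in> H"
    have "\<exists>u\<in>E. \<exists>v\<in>mons {..<n}. m = u + v" if m: "m \<in> supp (r * p)" for m
    proof -
      obtain a b where ab: "a \<in> supp r" "b \<in> supp p" "m = a + b" using keys_mult_split[OF m] by blast
      then obtain u v where "u \<in> E" "v \<in> mons {..<n}" "b = u + v" using rp(2) by (auto simp: H_def)
      moreover from this have "m = u + (v + a)" using ab by (simp add: algebra_simps)
      ultimately show ?thesis using polysD[OF rp(1) ab(1)] mons_add by blast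
    qed
    then show "r * p \<in> H" using rp by (auto simp: H_def)
  qed (auto simp: H_def)
  then have "ideal H (mpoly_ring n)" by (rule ideal_mpoly_ringI)
  moreover have "(\<lambda>m. term_of m 1) ` E \<subseteq> H"
  proof
    fix p assume "p \<in> (\<lambda>m. term_of m (1::'k)) ` E"
    then obtain u where u: "u \<in> E" "p = term_of u 1" by blast
    have "\<exists>v\<in>mons {..<n}. u = u + v" by (intro bexI[of _ 0]) auto
    then have "\<exists>u'\<in>E. \<exists>v\<in>mons {..<n}. u = u' + v" using u(1) by blast
    then show "p \<in> H" using u E term_polys[of u "{..<n}" "1::'k"] by (auto simp: H_def)
  qed
  ultimately have "monomial_ideal n E \<subseteq> H" unfolding monomial_ideal_def by (rule R.genideal_minimal)
  then show ?thesis using m by (auto simp: H_def)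
qed

lemma term_mem_monomial_ideal:
  assumes "E \<subseteq> mons {..<n}" "u \<in> E"
  shows "term_of u (1::'k::field) \<in> monomial_ideal n E"
proof -
  interpret R: cring "mpoly_ring n :: ((nat \<Rightarrow>\<^sub>0 nat) \<Rightarrow>\<^sub>0 'k) ring" by (rule mpoly_ring_cring)
  have "(\<lambda>m. term_of m (1::'k)) ` E \<subseteq> carrier (mpoly_ring n)"
    using assms(1) term_polys by (auto simp: mpoly_ring_simps(1) polys_def monomials_eq)
  from R.genideal_self[OF this] show ?thesis unfolding monomial_ideal_def using assms(2) by blast
qed

text \<open>A monomial belongs to a monomial ideal if and only if it is a multiple of one of the generators.  This is
  applied to both systems of generators of the initial ideal.\<close>

lemma (in monomial_ordering) squarefree_leading_monomials:
  fixes I :: "((nat \<Rightarrow>\<^sub>0 nat) \<Rightarrow>\<^sub>0 'k::field) set"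
  assumes I: "ideal_in (polys {..<n}) I" and sq: "squarefree_monomial_ideal n (initial_ideal n lt I)"
  obtains E where "finite E" "E \<subseteq> LM I" "\<And>u i. u \<in> E \<Longrightarrow> cf u i \<le> 1"
    "\<And>m. m \<in> LM I \<Longrightarrow> \<exists>u\<in>E. \<exists>v\<in>M. m = u + v"
proof -
  obtain E where E: "E \<subseteq> M" "\<forall>m\<in>E. \<forall>i. cf m i \<le> 1"
    "initial_ideal n lt I = (monomial_ideal n E :: ((nat \<Rightarrow>\<^sub>0 nat) \<Rightarrow>\<^sub>0 'k) set)"
    using sq unfolding squarefree_monomial_ideal_def monomials_eq by blast
  have LM: "initial_ideal n lt I = (monomial_ideal n (LM I) :: ((nat \<Rightarrow>\<^sub>0 nat) \<Rightarrow>\<^sub>0 'k) set)"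
    by (simp add: initial_ideal_def LM_def)
  note LM_M = LM_mons[OF I]
  have "finite E"
  proof (rule finite_subset)
    show "E \<subseteq> {m \<in> M. \<forall>i\<in>{..<n}. cf m i \<in> {..1}}" using E by auto
    show "finite {m \<in> M. \<forall>i\<in>{..<n}. cf m i \<in> {..1}}"
      using card_mons_box[of "{..<n}" "\<lambda>i. {..1}"] by simp
  qed
  moreover have "E \<subseteq> LM I"
  proof
    fix u assume "u \<in> E"
    then have "term_of u (1::'k) \<in> monomial_ideal n (LM I)"
      using term_mem_monomial_ideal[OF E(1), of u, where 'k='k] E(3) LM by simp
    then obtain l v where "l \<in> LM I" "v \<in> M" "u = l + v" using mem_monomial_ideal[OF LM_M] by blast
    then show "u \<in> LM I" using LM_add[OF I] by simp
  qed
  moreover have "\<exists>u\<in>E. \<exists>v\<in>M. m = u + v" if "m \<in> LM I" for m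
  proof (rule mem_monomial_ideal[OF E(1)])
    show "term_of m (1::'k) \<in> monomial_ideal n E"
      using term_mem_monomial_ideal[OF LM_M that, where 'k='k] E(3) LM by simp
  qed
  ultimately show thesis using that E(2) by blast
qed

lemma (in graded_ordering) equidimensional_affine_dim:
  fixes I :: "((nat \<Rightarrow>\<^sub>0 nat) \<Rightarrow>\<^sub>0 'k::field) set"
  assumes I: "ideal I (mpoly_ring n)" and eq: "equidimensional (mpoly_ring n) I"
    and P: "P \<in> minimal_members (primes_over (polys {..<n}) I)"
  shows "enat (affine_dim P) = krull_dim (mpoly_ring n Quot I)"
proof -
  let ?R = "mpoly_ring n :: ((nat \<Rightarrow>\<^sub>0 nat) \<Rightarrow>\<^sub>0 'k) ring"
  let ?h = "\<lambda>p. I +>\<^bsub>?R\<^esub> p"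
  note s = surjection_onto_quotient[OF surjection_onto_mpoly_ring I]
  interpret h: surjection_onto "polys {..<n}" "?R Quot I" ?h by (rule s(1))
  have ker: "h.ker = I" using s(2) ideal_inD(1)[OF ideal_mpoly_ring[OF I]] by auto
  have P': "P \<in> primes_over (polys {..<n}) h.ker" using P by (auto simp: minimal_members_def ker)
  then have prP: "prime_in (polys {..<n}) P" "h.ker \<subseteq> P" by (auto simp: primes_over_def)
  have pr: "primeideal (?h ` P) (?R Quot I)" by (rule h.prime_image[OF prP])
  have "?h ` P \<in> minimal_primes (?R Quot I)"
    unfolding minimal_primes_def
  proof (intro CollectI conjI allI impI)
    show "primeideal (?h ` P) (?R Quot I)" by (rule pr)
    fix q assume q: "primeideal q (?R Quot I)" "q \<subseteq> ?h ` P"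
    define Q where "Q = {a \<in> polys {..<n}. ?h a \<in> q}"
    have Q: "Q \<in> primes_over (polys {..<n}) h.ker" "?h ` Q = q"
      using h.prime_preimage[OF q(1)] by (auto simp: primes_over_def Q_def)
    then have "Q \<subseteq> P" using h.primes_mono[OF Q(1) P'] q(2) by simp
    then have "Q = P" using P Q(1) by (auto simp: minimal_members_def ker)
    then show "q = ?h ` P" using Q(2) by simp
  qed
  then have "krull_dim ((?R Quot I) Quot (?h ` P)) = krull_dim (?R Quot I)"
    using eq unfolding equidimensional_def by blast
  moreover have "krull_dim ((?R Quot I) Quot (?h ` P)) = enat (affine_dim P)"
  proof -
    note s2 = surjection_onto_quotient[OF s(1) primeideal.axioms(1)[OF pr]]
    have "{a \<in> polys {..<n}. ?h a \<in> ?h ` P} = P"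
      using h.image_mem_iff[OF prime_inD(1)[OF prP(1)] prP(2)] ideal_inD(1)[OF prime_inD(1)[OF prP(1)]] by blast
    then have "krull_dim ((?R Quot I) Quot (?h ` P)) =
        Sup {enat k | k f. strict_chain (primes_over (polys {..<n}) P) k f}"
      using surjection_onto.krull_dim_eq[OF s2(1)] s2(2) by simp
    then show ?thesis using Sup_chain_lengths[OF prP(1)] by simp
  qed
  ultimately show ?thesis by simp
qed

section \<open>The tensor product\<close>

text \<open>The additive extension of \<open>f\<close> to the free abelian group.\<close>

definition zlin :: "('i \<Rightarrow> 'r::comm_ring_1) \<Rightarrow> ('i \<Rightarrow>\<^sub>0 int) \<Rightarrow> 'r" where
  "zlin f x = (\<Sum>p\<in>supp x. of_int (cf x p) * f p)"

lemma zlin_superset: "finite T \<Longrightarrow> supp x \<subseteq> T \<Longrightarrow> zlin f x = (\<Sum>p\<in>T. of_int (cf x p) * f p)"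
  unfolding zlin_def by (intro sum.mono_neutral_left) (auto simp: in_keys_iff)

lemma zlin_zero [simp]: "zlin f 0 = 0"
  by (simp add: zlin_def)

lemma zlin_add: "zlin f (x + y) = zlin f x + zlin f y"
proof -
  let ?T = "supp x \<union> supp y"
  have "supp (x + y) \<subseteq> ?T" by (rule Poly_Mapping.keys_add)
  then show ?thesis
    using zlin_superset[of ?T "x + y" f] zlin_superset[of ?T x f] zlin_superset[of ?T y f]
    by (simp add: lookup_add algebra_simps sum.distrib)
qed

lemma zlin_diff: "zlin f (x - y) = zlin f x - zlin f y"
  using zlin_add[of f "x - y" y] by (simp add: algebra_simps)

lemma zlin_of [simp]: "zlin f (frag_of p) = f p"
  by (simp add: zlin_def)

lemma zlin_sum: "zlin f (sum g T) = (\<Sum>i\<in>T. zlin f (g i))"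
  by (induction T rule: infinite_finite_induct) (simp_all add: zlin_add)

lemma cring_field_type: "cring (ring_of_type_algebra :: 'a::field ring)"
  by (rule cring_from_type_algebra)

lemma field_type_simps:
  "carrier (ring_of_type_algebra :: 'a::field ring) = UNIV"
  "x \<otimes>\<^bsub>(ring_of_type_algebra :: 'a ring)\<^esub> y = x * y" "x \<oplus>\<^bsub>(ring_of_type_algebra :: 'a ring)\<^esub> y = x + y"
  "\<one>\<^bsub>(ring_of_type_algebra :: 'a ring)\<^esub> = 1"
  by (simp_all add: ring_of_type_algebra_def)

locale tensor_extension = extended_polys n lt w \<phi> + Q: surjection_onto "polys {..<n}" A q
  for n lt w and \<phi> :: "'k::field \<Rightarrow> 'l::field" and A :: "('b, 'm) ring_scheme"
    and q :: "((nat \<Rightarrow>\<^sub>0 nat) \<Rightarrow>\<^sub>0 'k) \<Rightarrow> 'b"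
begin

definition \<alpha> :: "'k \<Rightarrow> 'b" where "\<alpha> c = q (term_of 0 c)"

abbreviation "LL \<equiv> ring_of_type_algebra :: 'l ring"
abbreviation "KK \<equiv> ring_of_type_algebra :: 'k ring"
abbreviation "F \<equiv> free_pair_ring A LL"
abbreviation "rels \<equiv> tensor_relations KK A \<alpha> LL \<phi>"
abbreviation "T \<equiv> tensor_algebra KK A \<alpha> LL \<phi>"

definition N :: "('b \<times> 'l \<Rightarrow>\<^sub>0 int) set" where "N = Idl\<^bsub>F\<^esub> rels"

lemma ideal_ker: "ideal_in SK Q.ker"
  unfolding ideal_in_def
proof (intro conjI ballI)
  show "Q.ker \<subseteq> SK" by (auto simp: Q.ker_def)
  show "0 \<in> Q.ker" by (simp add: Q.ker_def Q.h_zero)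
  show "x + y \<in> Q.ker" if "x \<in> Q.ker" "y \<in> Q.ker" for x y
    using that by (simp add: Q.ker_def Q.h_add)
  show "r * x \<in> Q.ker" if "r \<in> SK" "x \<in> Q.ker" for r x
    using that by (simp add: Q.ker_def Q.h_mult Q.h_closed)
qed

lemma const_SK: "term_of 0 c \<in> SK"
  by (rule term_polys) simp

lemma \<alpha>_hom: "\<alpha> \<in> ring_hom KK A"
  unfolding \<alpha>_def
  by (rule ring_hom_memI)
     (use Q.h_closed[OF const_SK] Q.h_mult[OF const_SK const_SK] Q.h_add[OF const_SK const_SK] Q.h_one in
      \<open>simp_all add: field_type_simps mult_single single_add\<close>)

lemma \<phi>_hom: "\<phi> \<in> ring_hom KK LL"
  by (rule ring_hom_memI) (simp_all add: field_type_simps \<phi>_add \<phi>_mult \<phi>_one)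

lemma cring_F: "cring F"
  by (rule free_pair_ring_cring[OF Q.is_cring cring_field_type])

lemma ideal_N: "ideal N F"
proof -
  interpret F: cring F by (rule cring_F)
  show ?thesis
    unfolding N_def
    by (intro F.genideal_ideal tensor_relations_carrier[OF Q.is_cring cring_field_type \<alpha>_hom \<phi>_hom])
qed

lemma rels_N: "rels \<subseteq> N"
proof -
  interpret F: cring F by (rule cring_F)
  show ?thesis
    unfolding N_def
    by (intro F.genideal_self tensor_relations_carrier[OF Q.is_cring cring_field_type \<alpha>_hom \<phi>_hom])
qed

lemma uminus_F: "x \<in> carrier F \<Longrightarrow> \<ominus>\<^bsub>F\<^esub> x = - x"
proof -
  interpret F: cring F by (rule cring_F)
  assume "x \<in> carrier F"
  then show ?thesis by (intro F.minus_equality) (auto simp: free_pair_ring_simps)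
qed

lemma N_zero: "0 \<in> N" and N_sub: "N \<subseteq> carrier F"
  and N_add: "x \<in> N \<Longrightarrow> y \<in> N \<Longrightarrow> x + y \<in> N"
  and N_diff: "x \<in> N \<Longrightarrow> y \<in> N \<Longrightarrow> x - y \<in> N"
  and N_mult: "x \<in> N \<Longrightarrow> z \<in> carrier F \<Longrightarrow> z \<otimes>\<^bsub>F\<^esub> x \<in> N" "x \<in> N \<Longrightarrow> z \<in> carrier F \<Longrightarrow> x \<otimes>\<^bsub>F\<^esub> z \<in> N"
proof -
  interpret N: ideal N F by (rule ideal_N)
  note sg = ideal.axioms(1)[OF ideal_N]
  show "0 \<in> N" using additive_subgroup.zero_closed[OF sg] by (simp add: free_pair_ring_simps)
  show sub: "N \<subseteq> carrier F" by (rule N.a_subset)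
  show add: "x + y \<in> N" if "x \<in> N" "y \<in> N" for x y
    using additive_subgroup.a_closed[OF sg that] by (simp add: free_pair_ring_simps)
  show "x - y \<in> N" if "x \<in> N" "y \<in> N"
    using add[OF that(1) subgroup.m_inv_closed[OF additive_subgroup.a_subgroup[OF sg] that(2), folded a_inv_def]]
      uminus_F[of y] sub that by auto
  show "x \<in> N \<Longrightarrow> z \<in> carrier F \<Longrightarrow> z \<otimes>\<^bsub>F\<^esub> x \<in> N" "x \<in> N \<Longrightarrow> z \<in> carrier F \<Longrightarrow> x \<otimes>\<^bsub>F\<^esub> z \<in> N"
    by (rule N.I_l_closed, assumption+) (rule N.I_r_closed, assumption+)
qed

text \<open>Equality in the tensor product.\<close>

definition eqv :: "('b \<times> 'l \<Rightarrow>\<^sub>0 int) \<Rightarrow> ('b \<times> 'l \<Rightarrow>\<^sub>0 int) \<Rightarrow> bool" where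
  "eqv x y \<longleftrightarrow> x - y \<in> N"

lemma eqv_refl: "eqv x x"
  by (simp add: eqv_def N_zero)

lemma eqv_sym: "eqv x y \<Longrightarrow> eqv y x"
  unfolding eqv_def using N_diff[OF N_zero, of "x - y"] by simp

lemma eqv_trans [trans]: "eqv x y \<Longrightarrow> eqv y z \<Longrightarrow> eqv x z"
  unfolding eqv_def using N_add[of "x - y" "y - z"] by simp

lemma eqv_add: "eqv x y \<Longrightarrow> eqv x' y' \<Longrightarrow> eqv (x + x') (y + y')"
  unfolding eqv_def using N_add[of "x - y" "x' - y'"] by (simp add: algebra_simps)

lemma eqv_diff: "eqv x y \<Longrightarrow> eqv x' y' \<Longrightarrow> eqv (x - x') (y - y')"
  unfolding eqv_def using N_diff[of "x - y" "x' - y'"] by (simp add: algebra_simps)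

lemma eqv_sum: "(\<And>i. i \<in> B \<Longrightarrow> eqv (f i) (g i)) \<Longrightarrow> eqv (sum f B) (sum g B)"
  by (induction B rule: infinite_finite_induct) (auto simp: eqv_refl intro: eqv_add)

lemma of_closed: "a \<in> carrier A \<Longrightarrow> frag_of (a, b) \<in> carrier F"
  by (simp add: free_pair_ring_simps field_type_simps)

lemma carrier_F_add: "x \<in> carrier F \<Longrightarrow> y \<in> carrier F \<Longrightarrow> x + y \<in> carrier F"
  using Poly_Mapping.keys_add[of x y] by (auto simp: free_pair_ring_simps)

lemma carrier_F_sum: "(\<And>i. i \<in> B \<Longrightarrow> f i \<in> carrier F) \<Longrightarrow> sum f B \<in> carrier F"
proof (induction B rule: infinite_finite_induct)
  case (insert i B)
  then show ?case by (simp add: carrier_F_add)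
qed (simp_all add: free_pair_ring_simps)

lemma eqv_left: "a \<in> carrier A \<Longrightarrow> a' \<in> carrier A \<Longrightarrow>
    eqv (frag_of (a \<oplus>\<^bsub>A\<^esub> a', b)) (frag_of (a, b) + frag_of (a', b))"
proof -
  assume "a \<in> carrier A" "a' \<in> carrier A"
  then have "frag_of (a \<oplus>\<^bsub>A\<^esub> a', b) - frag_of (a, b) - frag_of (a', b) \<in> rels"
    unfolding tensor_relations_def field_type_simps by blast
  then show ?thesis using rels_N by (auto simp: eqv_def diff_diff_eq)
qed

lemma eqv_right: "a \<in> carrier A \<Longrightarrow> eqv (frag_of (a, b + b')) (frag_of (a, b) + frag_of (a, b'))"
proof -
  assume "a \<in> carrier A"
  then have "frag_of (a, b + b') - frag_of (a, b) - frag_of (a, b') \<in> rels"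
    unfolding tensor_relations_def field_type_simps by blast
  then show ?thesis using rels_N by (auto simp: eqv_def diff_diff_eq)
qed

lemma eqv_scalar: "a \<in> carrier A \<Longrightarrow> eqv (frag_of (\<alpha> k \<otimes>\<^bsub>A\<^esub> a, b)) (frag_of (a, \<phi> k * b))"
proof -
  assume "a \<in> carrier A"
  then have "frag_of (\<alpha> k \<otimes>\<^bsub>A\<^esub> a, b) - frag_of (a, \<phi> k * b) \<in> rels"
    unfolding tensor_relations_def field_type_simps by blast
  then show ?thesis using rels_N by (auto simp: eqv_def)
qed

lemma eqv_right_zero: "a \<in> carrier A \<Longrightarrow> eqv (frag_of (a, 0)) 0"
proof -
  assume "a \<in> carrier A"
  then have "eqv (frag_of (a, 0 + 0)) (frag_of (a, 0) + frag_of (a, 0))" by (rule eqv_right)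
  then have "eqv (frag_of (a, 0) - frag_of (a, 0)) (frag_of (a, 0) + frag_of (a, 0) - frag_of (a, 0))"
    by (intro eqv_diff eqv_refl) simp
  then show ?thesis by (intro eqv_sym[of 0]) simp
qed

lemma eqv_left_zero: "eqv (frag_of (\<zero>\<^bsub>A\<^esub>, b)) 0"
proof -
  have "eqv (frag_of (\<zero>\<^bsub>A\<^esub> \<oplus>\<^bsub>A\<^esub> \<zero>\<^bsub>A\<^esub>, b)) (frag_of (\<zero>\<^bsub>A\<^esub>, b) + frag_of (\<zero>\<^bsub>A\<^esub>, b))"
    by (rule eqv_left) simp_all
  then have "eqv (frag_of (\<zero>\<^bsub>A\<^esub>, b) - frag_of (\<zero>\<^bsub>A\<^esub>, b))
      (frag_of (\<zero>\<^bsub>A\<^esub>, b) + frag_of (\<zero>\<^bsub>A\<^esub>, b) - frag_of (\<zero>\<^bsub>A\<^esub>, b))"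
    by (intro eqv_diff eqv_refl) simp
  then show ?thesis by (intro eqv_sym[of 0]) simp
qed

definition qm :: "(nat \<Rightarrow>\<^sub>0 nat) \<Rightarrow> 'b" where "qm m = q (term_of m 1)"

lemma qm_closed: "m \<in> M \<Longrightarrow> qm m \<in> carrier A"
  unfolding qm_def by (intro Q.h_closed term_polys)

text \<open>A representative of the tensor that corresponds to \<open>g\<close>, namely the sum of \<open>x\<^sup>m \<otimes> c\<close> over the terms
  \<open>c x\<^sup>m\<close> of \<open>g\<close>.\<close>

definition lift :: "((nat \<Rightarrow>\<^sub>0 nat) \<Rightarrow>\<^sub>0 'l) \<Rightarrow> ('b \<times> 'l \<Rightarrow>\<^sub>0 int)" where
  "lift g = (\<Sum>m\<in>supp g. frag_of (qm m, cf g m))"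

lemma lift_closed: "g \<in> SL \<Longrightarrow> lift g \<in> carrier F"
  unfolding lift_def by (intro carrier_F_sum of_closed qm_closed) (rule polysD)

lemma lift_superset:
  assumes "finite B" "supp g \<subseteq> B" "B \<subseteq> M"
  shows "eqv (\<Sum>m\<in>B. frag_of (qm m, cf g m)) (lift g)"
proof -
  have "(\<Sum>m\<in>B. frag_of (qm m, cf g m)) = (\<Sum>m\<in>B - supp g. frag_of (qm m, cf g m)) + lift g"
    unfolding lift_def using assms by (intro sum.subset_diff) auto
  moreover have "eqv (\<Sum>m\<in>B - supp g. frag_of (qm m, cf g m)) (\<Sum>m\<in>B - supp g. 0)"
  proof (rule eqv_sum)
    fix m assume "m \<in> B - supp g"
    then show "eqv (frag_of (qm m, cf g m)) 0"
      using eqv_right_zero[OF qm_closed, of m] assms(3) by (auto simp: in_keys_iff)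
  qed
  ultimately show ?thesis using eqv_add[OF _ eqv_refl, of _ 0 "lift g"] by simp
qed

lemma lift_add:
  assumes "g \<in> SL" "h \<in> SL" shows "eqv (lift (g + h)) (lift g + lift h)"
proof -
  let ?B = "supp g \<union> supp h"
  have B: "finite ?B" "?B \<subseteq> M" using assms polysD by auto
  have "eqv (lift (g + h)) (\<Sum>m\<in>?B. frag_of (qm m, cf (g + h) m))"
    by (rule eqv_sym[OF lift_superset[OF B(1) Poly_Mapping.keys_add B(2)]])
  also have "eqv \<dots> (\<Sum>m\<in>?B. frag_of (qm m, cf g m) + frag_of (qm m, cf h m))"
    using B by (intro eqv_sum) (auto simp: lookup_add intro!: eqv_right qm_closed)
  also have "eqv \<dots> (lift g + lift h)"
    unfolding sum.distrib by (intro eqv_add lift_superset) (use B in auto)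
  finally show ?thesis .
qed

lemma lift_term: "m \<in> M \<Longrightarrow> eqv (lift (term_of m c)) (frag_of (qm m, c))"
proof (cases "c = 0")
  case True
  assume "m \<in> M"
  then show ?thesis using True eqv_sym[OF eqv_right_zero[OF qm_closed]] by (simp add: lift_def)
next
  case False
  then show ?thesis by (simp add: lift_def eqv_refl)
qed

lemma lift_sum: "(\<And>i. i \<in> B \<Longrightarrow> g i \<in> SL) \<Longrightarrow> eqv (lift (sum g B)) (\<Sum>i\<in>B. lift (g i))"
proof (induction B rule: infinite_finite_induct)
  case (insert i B)
  then have "eqv (lift (g i + sum g B)) (lift (g i) + lift (sum g B))"
    by (intro lift_add polys.sum_C) auto
  also have "eqv \<dots> (lift (g i) + (\<Sum>i\<in>B. lift (g i)))" using insert by (intro eqv_add eqv_refl) auto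
  finally show ?case using insert.hyps by simp
qed (simp_all add: lift_def eqv_refl)

lemma F_mult_sum:
  "(\<Sum>i\<in>B. f i) \<otimes>\<^bsub>F\<^esub> y = (\<Sum>i\<in>B. f i \<otimes>\<^bsub>F\<^esub> y)" "x \<otimes>\<^bsub>F\<^esub> (\<Sum>i\<in>B. f i) = (\<Sum>i\<in>B. x \<otimes>\<^bsub>F\<^esub> f i)"
  by (induction B rule: infinite_finite_induct) (simp_all add: free_pair_mult_lin)

lemma lift_mult:
  assumes g: "g \<in> SL" and h: "h \<in> SL" shows "eqv (lift (g * h)) (lift g \<otimes>\<^bsub>F\<^esub> lift h)"
proof -
  have M: "a \<in> M" "b \<in> M" if "a \<in> supp g" "b \<in> supp h" for a b using that g h polysD by auto
  have "g * h = (\<Sum>a\<in>supp g. \<Sum>b\<in>supp h. term_of (a + b) (cf g a * cf h b))"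
    by (subst (1) poly_expand[of g], subst (1) poly_expand[of h]) (simp add: sum_product mult_single)
  then have "eqv (lift (g * h)) (\<Sum>a\<in>supp g. lift (\<Sum>b\<in>supp h. term_of (a + b) (cf g a * cf h b)))"
    using M by (auto intro!: lift_sum polys.sum_C term_polys mons_add)
  also have "eqv \<dots> (\<Sum>a\<in>supp g. \<Sum>b\<in>supp h. lift (term_of (a + b) (cf g a * cf h b)))"
    using M by (intro eqv_sum lift_sum term_polys mons_add)
  also have "eqv \<dots> (\<Sum>a\<in>supp g. \<Sum>b\<in>supp h. frag_of (qm (a + b), cf g a * cf h b))"
    using M by (intro eqv_sum lift_term mons_add)
  also have "(\<Sum>a\<in>supp g. \<Sum>b\<in>supp h. frag_of (qm (a + b), cf g a * cf h b)) = lift g \<otimes>\<^bsub>F\<^esub> lift h"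
  proof -
    have "qm (a + b) = qm a \<otimes>\<^bsub>A\<^esub> qm b" if "a \<in> M" "b \<in> M" for a b
      unfolding qm_def using Q.h_mult[OF term_polys[OF that(1), of 1] term_polys[OF that(2), of 1]]
      by (simp add: mult_single)
    moreover have "lift g \<otimes>\<^bsub>F\<^esub> lift h =
        (\<Sum>a\<in>supp g. \<Sum>b\<in>supp h. frag_of (qm a, cf g a) \<otimes>\<^bsub>F\<^esub> frag_of (qm b, cf h b))"
      unfolding lift_def by (simp only: F_mult_sum(1)) (simp only: F_mult_sum(2))
    ultimately show ?thesis
      using M by (simp add: free_pair_mult_of field_type_simps cong: sum.cong)
  qed
  finally show ?thesis .
qed

lemma lift_one: "lift 1 = \<one>\<^bsub>F\<^esub>"
proof -
  have "qm 0 = \<one>\<^bsub>A\<^esub>" unfolding qm_def using Q.h_one by simp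
  then show ?thesis by (simp add: lift_def free_pair_ring_simps field_type_simps)
qed

lemma lift_extend:
  assumes f: "f \<in> SK"
  shows "eqv (frag_of (q f, b)) (lift (term_of 0 b * extend f))"
proof -
  have "eqv (frag_of (q (\<Sum>m\<in>B. term_of m (cf f m)), b)) (\<Sum>m\<in>B. lift (term_of m (b * \<phi> (cf f m))))"
    if "B \<subseteq> supp f" for B
    using finite_subset[OF that finite_keys] that
  proof (induction B rule: finite_induct)
    case empty
    then show ?case by (simp add: Q.h_zero eqv_left_zero)
  next
    case (insert m B)
    have mM: "m \<in> M" and BM: "B \<subseteq> M" using insert.prems f polysD by auto
    let ?p = "term_of m (cf f m)" and ?s = "\<Sum>m\<in>B. term_of m (cf f m)"
    have S: "?p \<in> SK" "?s \<in> SK" using mM BM by (auto intro!: polys.sum_C term_polys)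
    have "eqv (frag_of (q (?p + ?s), b)) (frag_of (q ?p, b) + frag_of (q ?s, b))"
      unfolding Q.h_add[OF S] by (intro eqv_left Q.h_closed S)
    also have "eqv \<dots> (lift (term_of m (b * \<phi> (cf f m))) + (\<Sum>m\<in>B. lift (term_of m (b * \<phi> (cf f m)))))"
    proof (rule eqv_add)
      have "q ?p = \<alpha> (cf f m) \<otimes>\<^bsub>A\<^esub> qm m"
        unfolding \<alpha>_def qm_def using Q.h_mult[OF const_SK term_polys[OF mM], of "cf f m" 1] by (simp add: mult_single)
      then have "eqv (frag_of (q ?p, b)) (frag_of (qm m, \<phi> (cf f m) * b))" using eqv_scalar[OF qm_closed[OF mM]] by simp
      also have "eqv \<dots> (lift (term_of m (b * \<phi> (cf f m))))"
        using eqv_sym[OF lift_term[OF mM, of "b * \<phi> (cf f m)"]] by (simp add: mult.commute)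
      finally show "eqv (frag_of (q ?p, b)) (lift (term_of m (b * \<phi> (cf f m))))" .
    qed (use insert in auto)
    finally show ?case using insert.hyps by simp
  qed
  from this[OF order_refl]
  have "eqv (frag_of (q f, b)) (\<Sum>m\<in>supp f. lift (term_of m (b * \<phi> (cf f m))))"
    by (simp add: poly_expand[symmetric])
  also have "eqv \<dots> (lift (\<Sum>m\<in>supp f. term_of m (b * \<phi> (cf f m))))"
    using f polysD by (intro eqv_sym[OF lift_sum] term_polys) auto
  also have "(\<Sum>m\<in>supp f. term_of m (b * \<phi> (cf f m))) = term_of 0 b * extend f"
    by (subst (3) poly_expand[of f]) (simp add: extend_sum extend_term sum_distrib_left mult_single)
  finally show ?thesis .
qed

lemma lift_surj:
  assumes "x \<in> carrier F" shows "\<exists>g\<in>SL. eqv x (lift g)"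
proof -
  have "supp x \<subseteq> carrier A \<times> UNIV" using assms by (simp add: free_pair_ring_simps field_type_simps)
  then show ?thesis
  proof (induction x rule: frag_induction)
    case zero
    show ?case by (intro bexI[of _ 0]) (simp_all add: lift_def eqv_refl polys.zero_C)
  next
    case (one ab)
    obtain a b where [simp]: "ab = (a, b)" by (cases ab)
    have "a \<in> q ` SK" using one Q.surj by auto
    then obtain f where f: "f \<in> SK" "a = q f" by blast
    have "term_of 0 b * extend f \<in> SL" using f by (intro polys.mult_C term_polys) auto
    then show ?case using lift_extend[OF f(1)] f(2) by auto
  next
    case (diff x y)
    then obtain g h where gh: "g \<in> SL" "eqv x (lift g)" "h \<in> SL" "eqv y (lift h)" by blast
    have "eqv (lift ((g - h) + h)) (lift (g - h) + lift h)" using gh by (intro lift_add polys.minus_C)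
    then have "eqv (lift g - lift h) (lift (g - h) + lift h - lift h)" by (intro eqv_diff eqv_refl) simp
    then have "eqv (x - y) (lift (g - h))" using eqv_trans[OF eqv_diff[OF gh(2,4)]] by simp
    then show ?case using gh by (intro bexI[of _ "g - h"] polys.minus_C)
  qed
qed

text \<open>A map in the other direction, \<open>a \<otimes> b \<mapsto> b a\<close>.  It depends on the chosen representatives, but is additive
  on the free abelian group, and it becomes well defined and multiplicative modulo the extended ideal.\<close>

definition rep :: "'b \<Rightarrow> ((nat \<Rightarrow>\<^sub>0 nat) \<Rightarrow>\<^sub>0 'k)" where
  "rep a = (SOME f. f \<in> SK \<and> q f = a)"

lemma rep: "a \<in> carrier A \<Longrightarrow> rep a \<in> SK \<and> q (rep a) = a"
proof -
  assume "a \<in> carrier A"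
  then have "a \<in> q ` SK" using Q.surj by simp
  then have "\<exists>f. f \<in> SK \<and> q f = a" by blast
  then show ?thesis unfolding rep_def by (rule someI_ex)
qed

lemma rep_eq: "a \<in> carrier A \<Longrightarrow> f \<in> SK \<Longrightarrow> q f = a \<Longrightarrow> rep a - f \<in> Q.ker"
  using rep[of a] Q.h_eq[of "rep a" f] by simp

abbreviation "IL \<equiv> extended_ideal Q.ker"

lemma ideal_IL: "ideal_in SL IL"
  by (rule extended_ideal_ideal[OF ideal_ker])

definition unlift :: "('b \<times> 'l \<Rightarrow>\<^sub>0 int) \<Rightarrow> ((nat \<Rightarrow>\<^sub>0 nat) \<Rightarrow>\<^sub>0 'l)" where
  "unlift = zlin (\<lambda>(a, b). term_of 0 b * extend (rep a))"

lemma extend_minus: "extend (f - g) = extend f - extend g"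
  using extend_add[of "f - g" g] by (simp add: algebra_simps)

lemma scaled_ker: "f \<in> Q.ker \<Longrightarrow> term_of 0 b * extend f \<in> IL"
proof -
  assume f: "f \<in> Q.ker"
  then have "f \<in> SK" by (simp add: Q.ker_def)
  then have "extend f \<in> IL" using extend_mem_extended_ideal[OF ideal_ker] f by blast
  then show ?thesis by (intro ideal_inD(4)[OF ideal_IL] term_polys) simp_all
qed

lemma unlift_closed:
  assumes "x \<in> carrier F" shows "unlift x \<in> SL"
proof -
  have "supp x \<subseteq> carrier A \<times> UNIV" using assms by (simp add: free_pair_ring_simps field_type_simps)
  then show ?thesis
  proof (induction x rule: frag_induction)
    case (one ab)
    then show ?case using rep by (cases ab) (auto simp: unlift_def intro!: polys.mult_C term_polys)
  qed (auto simp: unlift_def zlin_diff)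
qed

lemma unlift_mult:
  assumes "x \<in> carrier F" "y \<in> carrier F"
  shows "unlift (x \<otimes>\<^bsub>F\<^esub> y) - unlift x * unlift y \<in> IL"
proof -
  have supp: "supp x \<subseteq> carrier A \<times> UNIV" "supp y \<subseteq> carrier A \<times> UNIV"
    using assms by (simp_all add: free_pair_ring_simps field_type_simps)
  have diff: "u - v - (s - t) * z = (u - s * z) - (v - t * z)" "u - v - z * (s - t) = (u - z * s) - (v - z * t)"
    for u v s t z :: "(nat \<Rightarrow>\<^sub>0 nat) \<Rightarrow>\<^sub>0 'l" by (simp_all add: algebra_simps)
  show ?thesis
    using supp(1)
  proof (induction x rule: frag_induction)
    case zero
    then show ?case by (simp add: free_pair_mult_lin unlift_def ideal_inD(2)[OF ideal_IL])
  next
    case (one ab)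
    show ?case
      using supp(2)
    proof (induction y rule: frag_induction)
      case zero
      then show ?case by (simp add: free_pair_mult_lin unlift_def ideal_inD(2)[OF ideal_IL])
    next
      case (one cd)
      obtain a b c d where [simp]: "ab = (a, b)" "cd = (c, d)" by (cases ab, cases cd)
      have ac: "a \<in> carrier A" "c \<in> carrier A" using one \<open>ab \<in> carrier A \<times> UNIV\<close> by auto
      have "rep (a \<otimes>\<^bsub>A\<^esub> c) - rep a * rep c \<in> Q.ker"
        using rep[OF ac(1)] rep[OF ac(2)] ac by (intro rep_eq) (auto simp: Q.h_mult)
      then have "term_of 0 (b * d) * extend (rep (a \<otimes>\<^bsub>A\<^esub> c) - rep a * rep c) \<in> IL" by (rule scaled_ker)
      moreover have bd: "term_of 0 (b * d) = term_of 0 b * term_of 0 d" by (simp add: mult_single)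
      ultimately show ?case
        by (simp add: unlift_def free_pair_mult_of field_type_simps extend_minus extend_mult bd algebra_simps)
    next
      case (diff x' y')
      then show ?case
        using polys.ideal_minus[OF ideal_IL] unfolding free_pair_mult_lin unlift_def zlin_diff \<open>\<And>u v s t z. u - v - z * (s - t) = (u - z * s) - (v - z * t)\<close>
        by blast
    qed
  next
    case (diff x' y')
    then show ?case
      using polys.ideal_minus[OF ideal_IL] unfolding free_pair_mult_lin unlift_def zlin_diff \<open>\<And>u v s t z. u - v - (s - t) * z = (u - s * z) - (v - t * z)\<close>
      by blast
  qed
qed

lemma unlift_N:
  assumes "x \<in> N" shows "unlift x \<in> IL"
proof -
  interpret F: cring F by (rule cring_F)
  define H where "H = {x \<in> carrier F. unlift x \<in> IL}"
  have "ideal H F"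
  proof (rule idealI)
    show "ring F" by (rule F.ring_axioms)
    show "subgroup H (add_monoid F)"
    proof (rule F.add.subgroupI)
      show "H \<subseteq> carrier F" by (auto simp: H_def)
      have "0 \<in> H" using F.zero_closed ideal_inD(2)[OF ideal_IL] by (simp add: H_def unlift_def free_pair_ring_simps)
      then show "H \<noteq> {}" by blast
      fix a assume a: "a \<in> H"
      then have "- unlift a \<in> IL" using polys.ideal_uminus[OF ideal_IL] by (auto simp: H_def)
      moreover have "unlift (- a) = - unlift a" unfolding unlift_def using zlin_diff[of _ 0 a] by simp
      ultimately show "\<ominus>\<^bsub>F\<^esub> a \<in> H"
        using a uminus_F[of a] F.a_inv_closed[of a] by (auto simp: H_def)
    next
      fix a b assume "a \<in> H" "b \<in> H"
      then show "a \<oplus>\<^bsub>F\<^esub> b \<in> H"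
        using F.a_closed[of a b] ideal_inD(3)[OF ideal_IL, of "unlift a" "unlift b"]
        by (simp add: H_def unlift_def free_pair_ring_simps zlin_add)
    qed
    fix a z assume a: "a \<in> H" and z: "z \<in> carrier F"
    have aF: "a \<in> carrier F" "unlift a \<in> IL" using a by (auto simp: H_def)
    have "unlift z * unlift a \<in> IL" using unlift_closed[OF z] aF by (intro ideal_inD(4)[OF ideal_IL])
    then have "unlift (z \<otimes>\<^bsub>F\<^esub> a) \<in> IL"
      using ideal_inD(3)[OF ideal_IL unlift_mult[OF z aF(1)]] by force
    then show "z \<otimes>\<^bsub>F\<^esub> a \<in> H" using F.m_closed[OF z aF(1)] by (simp add: H_def)
    then show "a \<otimes>\<^bsub>F\<^esub> z \<in> H" using F.m_comm[OF z aF(1)] by simp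
  qed
  moreover have "rels \<subseteq> H"
  proof
    fix x assume x: "x \<in> rels"
    have xF: "x \<in> carrier F"
      using x tensor_relations_carrier[OF Q.is_cring cring_field_type \<alpha>_hom \<phi>_hom] by blast
    consider a a' b where "x = frag_of (a \<oplus>\<^bsub>A\<^esub> a', b) - frag_of (a, b) - frag_of (a', b)" "a \<in> carrier A" "a' \<in> carrier A"
      | a b b' where "x = frag_of (a, b + b') - frag_of (a, b) - frag_of (a, b')" "a \<in> carrier A"
      | k a b where "x = frag_of (\<alpha> k \<otimes>\<^bsub>A\<^esub> a, b) - frag_of (a, \<phi> k * b)" "a \<in> carrier A"
      using x unfolding tensor_relations_def field_type_simps by blast
    then have "unlift x \<in> IL"
    proof cases
      case 1
      have "rep (a \<oplus>\<^bsub>A\<^esub> a') - (rep a + rep a') \<in> Q.ker"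
        using rep[OF 1(2)] rep[OF 1(3)] 1 by (intro rep_eq) (auto simp: Q.h_add)
      then have "term_of 0 b * extend (rep (a \<oplus>\<^bsub>A\<^esub> a') - (rep a + rep a')) \<in> IL" by (rule scaled_ker)
      then show ?thesis by (simp add: 1 unlift_def zlin_diff zlin_add extend_minus extend_add algebra_simps)
    next
      case 2
      have "unlift x = 0" by (simp add: 2 unlift_def zlin_diff zlin_add single_add algebra_simps)
      then show ?thesis using ideal_inD(2)[OF ideal_IL] by simp
    next
      case 3
      have "rep (\<alpha> k \<otimes>\<^bsub>A\<^esub> a) - term_of 0 k * rep a \<in> Q.ker"
        using rep[OF 3(2)] 3 Q.h_closed[OF const_SK, of k]
        by (intro rep_eq) (auto simp: Q.h_mult const_SK \<alpha>_def intro!: polys.mult_C)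
      then have "term_of 0 b * extend (rep (\<alpha> k \<otimes>\<^bsub>A\<^esub> a) - term_of 0 k * rep a) \<in> IL" by (rule scaled_ker)
      moreover have kb: "term_of 0 (b * \<phi> k) = term_of 0 b * term_of 0 (\<phi> k)" by (simp add: mult_single)
      ultimately show ?thesis
        by (simp add: 3 unlift_def zlin_diff extend_minus extend_mult extend_term kb algebra_simps)
    qed
    then show "x \<in> H" using xF by (simp add: H_def)
  qed
  ultimately have "N \<subseteq> H" unfolding N_def by (rule F.genideal_minimal)
  then show ?thesis using assms by (auto simp: H_def)
qed

lemma unlift_lift:
  assumes g: "g \<in> SL" shows "unlift (lift g) - g \<in> IL"
proof -
  have "unlift (lift g) = (\<Sum>m\<in>supp g. term_of 0 (cf g m) * extend (rep (qm m)))"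
    by (simp add: unlift_def lift_def zlin_sum)
  moreover have "g = (\<Sum>m\<in>supp g. term_of 0 (cf g m) * extend (term_of m 1))"
    by (subst (1) poly_expand[of g]) (simp add: extend_term \<phi>_one mult_single)
  ultimately have "unlift (lift g) - g = (\<Sum>m\<in>supp g. term_of 0 (cf g m) * extend (rep (qm m) - term_of m 1))"
    by (simp add: extend_minus right_diff_distrib sum_subtractf)
  also have "\<dots> \<in> IL"
  proof (intro polys.ideal_sum[OF ideal_IL] scaled_ker rep_eq)
    fix m assume "m \<in> supp g"
    then have "m \<in> M" using g polysD by blast
    then show "qm m \<in> carrier A" "term_of m 1 \<in> SK" "q (term_of m 1) = qm m"
      using qm_closed term_polys by (auto simp: qm_def)
  qed
  finally show ?thesis .
qed

lemma lift_N_iff: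
  assumes g: "g \<in> SL" shows "lift g \<in> N \<longleftrightarrow> g \<in> IL"
proof
  assume "lift g \<in> N"
  then have "unlift (lift g) \<in> IL" by (rule unlift_N)
  then show "g \<in> IL" using polys.ideal_minus[OF ideal_IL _ unlift_lift[OF g]] by force
next
  have N_eqv: "x \<in> N \<longleftrightarrow> y \<in> N" if "eqv x y" for x y
    using that N_add[of "x - y" y] N_diff[of x "x - y"] by (auto simp: eqv_def)
  have "ideal_in SL {g \<in> SL. lift g \<in> N}"
    unfolding ideal_in_def
  proof (intro conjI ballI)
    show "0 \<in> {g \<in> SL. lift g \<in> N}" by (simp add: lift_def N_zero polys.zero_C)
    show "x + y \<in> {g \<in> SL. lift g \<in> N}" if "x \<in> {g \<in> SL. lift g \<in> N}" "y \<in> {g \<in> SL. lift g \<in> N}" for x y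
      using that N_eqv[OF lift_add, of x y] N_add by auto
    show "r * x \<in> {g \<in> SL. lift g \<in> N}" if "r \<in> SL" "x \<in> {g \<in> SL. lift g \<in> N}" for r x
      using that N_eqv[OF lift_mult, of r x] N_mult(1)[of "lift x" "lift r"] lift_closed by auto
  qed auto
  moreover have "extend ` Q.ker \<subseteq> {g \<in> SL. lift g \<in> N}"
  proof
    fix x assume "x \<in> extend ` Q.ker"
    then obtain f where f: "f \<in> Q.ker" "x = extend f" by blast
    then have fS: "f \<in> SK" "q f = \<zero>\<^bsub>A\<^esub>" by (auto simp: Q.ker_def)
    have "eqv 0 (lift x)"
      using eqv_trans[OF eqv_sym[OF eqv_left_zero] lift_extend[OF fS(1), of 1, unfolded fS(2)]] f(2) by simp
    then have "lift x \<in> N" using N_eqv N_zero by blast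
    then show "x \<in> {g \<in> SL. lift g \<in> N}" using f fS by simp
  qed
  ultimately have "IL \<subseteq> {g \<in> SL. lift g \<in> N}" by (rule extended_ideal_least)
  moreover assume "g \<in> IL"
  ultimately show "lift g \<in> N" by blast
qed

text \<open>In other words, \<open>A \<otimes> L\<close> is \<open>S\<^sub>L\<close> modulo the extension of the kernel of \<open>S\<^sub>K \<rightarrow> A\<close>.\<close>

lemma surjection_onto_tensor:
  "surjection_onto SL T (\<lambda>g. N +>\<^bsub>F\<^esub> lift g)" "surjection_onto.ker SL T (\<lambda>g. N +>\<^bsub>F\<^esub> lift g) = IL"
proof -
  interpret F: cring F by (rule cring_F)
  interpret N: ideal N F by (rule ideal_N)
  note hom = N.rcos_ring_hom
  have T: "T = F Quot N" by (simp add: tensor_algebra_def N_def)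
  have eq: "N +>\<^bsub>F\<^esub> x = N +>\<^bsub>F\<^esub> y" if "eqv x y" "x \<in> carrier F" "y \<in> carrier F" for x y
  proof -
    have "x \<ominus>\<^bsub>F\<^esub> y = x - y" using uminus_F[OF that(3)] by (simp add: a_minus_def free_pair_ring_simps)
    then show ?thesis using that F.quotient_eq_iff_same_a_r_cos[OF ideal_N that(2,3)] by (simp add: eqv_def)
  qed
  show s: "surjection_onto SL T (\<lambda>g. N +>\<^bsub>F\<^esub> lift g)"
  proof (intro surjection_onto.intro surjection_onto_axioms.intro)
    show "subring_in SL" by (rule subring_polys)
    show "cring T" by (rule tensor_algebra_cring[OF Q.is_cring cring_field_type \<alpha>_hom \<phi>_hom])
    show "(\<lambda>g. N +>\<^bsub>F\<^esub> lift g) ` SL = carrier T"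
    proof
      show "(\<lambda>g. N +>\<^bsub>F\<^esub> lift g) ` SL \<subseteq> carrier T"
        using lift_closed by (auto simp: T FactRing_def A_RCOSETS_def')
      show "carrier T \<subseteq> (\<lambda>g. N +>\<^bsub>F\<^esub> lift g) ` SL"
      proof
        fix y assume "y \<in> carrier T"
        then obtain x where x: "x \<in> carrier F" "y = N +>\<^bsub>F\<^esub> x" by (auto simp: T FactRing_def A_RCOSETS_def')
        then obtain g where g: "g \<in> SL" "eqv x (lift g)" using lift_surj by blast
        then have "y = N +>\<^bsub>F\<^esub> lift g" using eq[OF g(2) x(1) lift_closed[OF g(1)]] x by simp
        then show "y \<in> (\<lambda>g. N +>\<^bsub>F\<^esub> lift g) ` SL" using g by blast
      qed
    qed
    fix g h assume gh: "g \<in> SL" "h \<in> SL"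
    note c = lift_closed[OF gh(1)] lift_closed[OF gh(2)]
    have "N +>\<^bsub>F\<^esub> lift (g + h) = N +>\<^bsub>F\<^esub> (lift g + lift h)"
      using gh c by (intro eq lift_add lift_closed polys.add_C carrier_F_add)
    then show "N +>\<^bsub>F\<^esub> lift (g + h) = (N +>\<^bsub>F\<^esub> lift g) \<oplus>\<^bsub>T\<^esub> (N +>\<^bsub>F\<^esub> lift h)"
      using ring_hom_add[OF hom c] by (simp add: T free_pair_ring_simps)
    have "N +>\<^bsub>F\<^esub> lift (g * h) = N +>\<^bsub>F\<^esub> (lift g \<otimes>\<^bsub>F\<^esub> lift h)"
      using gh c by (intro eq lift_mult lift_closed polys.mult_C F.m_closed)
    then show "N +>\<^bsub>F\<^esub> lift (g * h) = (N +>\<^bsub>F\<^esub> lift g) \<otimes>\<^bsub>T\<^esub> (N +>\<^bsub>F\<^esub> lift h)"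
      using ring_hom_mult[OF hom c] by (simp add: T)
  next
    show "N +>\<^bsub>F\<^esub> lift 1 = \<one>\<^bsub>T\<^esub>" using ring_hom_one[OF hom] by (simp add: T lift_one)
  qed
  interpret s: surjection_onto SL T "\<lambda>g. N +>\<^bsub>F\<^esub> lift g" by (rule s)
  have "N +>\<^bsub>F\<^esub> lift g = \<zero>\<^bsub>T\<^esub> \<longleftrightarrow> g \<in> IL" if g: "g \<in> SL" for g
  proof -
    have "N +>\<^bsub>F\<^esub> lift g = N \<longleftrightarrow> lift g \<in> N"
      using N.a_rcos_const N.rcos_const_imp_mem[OF lift_closed[OF g]] by blast
    then show ?thesis using lift_N_iff[OF g] by (simp add: T FactRing_def)
  qed
  then show "s.ker = IL" unfolding s.ker_def by (auto simp: extended_ideal_def)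
qed

end

section \<open>The theorem\<close>

theorem corollary3p3:
  fixes n t :: nat
    and I :: "((nat \<Rightarrow>\<^sub>0 nat) \<Rightarrow>\<^sub>0 'k::field) set"
    and lt :: "(nat \<Rightarrow>\<^sub>0 nat) \<Rightarrow> (nat \<Rightarrow>\<^sub>0 nat) \<Rightarrow> bool"
    and \<phi> :: "'k \<Rightarrow> 'l::field"
  assumes "ideal I (mpoly_ring n)"
    and "equidimensional (mpoly_ring n) I"
    and "monomial_order n lt"
    and "squarefree_monomial_ideal n (initial_ideal n lt I)"
    and "enat t \<le> krull_dim (mpoly_ring n Quot I)"
    and "\<phi> \<in> ring_hom ring_of_type_algebra ring_of_type_algebra"
  shows "num_components (Gamma t (mpoly_ring n Quot I)) =
         num_components (Gamma t
           (tensor_algebra ring_of_type_algebra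
              (mpoly_ring n Quot I) (quotient_structure_map n I)
              ring_of_type_algebra \<phi>))"
proof -
  interpret O: monomial_ordering n lt by unfold_locales (rule assms(3))
  note I = ideal_mpoly_ring[OF assms(1)]
  obtain E where E: "finite E" "E \<subseteq> O.LM I" "\<And>u i. u \<in> E \<Longrightarrow> cf u i \<le> 1"
    "\<And>m. m \<in> O.LM I \<Longrightarrow> \<exists>u\<in>E. \<exists>v\<in>mons {..<n}. m = u + v"
    using O.squarefree_leading_monomials[OF I assms(4)] by blast
  have "\<exists>g\<in>I. cf g u = 1 \<and> (\<forall>x\<in>supp g. x \<noteq> u \<longrightarrow> lt x u)" if "u \<in> E" for u
  proof -
    have "u \<in> O.LM I" using E(2) that by blast
    then obtain f where f: "f \<in> I" "f \<noteq> 0" "u = O.lead f" unfolding O.LM_def by blast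
    have fS: "f \<in> polys {..<n}" using f ideal_inD(1)[OF I] by blast
    note lf = O.lead[OF fS f(2), folded f(3)]
    define g where "g = term_of 0 (inverse (cf f u)) * f"
    have cfg: "cf g x = inverse (cf f u) * cf f x" for x
      using cf_term_mult[of 0 "inverse (cf f u)" f x] by (simp add: g_def)
    have "g \<in> I" unfolding g_def by (intro ideal_inD(4)[OF I] term_polys f) simp
    moreover have "cf g u = 1" using lf(1) by (simp add: cfg in_keys_iff)
    moreover have "lt x u" if "x \<in> supp g" "x \<noteq> u" for x
      using lf(2)[of x] that by (auto simp: cfg in_keys_iff O.le_def)
    ultimately show ?thesis by blast
  qed
  then obtain g where g: "\<And>u. u \<in> E \<Longrightarrow> g u \<in> I" "\<And>u. u \<in> E \<Longrightarrow> cf (g u) u = 1"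
    "\<And>u x. u \<in> E \<Longrightarrow> x \<in> supp (g u) \<Longrightarrow> x \<noteq> u \<Longrightarrow> lt x u" by metis
  have LM_M: "O.LM I \<subseteq> mons {..<n}" by (rule O.LM_mons[OF I])
  have "\<exists>w. (\<forall>i<n. 0 < w i) \<and> (\<forall>(u, v)\<in>(SIGMA u:E. supp (g u) - {u}). wdeg n w v < wdeg n w u)"
  proof (rule O.weight_exists)
    show "finite (SIGMA u:E. supp (g u) - {u})" using E(1) by auto
    fix u v assume "(u, v) \<in> (SIGMA u:E. supp (g u) - {u})"
    then have uv: "u \<in> E" "v \<in> supp (g u)" "v \<noteq> u" by auto
    moreover have "g u \<in> polys {..<n}" using g(1)[OF uv(1)] ideal_inD(1)[OF I] by blast
    ultimately show "u \<in> mons {..<n} \<and> v \<in> mons {..<n} \<and> lt v u" using E(2) LM_M g(3) polysD by blast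
  qed
  then obtain w where w: "\<And>i. i < n \<Longrightarrow> 0 < w i"
    "\<And>u v. u \<in> E \<Longrightarrow> v \<in> supp (g u) \<Longrightarrow> v \<noteq> u \<Longrightarrow> wdeg n w v < wdeg n w u" by auto
  define lt' where "lt' = (\<lambda>u v. wdeg n w u < wdeg n w v \<or> (wdeg n w u = wdeg n w v \<and> lt u v))"
  have \<phi>: "\<phi> (a + b) = \<phi> a + \<phi> b" "\<phi> (a * b) = \<phi> a * \<phi> b" "\<phi> 1 = 1" for a b
    using ring_hom_add[OF assms(6), of a b] ring_hom_mult[OF assms(6), of a b] ring_hom_one[OF assms(6)]
    by (simp_all add: field_type_simps)
  interpret X: extended_polys n lt' w \<phi>
  proof unfold_locales
    show "monomial_order n lt'" unfolding lt'_def by (rule monomial_order_wdeg[OF assms(3)])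
    show "lt' u v" if "wdeg n w u < wdeg n w v" for u v using that by (simp add: lt'_def)
  qed (use w(1) \<phi> in auto)
  let ?R = "mpoly_ring n :: ((nat \<Rightarrow>\<^sub>0 nat) \<Rightarrow>\<^sub>0 'k) ring"
  note s = surjection_onto_quotient[OF surjection_onto_mpoly_ring assms(1)]
  interpret Y: tensor_extension n lt' w \<phi> "?R Quot I" "\<lambda>p. I +>\<^bsub>?R\<^esub> p"
    by (intro tensor_extension.intro X.extended_polys_axioms s(1))
  have ker: "Y.Q.ker = I" using s(2) ideal_inD(1)[OF I] by auto
  have inj: "inj_on X.contraction (minimal_members (primes_over X.SL (X.extended_ideal I)))"
  proof (rule X.contraction_injective[OF I])
    show "X.affine_dim P = the_enat (krull_dim (?R Quot I))" if "P \<in> minimal_members (primes_over X.SK I)" for P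
      using X.equidimensional_affine_dim[OF assms(1,2) that] by (metis the_enat.simps)
    show "(\<forall>i. cf u i \<le> 1) \<and> (\<exists>g\<in>I. cf g u = 1 \<and> (\<forall>x\<in>supp g. x \<noteq> u \<longrightarrow> wdeg n w x < wdeg n w u))"
      if "u \<in> E" for u using that E(3) g(1,2) w(2) by blast
    show "\<exists>u\<in>E. u \<in> mons B" if h: "B \<subseteq> {..<n}" "h \<in> I" "h \<in> polys B" "h \<noteq> 0" for B h
    proof -
      have "h \<in> polys {..<n}" using h ideal_inD(1)[OF I] by blast
      then have "O.lead h \<in> supp h" using O.lead h by blast
      then have "O.lead h \<in> mons B" using h polysD by blast
      moreover obtain u v where "u \<in> E" "O.lead h = u + v" using E(4)[OF O.LM_I[OF h(2,4)]] by blast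
      ultimately show ?thesis by (auto simp: mons_add_iff)
    qed
  qed
  have "num_components (Gamma t (?R Quot I)) = num_components (poset_graph t (primes_over X.SK I))"
    using Y.Q.num_components_Gamma[of t] by (simp add: ker)
  also have "\<dots> = num_components (poset_graph t (primes_over X.SL (X.extended_ideal I)))"
    by (rule X.num_components_extension[OF I inj, symmetric])
  also have "\<dots> = num_components (Gamma t Y.T)"
    using surjection_onto.num_components_Gamma[OF Y.surjection_onto_tensor(1), of t] Y.surjection_onto_tensor(2)
    by (simp add: ker)
  also have "Y.\<alpha> = quotient_structure_map n I"
    by (simp add: fun_eq_iff Y.\<alpha>_def quotient_structure_map_def)
  finally show ?thesis .
qed

end
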